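(* Let $n\ge 2$, let $\Omega=\{x\in\mathbb{R}^n:|x|<1\}$ be the unit ball, and let $m>0$, $m\neq 1$, be a constant. Then, as $r\to\infty$, \[ N(r)=|N_1(r)-N_\gamma(r)|+O(r^{n-1})=(2\pi)^{-n}\,\omega_n^2\,\bigl|1-m^{n/2}\bigr|\,r^n+O(r^{n-1}), \] where $\omega_n$ is the volume of the unit ball in $\mathbb{R}^n$.
   Context: Interior transmission problem: for $\lambda\neq 0$ consider $(-\Delta-\lambda^2 m)u=0$ in $\Omega$, $(-\Delta-\lambda^2)v=0$ in $\Omega$, $u=v$ and $\partial_\nu u=\partial_\nu v$ on $\partial\Omega$ ($\partial_\nu$ the normal derivative), with $u,v\in H^2(\Omega)$. A number $\lambda\neq0$ is an interior transmission eigenvalue (ITE) if this system has a solution $(u,v)$ with $u,v$ not both zero; such $(u,v)$ is an eigenpair. The geometric multiplicity of an ITE is the dimension of the linear space of its eigenpairs $(u,v)$. $N(r)$ is the number of real ITEs $\lambda$ with $0<\lambda\le r$, counted with geometric multiplicity. Set $\gamma=\sqrt m$. $N_1(r)$ is the number of Dirichlet eigenvalues $\lambda^2$ of $-\Delta$ on $\Omega$ with $\lambda\in(0,r]$, counted with multiplicity, and $N_\gamma(r)$ is the same for the operator $-\gamma^{-2}\Delta$ on $\Omega$. *)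

theory Defs
  imports "HOL-Analysis.Analysis" "HOL-Library.Landau_Symbols"
begin

fun pd :: "'a::euclidean_space list \<Rightarrow> ('a \<Rightarrow> real) \<Rightarrow> 'a \<Rightarrow> real" where
  "pd [] f = f"
| "pd (i # is) f = (\<lambda>x. frechet_derivative (pd is f) (at x) i)"

text \<open>Test functions C_c^infinity(Omega): all iterated partial derivatives exist everywhere
  (hence are continuous, i.e. the function is C^infinity), and the support is compact in Omega.\<close>
definition test_fun :: "'a::euclidean_space set \<Rightarrow> ('a \<Rightarrow> real) \<Rightarrow> bool" where
  "test_fun \<Omega> \<phi> \<longleftrightarrow>
     (\<forall>is. set is \<subseteq> Basis \<longrightarrow> (\<forall>x. pd is \<phi> differentiable (at x)))
     \<and> compact (closure {x. \<phi> x \<noteq> 0}) \<and> closure {x. \<phi> x \<noteq> 0} \<subseteq> \<Omega>"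

definition laplacian :: "('a::euclidean_space \<Rightarrow> real) \<Rightarrow> 'a \<Rightarrow> real" where
  "laplacian \<phi> x = (\<Sum>i\<in>Basis. pd [i, i] \<phi> x)"

definition L2 :: "'a::euclidean_space set \<Rightarrow> ('a \<Rightarrow> complex) \<Rightarrow> bool" where
  "L2 \<Omega> u \<longleftrightarrow> set_borel_measurable lebesgue \<Omega> u
     \<and> set_integrable lebesgue \<Omega> (\<lambda>x. (norm (u x))\<^sup>2)"

definition weak_pd1 :: "'a::euclidean_space set \<Rightarrow> ('a \<Rightarrow> complex) \<Rightarrow> 'a \<Rightarrow> ('a \<Rightarrow> complex) \<Rightarrow> bool" where
  "weak_pd1 \<Omega> u i g \<longleftrightarrow> (\<forall>\<phi>. test_fun \<Omega> \<phi> \<longrightarrow>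
     (LINT x:\<Omega>|lebesgue. u x * complex_of_real (pd [i] \<phi> x))
       = - (LINT x:\<Omega>|lebesgue. g x * complex_of_real (\<phi> x)))"

definition weak_pd2 :: "'a::euclidean_space set \<Rightarrow> ('a \<Rightarrow> complex) \<Rightarrow> 'a \<Rightarrow> 'a \<Rightarrow> ('a \<Rightarrow> complex) \<Rightarrow> bool" where
  "weak_pd2 \<Omega> u i j g \<longleftrightarrow> (\<forall>\<phi>. test_fun \<Omega> \<phi> \<longrightarrow>
     (LINT x:\<Omega>|lebesgue. u x * complex_of_real (pd [i, j] \<phi> x))
       = (LINT x:\<Omega>|lebesgue. g x * complex_of_real (\<phi> x)))"

definition H2 :: "'a::euclidean_space set \<Rightarrow> ('a \<Rightarrow> complex) \<Rightarrow> bool" where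
  "H2 \<Omega> u \<longleftrightarrow> L2 \<Omega> u
     \<and> (\<forall>i\<in>Basis. \<exists>g. L2 \<Omega> g \<and> weak_pd1 \<Omega> u i g)
     \<and> (\<forall>i\<in>Basis. \<forall>j\<in>Basis. \<exists>g. L2 \<Omega> g \<and> weak_pd2 \<Omega> u i j g)"

definition L2_dist2 :: "'a::euclidean_space set \<Rightarrow> ('a \<Rightarrow> complex) \<Rightarrow> ('a \<Rightarrow> real) \<Rightarrow> real" where
  "L2_dist2 \<Omega> g \<phi> = (LINT x:\<Omega>|lebesgue. (norm (g x - complex_of_real (\<phi> x)))\<^sup>2)"

definition H01 :: "'a::euclidean_space set \<Rightarrow> ('a \<Rightarrow> complex) \<Rightarrow> bool" where
  "H01 \<Omega> u \<longleftrightarrow> L2 \<Omega> u \<and> (\<exists>\<phi> g1.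
     (\<forall>k. test_fun \<Omega> (\<phi> k))
     \<and> (\<forall>i\<in>Basis. L2 \<Omega> (g1 i) \<and> weak_pd1 \<Omega> u i (g1 i))
     \<and> (\<lambda>k. L2_dist2 \<Omega> u (\<phi> k)) \<longlonglongrightarrow> 0
     \<and> (\<forall>i\<in>Basis. (\<lambda>k. L2_dist2 \<Omega> (g1 i) (pd [i] (\<phi> k))) \<longlonglongrightarrow> 0))"

text \<open>H^2_0(Omega): closure of C_c^infinity(Omega) in the H^2 norm
  (= H^2 functions with vanishing trace and normal-derivative trace).\<close>
definition H02 :: "'a::euclidean_space set \<Rightarrow> ('a \<Rightarrow> complex) \<Rightarrow> bool" where
  "H02 \<Omega> u \<longleftrightarrow> H2 \<Omega> u \<and> (\<exists>\<phi> g1 g2.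
     (\<forall>k. test_fun \<Omega> (\<phi> k))
     \<and> (\<forall>i\<in>Basis. L2 \<Omega> (g1 i) \<and> weak_pd1 \<Omega> u i (g1 i))
     \<and> (\<forall>i\<in>Basis. \<forall>j\<in>Basis. L2 \<Omega> (g2 i j) \<and> weak_pd2 \<Omega> u i j (g2 i j))
     \<and> (\<lambda>k. L2_dist2 \<Omega> u (\<phi> k)) \<longlonglongrightarrow> 0
     \<and> (\<forall>i\<in>Basis. (\<lambda>k. L2_dist2 \<Omega> (g1 i) (pd [i] (\<phi> k))) \<longlonglongrightarrow> 0)
     \<and> (\<forall>i\<in>Basis. \<forall>j\<in>Basis. (\<lambda>k. L2_dist2 \<Omega> (g2 i j) (pd [i, j] (\<phi> k))) \<longlonglongrightarrow> 0))"

definition ae_indep :: "'a::euclidean_space set \<Rightarrow> ('a \<Rightarrow> complex) set \<Rightarrow> bool" where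
  "ae_indep \<Omega> S \<longleftrightarrow> (\<forall>c :: ('a \<Rightarrow> complex) \<Rightarrow> complex.
     (AE x in lebesgue. x \<in> \<Omega> \<longrightarrow> (\<Sum>f\<in>S. c f * f x) = 0) \<longrightarrow> (\<forall>f\<in>S. c f = 0))"

definition ae_dim :: "'a::euclidean_space set \<Rightarrow> ('a \<Rightarrow> complex) set \<Rightarrow> nat" where
  "ae_dim \<Omega> V = Sup {card S | S. finite S \<and> S \<subseteq> V \<and> ae_indep \<Omega> S}"

definition ae_indep_pairs ::
    "'a::euclidean_space set \<Rightarrow> (('a \<Rightarrow> complex) \<times> ('a \<Rightarrow> complex)) set \<Rightarrow> bool" where
  "ae_indep_pairs \<Omega> S \<longleftrightarrow> (\<forall>c :: ('a \<Rightarrow> complex) \<times> ('a \<Rightarrow> complex) \<Rightarrow> complex.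
     (AE x in lebesgue. x \<in> \<Omega> \<longrightarrow>
        (\<Sum>p\<in>S. c p * fst p x) = 0 \<and> (\<Sum>p\<in>S. c p * snd p x) = 0)
     \<longrightarrow> (\<forall>p\<in>S. c p = 0))"

definition ae_dim_pairs ::
    "'a::euclidean_space set \<Rightarrow> (('a \<Rightarrow> complex) \<times> ('a \<Rightarrow> complex)) set \<Rightarrow> nat" where
  "ae_dim_pairs \<Omega> V = Sup {card S | S. finite S \<and> S \<subseteq> V \<and> ae_indep_pairs \<Omega> S}"

text \<open>(u,v) is an eigenpair (possibly zero) of the interior transmission problem for lambda:
  u, v in H^2(Omega), (-Delta - lambda^2 m) u = 0, (-Delta - lambda^2) v = 0 in Omega
  (in the sense of distributions), and u = v, d_nu u = d_nu v on the boundary,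
  i.e. u - v in H^2_0(Omega).\<close>
definition ITE_pair :: "'a::euclidean_space set \<Rightarrow> real \<Rightarrow> real \<Rightarrow> ('a \<Rightarrow> complex) \<Rightarrow> ('a \<Rightarrow> complex) \<Rightarrow> bool" where
  "ITE_pair \<Omega> m lam u v \<longleftrightarrow> H2 \<Omega> u \<and> H2 \<Omega> v
     \<and> (\<forall>\<phi>. test_fun \<Omega> \<phi> \<longrightarrow>
          (LINT x:\<Omega>|lebesgue. u x * complex_of_real (- laplacian \<phi> x - lam\<^sup>2 * m * \<phi> x)) = 0)
     \<and> (\<forall>\<phi>. test_fun \<Omega> \<phi> \<longrightarrow>
          (LINT x:\<Omega>|lebesgue. v x * complex_of_real (- laplacian \<phi> x - lam\<^sup>2 * \<phi> x)) = 0)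
     \<and> H02 \<Omega> (\<lambda>x. u x - v x)"

definition is_ITE :: "'a::euclidean_space set \<Rightarrow> real \<Rightarrow> real \<Rightarrow> bool" where
  "is_ITE \<Omega> m lam \<longleftrightarrow> lam \<noteq> 0 \<and> (\<exists>u v. ITE_pair \<Omega> m lam u v
      \<and> \<not> ((AE x in lebesgue. x \<in> \<Omega> \<longrightarrow> u x = 0) \<and> (AE x in lebesgue. x \<in> \<Omega> \<longrightarrow> v x = 0)))"

definition ITE_mult :: "'a::euclidean_space set \<Rightarrow> real \<Rightarrow> real \<Rightarrow> nat" where
  "ITE_mult \<Omega> m lam = ae_dim_pairs \<Omega> {(u, v). ITE_pair \<Omega> m lam u v}"

definition N_ITE :: "'a::euclidean_space set \<Rightarrow> real \<Rightarrow> real \<Rightarrow> nat" where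
  "N_ITE \<Omega> m r = (\<Sum>lam\<in>{lam. 0 < lam \<and> lam \<le> r \<and> is_ITE \<Omega> m lam}. ITE_mult \<Omega> m lam)"

definition dir_eigenspace :: "'a::euclidean_space set \<Rightarrow> real \<Rightarrow> real \<Rightarrow> ('a \<Rightarrow> complex) set" where
  "dir_eigenspace \<Omega> k \<mu> = {u. H01 \<Omega> u \<and> (\<forall>\<phi>. test_fun \<Omega> \<phi> \<longrightarrow>
      (LINT x:\<Omega>|lebesgue. u x * complex_of_real (- k * laplacian \<phi> x))
        = complex_of_real \<mu> * (LINT x:\<Omega>|lebesgue. u x * complex_of_real (\<phi> x)))}"

definition dir_mult :: "'a::euclidean_space set \<Rightarrow> real \<Rightarrow> real \<Rightarrow> nat" where
  "dir_mult \<Omega> k \<mu> = ae_dim \<Omega> (dir_eigenspace \<Omega> k \<mu>)"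

text \<open>Number of lambda in (0, r] such that lambda^2 is a Dirichlet eigenvalue of -k Delta,
  counted with multiplicity. N_1 = N_dir Omega 1, N_gamma = N_dir Omega (gamma^-2).\<close>
definition N_dir :: "'a::euclidean_space set \<Rightarrow> real \<Rightarrow> real \<Rightarrow> nat" where
  "N_dir \<Omega> k r = (\<Sum>lam\<in>{lam. 0 < lam \<and> lam \<le> r \<and> dir_mult \<Omega> k (lam\<^sup>2) > 0}. dir_mult \<Omega> k (lam\<^sup>2))"

end

theory Submission
  imports Defs
begin

text \<open>Separation of variables. Pairing an eigenfunction with \<open>P(x) h(|x|\<^sup>2)\<close>, \<open>P\<close> a harmonic polynomial of
degree \<open>l\<close>, reduces the weak equations to the Bessel equation of order \<open>\<nu> = l + n/2 - 1\<close>, and each such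
component of the eigenspace is at most one-dimensional. So \<open>N_1\<close> and \<open>N_gamma\<close> count the zeros of
\<open>bes \<nu> x\<close> and \<open>bes \<nu> (m x)\<close> in \<open>(0, r\<^sup>2]\<close>, and \<open>N\<close> counts those of the Wronskian \<open>bes_det \<nu> m 1\<close>, all weighted
with the dimension of the harmonic polynomials of degree \<open>l\<close>.

In polar form \<open>bes \<nu> = r sin \<theta>\<close>, \<open>x bes' \<nu> = r cos \<theta>\<close>, the Wronskian vanishes where
\<open>\<theta>(m x) - \<theta>(x)\<close> is a multiple of \<open>\<pi>\<close>, and these levels are only crossed in one direction. So for each \<open>l\<close> the number of its
zeros differs by at most 1 from the absolute difference of the two Bessel zero counts, whose sign does not depend on \<open>l\<close>.
Only \<open>l = O(r)\<close> contributes and the weights are \<open>O(l ^ (n - 2))\<close>, which gives the first estimate. For the second one,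
Liouville-Green asymptotics count the Bessel zeros up to \<open>O(1)\<close> uniformly in \<open>l\<close>, and the sum over \<open>l\<close> is compared with
an integral.\<close>

section \<open>Zeros of Bessel functions\<close>

text \<open>Eigenfunctions are known only as weak solutions. The proof uses neither interior
  regularity nor traces on the sphere: components are integrals over the whole ball, and the
  boundary conditions enter only through the approximating test functions. The choices h = 1 and h =
  1 - |x|^2 then read off the radial derivative and the boundary value of a component, up to
  factors.

  The variable x = t^2 removes the branch point at the origin: \<open>bes \<nu>\<close> is entire
  with value 1 at 0, so the phase starts at pi / 2 for every order.

  That levels are crossed in one direction rests on Lagrange's identity:
  \<open>x powr \<nu> * bes_det \<nu> a b x\<close> has a derivative proportional to
  \<open>bes \<nu> (a * x) * bes \<nu> (b * x)\<close>, and near a point where the two phases agree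
  modulo pi this product has a fixed sign. The error 1 per degree is the gap between the floor of a
  difference and the difference of the floors.

  The leading constant appears because the Liouville-Green phase is the integral of arccos (q / R)
  over q from the order to R. The sum over degrees becomes an integral of their counting function
  against arccos, with leading part q^(n-1) arccos q.\<close>

text \<open>An antiderivative \<open>F\<close> of \<open>z' / z\<close> is a logarithm of the curve:
  \<open>z * exp (- F)\<close> has derivative 0, so \<open>Im F\<close> is a continuous argument
  whose derivative is known from the start.\<close>

lemma phase_exists:
 fixes z z' :: "real => complex"
 assumes "a \<le> b"
  and d: "\<And>x. x \<in> {a..b} ==> (z has_vector_derivative z' x) (at x within {a..b})"
  and c: "continuous_on {a..b} z'"
  and nz: "\<And>x. x \<in> {a..b} ==> z x \<noteq> 0"
  and z0: "z a = of_real (norm (z a)) * cis \<theta>0"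
 obtains \<theta> where "\<theta> a = \<theta>0"
  and "\<And>x. x \<in> {a..b} ==> z x = of_real (norm (z x)) * cis (\<theta> x)"
  and "\<And>x. x \<in> {a..b} ==> (\<theta> has_real_derivative Im (z' x / z x)) (at x within {a..b})"
proof -
 have cz: "continuous_on {a..b} z"
  using d by (meson continuous_on_eq_continuous_within has_vector_derivative_continuous)
 have "continuous_on {a..b} (\<lambda>x. z' x / z x)"
  using c cz nz by (intro continuous_on_divide) auto
 then obtain \<phi> where \<phi>: "\<And>x. x \<in> {a..b} ==> (\<phi> has_vector_derivative (z' x / z x)) (at x within {a..b})"
  using antiderivative_continuous by blast
 define F where "F x = \<phi> x - \<phi> a" for x
 have F: "(F has_vector_derivative (z' x / z x)) (at x within {a..b})" if "x \<in> {a..b}" for x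
  unfolding F_def using \<phi>[OF that] by (auto intro!: derivative_eq_intros)
 have E: "((\<lambda>x. exp (- F x)) has_vector_derivative (- (z' x / z x)) * exp (- F x)) (at x within {a..b})"
  if x: "x \<in> {a..b}" for x
 proof -
  have "((\<lambda>x. - F x) has_vector_derivative - (z' x / z x)) (at x within {a..b})"
   using F[OF x] by (auto intro!: derivative_eq_intros)
  from field_vector_diff_chain_within[OF this, of exp "exp (- F x)"]
  show ?thesis by (simp add: o_def DERIV_exp has_field_derivative_at_within)
 qed
 have "((\<lambda>x. z x * exp (- F x)) has_vector_derivative 0) (at x within {a..b})" if x: "x \<in> {a..b}" for x
 proof -
  have "((\<lambda>x. z x * exp (- F x)) has_vector_derivative
    (z x * ((- (z' x / z x)) * exp (- F x)) + z' x * exp (- F x))) (at x within {a..b})"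
   using has_vector_derivative_mult[OF d[OF x] E[OF x]] .
  also have "z x * ((- (z' x / z x)) * exp (- F x)) + z' x * exp (- F x) = 0"
   using nz[OF x] by (simp add: field_simps)
  finally show ?thesis .
 qed
 then obtain k where k: "\<And>x. x \<in> {a..b} ==> z x * exp (- F x) = k"
  using has_vector_derivative_zero_constant[of "{a..b}" "\<lambda>x. z x * exp (- F x)"] by auto
 have Fa: "F a = 0" by (simp add: F_def)
 have zk: "z x = z a * exp (F x)" if "x \<in> {a..b}" for x
  using k[OF that] k[of a] \<open>a \<le> b\<close> Fa by (auto simp: exp_minus field_simps)
 define \<theta> where "\<theta> x = \<theta>0 + Im (F x)" for x
 show ?thesis
 proof (rule that[of \<theta>])
  show "\<theta> a = \<theta>0" by (simp add: \<theta>_def Fa)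
  fix x assume x: "x \<in> {a..b}"
  have "z x = (of_real (norm (z a)) * cis \<theta>0) * exp (F x)" using zk[OF x] z0 by simp
  also have "exp (F x) = of_real (exp (Re (F x))) * cis (Im (F x))"
   by (simp add: exp_eq_polar)
  finally have e: "z x = of_real (norm (z a) * exp (Re (F x))) * cis (\<theta> x)"
   by (simp add: \<theta>_def cis_mult)
  hence "norm (z x) = norm (z a) * exp (Re (F x))"
   by (metis abs_of_nonneg exp_ge_zero mult.right_neutral mult_nonneg_nonneg norm_cis norm_ge_zero norm_mult norm_of_real)
  with e show "z x = of_real (norm (z x)) * cis (\<theta> x)" by simp
  have "((\<lambda>x. Im (F x)) has_vector_derivative Im (z' x / z x)) (at x within {a..b})"
   using F[OF x] by (rule bounded_linear.has_vector_derivative[OF bounded_linear_Im])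
  thus "(\<theta> has_real_derivative Im (z' x / z x)) (at x within {a..b})"
   unfolding \<theta>_def has_real_derivative_iff_has_vector_derivative
   by (auto intro!: derivative_eq_intros)
 qed
qed

text \<open>If a continuous function meets the integer levels only on the way up, it meets each level
 at most once, so the points where it takes integer values are counted by floors.\<close>

lemma card_upward_crossings:
 fixes \<psi> :: "real => real"
 assumes ab: "a \<le> b" and c: "continuous_on {a..b} \<psi>"
  and R: "\<And>x k::int. x \<in> {a..b} ==> \<psi> x = of_int k ==> \<exists>d>0. \<forall>y\<in>{a..b}. x < y \<and> y < x + d --> \<psi> y > of_int k"
  and L: "\<And>x k::int. x \<in> {a..b} ==> \<psi> x = of_int k ==> \<exists>d>0. \<forall>y\<in>{a..b}. x - d < y \<and> y < x --> \<psi> y < of_int k"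
 shows "finite {x\<in>{a<..b}. \<psi> x \<in> \<int>}" (is "finite ?S")
  and "int (card {x\<in>{a<..b}. \<psi> x \<in> \<int>}) = \<lfloor>\<psi> b\<rfloor> - \<lfloor>\<psi> a\<rfloor>"
proof -
 have after: "\<psi> y > k" if x: "x \<in> {a..b}" "\<psi> x = of_int k" and y: "y \<in> {a..b}" "x < y" for x y and k :: int
 proof (rule ccontr)
  assume "\<not> \<psi> y > k"
  obtain d where d: "d > 0" "\<And>y. y\<in>{a..b} ==> x < y ==> y < x + d ==> \<psi> y > of_int k"
   using R[OF x] by blast
  define x1 where "x1 = min (x + d/2) y"
  have x1: "x < x1" "x1 < x + d" "x1 \<le> y" "x1 \<in> {a..b}"
   using d x y by (auto simp: x1_def min_def)
  have px1: "\<psi> x1 > k" using d(2) x1 by auto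
  \<comment> \<open>\<open>y1\<close> is the first point from \<open>x1\<close> on where \<psi> is
    at most \<open>k\<close>. By continuity the value there is exactly \<open>k\<close>, and
    \<open>L\<close> then puts \<psi> below \<open>k\<close> just before \<open>y1\<close>, against
    minimality.\<close>
  define A where "A = {x1..y} \<inter> {t\<in>{a..b}. \<psi> t \<in> {..of_int k}}"
  have "closed {t\<in>{a..b}. \<psi> t \<in> {..of_int k}}"
   using continuous_closed_preimage[OF c, of "{..of_int k}"] by (simp add: vimage_def Int_def)
  hence "compact A" unfolding A_def by (intro compact_Int_closed) auto
  moreover have "y \<in> A" using \<open>\<not> \<psi> y > k\<close> x1 y by (auto simp: A_def)
  ultimately obtain y1 where y1: "y1 \<in> A" "\<And>t. t \<in> A ==> y1 \<le> t"
   using compact_attains_inf[of A] by blast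
  have y1': "x1 \<le> y1" "y1 \<le> y" "y1 \<in> {a..b}" "\<psi> y1 \<le> k" using y1 by (auto simp: A_def)
  have "x1 < y1" using px1 y1' by (cases "x1 = y1") auto
  have gt: "\<psi> t > k" if "x1 \<le> t" "t < y1" for t
   using y1(2)[of t] that y1' x1 unfolding A_def by force
  have "\<psi> y1 \<ge> k"
  proof (rule ccontr)
   assume "\<not> ?thesis"
   hence lt: "\<psi> y1 < k" by simp
   have "continuous_on {x1..y1} \<psi>" using c by (rule continuous_on_subset) (use x1 y1' in auto)
   then obtain t where "x1 \<le> t" "t \<le> y1" "\<psi> t = k"
    using IVT2'[of \<psi> y1 k x1] lt px1 \<open>x1 < y1\<close> by auto
   thus False using gt[of t] lt by (cases "t = y1") auto
  qed
  with y1' have "\<psi> y1 = k" by simp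
  then obtain d' where d': "d' > 0" "\<And>t. t\<in>{a..b} ==> y1 - d' < t ==> t < y1 ==> \<psi> t < of_int k"
   using L[of y1 k] y1' by blast
  define t where "t = max x1 (y1 - d'/2)"
  have "t \<in> {a..b}" "y1 - d' < t" "t < y1" "x1 \<le> t"
   using d' \<open>x1 < y1\<close> x1 y1' by (auto simp: t_def max_def)
  thus False using d'(2)[of t] gt[of t] by simp
 qed
 have before: "\<psi> y < k" if x: "x \<in> {a..b}" "\<psi> x = of_int k" and y: "y \<in> {a..b}" "y < x" for x y and k :: int
 proof (rule ccontr)
  assume n: "\<not> \<psi> y < k"
  have neq: "\<psi> y \<noteq> k" using after[of y k x] x y by auto
  obtain d where d: "d > 0" "\<And>t. t\<in>{a..b} ==> x - d < t ==> t < x ==> \<psi> t < of_int k"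
   using L[OF x] by blast
  define t where "t = max y (x - d/2)"
  have t: "t \<in> {a..b}" "x - d < t" "t < x" "y \<le> t"
   using d x y by (auto simp: t_def max_def)
  have "\<psi> t < k" using d(2) t by auto
  moreover have "continuous_on {y..t} \<psi>" using c by (rule continuous_on_subset) (use t y in auto)
  ultimately obtain s where s: "y \<le> s" "s \<le> t" "\<psi> s = k"
   using IVT2'[of \<psi> t k y] n t by auto
  hence "\<psi> x > k" using after[of s k x] t y x by auto
  thus False using x by simp
 qed
 have mono: "\<lfloor>\<psi> a\<rfloor> \<le> \<lfloor>\<psi> b\<rfloor>"
 proof (rule ccontr)
  assume "\<not> ?thesis"
  hence "\<psi> b < \<lfloor>\<psi> a\<rfloor>" by (metis floor_less_iff not_le)
  moreover have "of_int \<lfloor>\<psi> a\<rfloor> \<le> \<psi> a" by simp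
  ultimately obtain s where s: "a \<le> s" "s \<le> b" "\<psi> s = \<lfloor>\<psi> a\<rfloor>"
   using IVT2'[of \<psi> b "of_int \<lfloor>\<psi> a\<rfloor>" a] c ab by auto
  thus False using after[of s "\<lfloor>\<psi> a\<rfloor>" b] \<open>\<psi> b < \<lfloor>\<psi> a\<rfloor>\<close> ab by (cases "s = b") auto
 qed
 \<comment> \<open>Both sides are half-open in the same way: a level met at \<open>a\<close> itself
   is counted neither by the set nor by the floors, as it equals the floor at
   \<open>a\<close>.\<close>
 have bij: "bij_betw (\<lambda>x. \<lfloor>\<psi> x\<rfloor>) ?S {\<lfloor>\<psi> a\<rfloor><..\<lfloor>\<psi> b\<rfloor>}"
 proof (rule bij_betwI')
  fix x y assume xy: "x \<in> ?S" "y \<in> ?S"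
  show "(\<lfloor>\<psi> x\<rfloor> = \<lfloor>\<psi> y\<rfloor>) = (x = y)"
  proof
   assume e: "\<lfloor>\<psi> x\<rfloor> = \<lfloor>\<psi> y\<rfloor>"
   have "\<psi> x = of_int \<lfloor>\<psi> x\<rfloor>" "\<psi> y = of_int \<lfloor>\<psi> x\<rfloor>" using xy e by (auto elim!: Ints_cases)
   thus "x = y" using after[of x "\<lfloor>\<psi> x\<rfloor>" y] after[of y "\<lfloor>\<psi> x\<rfloor>" x] xy
    by (metis (no_types, lifting) atLeastAtMost_iff greaterThanAtMost_iff less_eq_real_def less_irrefl linorder_neqE_linordered_idom mem_Collect_eq)
  qed simp
 next
  fix x assume x: "x \<in> ?S"
  then obtain k :: int where k: "\<psi> x = k" by (auto elim!: Ints_cases)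
  have "\<psi> a < k" using before[of x k a] k x by auto
  moreover have "k \<le> \<psi> b" using after[of x k b] k x by (cases "x = b") auto
  ultimately show "\<lfloor>\<psi> x\<rfloor> \<in> {\<lfloor>\<psi> a\<rfloor><..\<lfloor>\<psi> b\<rfloor>}" using k by (auto simp: floor_less_iff le_floor_iff)
 next
  fix k assume k: "k \<in> {\<lfloor>\<psi> a\<rfloor><..\<lfloor>\<psi> b\<rfloor>}"
  hence k': "\<psi> a < k" "k \<le> \<psi> b" by (auto simp: floor_less_iff le_floor_iff)
  then obtain s where s: "a \<le> s" "s \<le> b" "\<psi> s = k"
   using IVT'[of \<psi> a k b] c ab by auto
  hence "s \<in> ?S" using k' by (cases "s = a") auto
  thus "\<exists>x\<in>?S. k = \<lfloor>\<psi> x\<rfloor>" using s by (intro bexI[of _ s]) auto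
 qed
 show "finite ?S" using bij_betw_finite[OF bij] by simp
 show "int (card ?S) = \<lfloor>\<psi> b\<rfloor> - \<lfloor>\<psi> a\<rfloor>"
  using bij_betw_same_card[OF bij] mono by simp
qed

section \<open>The Bessel series, its equation, and positivity below the turning point\<close>

definition bes_coeff :: "real => nat => real" where
 "bes_coeff \<nu> j = (- 1 / 4) ^ j / (fact j * pochhammer (\<nu> + 1) j)"

text \<open>Up to a constant, \<open>t powr \<nu> * bes \<nu> (t\<^sup>2)\<close> is the Bessel function of order \<open>\<nu>\<close> at \<open>t\<close>.\<close>

definition bes :: "real => real => real" where
 "bes \<nu> x = (\<Sum>j. bes_coeff \<nu> j * x ^ j)"

definition bes' :: "real => real => real" where
 "bes' \<nu> x = - bes (\<nu> + 1) x / (4 * (\<nu> + 1))"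

text \<open>The Wronskian of the pair \<open>(x * bes' \<nu> x, bes \<nu> x)\<close>, that is, its
  angular velocity times the squared modulus, after elimination of second derivatives by Bessel's
  equation.\<close>

definition bes_p :: "real => real => real" where
 "bes_p \<nu> x = x * (bes' \<nu> x)\<^sup>2 + \<nu> * bes \<nu> x * bes' \<nu> x + (bes \<nu> x)\<^sup>2 / 4"

lemma summable_bes:
 assumes "\<nu> \<ge> 0" shows "summable (\<lambda>j. bes_coeff \<nu> j * x ^ j)"
proof (rule summable_comparison_test)
 have "norm (bes_coeff \<nu> j * x ^ j) \<le> inverse (fact j) * \<bar>x\<bar> ^ j" for j
 proof -
  have p: "pochhammer (\<nu> + 1) j \<ge> 1"
   unfolding pochhammer_prod by (rule prod_ge_1) (use assms in auto)
  have f: "(fact j :: real) > 0" by simp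
  have "norm (bes_coeff \<nu> j * x ^ j) = (1/4) ^ j * (\<bar>x\<bar> ^ j / (fact j * pochhammer (\<nu> + 1) j))"
   using p by (simp add: bes_coeff_def abs_mult power_abs abs_divide)
  also have "\<dots> \<le> 1 * (\<bar>x\<bar> ^ j / (fact j * 1))"
   using p by (intro mult_mono divide_left_mono mult_left_mono power_le_one) auto
  finally show ?thesis by (simp add: field_simps)
 qed
 thus "\<exists>N. \<forall>n\<ge>N. norm (bes_coeff \<nu> n * x ^ n) \<le> inverse (fact n) * \<bar>x\<bar> ^ n" by blast
 show "summable (\<lambda>n. inverse (fact n) * \<bar>x\<bar> ^ n)"
  using summable_exp[of "\<bar>x\<bar>"] by simp
qed

lemma bes_coeff_Suc:
 assumes "\<nu> \<ge> 0"
 shows "of_nat (Suc j) * bes_coeff \<nu> (Suc j) = - 1 / (4 * (\<nu> + 1)) * bes_coeff (\<nu> + 1) j"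
proof -
 have p: "pochhammer (\<nu> + 1 + 1) j > 0" using assms by (intro pochhammer_pos) auto
 have e: "pochhammer (\<nu> + 1) (Suc j) = (\<nu> + 1) * pochhammer (\<nu> + 1 + 1) j" by (rule pochhammer_rec)
 show ?thesis using p assms
  unfolding bes_coeff_def e fact_Suc power_Suc
  by (simp add: divide_simps del: of_nat_Suc)
qed

lemma bes_has_derivative:
 assumes "\<nu> \<ge> 0"
 shows "DERIV (bes \<nu>) x :> bes' \<nu> x"
proof -
 have "DERIV (\<lambda>x. \<Sum>j. bes_coeff \<nu> j * x ^ j) x :> (\<Sum>j. diffs (bes_coeff \<nu>) j * x ^ j)"
  using summable_bes[OF assms] by (rule termdiffs_strong_converges_everywhere)
 moreover have "(\<Sum>j. diffs (bes_coeff \<nu>) j * x ^ j) = bes' \<nu> x"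
 proof -
  have "(\<Sum>j. diffs (bes_coeff \<nu>) j * x ^ j) = (\<Sum>j. (- 1 / (4 * (\<nu> + 1))) * (bes_coeff (\<nu> + 1) j * x ^ j))"
   unfolding diffs_def bes_coeff_Suc[OF assms] by (simp add: mult.assoc)
  also have "\<dots> = (- 1 / (4 * (\<nu> + 1))) * (\<Sum>j. bes_coeff (\<nu> + 1) j * x ^ j)"
   by (rule suminf_mult) (use assms in \<open>auto intro: summable_bes\<close>)
  finally show ?thesis by (simp add: bes'_def bes_def)
 qed
 ultimately show ?thesis by (simp add: bes_def[abs_def])
qed

lemma bes_0: "bes \<nu> 0 = 1"
proof -
 have "bes \<nu> 0 = bes_coeff \<nu> 0" unfolding bes_def by (rule powser_zero)
 thus ?thesis by (simp add: bes_coeff_def)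
qed

text \<open>The recurrence \<open>J_\<nu> + J_(\<nu>+2) = 2 (\<nu> + 1) / t * J_(\<nu>+1)\<close> in
  this normalisation. Coefficients are compared; the factor \<open>x\<close> shifts the first series
  by one place.\<close>

lemma bes_contiguous:
 assumes "\<nu> \<ge> 0"
 shows "x * bes (\<nu> + 2) x / (4 * (\<nu> + 1) * (\<nu> + 2)) - bes (\<nu> + 1) x + bes \<nu> x = 0"
proof -
 define K where "K = 1 / (4 * (\<nu> + 1) * (\<nu> + 2))"
 have c: "bes_coeff \<nu> (Suc j) - bes_coeff (\<nu> + 1) (Suc j) + K * bes_coeff (\<nu> + 2) j = 0" for j
 proof -
  define p where "p = pochhammer (\<nu> + 3) j"
  have p: "p > 0" using assms by (auto simp: p_def intro!: pochhammer_pos)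
  \<comment> \<open>The same rising factorial is expanded from its lower end and from its upper end,
    to express all three coefficients through \<open>p\<close>.\<close>
  have e1: "pochhammer (\<nu> + 1) (Suc j) * (\<nu> + 2 + real j) = (\<nu> + 1) * (\<nu> + 2) * p"
  proof -
   have "pochhammer (\<nu> + 1) (Suc (Suc j)) = (\<nu> + 1) * ((\<nu> + 2) * p)"
    unfolding p_def pochhammer_rec[of "\<nu>+1"] pochhammer_rec[of "\<nu>+1+1"] by (simp add: add.assoc)
   moreover have "pochhammer (\<nu> + 1) (Suc (Suc j)) = pochhammer (\<nu> + 1) (Suc j) * (\<nu> + 1 + of_nat (Suc j))"
    by (rule pochhammer_Suc)
   ultimately show ?thesis by (simp add: algebra_simps)
  qed
  have e2: "pochhammer (\<nu> + 1 + 1) (Suc j) = (\<nu> + 2) * p"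
   unfolding p_def pochhammer_rec[of "\<nu>+1+1"] by (simp add: add.assoc)
  have pp: "pochhammer (\<nu> + 1) (Suc j) = (\<nu> + 1) * (\<nu> + 2) * p / (\<nu> + 2 + real j)"
   using e1 assms by (simp add: field_simps)
  show ?thesis
   unfolding bes_coeff_def pp e2 K_def using p assms
   by (simp add: divide_simps p_def[symmetric] add.commute add.left_commute) (simp add: algebra_simps p_def)
 qed
 have s: "summable (\<lambda>j. bes_coeff (\<nu> + real k) j * x ^ j)" for k using assms by (intro summable_bes) auto
 have s0: "summable (\<lambda>j. bes_coeff \<nu> j * x ^ j)" and s1: "summable (\<lambda>j. bes_coeff (\<nu> + 1) j * x ^ j)"
  and s2: "summable (\<lambda>j. bes_coeff (\<nu> + 2) j * x ^ j)" using s[of 0] s[of 1] s[of 2] by auto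
 have "bes \<nu> x = bes_coeff \<nu> 0 + (\<Sum>j. bes_coeff \<nu> (Suc j) * x ^ Suc j)"
  using suminf_split_head[OF s0] by (simp add: bes_def)
 moreover have "bes (\<nu> + 1) x = bes_coeff (\<nu> + 1) 0 + (\<Sum>j. bes_coeff (\<nu> + 1) (Suc j) * x ^ Suc j)"
  using suminf_split_head[OF s1] by (simp add: bes_def)
 moreover have "K * (x * bes (\<nu> + 2) x) = (\<Sum>j. K * bes_coeff (\<nu> + 2) j * x ^ Suc j)"
  unfolding bes_def using suminf_mult[OF s2, of "K * x"] by (simp add: mult_ac)
 moreover have "(\<Sum>j. bes_coeff \<nu> (Suc j) * x ^ Suc j) - (\<Sum>j. bes_coeff (\<nu> + 1) (Suc j) * x ^ Suc j)
    + (\<Sum>j. K * bes_coeff (\<nu> + 2) j * x ^ Suc j)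
   = (\<Sum>j. (bes_coeff \<nu> (Suc j) - bes_coeff (\<nu> + 1) (Suc j) + K * bes_coeff (\<nu> + 2) j) * x ^ Suc j)"
 proof -
  have t0: "summable (\<lambda>j. bes_coeff \<nu> (Suc j) * x ^ Suc j)"
   and t1: "summable (\<lambda>j. bes_coeff (\<nu> + 1) (Suc j) * x ^ Suc j)"
   using s0 s1 by (simp_all only: summable_Suc_iff[of "\<lambda>j. bes_coeff _ j * x ^ j"])
  have t2: "summable (\<lambda>j. K * bes_coeff (\<nu> + 2) j * x ^ Suc j)"
   using summable_mult[OF s2, of "K * x"] by (simp add: mult_ac)
  show ?thesis using t0 t1 t2
   by (simp add: suminf_diff suminf_add summable_diff algebra_simps)
 qed
 ultimately show ?thesis unfolding c by (simp add: bes_coeff_def K_def)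
qed

lemma bes'_has_derivative:
 assumes "\<nu> \<ge> 0"
 shows "DERIV (bes' \<nu>) x :> bes (\<nu> + 2) x / (16 * (\<nu> + 1) * (\<nu> + 2))"
proof -
 have "DERIV (\<lambda>x. - bes (\<nu> + 1) x / (4 * (\<nu> + 1))) x :> - bes' (\<nu> + 1) x / (4 * (\<nu> + 1))"
  using assms by (auto intro!: derivative_eq_intros bes_has_derivative)
 moreover have "- bes' (\<nu> + 1) x / (4 * (\<nu> + 1)) = bes (\<nu> + 2) x / (16 * (\<nu> + 1) * (\<nu> + 2))"
  using assms by (simp add: bes'_def add.assoc divide_simps) (simp add: algebra_simps)
 ultimately show ?thesis by (simp add: bes'_def[abs_def])
qed

text \<open>Bessel's equation in the variable x = t^2 reads
  \<open>x * f'' + (\<nu> + 1) * f' + f / 4 = 0\<close>; the second derivative appears in its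
  contiguous form, where the recurrence applies.\<close>

lemma bes_ode:
 assumes "\<nu> \<ge> 0"
 shows "x * (bes (\<nu> + 2) x / (16 * (\<nu> + 1) * (\<nu> + 2))) = - (\<nu> + 1) * bes' \<nu> x - bes \<nu> x / 4"
proof -
 have "4 * (x * (bes (\<nu> + 2) x / (16 * (\<nu> + 1) * (\<nu> + 2)))) = x * bes (\<nu> + 2) x / (4 * (\<nu> + 1) * (\<nu> + 2))"
  using assms by (simp add: divide_simps)
 also have "\<dots> = bes (\<nu> + 1) x - bes \<nu> x" using bes_contiguous[OF assms, of x] by simp
 also have "bes (\<nu> + 1) x = 4 * (- (\<nu> + 1) * bes' \<nu> x)" using assms by (simp add: bes'_def field_simps)
 finally show ?thesis by simp
qed

lemma bes_g_has_derivative: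
 assumes "\<nu> \<ge> 0"
 shows "DERIV (\<lambda>x. x * bes' \<nu> x) x :> - \<nu> * bes' \<nu> x - bes \<nu> x / 4"
proof -
 have "((\<lambda>x. x * bes' \<nu> x) has_real_derivative
   x * (bes (\<nu> + 2) x / (16 * (\<nu> + 1) * (\<nu> + 2))) + bes' \<nu> x) (at x)"
  using bes'_has_derivative[OF assms, of x] by (auto intro!: derivative_eq_intros)
 thus ?thesis unfolding bes_ode[OF assms] by (simp add: algebra_simps)
qed

lemma continuous_bes:
 assumes "\<nu> \<ge> 0" shows "continuous_on S (bes \<nu>)" "continuous_on S (bes' \<nu>)"
 using bes_has_derivative[OF assms] bes'_has_derivative[OF assms]
 by (meson DERIV_isCont continuous_at_imp_continuous_on)+

text \<open>The weighted quantity \<open>V y = y powr (\<nu> + 1) * bes_p \<nu> y\<close> has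
  derivative \<open>y powr \<nu> * (bes \<nu> y)^2 / 4\<close>, which is nonnegative. Since
  \<open>bes_p \<nu> 0 = 1 / (4 * (\<nu> + 1))\<close>, it is positive near 0 and stays so.\<close>

lemma bes_p_pos:
 assumes s: "\<nu> \<ge> 0" and x: "x \<ge> 0"
 shows "bes_p \<nu> x > 0"
proof -
 have p0: "bes_p \<nu> 0 > 0"
  using s by (simp add: bes_p_def bes'_def bes_0 field_simps)
 have cont: "continuous_on UNIV (bes_p \<nu>)" unfolding bes_p_def[abs_def]
  by (intro continuous_intros continuous_bes s) auto
 have "\<forall>\<^sub>F x in at 0. bes_p \<nu> x > 0"
  using cont p0 by (metis continuous_on_eq_continuous_at isCont_def open_UNIV order_tendstoD(1) UNIV_I)
 then obtain d where d: "d > 0" "\<And>y. y \<noteq> 0 ==> \<bar>y\<bar> < d ==> bes_p \<nu> y > 0"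
  by (auto simp: eventually_at dist_real_def)
 define V where "V y = y powr \<nu> * (y * bes_p \<nu> y)" for y
 have dV: "DERIV V y :> (y powr \<nu> * (bes \<nu> y)\<^sup>2 / 4)" if "y > 0" for y
 proof -
  let ?f = "bes \<nu>" let ?f' = "bes' \<nu>"
  define g where "g x = x * bes' \<nu> x" for x
  have dg: "DERIV g y :> - \<nu> * ?f' y - ?f y / 4"
   unfolding g_def by (rule bes_g_has_derivative[OF s])
  define D where "D = (\<nu> * (y powr \<nu> / y)) * ((g y)\<^sup>2 + \<nu> * ?f y * g y + y * (?f y)\<^sup>2 / 4) +
    y powr \<nu> * (2 * g y * (- \<nu> * ?f' y - ?f y / 4) + \<nu> * (?f' y * g y + ?f y * (- \<nu> * ?f' y - ?f y / 4))
     + ((?f y)\<^sup>2 + y * (2 * ?f y * ?f' y)) / 4)"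
  have e: "V = (\<lambda>y. y powr \<nu> * ((g y)\<^sup>2 + \<nu> * ?f y * g y + y * (?f y)\<^sup>2 / 4))"
   by (simp add: V_def bes_p_def algebra_simps power2_eq_square g_def fun_eq_iff)
  have d1: "((\<lambda>y. (g y)\<^sup>2 + \<nu> * ?f y * g y + y * (?f y)\<^sup>2 / 4) has_real_derivative
    (2 * g y * (- \<nu> * ?f' y - ?f y / 4) + \<nu> * (?f' y * g y + ?f y * (- \<nu> * ?f' y - ?f y / 4))
     + ((?f y)\<^sup>2 + y * (2 * ?f y * ?f' y)) / 4)) (at y)"
   by (auto intro!: derivative_eq_intros dg bes_has_derivative[OF s]) (simp add: algebra_simps)?
  have d2: "DERIV (\<lambda>y. y powr \<nu>) y :> \<nu> * (y powr \<nu> / y)"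
   using that by (auto intro!: derivative_eq_intros simp: powr_diff)
  have "DERIV V y :> D"
   unfolding e D_def using DERIV_mult[OF d2 d1] by (simp add: algebra_simps)
  also have "D = y powr \<nu> * (bes \<nu> y)\<^sup>2 / 4"
   using that unfolding D_def g_def by (simp add: divide_simps) (simp add: algebra_simps power2_eq_square)
  finally show ?thesis .
 qed
 show ?thesis
 proof (cases "\<bar>x\<bar> < d")
  case True
  thus ?thesis using d p0 by (cases "x = 0") auto
 next
  case False
  hence xd: "d/2 < x" "x > 0" using x d(1) by auto
  have "V (d/2) \<le> V x"
   by (rule DERIV_nonneg_imp_nondecreasing[of "d/2" x V]) (use xd d(1) in \<open>auto intro!: dV exI\<close>)
  moreover have "V (d/2) > 0" using d by (simp add: V_def)
  ultimately have "V x > 0" by simp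
  thus ?thesis using xd by (simp add: V_def zero_less_mult_iff)
 qed
qed

lemma bes_nonzero:
 assumes "\<nu> \<ge> 0" "x \<ge> 0" "bes \<nu> x = 0" shows "bes' \<nu> x \<noteq> 0" "x > 0"
 using bes_p_pos[OF assms(1,2)] assms by (auto simp: bes_p_def bes_0 le_less)

text \<open>By convexity of \<open>s \<mapsto> exp (\<nu> * s / 2) * bes \<nu> (exp s)\<close> below the turning point.\<close>

lemma bes_pos_below:
 assumes s: "\<nu> \<ge> 0" and x: "0 \<le> x" "x \<le> \<nu>\<^sup>2"
 shows "bes \<nu> x > 0"
proof (cases "x = 0")
 case True thus ?thesis by (simp add: bes_0)
next
 case False
 hence x0: "x > 0" using x by simp
 hence s0: "\<nu> > 0" using x s by (cases "\<nu> = 0") auto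
 define q where "q y = y * bes' \<nu> y + \<nu>/2 * bes \<nu> y" for y
 have dq: "DERIV q y :> (- \<nu> * bes' \<nu> y - bes \<nu> y / 4 + \<nu>/2 * bes' \<nu> y)" for y
  unfolding q_def by (intro DERIV_add DERIV_cmult bes_has_derivative[OF s] bes_g_has_derivative[OF s])
 \<comment> \<open>With y = exp s, \<open>Y\<close> is the function named above and \<open>U\<close>
   is its derivative in s; \<open>dU\<close> is the convexity, valid while \<open>Y\<close> is
   positive and y is at most \<nu>^2.\<close>
 define Y where "Y y = y powr (\<nu>/2) * bes \<nu> y" for y
 define U where "U y = y powr (\<nu>/2) * q y" for y
 have dpw: "DERIV (\<lambda>y. y powr (\<nu>/2)) y :> \<nu>/2 * (y powr (\<nu>/2) / y)" if "y > 0" for y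
 proof -
  have "DERIV (\<lambda>y. y powr (\<nu>/2)) y :> \<nu>/2 * y powr (\<nu>/2 - 1)"
   using has_real_derivative_powr[OF that] .
  thus ?thesis using that by (simp add: powr_diff)
 qed
 have dY: "DERIV Y y :> U y / y" if "y > 0" for y
  unfolding Y_def U_def q_def
  by (rule DERIV_cong[OF DERIV_mult[OF dpw[OF that] bes_has_derivative[OF s]]])
   (use that in \<open>simp add: field_simps\<close>)
 have dU: "DERIV U y :> (\<nu>\<^sup>2 - y) / (4 * y) * Y y" if "y > 0" for y
 proof -
  have "(U has_real_derivative (\<nu>/2 * (y powr (\<nu>/2) / y)) * q y +
    y powr (\<nu>/2) * (- \<nu> * bes' \<nu> y - bes \<nu> y / 4 + \<nu>/2 * bes' \<nu> y)) (at y)"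
   unfolding U_def using that by (auto intro!: derivative_eq_intros dq simp: powr_diff)
  also have "(\<nu>/2 * (y powr (\<nu>/2) / y)) * q y +
    y powr (\<nu>/2) * (- \<nu> * bes' \<nu> y - bes \<nu> y / 4 + \<nu>/2 * bes' \<nu> y) = (\<nu>\<^sup>2 - y) / (4 * y) * Y y"
   using that unfolding q_def Y_def by (simp add: divide_simps) (simp add: algebra_simps power2_eq_square)
  finally show ?thesis .
 qed
 have "\<forall>\<^sub>F y in at 0. bes \<nu> y > 0 \<and> q y > 0"
 proof (rule eventually_conj)
  show "\<forall>\<^sub>F y in at 0. bes \<nu> y > 0"
   using DERIV_isCont[OF bes_has_derivative[OF s, of 0]] by (intro order_tendstoD(1)) (auto simp: isCont_def bes_0)
  show "\<forall>\<^sub>F y in at 0. q y > 0"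
   using DERIV_isCont[OF dq[of 0]] s0 by (intro order_tendstoD(1)[of q "q 0"]) (auto simp: isCont_def q_def bes_0)
 qed
 then obtain d where d: "d > 0" "\<And>y. y \<noteq> 0 ==> \<bar>y\<bar> < d ==> bes \<nu> y > 0 \<and> q y > 0"
  by (auto simp: eventually_at dist_real_def)
 show ?thesis
 proof (rule ccontr)
  assume neg: "\<not> bes \<nu> x > 0"
  define a where "a = d/2"
  have a: "0 < a" "bes \<nu> a > 0" "q a > 0" using d by (auto simp: a_def)
  have ax: "a < x" using neg d(2)[of x] x0 d(1) unfolding a_def by (cases "x < d") auto
  \<comment> \<open>\<open>b\<close> is the first point of \<open>{a..x}\<close> at which
    \<open>bes \<nu>\<close> is no longer positive. Up to there \<open>U\<close>, and with it
    \<open>Y\<close>, does not decrease, which excludes such a point.\<close>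
  define A where "A = {a..x} \<inter> {t\<in>{a..x}. bes \<nu> t \<in> {..0}}"
  have "closed {t\<in>{a..x}. bes \<nu> t \<in> {..0}}"
   using continuous_closed_preimage[OF continuous_bes(1)[OF s], of "{a..x}" "{..0}"] by (simp add: vimage_def Int_def)
  hence "compact A" unfolding A_def by (intro compact_Int_closed) auto
  moreover have "x \<in> A" using neg ax by (auto simp: A_def)
  ultimately obtain b where b: "b \<in> A" "\<And>t. t \<in> A ==> b \<le> t"
   using compact_attains_inf[of A] by blast
  have b': "a \<le> b" "b \<le> x" "bes \<nu> b \<le> 0" using b by (auto simp: A_def)
  have pos: "bes \<nu> t > 0" if "a \<le> t" "t < b" for t
   using b(2)[of t] that b' unfolding A_def by force
  have Un: "U t \<ge> U a" if "a \<le> t" "t \<le> b" for t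
  proof (rule DERIV_nonneg_imp_increasing_open[OF \<open>a \<le> t\<close>])
   fix y assume y: "a < y" "y < t"
   hence "bes \<nu> y > 0" using pos[of y] that by auto
   hence "(\<nu>\<^sup>2 - y) / (4 * y) * Y y \<ge> 0" using y a b' that x by (auto simp: Y_def)
   thus "\<exists>D. DERIV U y :> D \<and> 0 \<le> D" using dU[of y] y a by (intro exI conjI) auto
  qed (rule DERIV_continuous_on[OF has_field_derivative_at_within[OF dU]], use a in auto)
  have Ua: "U a > 0" using a by (simp add: U_def)
  have "Y a \<le> Y b"
  proof (rule DERIV_nonneg_imp_nondecreasing[OF \<open>a \<le> b\<close>])
   fix t assume t: "a \<le> t" "t \<le> b"
   hence "U t / t \<ge> 0" using Un[OF t] Ua a by simp
   thus "\<exists>D. DERIV Y t :> D \<and> 0 \<le> D" using dY[of t] t a by auto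
  qed
  moreover have "Y a > 0" using a by (simp add: Y_def)
  ultimately have "Y b > 0" by simp
  thus False using b' a by (simp add: Y_def zero_less_mult_iff)
 qed
qed

section \<open>Phases, zero counts and the transmission determinant\<close>

lemma sin_zero_Ints: "sin x = 0 \<longleftrightarrow> x / pi \<in> \<int>"
 by (auto simp: sin_zero_iff_int2 Ints_def field_simps)

lemma card_strict_mono_levels:
 fixes \<theta> :: "real => real"
 assumes ab: "a \<le> b" and c: "continuous_on {a..b} \<theta>" and sm: "strict_mono_on {a..b} \<theta>"
 shows "finite {x\<in>{a<..b}. \<theta> x / pi \<in> \<int>}"
  "int (card {x\<in>{a<..b}. \<theta> x / pi \<in> \<int>}) = \<lfloor>\<theta> b / pi\<rfloor> - \<lfloor>\<theta> a / pi\<rfloor>"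
proof -
 define \<psi> where "\<psi> x = \<theta> x / pi" for x
 have sm': "\<psi> u < \<psi> v" if "u \<in> {a..b}" "v \<in> {a..b}" "u < v" for u v
  using strict_mono_onD[OF sm that] by (simp add: \<psi>_def divide_strict_right_mono)
 have c': "continuous_on {a..b} \<psi>" unfolding \<psi>_def by (intro continuous_intros c) auto
 have R: "\<exists>d>0. \<forall>y\<in>{a..b}. x < y \<and> y < x + d --> \<psi> y > of_int k"
  and L: "\<exists>d>0. \<forall>y\<in>{a..b}. x - d < y \<and> y < x --> \<psi> y < of_int k"
  if "x \<in> {a..b}" "\<psi> x = of_int k" for x and k :: int
 proof -
  have "\<psi> y > of_int k" if "y \<in> {a..b}" "x < y" for y
   using sm'[of x y] that \<open>x \<in> {a..b}\<close> \<open>\<psi> x = of_int k\<close> by simp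
  thus "\<exists>d>0. \<forall>y\<in>{a..b}. x < y \<and> y < x + d --> \<psi> y > of_int k" by (intro exI[of _ "1::real"]) auto
  have "\<psi> y < of_int k" if "y \<in> {a..b}" "y < x" for y
   using sm'[of y x] that \<open>x \<in> {a..b}\<close> \<open>\<psi> x = of_int k\<close> by simp
  thus "\<exists>d>0. \<forall>y\<in>{a..b}. x - d < y \<and> y < x --> \<psi> y < of_int k" by (intro exI[of _ "1::real"]) auto
 qed
 note * = card_upward_crossings[OF ab c' R L]
 from * show "finite {x\<in>{a<..b}. \<theta> x / pi \<in> \<int>}"
  "int (card {x\<in>{a<..b}. \<theta> x / pi \<in> \<int>}) = \<lfloor>\<theta> b / pi\<rfloor> - \<lfloor>\<theta> a / pi\<rfloor>" by (simp_all add: \<psi>_def)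
qed

text \<open>The argument of the curve \<open>A + i B\<close> has the Wronskian over the squared
  modulus as derivative, so it increases, and \<open>B\<close> vanishes exactly where it is a
  multiple of pi. Every zero count below is an instance, with \<open>A\<close> and \<open>B\<close>
  adapted to the region of the variable.\<close>

lemma phase_of_pair:
 fixes A B A' B' :: "real => real"
 assumes ab: "a \<le> b"
  and dA: "\<And>t. t \<in> {a..b} ==> DERIV A t :> A' t"
  and dB: "\<And>t. t \<in> {a..b} ==> DERIV B t :> B' t"
  and cA: "continuous_on {a..b} A'" and cB: "continuous_on {a..b} B'"
  and nz: "\<And>t. t \<in> {a..b} ==> B t = 0 ==> A t \<noteq> 0"
  and pos: "\<And>t. t \<in> {a<..<b} ==> B' t * A t - B t * A' t > 0"
 obtains \<theta> r where "continuous_on {a..b} \<theta>"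
  "\<And>t. t \<in> {a<..<b} ==> DERIV \<theta> t :> (B' t * A t - B t * A' t) / ((A t)\<^sup>2 + (B t)\<^sup>2)"
  "finite {x\<in>{a<..b}. B x = 0}"
  "int (card {x\<in>{a<..b}. B x = 0}) = \<lfloor>\<theta> b / pi\<rfloor> - \<lfloor>\<theta> a / pi\<rfloor>"
  "strict_mono_on {a..b} \<theta>" "\<theta> a = Arg (Complex (A a) (B a))"
  "\<And>t. t \<in> {a..b} ==> r t > 0 \<and> B t = r t * sin (\<theta> t) \<and> A t = r t * cos (\<theta> t)"
proof -
 define z where "z t = Complex (A t) (B t)" for t
 define z' where "z' t = Complex (A' t) (B' t)" for t
 have vec: "((\<lambda>x. complex_of_real (h x)) has_vector_derivative complex_of_real D) (at x within {a..b})"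
  if "DERIV h x :> D" for h D x
  by (rule has_vector_derivative_of_real)
   (use that in \<open>auto simp: has_real_derivative_iff_has_vector_derivative intro: has_vector_derivative_at_within\<close>)
 have dz: "(z has_vector_derivative z' x) (at x within {a..b})" if "x \<in> {a..b}" for x
  unfolding z_def z'_def Complex_eq
  by (intro has_vector_derivative_add has_vector_derivative_mult_right vec dA dB that)
 have cz': "continuous_on {a..b} z'"
  unfolding z'_def Complex_eq by (intro continuous_intros cA cB)
 have nz': "z x \<noteq> 0" if "x \<in> {a..b}" for x
  using nz[OF that] by (auto simp: z_def complex_eq_iff)
 have z0: "z a = of_real (norm (z a)) * cis (Arg (z a))"
  using nz'[of a] ab by (simp add: cis_Arg sgn_eq)
 obtain \<theta> where tha: "\<theta> a = Arg (z a)" and th: "\<And>x. x \<in> {a..b} ==> z x = of_real (norm (z x)) * cis (\<theta> x)"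
  "\<And>x. x \<in> {a..b} ==> (\<theta> has_real_derivative Im (z' x / z x)) (at x within {a..b})"
  by (rule phase_exists[OF ab dz cz' nz' z0], assumption+, rule that)
 have Imq: "Im (z' x / z x) = (B' x * A x - B x * A' x) / ((A x)\<^sup>2 + (B x)\<^sup>2)" for x
  unfolding z_def z'_def Im_divide complex.sel mult.commute[of "A' x"] ..
 have ct: "continuous_on {a..b} \<theta>"
  by (meson DERIV_continuous continuous_on_eq_continuous_within th(2))
 have d: "DERIV \<theta> t :> (B' t * A t - B t * A' t) / ((A t)\<^sup>2 + (B t)\<^sup>2)" if t: "t \<in> {a<..<b}" for t
 proof -
  have "at t within {a..b} = at t" using t by (intro at_within_interior) auto
  thus ?thesis using th(2)[of t] t unfolding Imq by auto
 qed
 have sm: "strict_mono_on {a..b} \<theta>"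
 proof (rule strict_mono_onI)
  fix u v assume uv: "u \<in> {a..b}" "v \<in> {a..b}" "u < v"
  show "\<theta> u < \<theta> v"
  proof (rule DERIV_pos_imp_increasing_open[OF \<open>u < v\<close>])
   fix x assume x: "u < x" "x < v"
   hence xab: "x \<in> {a<..<b}" using uv by auto
   have "(A x)\<^sup>2 + (B x)\<^sup>2 > 0" using nz[of x] xab by (auto simp: sum_power2_gt_zero_iff)
   with pos[OF xab] have "(B' x * A x - B x * A' x) / ((A x)\<^sup>2 + (B x)\<^sup>2) > 0" by (rule divide_pos_pos)
   with d[OF xab] show "\<exists>y. DERIV \<theta> x :> y \<and> 0 < y" by blast
  next
   show "continuous_on {u..v} \<theta>" using ct by (rule continuous_on_subset) (use uv in auto)
  qed
 qed
 have polar: "norm (z x) > 0 \<and> B x = norm (z x) * sin (\<theta> x) \<and> A x = norm (z x) * cos (\<theta> x)" if x: "x \<in> {a..b}" for x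
  using arg_cong[OF th(1)[OF x], of Im] arg_cong[OF th(1)[OF x], of Re] nz'[OF x] by (simp add: z_def)
 have e: "{x\<in>{a<..b}. B x = 0} = {x\<in>{a<..b}. \<theta> x / pi \<in> \<int>}"
 proof -
  have "B x = 0 \<longleftrightarrow> \<theta> x / pi \<in> \<int>" if "x \<in> {a<..b}" for x
   using polar[of x] that sin_zero_Ints[of "\<theta> x"] by auto
  thus ?thesis by auto
 qed
 show ?thesis
 proof (rule that[OF ct d _ _ sm tha[unfolded z_def] polar])
  show "finite {x\<in>{a<..b}. B x = 0}" unfolding e by (rule card_strict_mono_levels(1)[OF ab ct sm])
  show "int (card {x\<in>{a<..b}. B x = 0}) = \<lfloor>\<theta> b / pi\<rfloor> - \<lfloor>\<theta> a / pi\<rfloor>"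
   unfolding e by (rule card_strict_mono_levels(2)[OF ab ct sm])
 qed
qed

text \<open>The pair \<open>(x * bes', bes)\<close> has Wronskian \<open>bes_p\<close>, and it
  starts at the point (0, 1), hence at the angle pi / 2 whatever the order.\<close>

lemma bes_phase:
 assumes s: "\<nu> \<ge> 0" and X: "X > 0"
 obtains \<theta> r where "\<theta> 0 = pi / 2" "continuous_on {0..X} \<theta>" "strict_mono_on {0..X} \<theta>"
  "\<And>x. x \<in> {0..X} ==> r x > 0"
  "\<And>x. x \<in> {0..X} ==> bes \<nu> x = r x * sin (\<theta> x)"
  "\<And>x. x \<in> {0..X} ==> x * bes' \<nu> x = r x * cos (\<theta> x)"
proof (rule phase_of_pair[OF less_imp_le[OF X] bes_g_has_derivative[OF s] bes_has_derivative[OF s]])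
 show "continuous_on {0..X} (\<lambda>x. - \<nu> * bes' \<nu> x - bes \<nu> x / 4)" "continuous_on {0..X} (bes' \<nu>)"
  by (intro continuous_intros continuous_bes s; simp)+
 show "t * bes' \<nu> t \<noteq> 0" if "t \<in> {0..X}" "bes \<nu> t = 0" for t using bes_nonzero[OF s, of t] that by auto
 show "bes' \<nu> t * (t * bes' \<nu> t) - bes \<nu> t * (- \<nu> * bes' \<nu> t - bes \<nu> t / 4) > 0" if "t \<in> {0<..<X}" for t
  using bes_p_pos[OF s, of t] that by (simp add: bes_p_def power2_eq_square algebra_simps)
 fix \<theta> r assume "continuous_on {0..X} \<theta>" "strict_mono_on {0..X} \<theta>" "\<theta> 0 = Arg (Complex (0 * bes' \<nu> 0) (bes \<nu> 0))"
  "\<And>t. t \<in> {0..X} ==> r t > 0 \<and> bes \<nu> t = r t * sin (\<theta> t) \<and> t * bes' \<nu> t = r t * cos (\<theta> t)"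
 thus thesis using that[of \<theta> r] by (simp add: bes_0 Complex_eq)
qed

definition bes_zeros :: "real => real => real set" where
 "bes_zeros \<nu> X = {x\<in>{0<..X}. bes \<nu> x = 0}"

text \<open>The initial phase pi / 2 has floor 0 after division by pi, so only the floor at the
  right endpoint remains.\<close>

lemma card_bes_zeros_phase:
 fixes \<theta> :: "real => real"
 assumes "\<theta> 0 = pi / 2" "continuous_on {0..X} \<theta>" "strict_mono_on {0..X} \<theta>" "0 \<le> Y" "Y \<le> X"
  "\<And>x. x \<in> {0..X} ==> r x > 0" "\<And>x. x \<in> {0..X} ==> bes \<nu> x = r x * sin (\<theta> x)"
 shows "finite (bes_zeros \<nu> Y)" "int (card (bes_zeros \<nu> Y)) = \<lfloor>\<theta> Y / pi\<rfloor>"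
proof -
 have sub: "{0..Y} \<subseteq> {0..X}" using assms(5) by auto
 have "bes \<nu> x = 0 \<longleftrightarrow> \<theta> x / pi \<in> \<int>" if "x \<in> {0..X}" for x
  using assms(6)[OF that] assms(7)[OF that] sin_zero_Ints[of "\<theta> x"] by auto
 hence e: "bes_zeros \<nu> Y = {x\<in>{0<..Y}. \<theta> x / pi \<in> \<int>}" unfolding bes_zeros_def using assms(5) by auto
 note * = card_strict_mono_levels[OF assms(4) continuous_on_subset[OF assms(2) sub] monotone_on_subset[OF assms(3) sub]]
 show "finite (bes_zeros \<nu> Y)" "int (card (bes_zeros \<nu> Y)) = \<lfloor>\<theta> Y / pi\<rfloor>"
  unfolding e using * by (simp_all add: assms(1))
qed

lemma finite_bes_zeros: "\<nu> \<ge> 0 ==> finite (bes_zeros \<nu> Y)"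
proof (cases "Y > 0")
 case True assume s: "\<nu> \<ge> 0"
 show ?thesis using bes_phase[OF s True] card_bes_zeros_phase(1) True
  by (metis less_eq_real_def)
qed (simp add: bes_zeros_def)

lemma bes_zeros_empty: "\<nu> \<ge> 0 ==> Y \<le> \<nu>\<^sup>2 ==> bes_zeros \<nu> Y = {}"
 using bes_pos_below[of \<nu>] by (auto simp: bes_zeros_def) (metis less_eq_real_def less_irrefl order.trans)

text \<open>The Wronskian-type determinant whose zeros \<open>x = \<lambda>\<^sup>2\<close> are the transmission eigenvalues.\<close>

definition bes_det :: "real => real => real => real => real" where
 "bes_det \<nu> a b x = bes \<nu> (a * x) * (b * x * bes' \<nu> (b * x)) - (a * x * bes' \<nu> (a * x)) * bes \<nu> (b * x)"

definition det_zeros :: "real => real => real => real => real set" where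
 "det_zeros \<nu> a b X = {x\<in>{0<..X}. bes_det \<nu> a b x = 0}"

text \<open>Lagrange's identity: both profiles solve the same self-adjoint equation with weight
  \<open>x powr \<nu>\<close> and spectral parameters \<open>a\<close> and \<open>b\<close>, so the
  weighted Wronskian differentiates to \<open>b - a\<close> times their product.\<close>

lemma bes_det_has_derivative:
 assumes s: "\<nu> \<ge> 0" and x: "x > 0"
 shows "((\<lambda>x. x powr \<nu> * bes_det \<nu> a b x) has_real_derivative
      - (b - a) / 4 * x powr \<nu> * bes \<nu> (a * x) * bes \<nu> (b * x)) (at x)"
proof -
 have f: "DERIV (\<lambda>x. bes \<nu> (c * x)) x :> bes' \<nu> (c * x) * c" for c
  using DERIV_chain2[OF bes_has_derivative[OF s], of "\<lambda>x. c * x" c x] DERIV_cmult[OF DERIV_ident, of c] by simp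
 have g: "DERIV (\<lambda>x. c * x * bes' \<nu> (c * x)) x :> (- \<nu> * bes' \<nu> (c * x) - bes \<nu> (c * x) / 4) * c" for c
  using DERIV_chain2[OF bes_g_has_derivative[OF s], of "\<lambda>x. c * x" c x] DERIV_cmult[OF DERIV_ident, of c] by simp
 have p: "DERIV (\<lambda>y. y powr \<nu>) x :> \<nu> * (x powr \<nu> / x)"
  using has_real_derivative_powr[OF x, of \<nu>] x by (simp add: powr_diff)
 show ?thesis unfolding bes_det_def
  by (rule DERIV_cong[OF DERIV_mult[OF p DERIV_diff[OF DERIV_mult[OF f g] DERIV_mult[OF g f]]]])
   (use x in \<open>simp add: field_simps\<close>)
qed

lemma sin_pos_imp_pos: "sin (u::real) > 0 ==> \<bar>u\<bar> < pi ==> u > 0"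
 using sin_ge_zero[of "-u"] by (cases "u \<le> 0") auto

lemma sin_neg_imp_neg: "sin (u::real) < 0 ==> \<bar>u\<bar> < pi ==> u < 0"
 using sin_ge_zero[of "u"] by (cases "u \<ge> 0") auto

text \<open>Up to a positive factor the weighted determinant is the sine of the deviation of the
  phase difference from the level, so it suffices that the determinant, with the right sign,
  increases through \<open>x0\<close>. By Lagrange's identity this is a statement about the sign of
  \<open>sin (A y) * sin (B y)\<close> near \<open>x0\<close>.\<close>

lemma phase_difference_crossing:
 assumes s: "\<nu> \<ge> 0" and ab: "0 < a" "a < b" and X: "X > 0"
  and th: "continuous_on {0..b*X} \<theta>" "strict_mono_on {0..b*X} \<theta>"
  "\<And>x. x \<in> {0..b*X} ==> r x > 0"
  "\<And>x. x \<in> {0..b*X} ==> bes \<nu> x = r x * sin (\<theta> x)"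
  "\<And>x. x \<in> {0..b*X} ==> x * bes' \<nu> x = r x * cos (\<theta> x)"
  and x0: "0 < x0" "x0 \<le> X" and k: "\<theta> (b*x0) - \<theta> (a*x0) = of_int k * pi"
 shows "\<exists>d>0. \<forall>y\<in>{0..X}. (x0 < y \<and> y < x0 + d --> \<theta> (b*y) - \<theta> (a*y) > of_int k * pi)
          \<and> (x0 - d < y \<and> y < x0 --> \<theta> (b*y) - \<theta> (a*y) < of_int k * pi)"
proof -
 have b0: "b > 0" using ab by simp
 have inb: "b * y \<in> {0..b*X}" "a * y \<in> {0..b*X}" if "y \<in> {0..X}" for y
  using that ab b0 mult_mono[of a b y X] by auto
 define A where "A y = \<theta> (a * y)" for y
 define B where "B y = \<theta> (b * y)" for y
 have cA: "continuous_on {0..X} A" and cB: "continuous_on {0..X} B" unfolding A_def B_def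
  by (rule continuous_on_compose2[OF th(1)]; use inb in \<open>auto intro!: continuous_intros\<close>)+
 have x0': "x0 \<in> {0..X}" using x0 by simp
 define c where "c = cos (of_int k * pi)"
 have sk: "sin (of_int k * pi) = 0" by (simp add: sin_zero_iff_int2)
 have c2: "c * c = 1" using sin_cos_squared_add[of "of_int k * pi"] sk by (simp add: c_def power2_eq_square)
 have AB: "B x0 - A x0 = of_int k * pi" using k by (simp add: A_def B_def)
 have near: "\<exists>d>0. \<forall>y\<in>{0..X}. \<bar>y - x0\<bar> < d --> \<bar>h y - h x0\<bar> < e" if "continuous_on {0..X} h" "e > 0" for h and e :: real
  using that x0' by (auto simp: continuous_on_iff dist_real_def)
 obtain d1 where d1: "d1 > 0" "\<And>y. y \<in> {0..X} ==> \<bar>y - x0\<bar> < d1 ==> \<bar>(B y - A y) - (B x0 - A x0)\<bar> < pi"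
  using near[OF continuous_on_diff[OF cB cA] pi_gt_zero] by blast
 \<comment> \<open>\<open>c\<close> is the sign (-1)^k. If \<open>sin (A x0)\<close> is nonzero, the
   product at \<open>x0\<close> is its square and continuity suffices. Otherwise both sines vanish
   at \<open>x0\<close>; both phases increase strictly, so the sines change sign together and the
   product is positive on both sides.\<close>
 obtain d2 where d2: "d2 > 0" "\<And>y. y \<in> {0..X} ==> \<bar>y - x0\<bar> < d2 ==> y \<noteq> x0 ==> c * sin (A y) * sin (B y) > 0"
 proof (cases "sin (A x0) = 0")
  case False
  have "sin (B x0) = sin (A x0) * c"
   using AB sk by (simp add: sin_add c_def eq_diff_eq[symmetric] diff_eq_eq)
  hence "c * sin (A x0) * sin (B x0) = (c * c) * (sin (A x0))\<^sup>2" by (simp add: power2_eq_square)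
  with False c2 have p: "c * sin (A x0) * sin (B x0) > 0" by simp
  have "continuous_on {0..X} (\<lambda>y. c * sin (A y) * sin (B y))"
   using cA cB by (intro continuous_intros)
  from near[OF this p] obtain d where "d > 0" "\<And>y. y \<in> {0..X} ==> \<bar>y - x0\<bar> < d ==> \<bar>c * sin (A y) * sin (B y) - c * sin (A x0) * sin (B x0)\<bar> < c * sin (A x0) * sin (B x0)"
   by auto
  thus ?thesis by (intro that[of d]) (force simp: abs_if split: if_splits)+
 next
  case True
  then obtain j where j: "A x0 = of_int j * pi" by (auto simp: sin_zero_iff_int2)
  define ca where "ca = cos (of_int j * pi)"
  have sj: "sin (of_int j * pi) = 0" by (simp add: sin_zero_iff_int2)
  have ca2: "ca * ca = 1" using sin_cos_squared_add[of "of_int j * pi"] sj by (simp add: ca_def power2_eq_square)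
  obtain d3 where d3: "d3 > 0" "\<And>y. y \<in> {0..X} ==> \<bar>y - x0\<bar> < d3 ==> \<bar>A y - A x0\<bar> < pi"
   using near[OF cA pi_gt_zero] by auto
  obtain d4 where d4: "d4 > 0" "\<And>y. y \<in> {0..X} ==> \<bar>y - x0\<bar> < d4 ==> \<bar>B y - B x0\<bar> < pi"
   using near[OF cB pi_gt_zero] by auto
  show ?thesis
  proof (rule that[of "min d3 d4"])
   show "min d3 d4 > 0" using d3 d4 by simp
   fix y assume y: "y \<in> {0..X}" "\<bar>y - x0\<bar> < min d3 d4" "y \<noteq> x0"
   have "sin (A y) = sin ((A y - A x0) + of_int j * pi)" using j by simp
   hence e1: "sin (A y) = sin (A y - A x0) * ca" using sj by (simp only: sin_add ca_def)
   have "B y = ((B y - B x0) + of_int j * pi) + of_int k * pi" using j AB by linarith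
   hence "sin (B y) = sin (((B y - B x0) + of_int j * pi) + of_int k * pi)" by (rule arg_cong[where f=sin])
   also have "\<dots> = sin (B y - B x0) * ca * c"
    unfolding sin_add[of _ "of_int k * pi"] sin_add[of _ "of_int j * pi"] sj sk ca_def c_def by simp
   finally have e2: "sin (B y) = sin (B y - B x0) * ca * c" .
   have "c * sin (A y) * sin (B y) = (c * c) * (ca * ca) * (sin (A y - A x0) * sin (B y - B x0))"
    unfolding e1 e2 by (simp add: mult_ac)
   also have "\<dots> = sin (A y - A x0) * sin (B y - B x0)" using c2 ca2 by simp
   also have "\<dots> > 0"
   proof (cases "y > x0")
    case True
    have "A x0 < A y" "B x0 < B y" unfolding A_def B_def
     using True ab b0 strict_mono_onD[OF th(2) inb(1)[OF x0'] inb(1)[OF y(1)]]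
      strict_mono_onD[OF th(2) inb(2)[OF x0'] inb(2)[OF y(1)]] by simp_all
    thus ?thesis using d3(2)[of y] d4(2)[of y] y by (intro mult_pos_pos sin_gt_zero) auto
   next
    case False
    hence "y < x0" using y by simp
    hence "A y < A x0" "B y < B x0" unfolding A_def B_def
     using ab b0 strict_mono_onD[OF th(2) inb(1)[OF y(1)] inb(1)[OF x0']]
      strict_mono_onD[OF th(2) inb(2)[OF y(1)] inb(2)[OF x0']] by simp_all
    hence "sin (- (A y - A x0)) > 0" "sin (-(B y - B x0)) > 0"
     using d3(2)[of y] d4(2)[of y] y by (intro sin_gt_zero; simp)+
    hence "sin (A y - A x0) < 0" "sin (B y - B x0) < 0" by (simp_all only: sin_minus)
    thus ?thesis by (rule mult_neg_neg)
   qed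
   finally show "c * sin (A y) * sin (B y) > 0" .
  qed
 qed
 \<comment> \<open>The sign \<open>- c\<close> is chosen so that \<open>Vs\<close> has the sine with
   positive coefficients and \<open>dV\<close> has the product treated above, making
   \<open>V\<close> strictly increasing on both sides of its zero \<open>x0\<close>.\<close>
 define V where "V y = - c * (y powr \<nu> * bes_det \<nu> a b y)" for y
 have Vs: "V y = y powr \<nu> * r (a*y) * r (b*y) * sin (B y - A y - of_int k * pi)" if "y \<in> {0..X}" for y
 proof -
  have e1: "bes_det \<nu> a b y = r (a*y) * r (b*y) * (sin (A y) * cos (B y) - cos (A y) * sin (B y))"
   unfolding bes_det_def using th(4,5)[OF inb(1)[OF that]] th(4,5)[OF inb(2)[OF that]]
   by (simp add: A_def B_def algebra_simps)
  have e2: "sin (B y - A y - of_int k * pi) = (sin (B y) * cos (A y) - cos (B y) * sin (A y)) * c"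
   unfolding sin_diff sk c_def by simp
  show ?thesis unfolding V_def e1 e2 by (simp add: algebra_simps)
 qed
 have dV: "(V has_real_derivative ((b - a) / 4 * y powr \<nu> * r (a*y) * r (b*y) * (c * sin (A y) * sin (B y)))) (at y)"
  if "y \<in> {0..X}" "y > 0" for y
  unfolding V_def
  by (rule DERIV_cong[OF DERIV_cmult[OF bes_det_has_derivative[OF s that(2)]]])
   (use th(4)[OF inb(1)[OF that(1)]] th(4)[OF inb(2)[OF that(1)]] in \<open>simp add: A_def B_def algebra_simps\<close>)
 define d where "d = min (min d1 d2) x0"
 have d: "d > 0" "d \<le> d1" "d \<le> d2" "d \<le> x0" using d1 d2 x0 by (auto simp: d_def)
 have dVpos: "\<exists>D. DERIV V y :> D \<and> 0 < D" if "y \<in> {0..X}" "\<bar>y - x0\<bar> < d" "y \<noteq> x0" "y > 0" for y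
 proof -
  have "c * sin (A y) * sin (B y) > 0" using d2(2)[of y] that d by simp
  hence "(b - a) / 4 * y powr \<nu> * r (a*y) * r (b*y) * (c * sin (A y) * sin (B y)) > 0"
   using ab that(4) th(3)[OF inb(1)[OF that(1)]] th(3)[OF inb(2)[OF that(1)]]
   by (intro mult_pos_pos[OF mult_pos_pos[OF mult_pos_pos[OF mult_pos_pos]]]) auto
  with dV[OF that(1,4)] show ?thesis by blast
 qed
 have cV: "continuous_on {u..v} V" if "0 < u" "v \<le> X" for u v
  by (rule DERIV_continuous_on[OF has_field_derivative_at_within[OF dV]]) (use that in auto)
 have V0: "V x0 = 0" unfolding Vs[OF x0'] using AB by simp
 have sgn: "sin (B y - A y - of_int k * pi) > 0 \<longleftrightarrow> V y > 0" "sin (B y - A y - of_int k * pi) < 0 \<longleftrightarrow> V y < 0"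
  if "y \<in> {0..X}" "y > 0" for y
  unfolding Vs[OF that(1)] using th(3)[OF inb(1)[OF that(1)]] th(3)[OF inb(2)[OF that(1)]] that(2)
  by (auto simp: zero_less_mult_iff mult_less_0_iff)
 show ?thesis
 proof (intro exI[of _ d] conjI ballI impI)
  show "d > 0" by fact
  fix y assume y: "y \<in> {0..X}"
  show "\<theta> (b*y) - \<theta> (a*y) > of_int k * pi" if xy: "x0 < y \<and> y < x0 + d"
  proof -
   have "V x0 < V y"
    by (rule DERIV_pos_imp_increasing_open) (use xy y x0 in \<open>auto intro!: dVpos cV\<close>)
   hence "sin (B y - A y - of_int k * pi) > 0" using sgn(1)[OF y] V0 xy x0 by simp
   hence "B y - A y - of_int k * pi > 0"
    by (rule sin_pos_imp_pos) (use d1(2)[OF y] AB xy d in auto)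
   thus ?thesis by (simp add: A_def B_def)
  qed
  show "\<theta> (b*y) - \<theta> (a*y) < of_int k * pi" if xy: "x0 - d < y \<and> y < x0"
  proof -
   have y0: "y > 0" using xy d by simp
   have "V y < V x0"
    by (rule DERIV_pos_imp_increasing_open) (use xy y x0 y0 in \<open>auto intro!: dVpos cV\<close>)
   hence "sin (B y - A y - of_int k * pi) < 0" using sgn(2)[OF y y0] V0 by simp
   hence "B y - A y - of_int k * pi < 0"
    by (rule sin_neg_imp_neg) (use d1(2)[OF y] AB xy d in auto)
   thus ?thesis by (simp add: A_def B_def)
  qed
 qed
qed

text \<open>The determinant vanishes where the phase difference over pi is an integer, and upward
  crossings make the count one floor; the Bessel counts are the floors of the two phases, which
  gives the error 1. If \<open>b * X\<close> is below the turning point, both phases lie between pi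
  / 2 and pi and their difference cannot reach pi.\<close>

lemma det_zeros_count:
 assumes s: "\<nu> \<ge> 0" and ab: "0 < a" "a < b"
 shows "finite (det_zeros \<nu> a b X)"
  and "\<bar>int (card (det_zeros \<nu> a b X)) - (int (card (bes_zeros \<nu> (b*X))) - int (card (bes_zeros \<nu> (a*X))))\<bar> \<le> 1"
  and "b * X \<le> \<nu>\<^sup>2 ==> det_zeros \<nu> a b X = {}"
proof -
 have "finite (det_zeros \<nu> a b X) \<and>
  \<bar>int (card (det_zeros \<nu> a b X)) - (int (card (bes_zeros \<nu> (b*X))) - int (card (bes_zeros \<nu> (a*X))))\<bar> \<le> 1
  \<and> (b * X \<le> \<nu>\<^sup>2 --> det_zeros \<nu> a b X = {})"
 proof (cases "X > 0")
  case False
  hence "b * X \<le> 0" "a * X \<le> 0" using ab by (auto simp: mult_le_0_iff)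
  thus ?thesis using False by (simp add: det_zeros_def bes_zeros_def)
 next
  case True
  have b0: "b > 0" using ab by simp
  have bX: "b * X > 0" using True b0 by simp
  obtain \<theta> r where th: "\<theta> 0 = pi / 2" "continuous_on {0..b*X} \<theta>" "strict_mono_on {0..b*X} \<theta>"
   "\<And>x. x \<in> {0..b*X} ==> r x > 0"
   "\<And>x. x \<in> {0..b*X} ==> bes \<nu> x = r x * sin (\<theta> x)"
   "\<And>x. x \<in> {0..b*X} ==> x * bes' \<nu> x = r x * cos (\<theta> x)"
   using bes_phase[OF s bX] by metis
  have inb: "b * y \<in> {0..b*X}" "a * y \<in> {0..b*X}" if "y \<in> {0..X}" for y
   using that ab b0 mult_mono[of a b y X] by auto
  define \<psi> where "\<psi> y = (\<theta> (b*y) - \<theta> (a*y)) / pi" for y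
  have c: "continuous_on {0..X} \<psi>" unfolding \<psi>_def
   by (intro continuous_intros continuous_on_compose2[OF th(2)]; use inb in \<open>auto intro!: continuous_intros\<close>)
  have pos: "\<psi> y > 0" if "y \<in> {0..X}" "y > 0" for y
   unfolding \<psi>_def using strict_mono_onD[OF th(3) inb(2)[OF that(1)] inb(1)[OF that(1)]] ab that by simp
  have cross: "\<exists>d>0. \<forall>y\<in>{0..X}. (x < y \<and> y < x + d --> \<psi> y > of_int k) \<and> (x - d < y \<and> y < x --> \<psi> y < of_int k)"
   if x: "x \<in> {0..X}" "\<psi> x = of_int k" for x and k :: int
  proof (cases "x = 0")
   \<comment> \<open>At the left endpoint the difference is 0, so only the level 0 occurs, and it is
     left upwards because the phase increases strictly and a < b.\<close>
   case True
   thus ?thesis using x pos by (intro exI[of _ 1]) (auto simp: \<psi>_def)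
  next
   case False
   hence "\<theta> (b*x) - \<theta> (a*x) = of_int k * pi" "0 < x" "x \<le> X" using x by (auto simp: \<psi>_def field_simps)
   thus ?thesis using phase_difference_crossing[OF s ab True th(2-6), of x k]
    by (simp add: \<psi>_def field_simps)
  qed
  have e: "det_zeros \<nu> a b X = {x\<in>{0<..X}. \<psi> x \<in> \<int>}"
  proof -
   have "bes_det \<nu> a b x = 0 \<longleftrightarrow> \<psi> x \<in> \<int>" if x: "x \<in> {0..X}" for x
   proof -
    have "bes_det \<nu> a b x = - r (a*x) * r (b*x) * sin (\<theta> (b*x) - \<theta> (a*x))"
     unfolding bes_det_def using th(5,6)[OF inb(1)[OF x]] th(5,6)[OF inb(2)[OF x]]
     by (simp add: sin_diff algebra_simps)
    thus ?thesis using th(4)[OF inb(1)[OF x]] th(4)[OF inb(2)[OF x]] sin_zero_Ints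
     by (simp add: \<psi>_def)
   qed
   thus ?thesis by (auto simp: det_zeros_def)
  qed
  have crossR: "\<exists>d>0. \<forall>y\<in>{0..X}. x < y \<and> y < x + d --> \<psi> y > of_int k"
   and crossL: "\<exists>d>0. \<forall>y\<in>{0..X}. x - d < y \<and> y < x --> \<psi> y < of_int k"
   if x: "x \<in> {0..X}" "\<psi> x = of_int k" for x and k :: int
   using cross[OF x] by meson+
  have cnt: "finite (det_zeros \<nu> a b X)" "int (card (det_zeros \<nu> a b X)) = \<lfloor>\<psi> X\<rfloor>"
   using card_upward_crossings[OF less_imp_le[OF True] c crossR crossL] unfolding e
   by (auto simp: \<psi>_def)
  have Xin: "X \<in> {0..X}" using True by simp
  have zb: "int (card (bes_zeros \<nu> (b*X))) = \<lfloor>\<theta> (b*X) / pi\<rfloor>"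
   using card_bes_zeros_phase(2)[OF th(1-3) _ _ th(4,5)] inb(1)[OF Xin] by auto
  have za: "int (card (bes_zeros \<nu> (a*X))) = \<lfloor>\<theta> (a*X) / pi\<rfloor>"
   using card_bes_zeros_phase(2)[OF th(1-3) _ _ th(4,5), of "a*X"] inb(2)[OF Xin] by auto
  have "\<psi> X = \<theta> (b*X) / pi - \<theta> (a*X) / pi" by (simp add: \<psi>_def diff_divide_distrib)
  hence "\<bar>\<lfloor>\<psi> X\<rfloor> - (\<lfloor>\<theta> (b*X) / pi\<rfloor> - \<lfloor>\<theta> (a*X) / pi\<rfloor>)\<bar> \<le> 1" by linarith
  moreover have "det_zeros \<nu> a b X = {}" if le: "b * X \<le> \<nu>\<^sup>2"
  proof -
   have "\<lfloor>\<theta> (b*X) / pi\<rfloor> = 0" using zb bes_zeros_empty[OF s le] by simp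
   moreover have "\<theta> (a*X) \<ge> pi/2"
    using strict_mono_on_leD[OF th(3), of 0 "a*X"] inb(2)[OF Xin] bX th(1) ab True by auto
   ultimately have "\<theta> (b*X) / pi < 1" "\<theta> (a*X) / pi > 0"
    by (auto simp: floor_eq_iff intro!: divide_pos_pos less_le_trans[OF _ \<open>\<theta> (a*X) \<ge> pi/2\<close>])
   hence "\<psi> X < 1" unfolding \<psi>_def diff_divide_distrib by linarith
   moreover have "\<psi> X > 0" using pos[OF Xin True] .
   ultimately have "\<lfloor>\<psi> X\<rfloor> = 0" by (simp add: floor_eq_iff)
   thus ?thesis using cnt by simp
  qed
  ultimately show ?thesis using cnt zb za by auto
 qed
 thus "finite (det_zeros \<nu> a b X)"
  and "\<bar>int (card (det_zeros \<nu> a b X)) - (int (card (bes_zeros \<nu> (b*X))) - int (card (bes_zeros \<nu> (a*X))))\<bar> \<le> 1"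
  and "b * X \<le> \<nu>\<^sup>2 ==> det_zeros \<nu> a b X = {}" by auto
qed

section \<open>Zero counts uniform in the order\<close>

text \<open>Back in the variable t: multiplied by \<open>t powr \<nu>\<close>, \<open>bes_f\<close>
  and \<open>bes_w\<close> are, up to one common constant, the Bessel function J and t J'. Dropping
  this positive factor does not change phases.\<close>

definition bes_f :: "real => real => real" where "bes_f \<nu> t = bes \<nu> (t\<^sup>2)"
definition bes_w :: "real => real => real" where "bes_w \<nu> t = \<nu> * bes \<nu> (t\<^sup>2) + 2 * t\<^sup>2 * bes' \<nu> (t\<^sup>2)"

lemma bes_fw_has_derivative:
 assumes s: "\<nu> \<ge> 0" and t: "t > 0"
 shows "DERIV (bes_f \<nu>) t :> (bes_w \<nu> t - \<nu> * bes_f \<nu> t) / t"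
  and "DERIV (bes_w \<nu>) t :> (- \<nu> * bes_w \<nu> t - (t\<^sup>2 - \<nu>\<^sup>2) * bes_f \<nu> t) / t"
proof -
 have sq: "DERIV (\<lambda>t. t\<^sup>2) t :> 2 * t" by (auto intro!: derivative_eq_intros)
 have f: "DERIV (\<lambda>t. bes \<nu> (t\<^sup>2)) t :> bes' \<nu> (t\<^sup>2) * (2 * t)"
  using DERIV_chain2[OF bes_has_derivative[OF s] sq] .
 have g: "DERIV (\<lambda>t. t\<^sup>2 * bes' \<nu> (t\<^sup>2)) t :> (- \<nu> * bes' \<nu> (t\<^sup>2) - bes \<nu> (t\<^sup>2) / 4) * (2 * t)"
  using DERIV_chain2[OF bes_g_has_derivative[OF s] sq] .
 show "DERIV (bes_f \<nu>) t :> (bes_w \<nu> t - \<nu> * bes_f \<nu> t) / t"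
  unfolding bes_f_def[abs_def]
  by (rule DERIV_cong[OF f]) (use t in \<open>simp add: bes_w_def power2_eq_square\<close>)
 have "((\<lambda>t. \<nu> * bes \<nu> (t\<^sup>2) + 2 * (t\<^sup>2 * bes' \<nu> (t\<^sup>2))) has_real_derivative
   (- \<nu> * bes_w \<nu> t - (t\<^sup>2 - \<nu>\<^sup>2) * bes_f \<nu> t) / t) (at t)"
  by (rule DERIV_cong[OF DERIV_add[OF DERIV_cmult[OF f] DERIV_cmult[OF g]]])
   (use t in \<open>simp add: bes_w_def bes_f_def field_simps power2_eq_square\<close>)
 thus "DERIV (bes_w \<nu>) t :> (- \<nu> * bes_w \<nu> t - (t\<^sup>2 - \<nu>\<^sup>2) * bes_f \<nu> t) / t"
  unfolding bes_w_def[abs_def] by (simp add: mult.assoc)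
qed

lemma bes_fw_nonzero:
 assumes s: "\<nu> \<ge> 0" and t: "t > 0" and "bes_f \<nu> t = 0" shows "bes_w \<nu> t \<noteq> 0"
proof -
 have e: "bes \<nu> (t\<^sup>2) = 0" using assms(3) by (simp add: bes_f_def)
 have "bes' \<nu> (t\<^sup>2) \<noteq> 0" by (rule bes_nonzero(1)[OF s _ e]) simp
 thus ?thesis using t unfolding bes_w_def e by simp
qed

text \<open>The Liouville-Green phase: the integral of \<open>sqrt (s^2 - \<nu>^2) / s\<close> over
  s from the turning point \<nu> to \<open>t\<close>.\<close>

definition bes_h :: "real => real => real" where
 "bes_h \<nu> t = sqrt (t\<^sup>2 - \<nu>\<^sup>2) - \<nu> * arccos (\<nu> / t)"

lemma bes_h_has_derivative:
 assumes s: "0 \<le> \<nu>" "\<nu> < t"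
 shows "DERIV (bes_h \<nu>) t :> sqrt (t\<^sup>2 - \<nu>\<^sup>2) / t"
proof -
 define R where "R = sqrt (t\<^sup>2 - \<nu>\<^sup>2)"
 have t0: "t > 0" using s by simp
 have Q: "t\<^sup>2 - \<nu>\<^sup>2 > 0" using s by (simp add: power_strict_mono)
 have R: "R > 0" "R * R = t\<^sup>2 - \<nu>\<^sup>2" using Q by (simp_all add: R_def)
 have d1: "DERIV (\<lambda>t. sqrt (t\<^sup>2 - \<nu>\<^sup>2)) t :> t / R"
  using Q by (auto intro!: derivative_eq_intros simp: R_def field_simps)
 have "DERIV (\<lambda>t. \<nu> / t) t :> - \<nu> / t\<^sup>2"
  using t0 by (auto intro!: derivative_eq_intros simp: power2_eq_square)
 moreover have "-1 < \<nu> / t" "\<nu> / t < 1" using s t0 by (auto simp: field_simps)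
 ultimately have d2: "((\<lambda>t. arccos (\<nu> / t)) has_real_derivative inverse (- sqrt (1 - (\<nu> / t)\<^sup>2)) * (- \<nu> / t\<^sup>2)) (at t)"
  by (intro DERIV_chain2[OF DERIV_arccos])
 have e: "sqrt (1 - (\<nu> / t)\<^sup>2) = R / t"
 proof -
  have "1 - (\<nu> / t)\<^sup>2 = (t\<^sup>2 - \<nu>\<^sup>2) / t\<^sup>2" using t0 by (simp add: field_simps)
  thus ?thesis using t0 by (simp add: R_def real_sqrt_divide)
 qed
 show ?thesis unfolding bes_h_def[abs_def] R_def[symmetric]
 proof (rule DERIV_cong[OF DERIV_diff[OF d1 DERIV_cmult[OF d2]]])
  have "t / R - \<nu> * (inverse (- sqrt (1 - (\<nu> / t)\<^sup>2)) * (- \<nu> / t\<^sup>2)) = t / R - \<nu>\<^sup>2 / (R * t)"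
   unfolding e using R t0 by (simp add: field_simps power2_eq_square)
  also have "\<dots> = R * R / (R * t)" unfolding R using R t0 by (simp add: field_simps power2_eq_square)
  also have "\<dots> = R / t" using R(1) by simp
  finally show "t / R - \<nu> * (inverse (- sqrt (1 - (\<nu> / t)\<^sup>2)) * (- \<nu> / t\<^sup>2)) = R / t" .
 qed
qed

lemma card_zeros_sq:
 assumes s: "\<nu> \<ge> 0" and ab: "0 \<le> a" "a \<le> b"
 shows "int (card {t\<in>{a<..b}. bes_f \<nu> t = 0}) = int (card (bes_zeros \<nu> (b\<^sup>2))) - int (card (bes_zeros \<nu> (a\<^sup>2)))"
proof -
 have fin: "finite (bes_zeros \<nu> (b\<^sup>2))" by (rule finite_bes_zeros[OF s])
 have sub: "bes_zeros \<nu> (a\<^sup>2) \<subseteq> bes_zeros \<nu> (b\<^sup>2)"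
  using order_trans[OF _ power_mono[OF ab(2,1), of 2]] by (auto simp: bes_zeros_def)
 have e: "(\<lambda>t. t\<^sup>2) ` {t\<in>{a<..b}. bes_f \<nu> t = 0} = bes_zeros \<nu> (b\<^sup>2) - bes_zeros \<nu> (a\<^sup>2)"
 proof (intro equalityI subsetI)
  fix x assume "x \<in> (\<lambda>t. t\<^sup>2) ` {t\<in>{a<..b}. bes_f \<nu> t = 0}"
  then obtain t where t: "x = t\<^sup>2" "a < t" "t \<le> b" "bes \<nu> (t\<^sup>2) = 0" by (auto simp: bes_f_def)
  have "a\<^sup>2 < t\<^sup>2" "t\<^sup>2 \<le> b\<^sup>2" using t ab by (auto intro!: power_strict_mono power_mono)
  thus "x \<in> bes_zeros \<nu> (b\<^sup>2) - bes_zeros \<nu> (a\<^sup>2)" using t ab by (auto simp: bes_zeros_def)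
 next
  fix x assume "x \<in> bes_zeros \<nu> (b\<^sup>2) - bes_zeros \<nu> (a\<^sup>2)"
  hence x: "0 < x" "x \<le> b\<^sup>2" "bes \<nu> x = 0" "a\<^sup>2 < x" by (auto simp: bes_zeros_def)
  hence "sqrt x \<in> {t\<in>{a<..b}. bes_f \<nu> t = 0}" "x = (sqrt x)\<^sup>2"
   using ab by (auto simp: bes_f_def real_less_rsqrt intro: real_le_lsqrt)
  thus "x \<in> (\<lambda>t. t\<^sup>2) ` {t\<in>{a<..b}. bes_f \<nu> t = 0}" by blast
 qed
 have "inj_on (\<lambda>t. t\<^sup>2) {t\<in>{a<..b}. bes_f \<nu> t = 0}" using ab by (auto intro!: inj_onI simp: power2_eq_iff)
 hence "card {t\<in>{a<..b}. bes_f \<nu> t = 0} = card (bes_zeros \<nu> (b\<^sup>2) - bes_zeros \<nu> (a\<^sup>2))"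
  unfolding e[symmetric] by (rule card_image[symmetric])
 also have "\<dots> = card (bes_zeros \<nu> (b\<^sup>2)) - card (bes_zeros \<nu> (a\<^sup>2))"
  using sub fin by (intro card_Diff_subset) (auto intro: finite_subset)
 finally show ?thesis using card_mono[OF fin sub] by simp
qed

text \<open>Liouville-Green: \<open>z = (w + t\<^sup>2 / (2 Q) f) + i sqrt Q f\<close> with \<open>Q = t\<^sup>2 - \<nu>\<^sup>2\<close> rotates with speed
 \<open>sqrt Q / t\<close> up to an integrable error.\<close>

lemma bes_count_oscillatory:
 assumes s: "\<nu> \<ge> 0" and d: "\<delta> > 0" and r: "\<nu> + \<delta> \<le> r"
  and E: "E = 1 / (4 * sqrt ((\<nu> + \<delta>)\<^sup>2 - \<nu>\<^sup>2)) + 5 * \<nu>\<^sup>2 / (12 * sqrt ((\<nu> + \<delta>)\<^sup>2 - \<nu>\<^sup>2) ^ 3)"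
 shows "\<bar>(real (card (bes_zeros \<nu> (r\<^sup>2))) - real (card (bes_zeros \<nu> ((\<nu> + \<delta>)\<^sup>2)))) - (bes_h \<nu> r - bes_h \<nu> (\<nu> + \<delta>)) / pi\<bar> \<le> E / pi + 1"
proof -
 define t1 where "t1 = \<nu> + \<delta>"
 define R where "R t = sqrt (t\<^sup>2 - \<nu>\<^sup>2)" for t
 \<comment> \<open>In the variable ln t the equation is Y'' + Q Y = 0, and \<open>k\<close> is Q' /
   (4 Q), the logarithmic derivative of the amplitude correction Q^(1/4).\<close>
 define k where "k t = t\<^sup>2 / (2 * (t\<^sup>2 - \<nu>\<^sup>2))" for t
 define A where "A t = bes_w \<nu> t + k t * bes_f \<nu> t" for t
 define B where "B t = R t * bes_f \<nu> t" for t
 define k' where "k' t = t / (t\<^sup>2 - \<nu>\<^sup>2) - t ^ 3 / (t\<^sup>2 - \<nu>\<^sup>2)\<^sup>2" for t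
 define f' where "f' t = (bes_w \<nu> t - \<nu> * bes_f \<nu> t) / t" for t
 define w' where "w' t = (- \<nu> * bes_w \<nu> t - (t\<^sup>2 - \<nu>\<^sup>2) * bes_f \<nu> t) / t" for t
 define A' where "A' t = w' t + (k t * f' t + k' t * bes_f \<nu> t)" for t
 define B' where "B' t = R t * f' t + (t / R t) * bes_f \<nu> t" for t
 define e where "e t = t\<^sup>2 * (t\<^sup>2 / 4 + \<nu>\<^sup>2) / (R t ^ 6)" for t
 have t1: "t1 > \<nu>" "t1 > 0" using d s by (auto simp: t1_def)
 have tr: "t1 \<le> r" using r by (simp add: t1_def)
 have Q: "t\<^sup>2 - \<nu>\<^sup>2 > 0" "R t > 0" "R t * R t = t\<^sup>2 - \<nu>\<^sup>2" "t > 0" "t > \<nu>" if "t \<in> {t1..r}" for t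
 proof -
  show t: "t > \<nu>" "t > 0" using that t1 by auto
  show "t\<^sup>2 - \<nu>\<^sup>2 > 0" using t s by (simp add: power_strict_mono)
  thus "R t > 0" "R t * R t = t\<^sup>2 - \<nu>\<^sup>2" by (auto simp: R_def)
 qed
 have df: "DERIV (bes_f \<nu>) t :> f' t" and dw: "DERIV (bes_w \<nu>) t :> w' t"
  if "t > 0" for t
  using bes_fw_has_derivative[OF s that] by (simp_all add: f'_def w'_def)
 have dR: "DERIV R t :> t / R t" if t: "t \<in> {t1..r}" for t
  unfolding R_def using Q[OF t] by (auto intro!: derivative_eq_intros simp: field_simps)
 have dk: "DERIV k t :> k' t" if t: "t \<in> {t1..r}" for t
  unfolding k_def k'_def using Q(1)[OF t]
  by (auto intro!: derivative_eq_intros simp: divide_simps) (auto simp: algebra_simps power2_eq_square power3_eq_cube)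
 have dA: "DERIV A t :> A' t" if t: "t \<in> {t1..r}" for t
  unfolding A_def A'_def by (intro DERIV_add dw Q(4)[OF t] DERIV_cong[OF DERIV_mult[OF dk[OF t] df[OF Q(4)[OF t]]]])
   (simp add: algebra_simps)
 have dB: "DERIV B t :> B' t" if t: "t \<in> {t1..r}" for t
  unfolding B_def B'_def by (intro DERIV_cong[OF DERIV_mult[OF dR[OF t] df[OF Q(4)[OF t]]]])
   (simp add: algebra_simps)
 have cf: "continuous_on {t1..r} (bes_f \<nu>)" "continuous_on {t1..r} (bes_w \<nu>)"
  using Q(4) by (auto intro!: continuous_at_imp_continuous_on DERIV_isCont[OF df] DERIV_isCont[OF dw])
 have cR: "continuous_on {t1..r} R" unfolding R_def by (intro continuous_intros)
 have nz0: "t \<noteq> 0" "t\<^sup>2 - \<nu>\<^sup>2 \<noteq> 0" "R t \<noteq> 0" if "t \<in> {t1..r}" for t using Q[OF that] by auto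
 have cA: "continuous_on {t1..r} A'" unfolding A'_def w'_def f'_def k'_def k_def
  by (intro continuous_intros cf) (use nz0 in auto)
 have cB: "continuous_on {t1..r} B'" unfolding B'_def f'_def
  by (intro continuous_intros cf cR) (use nz0 in auto)
 have nz: "A t \<noteq> 0" if "t \<in> {t1..r}" "B t = 0" for t
  using that Q[OF that(1)] bes_fw_nonzero[OF s, of t] by (auto simp: A_def B_def)
 \<comment> \<open>With this \<open>k\<close> the terms in \<open>A * B\<close> cancel. What exceeds
   the speed \<open>R t / t\<close> is a nonnegative multiple of \<open>B^2\<close>, so the excess
   lies between 0 and \<open>R t / t * e t\<close>.\<close>
 have key: "B' t * A t - B t * A' t = R t / t * ((A t)\<^sup>2 + (B t)\<^sup>2 + (B t)\<^sup>2 * e t)" if t: "t \<in> {t1..r}" for t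
 proof -
  define p where "p = R t"
  define f where "f = bes_f \<nu> t"
  define w where "w = bes_w \<nu> t"
  have p: "p > 0" "t > 0" using Q[OF t] by (auto simp: p_def)
  have sg: "\<nu>\<^sup>2 = t\<^sup>2 - p\<^sup>2" using Q(3)[OF t] by (simp add: p_def power2_eq_square)
  have q: "t\<^sup>2 - \<nu>\<^sup>2 = p\<^sup>2" using sg by simp
  have eqs: "A t = w + t\<^sup>2 / (2 * p\<^sup>2) * f" "B t = p * f"
   "A' t = (- \<nu> * w - p\<^sup>2 * f) / t + (t\<^sup>2 / (2 * p\<^sup>2) * ((w - \<nu> * f) / t) + (t / p\<^sup>2 - t ^ 3 / p ^ 4) * f)"
   "B' t = p * ((w - \<nu> * f) / t) + t / p * f"
   "e t = t\<^sup>2 * (t\<^sup>2 / 4 + (t\<^sup>2 - p\<^sup>2)) / p ^ 6"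
   unfolding A_def B_def A'_def B'_def k_def k'_def w'_def f'_def e_def q p_def[symmetric] f_def[symmetric] w_def[symmetric] sg
   by simp_all
  show ?thesis unfolding eqs p_def[symmetric] using p
   by (simp add: divide_simps) (simp add: algebra_simps power_def numeral_eq_Suc)
 qed
 have e0: "e t \<ge> 0" if "t \<in> {t1..r}" for t using Q[OF that] by (simp add: e_def)
 have AB: "(A t)\<^sup>2 + (B t)\<^sup>2 > 0" if "t \<in> {t1..r}" for t
  using nz[OF that] by (auto simp: sum_power2_gt_zero_iff)
 have pos: "B' t * A t - B t * A' t > 0" if "t \<in> {t1<..<r}" for t
 proof -
  have t: "t \<in> {t1..r}" using that by auto
  have "(A t)\<^sup>2 + (B t)\<^sup>2 + (B t)\<^sup>2 * e t > 0"
   by (rule add_pos_nonneg[OF AB[OF t] mult_nonneg_nonneg[OF zero_le_power2 e0[OF t]]])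
  thus ?thesis unfolding key[OF t] using Q[OF t] by (intro mult_pos_pos divide_pos_pos)
 qed
 obtain \<theta> where th: "continuous_on {t1..r} \<theta>"
  "\<And>t. t \<in> {t1<..<r} ==> DERIV \<theta> t :> (B' t * A t - B t * A' t) / ((A t)\<^sup>2 + (B t)\<^sup>2)"
  "finite {x\<in>{t1<..r}. B x = 0}" "int (card {x\<in>{t1<..r}. B x = 0}) = \<lfloor>\<theta> r / pi\<rfloor> - \<lfloor>\<theta> t1 / pi\<rfloor>"
  by (rule phase_of_pair[OF tr dA dB cA cB nz pos], assumption+, rule that)
 \<comment> \<open>With t^2 = R^2 + \<nu>^2 the error speed is
   \<open>t / (4 * R^3) + 5 * \<nu>^2 * t / (4 * R^5)\<close>, where \<open>R\<close> stands for
   \<open>R t\<close>. This antiderivative tends to 0 at infinity, so \<open>E = - Er t1\<close>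
   bounds the error on any interval starting at \<open>t1\<close>.\<close>
 define Er where "Er t = - (1 / (4 * R t) + 5 * \<nu>\<^sup>2 / (12 * R t ^ 3))" for t
 have dEr: "DERIV Er t :> (R t / t * e t)" if t: "t \<in> {t1..r}" for t
 proof -
  define p where "p = R t"
  have p: "p > 0" "t > 0" using Q[OF t] by (auto simp: p_def)
  have sg: "\<nu>\<^sup>2 = t\<^sup>2 - p\<^sup>2" using Q(3)[OF t] by (simp add: p_def power2_eq_square)
  have dp: "DERIV R t :> t / p" using dR[OF t] by (simp add: p_def)
  have "DERIV Er t :> t / (4 * p ^ 3) + 5 * \<nu>\<^sup>2 * t / (4 * p ^ 5)" unfolding Er_def[abs_def]
   by (rule derivative_eq_intros dp refl | (use p in \<open>simp add: p_def\<close>; fail))+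
    (use p in \<open>simp add: p_def[symmetric] divide_simps eval_nat_numeral\<close>)
  moreover have "t / (4 * p ^ 3) + 5 * \<nu>\<^sup>2 * t / (4 * p ^ 5) = R t / t * e t"
   unfolding e_def p_def[symmetric] sg using p
   by (simp add: divide_simps) (simp add: algebra_simps power_def numeral_eq_Suc)
  ultimately show ?thesis by simp
 qed
 have dh: "DERIV (bes_h \<nu>) t :> R t / t" if t: "t \<in> {t1..r}" for t
  using bes_h_has_derivative[OF s Q(5)[OF t]] by (simp add: R_def)
 have ch: "continuous_on {t1..r} (bes_h \<nu>)"
  by (rule DERIV_continuous_on[OF has_field_derivative_at_within[OF dh]])
 have cE: "continuous_on {t1..r} Er"
  by (rule DERIV_continuous_on[OF has_field_derivative_at_within[OF dEr]])
 have quot: "(B' t * A t - B t * A' t) / ((A t)\<^sup>2 + (B t)\<^sup>2) = R t / t + R t / t * e t * ((B t)\<^sup>2 / ((A t)\<^sup>2 + (B t)\<^sup>2))"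
  if t: "t \<in> {t1..r}" for t
 proof -
  have "X * (S + b * u) / S = X + X * u * (b / S)" if "S > 0" for X S b u :: real
   using that by (simp add: field_simps)
  from this[OF AB[OF t]] show ?thesis unfolding key[OF t] .
 qed
 have qpos: "0 \<le> R t / t * e t * ((B t)\<^sup>2 / ((A t)\<^sup>2 + (B t)\<^sup>2))" if t: "t \<in> {t1..r}" for t
  using Q[OF t] e0[OF t] AB[OF t] by (intro mult_nonneg_nonneg divide_nonneg_nonneg) auto
 have lo: "\<theta> t1 - bes_h \<nu> t1 \<le> \<theta> r - bes_h \<nu> r"
 proof (rule DERIV_nonneg_imp_increasing_open[OF tr])
  fix t assume "t1 < t" "t < r"
  hence t: "t \<in> {t1..r}" "t \<in> {t1<..<r}" by auto
  show "\<exists>y. DERIV (\<lambda>t. \<theta> t - bes_h \<nu> t) t :> y \<and> 0 \<le> y"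
   using DERIV_diff[OF th(2)[OF t(2)] dh[OF t(1)]] qpos[OF t(1)] unfolding quot[OF t(1)] by auto
 qed (intro continuous_intros th ch)
 have hi: "(bes_h \<nu> t1 + Er t1) - \<theta> t1 \<le> (bes_h \<nu> r + Er r) - \<theta> r"
 proof (rule DERIV_nonneg_imp_increasing_open[OF tr])
  fix t assume "t1 < t" "t < r"
  hence t: "t \<in> {t1..r}" "t \<in> {t1<..<r}" by auto
  have "R t / t * e t * ((B t)\<^sup>2 / ((A t)\<^sup>2 + (B t)\<^sup>2)) \<le> R t / t * e t * 1"
   using Q[OF t(1)] e0[OF t(1)] AB[OF t(1)] by (intro mult_left_mono) auto
  hence "0 \<le> R t / t + R t / t * e t - (R t / t + R t / t * e t * ((B t)\<^sup>2 / ((A t)\<^sup>2 + (B t)\<^sup>2)))" by simp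
  thus "\<exists>y. DERIV (\<lambda>t. bes_h \<nu> t + Er t - \<theta> t) t :> y \<and> 0 \<le> y"
   using DERIV_diff[OF DERIV_add[OF dh[OF t(1)] dEr[OF t(1)]] th(2)[OF t(2)]] unfolding quot[OF t(1)] by blast
 qed (intro continuous_intros th ch cE)
 have "0 \<le> 1 / (4 * R r) + 5 * \<nu>\<^sup>2 / (12 * R r ^ 3)"
  using Q(2)[of r] tr by (intro add_nonneg_nonneg divide_nonneg_nonneg) auto
 hence "Er r \<le> 0" by (simp add: Er_def)
 moreover have "Er t1 = - E" by (simp add: Er_def E R_def t1_def)
 ultimately have th': "bes_h \<nu> r - bes_h \<nu> t1 \<le> \<theta> r - \<theta> t1" "\<theta> r - \<theta> t1 \<le> bes_h \<nu> r - bes_h \<nu> t1 + E"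
  using lo hi by auto
 have "{x\<in>{t1<..r}. B x = 0} = {x\<in>{t1<..r}. bes_f \<nu> x = 0}" using nz0(3) by (auto simp: B_def)
 hence "int (card (bes_zeros \<nu> (r\<^sup>2))) - int (card (bes_zeros \<nu> (t1\<^sup>2))) = \<lfloor>\<theta> r / pi\<rfloor> - \<lfloor>\<theta> t1 / pi\<rfloor>"
  using card_zeros_sq[OF s, of t1 r] t1 tr th(4) by simp
 hence c: "real (card (bes_zeros \<nu> (r\<^sup>2))) - real (card (bes_zeros \<nu> (t1\<^sup>2))) = of_int \<lfloor>\<theta> r / pi\<rfloor> - of_int \<lfloor>\<theta> t1 / pi\<rfloor>"
  by (metis of_int_diff of_int_of_nat_eq)
 define a where "a = \<theta> r / pi" define b where "b = \<theta> t1 / pi"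
 define H where "H = (bes_h \<nu> r - bes_h \<nu> t1) / pi"
 have "H \<le> a - b" "a - b \<le> H + E / pi"
  using th' by (auto simp: a_def b_def H_def diff_divide_distrib[symmetric] add_divide_distrib[symmetric] divide_right_mono)
 moreover have "\<bar>(of_int \<lfloor>a\<rfloor> - of_int \<lfloor>b\<rfloor>) - (a - b)\<bar> \<le> 1" by linarith
 ultimately show ?thesis using c unfolding t1_def[symmetric] a_def[symmetric] b_def[symmetric] H_def[symmetric] by linarith
qed

lemma bes_h_self: "0 \<le> \<nu> ==> bes_h \<nu> \<nu> = 0"
 by (cases "\<nu> = 0") (auto simp: bes_h_def)

lemma continuous_on_bes_h:
 assumes s: "0 \<le> \<nu>" shows "continuous_on {\<nu>..T} (bes_h \<nu>)"
proof (cases "\<nu> = 0")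
 case True
 thus ?thesis by (auto simp: bes_h_def[abs_def] intro!: continuous_intros)
next
 case False
 hence s0: "\<nu> > 0" using s by simp
 have "\<nu> / t \<le> 1" "- 1 \<le> \<nu> / t" if "t \<in> {\<nu>..T}" for t
  using that s0 order.trans[of "-1" 0 "\<nu> / t"] by auto
 thus ?thesis unfolding bes_h_def[abs_def] using s0 by (intro continuous_intros) auto
qed

lemma bes_h_mono:
 assumes s: "0 \<le> \<nu>" and t: "\<nu> \<le> t" "t \<le> t'"
 shows "bes_h \<nu> t \<le> bes_h \<nu> t'"
proof (rule DERIV_nonneg_imp_increasing_open[OF t(2)])
 fix x assume x: "t < x" "x < t'"
 hence sx: "\<nu> < x" "x > 0" using s t by auto
 hence "sqrt (x\<^sup>2 - \<nu>\<^sup>2) / x \<ge> 0" using s by (simp add: power_mono)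
 thus "\<exists>y. DERIV (bes_h \<nu>) x :> y \<and> 0 \<le> y"
  using bes_h_has_derivative[OF s sx(1)] by blast
next
 show "continuous_on {t..t'} (bes_h \<nu>)"
  by (rule continuous_on_subset[OF continuous_on_bes_h[OF s, of t']]) (use t in auto)
qed

lemma bes_h_nonneg: "0 \<le> \<nu> ==> \<nu> \<le> t ==> 0 \<le> bes_h \<nu> t"
 using bes_h_mono[of \<nu> \<nu> t] by (simp add: bes_h_self)

text \<open>On this interval the slope \<open>sqrt (x^2 - \<nu>^2) / x\<close> is at most
  \<open>K / \<nu>\<close>: its numerator is largest at the right end and its denominator smallest
  at the left end.\<close>

lemma bes_h_turning:
 assumes s: "0 < \<nu>" and d: "\<delta> > 0" and K: "K = sqrt ((\<nu> + \<delta>)\<^sup>2 - \<nu>\<^sup>2)"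
 shows "bes_h \<nu> (\<nu> + \<delta>) \<le> K / \<nu> * \<delta>"
proof -
 have "K / \<nu> * \<nu> - bes_h \<nu> \<nu> \<le> K / \<nu> * (\<nu> + \<delta>) - bes_h \<nu> (\<nu> + \<delta>)"
 proof (rule DERIV_nonneg_imp_increasing_open[where f="\<lambda>x. K / \<nu> * x - bes_h \<nu> x"])
  fix x assume x: "\<nu> < x" "x < \<nu> + \<delta>"
  have "sqrt (x\<^sup>2 - \<nu>\<^sup>2) \<le> K" unfolding K using x s by (intro real_sqrt_le_mono diff_right_mono power_mono) auto
  moreover have "0 \<le> sqrt (x\<^sup>2 - \<nu>\<^sup>2)" using x s by (simp add: power_mono)
  ultimately have "sqrt (x\<^sup>2 - \<nu>\<^sup>2) / x \<le> K / \<nu>" using x s by (intro frac_le) linarith+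
  thus "\<exists>y. DERIV (\<lambda>x. K / \<nu> * x - bes_h \<nu> x) x :> y \<and> 0 \<le> y"
   using DERIV_diff[OF DERIV_cmult[OF DERIV_ident, of "K / \<nu>"] bes_h_has_derivative[OF less_imp_le[OF s] x(1)]]
   by (intro exI[of _ "K / \<nu> * 1 - sqrt (x\<^sup>2 - \<nu>\<^sup>2) / x"]) simp
 qed (use d s in \<open>auto intro!: continuous_intros continuous_on_bes_h\<close>)
 thus ?thesis using s bes_h_self[of \<nu>] unfolding distrib_left by linarith
qed

text \<open>Near the turning point Q degenerates and dividing by it is impossible. Replacing
  \<open>sqrt Q\<close> by the constant \<open>K\<close> gives the pair \<open>(w, K * f)\<close>,
  whose angular speed is at most \<open>K / \<nu>\<close> because Q is at most K^2 on the
  interval.\<close>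

lemma bes_count_turning:
 assumes s: "\<nu> > 0" and d: "\<delta> > 0" and K: "K = sqrt ((\<nu> + \<delta>)\<^sup>2 - \<nu>\<^sup>2)"
 shows "real (card (bes_zeros \<nu> ((\<nu> + \<delta>)\<^sup>2))) \<le> K / \<nu> * \<delta> / pi + 1"
proof -
 define b where "b = \<nu> + \<delta>"
 have b: "\<nu> \<le> b" "\<nu> < b" using d by (auto simp: b_def)
 have K2: "K * K = b\<^sup>2 - \<nu>\<^sup>2" "K > 0"
  using s b by (auto simp: K b_def[symmetric] power_strict_mono power_mono)
 define f' where "f' t = (bes_w \<nu> t - \<nu> * bes_f \<nu> t) / t" for t
 define w' where "w' t = (- \<nu> * bes_w \<nu> t - (t\<^sup>2 - \<nu>\<^sup>2) * bes_f \<nu> t) / t" for t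
 have df: "DERIV (bes_f \<nu>) t :> f' t" and dw: "DERIV (bes_w \<nu>) t :> w' t"
  if "t > 0" for t
  using bes_fw_has_derivative[OF less_imp_le[OF s] that] by (simp_all add: f'_def w'_def)
 have cf: "continuous_on {\<nu>..b} (bes_f \<nu>)" "continuous_on {\<nu>..b} (bes_w \<nu>)"
  using s by (auto intro!: continuous_at_imp_continuous_on DERIV_isCont[OF df] DERIV_isCont[OF dw])
 have dA: "DERIV (bes_w \<nu>) t :> w' t" if "t \<in> {\<nu>..b}" for t using dw that s by simp
 have dB: "DERIV (\<lambda>t. K * bes_f \<nu> t) t :> K * f' t" if "t \<in> {\<nu>..b}" for t
  by (rule DERIV_cmult[OF df]) (use that s in simp)
 have cA: "continuous_on {\<nu>..b} w'" unfolding w'_def using s by (intro continuous_intros cf) auto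
 have cB: "continuous_on {\<nu>..b} (\<lambda>t. K * f' t)" unfolding f'_def using s by (intro continuous_intros cf) auto
 have nz: "bes_w \<nu> t \<noteq> 0" if "t \<in> {\<nu>..b}" "K * bes_f \<nu> t = 0" for t
  using that K2 s bes_fw_nonzero[of \<nu> t] by simp
 have key: "K * f' t * bes_w \<nu> t - K * bes_f \<nu> t * w' t = K / t * ((bes_w \<nu> t)\<^sup>2 + (t\<^sup>2 - \<nu>\<^sup>2) * (bes_f \<nu> t)\<^sup>2)"
  if "t > 0" for t
  unfolding f'_def w'_def using that by (simp add: divide_simps) (simp add: algebra_simps power2_eq_square)
 have Q: "0 < t\<^sup>2 - \<nu>\<^sup>2" "t\<^sup>2 - \<nu>\<^sup>2 \<le> K * K" "t > 0" if "t \<in> {\<nu><..<b}" for t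
  using that s unfolding K2 by (auto simp: power_strict_mono power_mono)
 have sp: "(bes_w \<nu> t)\<^sup>2 + (t\<^sup>2 - \<nu>\<^sup>2) * (bes_f \<nu> t)\<^sup>2 > 0" if t: "t \<in> {\<nu><..<b}" for t
 proof (cases "bes_f \<nu> t = 0")
  case True
  thus ?thesis using bes_fw_nonzero[OF less_imp_le[OF s] Q(3)[OF t]] by simp
 next
  case False
  thus ?thesis using Q(1)[OF t] by (intro add_nonneg_pos mult_pos_pos) auto
 qed
 have pos: "K * f' t * bes_w \<nu> t - K * bes_f \<nu> t * w' t > 0" if t: "t \<in> {\<nu><..<b}" for t
  unfolding key[OF Q(3)[OF t]] using sp[OF t] K2(2) Q(3)[OF t] by (intro mult_pos_pos divide_pos_pos)
 obtain \<theta> where th: "continuous_on {\<nu>..b} \<theta>"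
  "\<And>t. t \<in> {\<nu><..<b} ==> DERIV \<theta> t :> (K * f' t * bes_w \<nu> t - K * bes_f \<nu> t * w' t) / ((bes_w \<nu> t)\<^sup>2 + (K * bes_f \<nu> t)\<^sup>2)"
  "finite {x\<in>{\<nu><..b}. K * bes_f \<nu> x = 0}"
  "int (card {x\<in>{\<nu><..b}. K * bes_f \<nu> x = 0}) = \<lfloor>\<theta> b / pi\<rfloor> - \<lfloor>\<theta> \<nu> / pi\<rfloor>"
  by (rule phase_of_pair[OF b(1) dA dB cA cB nz pos], assumption+, rule that)
 have "K / \<nu> * \<nu> - \<theta> \<nu> \<le> K / \<nu> * b - \<theta> b"
 proof (rule DERIV_nonneg_imp_increasing_open[OF b(1)])
  fix t assume "\<nu> < t" "t < b"
  hence t: "t \<in> {\<nu><..<b}" by simp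
  define S where "S = (bes_w \<nu> t)\<^sup>2 + (K * bes_f \<nu> t)\<^sup>2"
  define P where "P = (bes_w \<nu> t)\<^sup>2 + (t\<^sup>2 - \<nu>\<^sup>2) * (bes_f \<nu> t)\<^sup>2"
  have "P \<le> S" unfolding P_def S_def using mult_right_mono[OF Q(2)[OF t], of "(bes_f \<nu> t)\<^sup>2"]
   by (simp add: power2_eq_square mult_ac)
  moreover have "P > 0" using sp[OF t] by (simp add: P_def)
  ultimately have "P / S \<le> 1" by simp
  hence "K / t * (P / S) \<le> K / t * 1" using K2(2) Q(3)[OF t] by (intro mult_left_mono) auto
  also have "\<dots> \<le> K / \<nu>" using K2(2) t s by (simp add: frac_le)
  finally have "0 \<le> K / \<nu> * 1 - (K * f' t * bes_w \<nu> t - K * bes_f \<nu> t * w' t) / S"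
   unfolding key[OF Q(3)[OF t]] P_def by simp
  thus "\<exists>y. DERIV (\<lambda>t. K / \<nu> * t - \<theta> t) t :> y \<and> 0 \<le> y"
   using DERIV_diff[OF DERIV_cmult[OF DERIV_ident, of "K / \<nu>"] th(2)[OF t]] unfolding S_def by blast
 qed (intro continuous_intros th)
 hence "\<theta> b - \<theta> \<nu> \<le> K / \<nu> * \<delta>" unfolding b_def distrib_left by linarith
 hence le: "\<theta> b / pi - \<theta> \<nu> / pi \<le> K / \<nu> * \<delta> / pi"
  unfolding diff_divide_distrib[symmetric] by (rule divide_right_mono) simp
 have "{x\<in>{\<nu><..b}. K * bes_f \<nu> x = 0} = {x\<in>{\<nu><..b}. bes_f \<nu> x = 0}" using K2 by auto
 \<comment> \<open>No zero lies at or below the turning point, so counting from \<nu> on counts all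
   of them.\<close>
 hence "int (card (bes_zeros \<nu> (b\<^sup>2))) = \<lfloor>\<theta> b / pi\<rfloor> - \<lfloor>\<theta> \<nu> / pi\<rfloor>"
  using card_zeros_sq[of \<nu> \<nu> b] s b th(4) bes_zeros_empty[of \<nu> "\<nu>\<^sup>2"] by simp
 hence "real (card (bes_zeros \<nu> (b\<^sup>2))) = of_int \<lfloor>\<theta> b / pi\<rfloor> - of_int \<lfloor>\<theta> \<nu> / pi\<rfloor>"
  by (metis of_int_diff of_int_of_nat_eq)
 moreover have "of_int \<lfloor>\<theta> b / pi\<rfloor> - of_int \<lfloor>\<theta> \<nu> / pi\<rfloor> \<le> \<theta> b / pi - \<theta> \<nu> / pi + 1" by linarith
 ultimately show ?thesis using le unfolding b_def[symmetric] by linarith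
qed

lemma card_bes_zeros_mono: "\<nu> \<ge> 0 ==> X \<le> Y ==> card (bes_zeros \<nu> X) \<le> card (bes_zeros \<nu> Y)"
 by (intro card_mono finite_bes_zeros) (auto simp: bes_zeros_def)

text \<open>The turning zone \<open>{\<nu>..\<nu> + \<delta>}\<close> has width \<open>\<delta> = \<nu> powr (1/3)\<close>: there the phase changes only by \<open>O(1)\<close>, and
 beyond it the Liouville-Green error is \<open>O(1)\<close>.\<close>

lemma bes_count_large:
 assumes s: "\<nu> \<ge> 1" and r: "\<nu> \<le> r"
 shows "\<bar>real (card (bes_zeros \<nu> (r\<^sup>2))) - bes_h \<nu> r / pi\<bar> \<le> 4"
proof -
 define \<delta> where "\<delta> = root 3 \<nu>"
 have d: "\<delta> \<ge> 1" "\<delta> > 0" "\<delta> ^ 3 = \<nu>" using s by (auto simp: \<delta>_def)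
 define K where "K = sqrt ((\<nu> + \<delta>)\<^sup>2 - \<nu>\<^sup>2)"
 \<comment> \<open>Consequently \<open>K\<close> lies between \<delta>^2 and 2 \<delta>^2. The first
   bound makes both error terms, of sizes 1 / K and \<nu>^2 / K^3, bounded; the second one bounds
   the phase change \<open>K / \<nu> * \<delta>\<close> by 2.\<close>
 have e: "(\<nu> + \<delta>)\<^sup>2 - \<nu>\<^sup>2 = 2 * \<delta> ^ 4 + \<delta>\<^sup>2" unfolding d(3)[symmetric]
  by (simp add: algebra_simps power2_eq_square eval_nat_numeral)
 have d24: "\<delta>\<^sup>2 \<le> \<delta> ^ 4" using d by (intro power_increasing) auto
 have "2 * \<delta> ^ 4 + \<delta>\<^sup>2 \<le> 4 * \<delta> ^ 4" using d24 zero_le_power[OF less_imp_le[OF d(2)], of 4] by linarith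
 hence "K \<le> sqrt ((2 * \<delta>\<^sup>2)\<^sup>2)" unfolding K_def e
  by (intro real_sqrt_le_mono) (use d(2) in \<open>simp add: power_mult_distrib add_increasing\<close>)
 hence K2: "K \<le> 2 * \<delta>\<^sup>2" by (simp only: real_sqrt_abs) simp
 have "sqrt ((\<delta>\<^sup>2)\<^sup>2) \<le> K" unfolding K_def e by (intro real_sqrt_le_mono) simp
 hence K1: "\<delta>\<^sup>2 \<le> K" by (simp only: real_sqrt_abs abs_power2)
 have "K / \<nu> * \<delta> \<le> 2 * \<delta>\<^sup>2 / \<nu> * \<delta>" using K2 d s by (intro mult_right_mono divide_right_mono) auto
 also have "\<dots> = 2" unfolding d(3)[symmetric] using d(2) by (simp add: divide_simps eval_nat_numeral)
 finally have Kd: "K / \<nu> * \<delta> \<le> 2" .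
 have s0: "\<nu> > 0" "\<nu> \<ge> 0" using s by auto
 have pi2: "2 / pi \<le> 1" "1 / pi \<le> 1" using pi_ge_two by auto
 have c1: "real (card (bes_zeros \<nu> ((\<nu> + \<delta>)\<^sup>2))) \<le> 2"
  using bes_count_turning[OF s0(1) d(2) K_def] divide_right_mono[OF Kd pi_ge_zero] pi2 by linarith
 have h1: "bes_h \<nu> (\<nu> + \<delta>) \<le> 2" using bes_h_turning[OF s0(1) d(2) K_def] Kd by simp
 show ?thesis
 proof (cases "r \<le> \<nu> + \<delta>")
  case True
  have "card (bes_zeros \<nu> (r\<^sup>2)) \<le> card (bes_zeros \<nu> ((\<nu> + \<delta>)\<^sup>2))"
   using True s r by (intro card_bes_zeros_mono power_mono) auto
  moreover have "bes_h \<nu> r / pi \<le> 2 / pi"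
   using bes_h_mono[OF s0(2) r True] h1 by (intro divide_right_mono) auto
  moreover have "0 \<le> bes_h \<nu> r / pi" using bes_h_nonneg[OF s0(2) r] by simp
  ultimately show ?thesis using c1 pi2 by linarith
 next
  case False
  have "1 / (4 * K) \<le> 1 / 4"
   using K1 power_mono[OF d(1), of 2] by (intro divide_left_mono) auto
  moreover have "5 * \<nu>\<^sup>2 / (12 * K ^ 3) \<le> 5 / 12"
  proof -
   have "\<nu>\<^sup>2 = (\<delta>\<^sup>2) ^ 3" unfolding d(3)[symmetric] by (simp add: power_mult[symmetric])
   also have "\<dots> \<le> K ^ 3" using K1 by (intro power_mono) auto
   finally have "\<nu>\<^sup>2 \<le> K ^ 3" .
   moreover have "0 < K ^ 3" using K1 d(2) by (intro zero_less_power less_le_trans[OF _ K1]) simp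
   ultimately show ?thesis by (simp add: divide_simps)
  qed
  ultimately have E: "1 / (4 * K) + 5 * \<nu>\<^sup>2 / (12 * K ^ 3) \<le> 1" by simp
  have "\<bar>(real (card (bes_zeros \<nu> (r\<^sup>2))) - real (card (bes_zeros \<nu> ((\<nu> + \<delta>)\<^sup>2)))) - (bes_h \<nu> r - bes_h \<nu> (\<nu> + \<delta>)) / pi\<bar>
    \<le> (1 / (4 * K) + 5 * \<nu>\<^sup>2 / (12 * K ^ 3)) / pi + 1"
   by (rule bes_count_oscillatory[OF s0(2) d(2)]) (use False K_def in auto)
  also have "\<dots> \<le> 1 / pi + 1" using E by (intro add_right_mono divide_right_mono) auto
  finally have "\<bar>(real (card (bes_zeros \<nu> (r\<^sup>2))) - real (card (bes_zeros \<nu> ((\<nu> + \<delta>)\<^sup>2)))) - (bes_h \<nu> r / pi - bes_h \<nu> (\<nu> + \<delta>) / pi)\<bar> \<le> 2"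
   using pi2 unfolding diff_divide_distrib by linarith
  moreover have "0 \<le> bes_h \<nu> (\<nu> + \<delta>) / pi" using bes_h_nonneg[OF s0(2)] d by simp
  moreover have "bes_h \<nu> (\<nu> + \<delta>) / pi \<le> 1" using divide_right_mono[OF h1 pi_ge_zero] pi2 by linarith
  ultimately show ?thesis using c1 by linarith
 qed
qed

text \<open>Covers the orders below 1, which occur only for degree 0 in dimensions 2 and 3; for one
  order the constant may be anything, so a transition zone of width 1 does.\<close>

lemma bes_count_fixed:
 assumes s: "\<nu> \<ge> 0"
 shows "\<exists>C. \<forall>r\<ge>\<nu>. \<bar>real (card (bes_zeros \<nu> (r\<^sup>2))) - bes_h \<nu> r / pi\<bar> \<le> C"
proof -
 define E where "E = 1 / (4 * sqrt ((\<nu> + 1)\<^sup>2 - \<nu>\<^sup>2)) + 5 * \<nu>\<^sup>2 / (12 * sqrt ((\<nu> + 1)\<^sup>2 - \<nu>\<^sup>2) ^ 3)"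
 define c where "c = real (card (bes_zeros \<nu> ((\<nu> + 1)\<^sup>2)))"
 define h where "h = bes_h \<nu> (\<nu> + 1) / pi"
 have h0: "h \<ge> 0" using bes_h_nonneg[OF s, of "\<nu> + 1"] by (simp add: h_def)
 have c0: "c \<ge> 0" by (simp add: c_def)
 have E0: "E \<ge> 0" using s by (simp add: E_def power_mono)
 have "\<bar>real (card (bes_zeros \<nu> (r\<^sup>2))) - bes_h \<nu> r / pi\<bar> \<le> E / pi + 1 + c + h" if r: "r \<ge> \<nu>" for r
 proof (cases "\<nu> + 1 \<le> r")
  case True
  have "\<bar>(real (card (bes_zeros \<nu> (r\<^sup>2))) - c) - (bes_h \<nu> r / pi - h)\<bar> \<le> E / pi + 1"
   using bes_count_oscillatory[OF s zero_less_one True E_def] by (simp add: c_def h_def diff_divide_distrib)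
  thus ?thesis using c0 h0 by linarith
 next
  case False
  have "card (bes_zeros \<nu> (r\<^sup>2)) \<le> card (bes_zeros \<nu> ((\<nu> + 1)\<^sup>2))"
   using False s r by (intro card_bes_zeros_mono power_mono) auto
  hence "real (card (bes_zeros \<nu> (r\<^sup>2))) \<le> c" by (simp add: c_def)
  moreover have "bes_h \<nu> r / pi \<le> h" unfolding h_def
   using bes_h_mono[OF s r, of "\<nu> + 1"] False by (intro divide_right_mono) auto
  moreover have "0 \<le> bes_h \<nu> r / pi" using bes_h_nonneg[OF s r] by simp
  moreover have "0 \<le> E / pi" using E0 by simp
  ultimately show ?thesis using c0 h0 by linarith
 qed
 thus ?thesis by blast
qed

section \<open>Test functions and pairings on the unit ball\<close>

text \<open>The recursion peels off the innermost derivative, while \<open>pd (i # is)\<close> adds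
  an outermost one. In this order, closure under sums, products and compositions is an induction on
  \<open>n\<close>.\<close>

primrec smooth_n :: "nat => ('a::euclidean_space => real) => bool" where
 "smooth_n 0 f = True"
| "smooth_n (Suc n) f = ((\<forall>x. f differentiable (at x)) \<and> (\<forall>i\<in>Basis. smooth_n n (pd [i] f)))"

definition smooth :: "('a::euclidean_space => real) => bool" where
 "smooth f \<longleftrightarrow> (\<forall>n. smooth_n n f)"

lemma pd_eqI: "(f has_derivative f') (at x) ==> pd [i] f x = f' i"
 by (simp add: frechet_derivative_at[symmetric])

lemma pd_const: "pd [i] (\<lambda>x. c) = (\<lambda>x. 0)"
 by simp

lemma pd_single: "pd [i] f x = frechet_derivative f (at x) i"
 by simp

lemma pd_append: "pd (is @ js) f = pd is (pd js f)"
 by (induction "is") auto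

lemma smooth_pd: "smooth f ==> i \<in> Basis ==> smooth (pd [i] f)"
 by (metis smooth_def smooth_n.simps(2))

lemma smooth_differentiable: "smooth f ==> f differentiable (at x)"
 by (metis smooth_def smooth_n.simps(2))

lemma smooth_pds: "smooth f ==> set is \<subseteq> Basis ==> smooth (pd is f)"
proof (induction "is")
 case (Cons i "is")
 have "pd (i # is) f = pd [i] (pd is f)" by simp
 thus ?case using Cons smooth_pd by (metis insert_subset list.simps(15))
qed simp

lemma smoothI:
 assumes "\<And>is x. set is \<subseteq> Basis ==> pd is f differentiable (at x)"
 shows "smooth f"
proof -
 have "smooth_n n g" if "\<And>is x. set is \<subseteq> Basis ==> pd is g differentiable (at x)" for n g
  using that
 proof (induction n arbitrary: g)
  case (Suc n)
  have "pd is (pd [i] g) differentiable (at x)" if "i \<in> Basis" "set is \<subseteq> Basis" for i "is" x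
   using Suc.prems[of "is @ [i]" x] that unfolding pd_append by simp
  thus ?case using Suc.IH Suc.prems[of "[]"] by simp
 qed simp
 thus ?thesis using assms unfolding smooth_def by blast
qed

lemma test_fun_iff: "test_fun \<Omega> \<phi> \<longleftrightarrow> smooth \<phi> \<and> compact (closure {x. \<phi> x \<noteq> 0}) \<and> closure {x. \<phi> x \<noteq> 0} \<subseteq> \<Omega>"
 using smoothI smooth_pds smooth_differentiable unfolding test_fun_def by blast

lemma smooth_has_derivative: "smooth f ==> (f has_derivative frechet_derivative f (at x)) (at x)"
 using smooth_differentiable frechet_derivative_works by blast

lemma smooth_continuous: "smooth f ==> continuous_on S f"
 by (meson continuous_at_imp_continuous_on differentiable_imp_continuous_within smooth_differentiable)

lemma smooth_n_mono: "smooth_n (Suc n) f ==> smooth_n n f"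
 by (induction n arbitrary: f) auto

declare pd.simps(2) [simp del]

lemma pd_inner: "pd [i] (\<lambda>x. x \<bullet> j) = (\<lambda>x. i \<bullet> j)"
 by (rule ext, rule pd_eqI) (auto intro!: derivative_eq_intros)

lemma pd_add:
 assumes "f differentiable (at x)" "g differentiable (at x)"
 shows "pd [i] (\<lambda>x. f x + g x) x = pd [i] f x + pd [i] g x"
 using pd_eqI[OF has_derivative_add[OF assms[unfolded frechet_derivative_works]]] by (simp add: pd_single)

lemma pd_mult:
 fixes f g :: "'a::euclidean_space => real"
 assumes "f differentiable (at x)" "g differentiable (at x)"
 shows "pd [i] (\<lambda>x. f x * g x) x = f x * pd [i] g x + pd [i] f x * g x"
 using pd_eqI[OF has_derivative_mult[OF assms[unfolded frechet_derivative_works]]] by (simp add: pd_single)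

lemma pd_compose:
 fixes \<eta> :: "real => real" and f :: "'a::euclidean_space => real"
 assumes "f differentiable (at x)" "DERIV \<eta> (f x) :> d"
 shows "pd [i] (\<lambda>x. \<eta> (f x)) x = d * pd [i] f x"
proof -
 have "(\<eta> has_derivative (*) d) (at (f x))" using assms(2) by (simp add: has_field_derivative_def)
 from pd_eqI[OF has_derivative_compose[OF assms(1)[unfolded frechet_derivative_works] this]]
 show ?thesis by (simp add: pd_single)
qed

lemma pd_real: "DERIV \<eta> x :> d ==> pd [1] \<eta> x = d"
 by (subst pd_eqI[of _ "(*) d"]) (auto simp: has_field_derivative_def)

lemma smooth_n_const: "smooth_n n (\<lambda>x. c)"
proof (induction n arbitrary: c)
 case (Suc n)
 thus ?case unfolding smooth_n.simps pd_const by simp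
qed simp

lemma smooth_n_inner: "smooth_n n (\<lambda>x. x \<bullet> j)"
proof (cases n)
 case (Suc m)
 have "(\<lambda>x. x \<bullet> j) differentiable at x" for x
  unfolding differentiable_def by (rule exI[of _ "\<lambda>x. x \<bullet> j"]) (auto intro!: derivative_eq_intros)
 thus ?thesis unfolding Suc smooth_n.simps pd_inner by (simp add: smooth_n_const)
qed simp

lemma smooth_n_add: "smooth_n n f ==> smooth_n n g ==> smooth_n n (\<lambda>x. f x + g x)"
proof (induction n arbitrary: f g)
 case (Suc n)
 have "pd [i] (\<lambda>x. f x + g x) = (\<lambda>x. pd [i] f x + pd [i] g x)" for i
  by (intro ext pd_add) (use Suc.prems in simp_all)
 thus ?case using Suc by (simp add: differentiable_add)
qed simp

lemma smooth_n_mult: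
 fixes f g :: "'a::euclidean_space => real"
 shows "smooth_n n f ==> smooth_n n g ==> smooth_n n (\<lambda>x. f x * g x)"
proof (induction n arbitrary: f g)
 case (Suc n)
 have "pd [i] (\<lambda>x. f x * g x) = (\<lambda>x. f x * pd [i] g x + pd [i] f x * g x)" for i
  by (intro ext pd_mult) (use Suc.prems in simp_all)
 moreover have "smooth_n n f" "smooth_n n g" using Suc.prems smooth_n_mono by blast+
 ultimately show ?case using Suc by (simp add: differentiable_mult smooth_n_add)
qed simp

lemma smooth_n_compose:
 fixes \<eta> :: "real => real" and f :: "'a::euclidean_space => real"
 shows "smooth_n n \<eta> ==> smooth_n n f ==> smooth_n n (\<lambda>x. \<eta> (f x))"
proof (induction n arbitrary: f \<eta>)
 case (Suc n)
 have d: "DERIV \<eta> x :> (pd [1] \<eta> x)" for x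
 proof -
  obtain D where "DERIV \<eta> x :> D"
   using Suc.prems(1) unfolding smooth_n.simps real_differentiable_def by blast
  thus ?thesis using pd_real by metis
 qed
 have "pd [i] (\<lambda>x. \<eta> (f x)) = (\<lambda>x. pd [1] \<eta> (f x) * pd [i] f x)" for i
  by (intro ext pd_compose d) (use Suc.prems in simp_all)
 moreover have "smooth_n n f" using Suc.prems smooth_n_mono by blast
 moreover have "(\<lambda>x. \<eta> (f x)) differentiable at x" for x
  using differentiable_compose[of \<eta> f x UNIV] Suc.prems by simp
 ultimately show ?case using Suc by (simp add: smooth_n_mult Basis_real_def)
qed simp

lemma smooth_const [intro]: "smooth (\<lambda>x. c)"
 and smooth_inner [intro]: "smooth (\<lambda>x. x \<bullet> j)"
 and smooth_add [intro]: "smooth f ==> smooth g ==> smooth (\<lambda>x. f x + g x)"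
 and smooth_mult [intro]: "smooth f ==> smooth g ==> smooth (\<lambda>x. f x * g x)"
 and smooth_compose: "smooth \<eta> ==> smooth f ==> smooth (\<lambda>x. \<eta> (f x))"
 by (simp_all add: smooth_def smooth_n_const smooth_n_inner smooth_n_add smooth_n_mult smooth_n_compose)

lemma smooth_cmult: "smooth f ==> smooth (\<lambda>x. c * f x)" by auto

lemma smooth_diff [intro]: "smooth f ==> smooth g ==> smooth (\<lambda>x. f x - g x)"
 using smooth_add[of f "\<lambda>x. (-1) * g x"] smooth_cmult[of g "-1"] by simp

lemma smooth_power [intro]: "smooth f ==> smooth (\<lambda>x. f x ^ k)"
 by (induction k) auto

lemma smooth_sum [intro]: "(\<And>i. i \<in> I ==> smooth (f i)) ==> smooth (\<lambda>x. \<Sum>i\<in>I. f i x)"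
 by (induction I rule: infinite_finite_induct) auto

lemma smooth_real_id [intro]: "smooth (\<lambda>x::real. x)"
 using smooth_inner[of "1::real"] by simp

lemma smooth_norm2 [intro]: "smooth (\<lambda>x::'a::euclidean_space. x \<bullet> x)"
proof -
 have "(\<lambda>x::'a. x \<bullet> x) = (\<lambda>x. \<Sum>i\<in>Basis. (x \<bullet> i) * (x \<bullet> i))"
  by (rule ext) (rule euclidean_inner)
 thus ?thesis by (auto intro!: smooth_sum)
qed

text \<open>If differentiation only moves the index inside the family and multiplies by a constant,
  one derivative formula yields all orders at once. Both the Bessel series (order \<nu> to \<nu> +
  1) and \<open>flat_exp\<close> (polynomial to polynomial) have this form.\<close>

lemma smooth_DERIV_family:
 fixes F :: "'p => real => real"
 assumes "\<And>p x. p \<in> A ==> DERIV (F p) x :> c p * F (d p) x" "\<And>p. p \<in> A ==> d p \<in> A" "p \<in> A"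
 shows "smooth (F p)"
proof -
 have "smooth_n n (F p)" if "p \<in> A" for n p
  using that
 proof (induction n arbitrary: p)
  case (Suc n)
  have "pd [1] (F p) = (\<lambda>x. c p * F (d p) x)" using pd_real assms(1)[OF Suc.prems] by blast
  moreover have "F p differentiable at x" for x
   using assms(1)[OF Suc.prems] real_differentiable_def by blast
  ultimately show ?case using Suc assms(2)
   by (simp add: Basis_real_def smooth_n_mult smooth_n_const)
 qed simp
 thus ?thesis using assms(3) by (simp add: smooth_def)
qed

lemma smooth_bes: "\<nu> \<ge> 0 ==> smooth (bes \<nu>)"
proof (rule smooth_DERIV_family[where A = "{0..}" and d = "\<lambda>s. s + 1" and c = "\<lambda>s. - 1 / (4 * (s + 1))"])
 fix p x :: real assume "p \<in> {0..}"
 thus "DERIV (bes p) x :> - 1 / (4 * (p + 1)) * bes (p + 1) x"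
  using bes_has_derivative[of p x] by (simp add: bes'_def)
qed auto

section \<open>Flat exponentials and smooth cut-offs\<close>

text \<open>The polynomial factor in 1 / t makes the family closed under differentiation: with u = 1
  / t the polynomial \<open>p\<close> is replaced by \<open>u^2 * (p - p')\<close>.\<close>

definition flat_exp :: "real poly => real => real" where
 "flat_exp p t = (if t > 0 then poly p (1 / t) * exp (- (1 / t)) else 0)"

lemma poly_exp_tendsto_0: "((\<lambda>u::real. poly p u * exp (- u)) \<longlongrightarrow> 0) at_top"
proof -
 have "((\<lambda>u::real. \<Sum>i\<le>degree p. coeff p i * (u ^ i / exp u)) \<longlongrightarrow> (\<Sum>i\<le>degree p. coeff p i * 0)) at_top"
  by (intro tendsto_sum tendsto_mult tendsto_const tendsto_power_div_exp_0)
 thus ?thesis by (simp add: poly_altdef exp_minus sum_divide_distrib divide_inverse sum_distrib_left mult_ac)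
qed

lemma poly_exp_bounded: "\<exists>C>0. \<forall>u\<ge>0. \<bar>poly p u * exp (- u)\<bar> \<le> (C::real)"
proof -
 have "\<forall>\<^sub>F u in at_top. \<bar>poly p u * exp (- u)\<bar> < 1"
  using tendstoD[OF poly_exp_tendsto_0[of p], of 1] by (simp add: dist_real_def)
 then obtain U where U: "\<And>u. u \<ge> U ==> \<bar>poly p u * exp (- u)\<bar> < 1"
  by (auto simp: eventually_at_top_linorder)
 have "compact ((\<lambda>u. poly p u * exp (- u)) ` {0..U})"
  by (intro compact_continuous_image continuous_intros) auto
 then obtain B where B: "\<And>u. u \<in> {0..U} ==> \<bar>poly p u * exp (- u)\<bar> \<le> B"
  by (fastforce dest!: compact_imp_bounded simp: bounded_iff)
 have "\<bar>poly p u * exp (- u)\<bar> \<le> max B 1" if "u \<ge> 0" for u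
  using U[of u] B[of u] that by (cases "u \<ge> U") auto
 thus ?thesis by (intro exI[of _ "max B 1"]) auto
qed

lemma flat_exp_has_derivative:
 "DERIV (flat_exp p) t :> flat_exp ([:0, 0, 1:] * (p - pderiv p)) t"
proof -
 consider "t < 0" | "t > 0" | "t = 0" by linarith
 thus ?thesis
 proof cases
  case 1
  have "DERIV (\<lambda>_. 0) t :> flat_exp ([:0, 0, 1:] * (p - pderiv p)) t"
   using 1 by (simp add: flat_exp_def)
  thus ?thesis
   by (rule has_field_derivative_transform_within_open[of _ _ _ "{..<0}"]) (use 1 in \<open>auto simp: flat_exp_def\<close>)
 next
  case 2
  have i: "DERIV (\<lambda>t. 1 / t) t :> - (1 / t\<^sup>2)"
   using 2 by (auto intro!: derivative_eq_intros simp: power2_eq_square)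
  have "((\<lambda>t. poly p (1 / t) * exp (- (1 / t))) has_real_derivative
    (poly (pderiv p) (1 / t) * (- (1 / t\<^sup>2))) * exp (- (1 / t)) + (exp (- (1 / t)) * (1 / t\<^sup>2)) * poly p (1 / t)) (at t)"
   using DERIV_mult[OF DERIV_chain2[OF poly_DERIV i, of p] DERIV_chain2[OF DERIV_exp DERIV_minus[OF i]]]
   by simp
  moreover have "(poly (pderiv p) (1 / t) * (- (1 / t\<^sup>2))) * exp (- (1 / t)) + (exp (- (1 / t)) * (1 / t\<^sup>2)) * poly p (1 / t)
    = flat_exp ([:0, 0, 1:] * (p - pderiv p)) t"
   using 2 by (simp add: flat_exp_def field_simps power2_eq_square)
  ultimately have "DERIV (\<lambda>t. poly p (1 / t) * exp (- (1 / t))) t :> flat_exp ([:0, 0, 1:] * (p - pderiv p)) t" by simp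
  thus ?thesis
   by (rule has_field_derivative_transform_within_open[of _ _ _ "{0<..}"]) (use 2 in \<open>auto simp: flat_exp_def\<close>)
 next
  case 3
  have "((\<lambda>h. flat_exp p h / h) \<longlongrightarrow> 0) (at 0)"
  proof (rule filterlim_split_at)
   have "\<forall>\<^sub>F h in at_left (0::real). 0 = flat_exp p h / h"
    by (auto simp: eventually_at_left_field flat_exp_def intro!: exI[of _ "-1"])
   thus "((\<lambda>h. flat_exp p h / h) \<longlongrightarrow> 0) (at_left 0)"
    by (rule Lim_transform_eventually[OF tendsto_const])
   \<comment> \<open>Dividing by \<open>h\<close> multiplies by u = 1 / h, that is, prepends a zero
     coefficient; the decay of \<open>exp (- u)\<close> absorbs it.\<close>
   have "((\<lambda>h. poly (pCons 0 p) (inverse h) * exp (- inverse h)) \<longlongrightarrow> 0) (at_right 0)"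
    by (rule filterlim_compose[OF poly_exp_tendsto_0 filterlim_inverse_at_top_right])
   moreover have "\<forall>\<^sub>F h in at_right (0::real). poly (pCons 0 p) (inverse h) * exp (- inverse h) = flat_exp p h / h"
    by (auto simp: eventually_at_right_field flat_exp_def field_simps intro!: exI[of _ "1"])
   ultimately show "((\<lambda>h. flat_exp p h / h) \<longlongrightarrow> 0) (at_right 0)"
    by (rule Lim_transform_eventually)
  qed
  thus ?thesis using 3 by (simp add: has_field_derivative_iff flat_exp_def)
 qed
qed

lemma smooth_flat_exp: "smooth (flat_exp p)"
 by (rule smooth_DERIV_family[where A = UNIV and c = "\<lambda>_. 1" and d = "\<lambda>p. [:0, 0, 1:] * (p - pderiv p)"])
   (use flat_exp_has_derivative in auto)

text \<open>In the variable \<open>\<rho> = |x|\<^sup>2\<close>, a smooth cutoff inside the ball of radius \<open>sqrt R\<close>.\<close>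

definition cut0 :: "real => nat => real => real" where
 "cut0 R N \<rho> = flat_exp 1 (real (Suc N) * (R - \<rho>) - 1)"
definition cut1 :: "real => nat => real => real" where
 "cut1 R N \<rho> = - real (Suc N) * flat_exp [:0, 0, 1:] (real (Suc N) * (R - \<rho>) - 1)"
definition cut2 :: "real => nat => real => real" where
 "cut2 R N \<rho> = (real (Suc N))\<^sup>2 * flat_exp [:0, 0, 0, -2, 1:] (real (Suc N) * (R - \<rho>) - 1)"

lemma cut_has_derivative:
 "(cut0 R N has_real_derivative cut1 R N \<rho>) (at \<rho>)"
 "(cut1 R N has_real_derivative cut2 R N \<rho>) (at \<rho>)"
proof -
 have a: "((\<lambda>\<rho>. real (Suc N) * (R - \<rho>) - 1) has_real_derivative - real (Suc N)) (at \<rho>)"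
  by (auto intro!: derivative_eq_intros)
 have e1: "[:0, 0, 1:] * (1 - pderiv 1) = [:0, 0, 1 :: real:]" by simp
 have e2: "[:0, 0, 1:] * ([:0, 0, 1:] - pderiv [:0, 0, 1:]) = [:0, 0, 0, -2, 1 :: real:]" by (simp add: pderiv_pCons)
 show "(cut0 R N has_real_derivative cut1 R N \<rho>) (at \<rho>)"
  using DERIV_chain2[OF flat_exp_has_derivative[of 1] a] unfolding e1 cut0_def[abs_def] cut1_def by (simp add: mult.commute)
 show "(cut1 R N has_real_derivative cut2 R N \<rho>) (at \<rho>)"
  using DERIV_cmult[OF DERIV_chain2[OF flat_exp_has_derivative[of "[:0, 0, 1:]"] a], of "- real (Suc N)"]
  unfolding e2 cut1_def[abs_def] cut2_def by (simp add: power2_eq_square algebra_simps)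
qed

lemma smooth_cut: "smooth (cut0 R N)"
proof -
 have "smooth (\<lambda>\<rho>. real (Suc N) * (R - \<rho>) - 1)" by (intro smooth_diff smooth_cmult smooth_const smooth_real_id)
 thus ?thesis unfolding cut0_def[abs_def] by (rule smooth_compose[OF smooth_flat_exp])
qed

lemma cut_zero:
 assumes "\<rho> \<ge> R - 1 / real (Suc N)"
 shows "cut0 R N \<rho> = 0" "cut1 R N \<rho> = 0" "cut2 R N \<rho> = 0"
proof -
 have "R - \<rho> \<le> 1 / real (Suc N)" using assms by simp
 hence "real (Suc N) * (R - \<rho>) \<le> 1" by (simp add: pos_le_divide_eq mult.commute del: of_nat_Suc)
 thus "cut0 R N \<rho> = 0" "cut1 R N \<rho> = 0" "cut2 R N \<rho> = 0"
  by (simp_all add: cut0_def cut1_def cut2_def flat_exp_def del: of_nat_Suc)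
qed

lemma cut_bounds: "0 \<le> cut0 R N \<rho>" "cut0 R N \<rho> \<le> 1"
 by (auto simp: cut0_def flat_exp_def)

text \<open>With u = 1 / s the weight \<open>(s + 1) ^ j\<close> becomes
  \<open>((u + 1) / u) ^ j\<close>, and the assumption says that its product with \<open>p\<close>
  is again a polynomial \<open>q\<close>; a polynomial times \<open>exp (- u)\<close> is
  bounded.\<close>

lemma flat_exp_decay:
 assumes q: "\<And>u. u > 0 ==> poly q u = poly p u * ((u + 1) / u) ^ j"
 shows "\<exists>C>0. \<forall>s. s > - 1 --> \<bar>flat_exp p s\<bar> * (s + 1) ^ j \<le> C"
proof -
 obtain C where C: "C > 0" "\<And>u. u \<ge> 0 ==> \<bar>poly q u * exp (- u)\<bar> \<le> C" using poly_exp_bounded by metis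
 have "\<bar>flat_exp p s\<bar> * (s + 1) ^ j \<le> C" if s: "s > -1" for s
 proof (cases "s > 0")
  case True
  define u where "u = 1 / s"
  have u: "u > 0" "s = 1 / u" using True by (auto simp: u_def)
  have "\<bar>flat_exp p s\<bar> * (s + 1) ^ j = \<bar>poly p u * exp (- u)\<bar> * ((u + 1) / u) ^ j"
  proof -
   have "1 / s = u" by (simp add: u_def)
   moreover have "s + 1 = (u + 1) / u" using u by (simp add: divide_simps distrib_right)
   ultimately show ?thesis using True by (simp add: flat_exp_def)
  qed
  also have "\<dots> = \<bar>poly q u * exp (- u)\<bar>"
   unfolding q[OF u(1)] using u by (simp add: abs_mult)
  also have "\<dots> \<le> C" using C(2)[of u] u by simp
  finally show ?thesis .
 next
  case False
  thus ?thesis using C by (simp add: flat_exp_def)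
 qed
 thus ?thesis using C(1) by blast
qed

text \<open>By scaling, s + 1 = (N + 1) (R - \<rho>). Each derivative of the cut-off costs one power
  of the distance to the edge, uniformly in \<open>N\<close>; giving up one power more gains the
  factor 1 / (N + 1), which yields pointwise convergence to 0.\<close>

lemma cut_derivative_bounds:
 "\<exists>C>0. \<forall>R N \<rho>. \<rho> < R --> \<bar>cut1 R N \<rho>\<bar> * (R - \<rho>) \<le> C \<and> \<bar>cut1 R N \<rho>\<bar> * (R - \<rho>)\<^sup>2 \<le> C / real (Suc N)
    \<and> \<bar>cut2 R N \<rho>\<bar> * (R - \<rho>)\<^sup>2 \<le> C \<and> \<bar>cut2 R N \<rho>\<bar> * (R - \<rho>) ^ 3 \<le> C / real (Suc N)"
proof -
 let ?p = "[:0, 0, 1 :: real:]" let ?p2 = "[:0, 0, 0, -2, 1 :: real:]"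
 \<comment> \<open>The polynomials are \<open>p * ((u + 1) / u)^j\<close> for \<open>p\<close> = u^2
   and \<open>p\<close> = u^4 - 2 u^3, the latter two being the polynomials of the first and second
   derivative of the cut-off.\<close>
 obtain C1 where C1: "C1 > 0" "\<And>s. s > -1 ==> \<bar>flat_exp ?p s\<bar> * (s + 1) ^ 1 \<le> C1"
  using flat_exp_decay[of "[:0, 1, 1:]" ?p 1] by (auto simp: field_simps)
 obtain C2 where C2: "C2 > 0" "\<And>s. s > -1 ==> \<bar>flat_exp ?p s\<bar> * (s + 1) ^ 2 \<le> C2"
  using flat_exp_decay[of "[:1, 2, 1:]" ?p 2] by (auto simp: field_simps power2_eq_square)
 obtain C3 where C3: "C3 > 0" "\<And>s. s > -1 ==> \<bar>flat_exp ?p2 s\<bar> * (s + 1) ^ 2 \<le> C3"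
  using flat_exp_decay[of "[:0, -2, 1:] * [:1, 1:] ^ 2" ?p2 2] by (auto simp: field_simps power2_eq_square)
 obtain C4 where C4: "C4 > 0" "\<And>s. s > -1 ==> \<bar>flat_exp ?p2 s\<bar> * (s + 1) ^ 3 \<le> C4"
  using flat_exp_decay[of "[:-2, 1:] * [:1, 1:] ^ 3" ?p2 3] by (auto simp: field_simps power3_eq_cube)
 define C where "C = C1 + C2 + C3 + C4"
 have "\<bar>cut1 R N \<rho>\<bar> * (R - \<rho>) \<le> C \<and> \<bar>cut1 R N \<rho>\<bar> * (R - \<rho>)\<^sup>2 \<le> C / real (Suc N)
    \<and> \<bar>cut2 R N \<rho>\<bar> * (R - \<rho>)\<^sup>2 \<le> C \<and> \<bar>cut2 R N \<rho>\<bar> * (R - \<rho>) ^ 3 \<le> C / real (Suc N)" if "\<rho> < R" for R N \<rho>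
 proof -
  define M where "M = real (Suc N)"
  define d where "d = R - \<rho>"
  have M: "M > 0" by (simp add: M_def)
  have d: "d > 0" using that by (simp add: d_def)
  define s where "s = M * d - 1"
  have s: "s > -1" "s + 1 = M * d" using M d by (auto simp: s_def)
  have c1: "\<bar>cut1 R N \<rho>\<bar> = M * \<bar>flat_exp ?p s\<bar>" and c2: "\<bar>cut2 R N \<rho>\<bar> = M\<^sup>2 * \<bar>flat_exp ?p2 s\<bar>"
   unfolding cut1_def cut2_def M_def[symmetric] d_def[symmetric] s_def[symmetric] using M by (simp_all add: abs_mult)
  have "M * \<bar>flat_exp ?p s\<bar> * d \<le> C1" using C1(2)[OF s(1)] unfolding s(2) by (simp add: mult_ac)
  moreover have "M * \<bar>flat_exp ?p s\<bar> * d\<^sup>2 \<le> C2 / M"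
   using C2(2)[OF s(1)] M unfolding s(2) by (simp add: field_simps power2_eq_square)
  moreover have "M\<^sup>2 * \<bar>flat_exp ?p2 s\<bar> * d\<^sup>2 \<le> C3" using C3(2)[OF s(1)] unfolding s(2) by (simp add: mult_ac power_mult_distrib)
  moreover have "M\<^sup>2 * \<bar>flat_exp ?p2 s\<bar> * d ^ 3 \<le> C4 / M"
   using C4(2)[OF s(1)] M unfolding s(2) by (simp add: field_simps power2_eq_square power3_eq_cube)
  moreover have "C1 \<le> C" "C3 \<le> C" "C2 / M \<le> C / M" "C4 / M \<le> C / M"
   using C1 C2 C3 C4 M by (auto simp: C_def divide_right_mono)
  ultimately show ?thesis unfolding c1 c2 M_def[symmetric] d_def[symmetric] by linarith
 qed
 thus ?thesis using C1 C2 C3 C4 by (intro exI[of _ C]) (auto simp: C_def)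
qed

lemma inverse_Suc_tendsto_0: "(\<lambda>N. c / real (Suc N)) \<longlonglongrightarrow> 0"
 using tendsto_mult[OF tendsto_const[of c] LIMSEQ_inverse_real_of_nat] by (simp add: divide_inverse)

lemma cut_tendsto:
 assumes "\<rho> < R"
 shows "(\<lambda>N. cut0 R N \<rho>) \<longlonglongrightarrow> 1" "(\<lambda>N. cut1 R N \<rho>) \<longlonglongrightarrow> 0" "(\<lambda>N. cut2 R N \<rho>) \<longlonglongrightarrow> 0"
proof -
 define d where "d = R - \<rho>"
 have d: "d > 0" using assms by (simp add: d_def)
 obtain C where C: "C > 0" "\<And>N. \<bar>cut1 R N \<rho>\<bar> * d\<^sup>2 \<le> C / real (Suc N)" "\<And>N. \<bar>cut2 R N \<rho>\<bar> * d ^ 3 \<le> C / real (Suc N)"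
  using cut_derivative_bounds assms unfolding d_def by metis
 have "\<bar>cut1 R N \<rho>\<bar> \<le> (C / d\<^sup>2) / real (Suc N)" "\<bar>cut2 R N \<rho>\<bar> \<le> (C / d ^ 3) / real (Suc N)" for N
 proof -
  have "X \<le> (C / e) / M" if "X * e \<le> C / M" "e > 0" for X e M :: real
   using that by (metis divide_divide_eq_left mult.commute pos_le_divide_eq)
  thus "\<bar>cut1 R N \<rho>\<bar> \<le> (C / d\<^sup>2) / real (Suc N)" "\<bar>cut2 R N \<rho>\<bar> \<le> (C / d ^ 3) / real (Suc N)"
   using C(2)[of N] C(3)[of N] d by simp_all
 qed
 thus "(\<lambda>N. cut1 R N \<rho>) \<longlonglongrightarrow> 0" "(\<lambda>N. cut2 R N \<rho>) \<longlonglongrightarrow> 0"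
  using Lim_null_comparison[OF always_eventually inverse_Suc_tendsto_0[of "C / d\<^sup>2"], of "\<lambda>N. cut1 R N \<rho>"]
   Lim_null_comparison[OF always_eventually inverse_Suc_tendsto_0[of "C / d ^ 3"], of "\<lambda>N. cut2 R N \<rho>"]
  by simp_all
 have lim: "filterlim (\<lambda>N. real (Suc N) * d - 1) at_top sequentially"
 proof -
  have "filterlim (\<lambda>N. d * real (Suc N)) at_top sequentially"
   using filterlim_tendsto_pos_mult_at_top[OF tendsto_const d, of "\<lambda>N. real (Suc N)" sequentially]
    filterlim_compose[OF filterlim_real_sequentially filterlim_Suc] by simp
  from filterlim_tendsto_add_at_top[OF tendsto_const this, of "-1"]
  show ?thesis by (simp add: mult.commute)
 qed
 have A: "(\<lambda>N. exp (- inverse (real (Suc N) * d - 1))) \<longlonglongrightarrow> exp (- 0)"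
  by (intro tendsto_exp tendsto_minus filterlim_compose[OF tendsto_inverse_0_at_top[OF filterlim_ident] lim])
 have B: "\<forall>\<^sub>F N in sequentially. exp (- inverse (real (Suc N) * d - 1)) = cut0 R N \<rho>"
  using filterlim_at_top_dense[THEN iffD1, OF lim, rule_format, of 0]
  by (rule eventually_mono) (simp add: cut0_def flat_exp_def d_def inverse_eq_divide del: of_nat_Suc)
 show "(\<lambda>N. cut0 R N \<rho>) \<longlonglongrightarrow> 1"
  using Lim_transform_eventually[OF A B] by simp
qed

section \<open>Pairing integrable functions on the ball with continuous ones\<close>

abbreviation cplx :: "('a => real) => 'a => complex" where
 "cplx w \<equiv> \<lambda>x. complex_of_real (w x)"

text \<open>Continuous weights are bounded on the closed ball, so plain integrability is enough for
  every pairing; square integrability returns only for limits of approximating sequences.\<close>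

abbreviation ubi :: "('a::euclidean_space => 'b::{banach, second_countable_topology}) => bool" where
 "ubi u \<equiv> set_integrable lebesgue (ball 0 1) u"

definition ip :: "('a::euclidean_space => complex) => ('a => real) => complex" where
 "ip u \<psi> = (LINT x:ball 0 1|lebesgue. u x * complex_of_real (\<psi> x))"

lemma continuous_borel_lebesgue:
 fixes \<psi> :: "'a::euclidean_space => 'b::euclidean_space"
 shows "continuous_on UNIV \<psi> ==> \<psi> \<in> borel_measurable lebesgue"
 by (intro measurable_completion) (simp add: borel_measurable_continuous_onI)

lemma continuous_bounded_ball:
 fixes \<psi> :: "'a::euclidean_space => 'b::real_normed_vector"
 assumes "continuous_on UNIV \<psi>"
 obtains C where "C > 0" "\<And>x. x \<in> cball 0 1 ==> norm (\<psi> x) \<le> C"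
proof -
 have "bounded (\<psi> ` cball 0 1)"
  by (intro compact_imp_bounded compact_continuous_image continuous_on_subset[OF assms]) auto
 thus ?thesis using that unfolding bounded_pos by auto
qed

lemma ubi_const: "ubi (\<lambda>x. c)"
proof -
 have "ball (0::'a) 1 \<in> lmeasurable" by simp
 thus ?thesis unfolding set_integrable_def
  by (intro integrable_scaleR_left) (auto intro!: integrable_real_indicator simp: fmeasurable_def)
qed

lemma ubi_measurable: "ubi u ==> set_borel_measurable lebesgue (ball 0 1) u"
 unfolding set_integrable_def set_borel_measurable_def by (rule borel_measurable_integrable)

lemma ubi_mult:
 fixes u :: "'a::euclidean_space => 'b::{real_normed_field, banach, second_countable_topology}" and \<psi> :: "'a => real"
 assumes u: "ubi u" and m: "\<psi> \<in> borel_measurable lebesgue" and C: "\<And>x. x \<in> ball 0 1 ==> \<bar>\<psi> x\<bar> \<le> C"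
 shows "ubi (\<lambda>x. u x * of_real (\<psi> x))"
proof (rule set_integrable_bound)
 show "ubi (\<lambda>x. of_real C * u x)" using u by (intro set_integrable_mult_right)
 have "(\<lambda>x. (indicator (ball 0 1) x *\<^sub>R u x) * of_real (\<psi> x)) \<in> borel_measurable lebesgue"
  using ubi_measurable[OF u] unfolding set_borel_measurable_def
  by (intro borel_measurable_times
    measurable_compose[OF m borel_measurable_continuous_onI[OF continuous_on_of_real[OF continuous_on_id]]])
 thus "set_borel_measurable lebesgue (ball 0 1) (\<lambda>x. u x * of_real (\<psi> x))"
  by (simp add: set_borel_measurable_def)
 have "norm (u x * of_real (\<psi> x)) \<le> norm (of_real C * u x)" if "x \<in> ball 0 1" for x
 proof -
  have "\<bar>\<psi> x\<bar> \<le> \<bar>C\<bar>" using C[OF that] by linarith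
  from mult_left_mono[OF this norm_ge_zero[of "u x"]] show ?thesis by (simp add: norm_mult mult.commute)
 qed
 thus "AE x in lebesgue. x \<in> ball 0 1 --> norm (u x * of_real (\<psi> x)) \<le> norm (of_real C * u x)" by simp
qed

lemma ubi_mult_continuous:
 fixes u :: "'a::euclidean_space => complex"
 assumes u: "ubi u" and c: "continuous_on UNIV \<psi>"
 shows "ubi (\<lambda>x. u x * complex_of_real (\<psi> x))"
proof -
 obtain C where C: "C > 0" "\<And>x. x \<in> cball 0 1 ==> norm (\<psi> x) \<le> C" using continuous_bounded_ball[OF c] by blast
 show ?thesis by (rule ubi_mult[OF u continuous_borel_lebesgue[OF c], of C]) (use C in auto)
qed

lemma ubi_continuous_real:
 fixes w :: "'a::euclidean_space => real"
 assumes c: "continuous_on UNIV w" shows "ubi w"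
proof -
 obtain C where C: "C > 0" "\<And>x. x \<in> cball 0 1 ==> norm (w x) \<le> C" using continuous_bounded_ball[OF c] by blast
 have "ubi (\<lambda>x. (1::real) * of_real (w x))"
  by (rule ubi_mult[OF ubi_const continuous_borel_lebesgue[OF c], of C]) (use C in auto)
 thus ?thesis by simp
qed

lemma ubi_of_real:
 assumes "ubi (w :: 'a::euclidean_space => real)" shows "ubi (cplx w)"
proof -
 have "integrable lebesgue (\<lambda>x. complex_of_real (indicator (ball 0 1) x *\<^sub>R w x))"
  using assms unfolding set_integrable_def by (rule integrable_of_real)
 thus ?thesis unfolding set_integrable_def by (simp add: scaleR_conv_of_real)
qed

lemma ubi_continuous: "continuous_on UNIV w ==> ubi (cplx w)"
 by (intro ubi_of_real ubi_continuous_real)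

lemma ip_real:
 "ip (cplx w) \<psi> = complex_of_real (LINT x:ball 0 1|lebesgue. w x * \<psi> x)"
 unfolding ip_def by (simp flip: of_real_mult add: set_integral_complex_of_real)

lemma ip_add:
 assumes "ubi u" "continuous_on UNIV \<psi>" "continuous_on UNIV \<phi>"
 shows "ip u (\<lambda>x. \<psi> x + \<phi> x) = ip u \<psi> + ip u \<phi>"
 unfolding ip_def using ubi_mult_continuous[OF assms(1,2)] ubi_mult_continuous[OF assms(1,3)]
 by (simp add: distrib_left set_integral_add)

lemma ip_cmult: "ip u (\<lambda>x. c * \<psi> x) = of_real c * ip u \<psi>"
 unfolding ip_def by (simp add: mult.left_commute)

lemma ip_diff:
 assumes "ubi u" "continuous_on UNIV \<psi>" "continuous_on UNIV \<phi>"
 shows "ip u (\<lambda>x. \<psi> x - \<phi> x) = ip u \<psi> - ip u \<phi>"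
 unfolding ip_def using ubi_mult_continuous[OF assms(1,2)] ubi_mult_continuous[OF assms(1,3)]
 by (simp add: right_diff_distrib set_integral_diff)

lemma ip_zero: "ip u (\<lambda>x. 0) = 0"
 by (simp add: ip_def)

lemma ip_sum:
 assumes "ubi u" "finite I" "\<And>i. i \<in> I ==> continuous_on UNIV (\<psi> i)"
 shows "ip u (\<lambda>x. \<Sum>i\<in>I. \<psi> i x) = (\<Sum>i\<in>I. ip u (\<psi> i))"
 using assms(2,3)
proof (induction I rule: finite_induct)
 case (insert i I)
 thus ?case using ip_add[OF assms(1), of "\<psi> i" "\<lambda>x. \<Sum>i\<in>I. \<psi> i x"] by (simp add: continuous_on_sum)
qed (simp add: ip_zero)

lemma ip_lincomb:
 assumes "finite S" "\<And>f. f \<in> S ==> ubi (g f)" "continuous_on UNIV \<psi>"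
 shows "ip (\<lambda>x. \<Sum>f\<in>S. c f * g f x) \<psi> = (\<Sum>f\<in>S. c f * ip (g f) \<psi>)"
  and "ubi (\<lambda>x. \<Sum>f\<in>S. c f * g f x)"
proof -
 have "ubi (\<lambda>x. \<Sum>f\<in>S. c f * g f x) \<and> ip (\<lambda>x. \<Sum>f\<in>S. c f * g f x) \<psi> = (\<Sum>f\<in>S. c f * ip (g f) \<psi>)"
  using assms(1,2)
 proof (induction S rule: finite_induct)
  case empty
  show ?case using ubi_const[of 0] by (simp add: ip_def)
 next
  case (insert f S)
  have 1: "ubi (\<lambda>x. c f * g f x)" using insert by (intro set_integrable_mult_right) auto
  have 2: "ubi (\<lambda>x. \<Sum>f\<in>S. c f * g f x)" using insert by auto
  have "ubi (\<lambda>x. c f * g f x + (\<Sum>f\<in>S. c f * g f x))" by (rule set_integral_add(1)[OF 1 2])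
  moreover have "ip (\<lambda>x. c f * g f x + (\<Sum>f\<in>S. c f * g f x)) \<psi> = c f * ip (g f) \<psi> + ip (\<lambda>x. \<Sum>f\<in>S. c f * g f x) \<psi>"
   unfolding ip_def using set_integral_add(2)[OF ubi_mult_continuous[OF 1 assms(3)] ubi_mult_continuous[OF 2 assms(3)]]
   by (simp add: distrib_right mult.assoc)
  ultimately show ?case using insert by simp
 qed
 thus "ip (\<lambda>x. \<Sum>f\<in>S. c f * g f x) \<psi> = (\<Sum>f\<in>S. c f * ip (g f) \<psi>)" "ubi (\<lambda>x. \<Sum>f\<in>S. c f * g f x)"
  by auto
qed

lemma ip_diff_left:
 assumes "ubi u" "ubi v" "continuous_on UNIV \<psi>"
 shows "ip (\<lambda>x. u x - v x) \<psi> = ip u \<psi> - ip v \<psi>"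
 unfolding ip_def using ubi_mult_continuous[OF assms(1,3)] ubi_mult_continuous[OF assms(2,3)]
 by (simp add: left_diff_distrib set_integral_diff)

lemma ip_cmult_left: "ip (\<lambda>x. c * u x) \<psi> = c * ip u \<psi>"
 unfolding ip_def by (simp add: mult.assoc)

lemma ip_cong: "(\<And>x. x \<in> ball 0 1 ==> \<psi> x = \<phi> x) ==> ip u \<psi> = ip u \<phi>"
 unfolding ip_def by (rule set_lebesgue_integral_cong) auto

lemma ip_dominated:
 assumes u: "ubi u" and m: "\<And>k. continuous_on UNIV (\<psi> k)" "continuous_on UNIV \<psi>'"
  and C: "\<And>k x. x \<in> ball 0 1 ==> \<bar>\<psi> k x\<bar> \<le> C"
  and lim: "\<And>x. x \<in> ball 0 1 ==> (\<lambda>k. \<psi> k x) \<longlonglongrightarrow> \<psi>' x"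
 shows "(\<lambda>k. ip u (\<psi> k)) \<longlonglongrightarrow> ip u \<psi>'"
 unfolding ip_def set_lebesgue_integral_def
proof (rule integral_dominated_convergence)
 have "ubi (\<lambda>x. complex_of_real C * u x)" using u by (intro set_integrable_mult_right)
 thus "integrable lebesgue (\<lambda>x. norm (indicator (ball 0 1) x *\<^sub>R (complex_of_real C * u x)))"
  unfolding set_integrable_def by (rule integrable_norm)
 show "(\<lambda>x. indicator (ball 0 1) x *\<^sub>R (u x * complex_of_real (\<psi>' x))) \<in> borel_measurable lebesgue"
  using ubi_mult_continuous[OF u m(2)] unfolding set_integrable_def by (rule borel_measurable_integrable)
 show "(\<lambda>x. indicator (ball 0 1) x *\<^sub>R (u x * complex_of_real (\<psi> k x))) \<in> borel_measurable lebesgue" for k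
  using ubi_mult_continuous[OF u m(1)[of k]] unfolding set_integrable_def by (rule borel_measurable_integrable)
 have "(\<lambda>k. indicator (ball 0 1) x *\<^sub>R (u x * complex_of_real (\<psi> k x)))
     \<longlonglongrightarrow> indicator (ball 0 1) x *\<^sub>R (u x * complex_of_real (\<psi>' x))" for x
 proof (cases "x \<in> ball 0 1")
  case True
  thus ?thesis using lim[OF True] by (intro tendsto_intros)
 qed simp
 thus "AE x in lebesgue. (\<lambda>k. indicator (ball 0 1) x *\<^sub>R (u x * complex_of_real (\<psi> k x)))
     \<longlonglongrightarrow> indicator (ball 0 1) x *\<^sub>R (u x * complex_of_real (\<psi>' x))" by simp
 have "norm (indicator (ball 0 1) x *\<^sub>R (u x * complex_of_real (\<psi> k x)))
   \<le> norm (indicator (ball 0 1) x *\<^sub>R (complex_of_real C * u x))" for k x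
 proof (cases "x \<in> ball 0 1")
  case True
  have "\<bar>\<psi> k x\<bar> \<le> \<bar>C\<bar>" using C[OF True, of k] by linarith
  from mult_left_mono[OF this norm_ge_zero[of "u x"]] show ?thesis
   using True by (simp add: norm_mult mult.commute)
 qed simp
 thus "AE x in lebesgue. norm (indicator (ball 0 1) x *\<^sub>R (u x * complex_of_real (\<psi> k x)))
   \<le> norm (indicator (ball 0 1) x *\<^sub>R (complex_of_real C * u x))" for k by simp
qed

definition mass :: "('a::euclidean_space => complex) => real" where
 "mass u = (LINT x:ball 0 1|lebesgue. norm (u x))"

lemma ubi_norm: "ubi u ==> ubi (\<lambda>x. norm (u x))"
 using integrable_norm[of lebesgue "\<lambda>x. indicator (ball 0 1) x *\<^sub>R u x"]
 unfolding set_integrable_def by (simp add: abs_mult)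

lemma norm_ip_le:
 assumes u: "ubi u" and c: "continuous_on UNIV \<psi>" and C: "\<And>x. x \<in> ball 0 1 ==> \<bar>\<psi> x\<bar> \<le> C"
 shows "norm (ip u \<psi>) \<le> C * mass u"
proof -
 have "norm (ip u \<psi>) \<le> (LINT x:ball 0 1|lebesgue. norm (u x * complex_of_real (\<psi> x)))"
  unfolding ip_def by (rule set_integral_norm_bound[OF ubi_mult_continuous[OF u c]])
 also have "\<dots> \<le> (LINT x:ball 0 1|lebesgue. C * norm (u x))"
  using ubi_norm[OF ubi_mult_continuous[OF u c]] set_integrable_mult_right[OF ubi_norm[OF u], of C]
  by (rule set_integral_mono) (use C in \<open>auto simp: norm_mult mult.commute[of C] intro!: mult_left_mono\<close>)
 finally show ?thesis by (simp add: mass_def)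
qed

lemma L2_ubi: assumes "L2 (ball 0 1) u" shows "ubi u"
proof (rule set_integrable_bound)
 have "ubi (\<lambda>x. (norm (u x))\<^sup>2)" using assms by (simp add: L2_def)
 thus "ubi (\<lambda>x. 1 + (norm (u x))\<^sup>2)" by (intro set_integral_add(1)[OF ubi_const])
 show "set_borel_measurable lebesgue (ball 0 1) u" using assms by (simp add: L2_def)
 have "t \<le> norm (1 + t\<^sup>2)" for t :: real
 proof -
  have "0 \<le> (t - 1/2)\<^sup>2" by simp
  moreover have "(t - 1/2)\<^sup>2 = t\<^sup>2 - t + 1/4" by (simp add: power2_eq_square algebra_simps)
  ultimately have "t \<le> 1 + t\<^sup>2" by linarith
  thus ?thesis by simp
 qed
 thus "AE x in lebesgue. x \<in> ball 0 1 --> norm (u x) \<le> norm (1 + (norm (u x))\<^sup>2)" by simp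
qed

lemma L2_continuous:
 assumes c: "continuous_on UNIV (w :: 'a::euclidean_space => real)" shows "L2 (ball 0 1) (cplx w)"
 unfolding L2_def
proof
 show "set_borel_measurable lebesgue (ball 0 1) (cplx w)"
  by (rule ubi_measurable[OF ubi_continuous[OF c]])
 have "ubi (\<lambda>x. (w x)\<^sup>2)" by (intro ubi_continuous_real continuous_intros c)
 thus "ubi (\<lambda>x. (norm (complex_of_real (w x)))\<^sup>2)" by simp
qed

lemma L2_diff_integrable:
 assumes u: "L2 (ball 0 1) u" and c: "continuous_on UNIV \<phi>"
 shows "ubi (\<lambda>x. (norm (u x - complex_of_real (\<phi> x)))\<^sup>2)"
proof (rule set_integrable_bound)
 let ?w = "\<lambda>x. u x - complex_of_real (\<phi> x)"
 have 1: "ubi (\<lambda>x. 2 * (norm (u x))\<^sup>2)" using u by (intro set_integrable_mult_right) (simp add: L2_def)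
 have 2: "ubi (\<lambda>x. 2 * (\<phi> x)\<^sup>2)" by (intro ubi_continuous_real continuous_intros c)
 show "ubi (\<lambda>x. 2 * (norm (u x))\<^sup>2 + 2 * (\<phi> x)\<^sup>2)" by (rule set_integral_add(1)[OF 1 2])
 have "ubi ?w" by (intro set_integral_diff L2_ubi[OF u] ubi_continuous c)
 hence "set_borel_measurable lebesgue (ball 0 1) ?w" by (rule ubi_measurable)
 hence "(\<lambda>x. (norm (indicator (ball 0 1) x *\<^sub>R (?w x)))\<^sup>2) \<in> borel_measurable lebesgue"
  unfolding set_borel_measurable_def by measurable
 moreover have "(\<lambda>x. (norm (indicator (ball 0 1) x *\<^sub>R (?w x)))\<^sup>2)
   = (\<lambda>x. indicator (ball 0 1) x *\<^sub>R (norm (?w x))\<^sup>2)"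
  by (auto simp: fun_eq_iff indicator_def)
 ultimately show "set_borel_measurable lebesgue (ball 0 1) (\<lambda>x. (norm (?w x))\<^sup>2)"
  by (simp add: set_borel_measurable_def)
 have "(norm (?w x))\<^sup>2 \<le> 2 * (norm (u x))\<^sup>2 + 2 * (\<phi> x)\<^sup>2" for x
 proof -
  have "(norm (?w x))\<^sup>2 \<le> (norm (u x) + \<bar>\<phi> x\<bar>)\<^sup>2"
   using norm_triangle_ineq4[of "u x" "complex_of_real (\<phi> x)"] by (intro power_mono) auto
  also have "\<dots> \<le> 2 * (norm (u x))\<^sup>2 + 2 * (\<phi> x)\<^sup>2"
   using sum_squares_bound[of "norm (u x)" "\<bar>\<phi> x\<bar>"] by (simp add: power2_sum)
  finally show ?thesis .
 qed
 thus "AE x in lebesgue. x \<in> ball 0 1 --> norm ((norm (?w x))\<^sup>2) \<le> norm (2 * (norm (u x))\<^sup>2 + 2 * (\<phi> x)\<^sup>2)"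
  by simp
qed

text \<open>\<open>2 d \<le> \<delta> + d\<^sup>2 / \<delta>\<close> replaces the Cauchy-Schwarz inequality.\<close>

lemma L2_dist2_ip_tendsto:
 fixes u :: "'a::euclidean_space => complex"
 assumes u: "L2 (ball 0 1) u" and c: "\<And>k. continuous_on UNIV (\<phi> k)" and c': "continuous_on UNIV \<psi>"
  and lim: "(\<lambda>k. L2_dist2 (ball 0 1) u (\<phi> k)) \<longlonglongrightarrow> 0"
 shows "(\<lambda>k. ip (cplx (\<phi> k)) \<psi>) \<longlonglongrightarrow> ip u \<psi>"
proof -
 let ?w = "\<lambda>k x. u x - complex_of_real (\<phi> k x)"
 obtain C where C: "C > 0" "\<And>x. x \<in> cball 0 1 ==> norm (\<psi> x) \<le> C" using continuous_bounded_ball[OF c'] by blast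
 define vol where "vol = (LINT x:ball (0::'a) 1|lebesgue. (1::real))"
 have vol: "vol \<ge> 0" unfolding vol_def set_lebesgue_integral_def by (rule integral_nonneg_AE) auto
 have bd: "norm (ip (cplx (\<phi> k)) \<psi> - ip u \<psi>) \<le> C * (\<delta> / 2 * vol + L2_dist2 (ball 0 1) u (\<phi> k) / (2 * \<delta>))"
  if d: "\<delta> > 0" for k \<delta>
 proof -
  have ud: "ubi (?w k)" by (intro set_integral_diff L2_ubi[OF u] ubi_continuous c)
  have "norm (ip (cplx (\<phi> k)) \<psi> - ip u \<psi>) = norm (ip (?w k) \<psi>)"
   using ip_diff_left[OF L2_ubi[OF u] ubi_continuous[OF c[of k]] c'] by (simp add: norm_minus_commute)
  also have "\<dots> \<le> C * mass (?w k)"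
   by (rule norm_ip_le[OF ud c']) (use C in auto)
  also have "mass (?w k)
    \<le> (LINT x:ball 0 1|lebesgue. \<delta> / 2 * 1 + 1 / (2 * \<delta>) * (norm (?w k x))\<^sup>2)"
   unfolding mass_def
  proof (rule set_integral_mono[OF ubi_norm[OF ud]])
   show "ubi (\<lambda>x. \<delta> / 2 * 1 + 1 / (2 * \<delta>) * (norm (?w k x))\<^sup>2)"
    by (intro set_integral_add(1)[OF ubi_const] set_integrable_mult_right L2_diff_integrable[OF u c])
   fix x
   have "t \<le> \<delta> / 2 * 1 + 1 / (2 * \<delta>) * t\<^sup>2" for t
   proof -
    have "0 \<le> (t - \<delta>)\<^sup>2 / (2 * \<delta>)" using d by simp
    also have "\<dots> = \<delta> / 2 * 1 + 1 / (2 * \<delta>) * t\<^sup>2 - t" using d by (simp add: field_simps power2_eq_square)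
    finally show ?thesis by simp
   qed
   thus "norm (?w k x) \<le> \<delta> / 2 * 1 + 1 / (2 * \<delta>) * (norm (?w k x))\<^sup>2" .
  qed
  also have "\<dots> = \<delta> / 2 * vol + L2_dist2 (ball 0 1) u (\<phi> k) / (2 * \<delta>)"
  proof -
   have "(LINT x:ball 0 1|lebesgue. \<delta> / 2 * 1 + 1 / (2 * \<delta>) * (norm (?w k x))\<^sup>2)
    = (LINT x:ball (0::'a) 1|lebesgue. \<delta> / 2 * 1) + (LINT x:ball 0 1|lebesgue. 1 / (2 * \<delta>) * (norm (?w k x))\<^sup>2)"
    by (rule set_integral_add(2)[OF set_integrable_mult_right[OF ubi_const] set_integrable_mult_right[OF L2_diff_integrable[OF u c]]])
   also have "\<dots> = \<delta> / 2 * vol + 1 / (2 * \<delta>) * L2_dist2 (ball 0 1) u (\<phi> k)"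
    unfolding set_integral_mult_right vol_def L2_dist2_def ..
   finally show ?thesis by simp
  qed
  finally show ?thesis using C(1) by simp
 qed
 show ?thesis
 proof (rule LIMSEQ_I)
  fix e :: real assume e: "e > 0"
  \<comment> \<open>Chosen so that the term independent of \<open>k\<close> is at most e / 2; the
    other term is then made smaller than e / 2 by taking \<open>k\<close> large.\<close>
  define \<delta> where "\<delta> = e / (C * (vol + 1))"
  have d: "\<delta> > 0" using e C vol by (simp add: \<delta>_def)
  have d2: "C * (\<delta> / 2 * vol) \<le> e / 2"
  proof -
   have "C * (\<delta> / 2 * vol) = e / 2 * (vol / (vol + 1))" using C(1) vol by (simp add: \<delta>_def divide_simps)
   also have "\<dots> \<le> e / 2 * 1" using e vol by (intro mult_left_mono) auto
   finally show ?thesis by simp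
  qed
  have "e * \<delta> / C > 0" using e d C by simp
  from LIMSEQ_D[OF lim this] obtain N where N: "\<And>k. k \<ge> N ==> \<bar>L2_dist2 (ball 0 1) u (\<phi> k)\<bar> < e * \<delta> / C" by auto
  have "norm (ip (cplx (\<phi> k)) \<psi> - ip u \<psi>) < e" if "k \<ge> N" for k
  proof -
   have "C * (L2_dist2 (ball 0 1) u (\<phi> k) / (2 * \<delta>)) < C * ((e * \<delta> / C) / (2 * \<delta>))"
    using N[OF that] C d by (intro mult_strict_left_mono divide_strict_right_mono) auto
   also have "\<dots> = e / 2" using C d by (simp add: field_simps)
   finally show ?thesis using bd[OF d, of k] d2 by (simp add: distrib_left)
  qed
  thus "\<exists>no. \<forall>n\<ge>no. norm (ip (cplx (\<phi> n)) \<psi> - ip u \<psi>) < e" by blast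
 qed
qed

section \<open>Integration by parts against test functions\<close>

lemma test_fun_smooth: "test_fun \<Omega> \<phi> ==> smooth \<phi>"
 by (simp add: test_fun_iff)

lemma test_fun_pd:
 assumes t: "test_fun \<Omega> \<phi>" and i: "i \<in> Basis"
 shows "test_fun \<Omega> (pd [i] \<phi>)"
proof -
 have z: "pd [i] \<phi> x = 0" if "x \<notin> closure {x. \<phi> x \<noteq> 0}" for x
 proof -
  have "((\<lambda>_. 0) has_derivative (\<lambda>_. 0)) (at x)" by simp
  hence "(\<phi> has_derivative (\<lambda>_. 0)) (at x)"
   by (rule has_derivative_transform_within_open[of _ _ _ _ "- closure {x. \<phi> x \<noteq> 0}"])
    (use that closure_subset[of "{x. \<phi> x \<noteq> 0}"] in auto)
  thus ?thesis by (rule pd_eqI)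
 qed
 hence "{x. pd [i] \<phi> x \<noteq> 0} \<subseteq> closure {x. \<phi> x \<noteq> 0}" by auto
 hence sub: "closure {x. pd [i] \<phi> x \<noteq> 0} \<subseteq> closure {x. \<phi> x \<noteq> 0}" by (rule closure_minimal) simp
 hence "compact (closure {x. pd [i] \<phi> x \<noteq> 0})"
  using t compact_Int_closed[of "closure {x. \<phi> x \<noteq> 0}" "closure {x. pd [i] \<phi> x \<noteq> 0}"]
  by (simp add: test_fun_iff Int_absorb1)
 thus ?thesis using t sub i smooth_pd by (auto simp: test_fun_iff)
qed

lemma test_fun_mult:
 assumes t: "test_fun \<Omega> \<phi>" and w: "smooth w"
 shows "test_fun \<Omega> (\<lambda>x. w x * \<phi> x)"
proof -
 have "{x. w x * \<phi> x \<noteq> 0} \<subseteq> {x. \<phi> x \<noteq> 0}" by auto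
 hence sub: "closure {x. w x * \<phi> x \<noteq> 0} \<subseteq> closure {x. \<phi> x \<noteq> 0}" by (rule closure_mono)
 hence "compact (closure {x. w x * \<phi> x \<noteq> 0})"
  using t compact_Int_closed[of "closure {x. \<phi> x \<noteq> 0}" "closure {x. w x * \<phi> x \<noteq> 0}"]
  by (simp add: test_fun_iff Int_absorb1)
 thus ?thesis using t sub w by (auto simp: test_fun_iff)
qed

lemma test_fun_zero: "test_fun \<Omega> \<phi> ==> x \<notin> \<Omega> ==> \<phi> x = 0"
 using closure_subset[of "{x. \<phi> x \<noteq> 0}"] by (auto simp: test_fun_iff)

text \<open>The difference quotients of \<phi> have integral 0 by translation invariance of Lebesgue
  measure, and they converge boundedly to the partial derivative.\<close>

lemma integral_pd_zero:
 fixes \<phi> :: "'a::euclidean_space => real"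
 assumes t: "test_fun (ball 0 1) \<phi>" and i: "i \<in> Basis"
 shows "(LINT x:ball 0 1|lebesgue. pd [i] \<phi> x) = 0"
proof -
 define D where "D = pd [i] \<phi>"
 have tD: "test_fun (ball 0 1) D" unfolding D_def by (rule test_fun_pd[OF t i])
 have cD: "continuous_on UNIV D" and c\<phi>: "continuous_on UNIV \<phi>"
  using t tD test_fun_smooth smooth_continuous by blast+
 obtain M where M: "M > 0" "\<And>x. x \<in> cball 0 1 ==> norm (D x) \<le> M" using continuous_bounded_ball[OF cD] by blast
 have M': "\<bar>D x\<bar> \<le> M" for x
  using M test_fun_zero[OF tD, of x] by (cases "x \<in> ball 0 1") auto
 have dline: "DERIV (\<lambda>s. \<phi> (x + s *\<^sub>R i)) s :> D (x + s *\<^sub>R i)" for x s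
 proof -
  have "(\<phi> has_derivative frechet_derivative \<phi> (at (x + s *\<^sub>R i))) (at (x + s *\<^sub>R i))"
   using smooth_has_derivative[OF test_fun_smooth[OF t]] .
  moreover have "((\<lambda>s. x + s *\<^sub>R i) has_derivative (\<lambda>h. h *\<^sub>R i)) (at s)"
   by (auto intro!: derivative_eq_intros)
  ultimately have "((\<lambda>s. \<phi> (x + s *\<^sub>R i)) has_derivative (\<lambda>h. frechet_derivative \<phi> (at (x + s *\<^sub>R i)) (h *\<^sub>R i))) (at s)"
   by (rule has_derivative_compose[rotated])
  moreover have "frechet_derivative \<phi> (at (x + s *\<^sub>R i)) (h *\<^sub>R i) = D (x + s *\<^sub>R i) * h" for h
   using linear_frechet_derivative[OF smooth_differentiable[OF test_fun_smooth[OF t]]]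
   by (simp add: D_def pd_single linear_scale mult.commute)
  ultimately show ?thesis by (simp add: has_field_derivative_def mult.commute[of _ "D _"])
 qed
 define F where "F k x = real (Suc k) * (\<phi> (x + (1 / real (Suc k)) *\<^sub>R i) - \<phi> x)" for k x
 \<comment> \<open>Shifts have length at most 1 and \<phi> lives in the unit ball, so all quotients
   vanish outside the ball of radius 2; inside, the mean value theorem bounds them by
   \<open>M\<close>.\<close>
 have F_le: "\<bar>F k x\<bar> \<le> M * indicator (cball 0 2) x" for k x
 proof (cases "x \<in> cball 0 2")
  case True
  obtain s where s: "\<phi> (x + (1 / real (Suc k)) *\<^sub>R i) - \<phi> (x + 0 *\<^sub>R i) = (1 / real (Suc k) - 0) * D (x + s *\<^sub>R i)"
   using MVT2[of 0 "1 / real (Suc k)" "\<lambda>s. \<phi> (x + s *\<^sub>R i)" "\<lambda>s. D (x + s *\<^sub>R i)"] dline by auto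
  hence "F k x = D (x + s *\<^sub>R i)" by (simp add: F_def)
  thus ?thesis using M' True by simp
 next
  case False
  let ?z = "(1 / real (Suc k)) *\<^sub>R i"
  have n: "norm ?z \<le> 1" using i by simp
  have "norm x - norm ?z \<le> norm (x + ?z)"
   using norm_triangle_ineq4[of "x + ?z" "?z"] by simp
  moreover have "norm x > 2" using False by simp
  ultimately have "norm (x + ?z) > 1" "norm x > 1" using n by linarith+
  hence "x \<notin> ball 0 1" "x + ?z \<notin> ball 0 1" by simp_all
  hence "F k x = 0" using test_fun_zero[OF t] by (simp add: F_def)
  thus ?thesis using M(1) by simp
 qed
 have int\<phi>: "integrable lborel \<phi>"
 proof -
  obtain C where C: "C > 0" "\<And>x. x \<in> cball 0 1 ==> norm (\<phi> x) \<le> C" using continuous_bounded_ball[OF c\<phi>] by blast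
  show ?thesis
  proof (rule Bochner_Integration.integrable_bound)
   show "integrable lborel (\<lambda>x. C * indicator (cball (0::'a) 1) x)"
    by (intro integrable_mult_right integrable_real_indicator) (auto intro: emeasure_lborel_cball_finite[unfolded infinity_ennreal_def])
   show "\<phi> \<in> borel_measurable lborel" using c\<phi> by (simp add: borel_measurable_continuous_onI)
   have "\<bar>\<phi> x\<bar> \<le> C * indicator (cball 0 1) x" for x
    using C test_fun_zero[OF t, of x] by (cases "x \<in> cball 0 1") (auto simp: indicator_def)
   thus "AE x in lborel. norm (\<phi> x) \<le> norm (C * indicator (cball 0 1) x :: real)" using C(1) by simp
  qed
 qed
 have shift: "integral\<^sup>L lborel (\<lambda>x. \<phi> (x + c)) = integral\<^sup>L lborel \<phi>" "integrable lborel (\<lambda>x. \<phi> (x + c))" for c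
 proof -
  have "integral\<^sup>L (distr lborel borel ((+) c)) \<phi> = integral\<^sup>L lborel (\<lambda>x. \<phi> (c + x))"
   by (rule integral_distr) (use c\<phi> in \<open>auto simp: borel_measurable_continuous_onI\<close>)
  thus "integral\<^sup>L lborel (\<lambda>x. \<phi> (x + c)) = integral\<^sup>L lborel \<phi>"
   by (simp add: lborel_distr_plus add.commute)
  have "integrable (distr lborel borel ((+) c)) \<phi>" using int\<phi> by (simp add: lborel_distr_plus)
  thus "integrable lborel (\<lambda>x. \<phi> (x + c))"
   by (subst (asm) integrable_distr_eq) (use c\<phi> in \<open>auto simp: borel_measurable_continuous_onI add.commute\<close>)
 qed
 have F0: "integral\<^sup>L lborel (F k) = 0" for k
  unfolding F_def using shift[of "(1 / real (Suc k)) *\<^sub>R i"] int\<phi> by simp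
 have mF: "F k \<in> borel_measurable lborel" for k
 proof -
  have "continuous_on UNIV (F k)" unfolding F_def
   by (intro continuous_intros c\<phi> continuous_on_compose2[OF c\<phi>]) auto
  thus ?thesis by (simp add: borel_measurable_continuous_onI)
 qed
 have "(\<lambda>k. integral\<^sup>L lborel (F k)) \<longlonglongrightarrow> integral\<^sup>L lborel D"
 proof (rule integral_dominated_convergence)
  show "integrable lborel (\<lambda>x. M * indicator (cball (0::'a) 2) x)"
   by (intro integrable_mult_right integrable_real_indicator) (auto intro: emeasure_lborel_cball_finite[unfolded infinity_ennreal_def])
  show "D \<in> borel_measurable lborel" using cD by (simp add: borel_measurable_continuous_onI)
  show "F k \<in> borel_measurable lborel" for k by (rule mF)
  show "AE x in lborel. norm (F k x) \<le> M * indicator (cball 0 2) x" for k using F_le[of k] by simp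
  have "(\<lambda>k. F k x) \<longlonglongrightarrow> D x" for x
  proof -
   have "((\<lambda>h. (\<phi> (x + h *\<^sub>R i) - \<phi> x) / h) \<longlongrightarrow> D x) (at 0)"
    using dline[of x 0] by (simp add: has_field_derivative_iff)
   moreover have "filterlim (\<lambda>k. 1 / real (Suc k)) (at 0) sequentially"
    using inverse_Suc_tendsto_0[of 1] by (auto simp: filterlim_at)
   ultimately have "(\<lambda>k. (\<phi> (x + (1 / real (Suc k)) *\<^sub>R i) - \<phi> x) / (1 / real (Suc k))) \<longlonglongrightarrow> D x"
    by (rule filterlim_compose)
   thus ?thesis by (simp add: F_def mult.commute)
  qed
  thus "AE x in lborel. (\<lambda>k. F k x) \<longlonglongrightarrow> D x" by simp
 qed
 hence "integral\<^sup>L lborel D = 0" unfolding F0 by (simp add: LIMSEQ_const_iff)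
 moreover have "(\<lambda>x. indicator (ball 0 1) x *\<^sub>R D x) = D"
  using test_fun_zero[OF tD] by (auto simp: fun_eq_iff indicator_def)
 moreover have "integral\<^sup>L lebesgue D = integral\<^sup>L lborel D"
  using cD by (intro integral_completion) (simp add: borel_measurable_continuous_onI)
 ultimately show ?thesis unfolding set_lebesgue_integral_def D_def[symmetric] by simp
qed

lemma integration_by_parts:
 fixes \<phi> w :: "'a::euclidean_space => real"
 assumes t: "test_fun (ball 0 1) \<phi>" and w: "smooth w" and i: "i \<in> Basis"
 shows "(LINT x:ball 0 1|lebesgue. w x * pd [i] \<phi> x) = - (LINT x:ball 0 1|lebesgue. pd [i] w x * \<phi> x)"
proof -
 have s: "smooth \<phi>" using test_fun_smooth[OF t] .
 have e: "pd [i] (\<lambda>x. w x * \<phi> x) = (\<lambda>x. w x * pd [i] \<phi> x + pd [i] w x * \<phi> x)"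
  by (intro ext pd_mult smooth_differentiable w s)
 have "0 = (LINT x:ball 0 1|lebesgue. w x * pd [i] \<phi> x + pd [i] w x * \<phi> x)"
  using integral_pd_zero[OF test_fun_mult[OF t w] i] unfolding e by simp
 also have "\<dots> = (LINT x:ball 0 1|lebesgue. w x * pd [i] \<phi> x) + (LINT x:ball 0 1|lebesgue. pd [i] w x * \<phi> x)"
  by (intro set_integral_add ubi_continuous_real continuous_intros smooth_continuous w s smooth_pd i)
 finally show ?thesis by simp
qed

lemma ip_by_parts:
 fixes \<phi> w :: "'a::euclidean_space => real"
 assumes t: "test_fun (ball 0 1) \<phi>" and w: "smooth w" and i: "i \<in> Basis"
 shows "ip (cplx w) (pd [i] \<phi>) = - ip (cplx (pd [i] w)) \<phi>"
  and "ip (cplx (pd [i] \<phi>)) w = - ip (cplx \<phi>) (pd [i] w)"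
 unfolding ip_real using integration_by_parts[OF assms] by (simp_all add: mult.commute)

section \<open>Harmonic polynomials\<close>

lemma pd_two: "pd [i, j] f = pd [i] (pd [j] f)"
 using pd_append[of "[i]" "[j]" f] by simp

lemma pd_norm2: "pd [i] (\<lambda>x::'a::euclidean_space. x \<bullet> x) = (\<lambda>x. 2 * (x \<bullet> i))"
proof (rule ext)
 fix x :: 'a
 have "((\<lambda>x::'a. x \<bullet> x) has_derivative (\<lambda>h. x \<bullet> h + h \<bullet> x)) (at x)"
  by (auto intro!: derivative_eq_intros)
 from pd_eqI[OF this] show "pd [i] (\<lambda>x::'a. x \<bullet> x) x = 2 * (x \<bullet> i)" by (simp add: inner_commute)
qed

lemma pd_radial:
 fixes P :: "'a::euclidean_space => real"
 assumes P: "smooth P" and k: "\<And>s. DERIV k s :> k' s"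
 shows "pd [i] (\<lambda>x. P x * k (x \<bullet> x)) x = pd [i] P x * k (x \<bullet> x) + 2 * (x \<bullet> i) * P x * k' (x \<bullet> x)"
proof -
 have d: "(\<lambda>x. x \<bullet> x) differentiable (at x)" by (rule smooth_differentiable[OF smooth_norm2])
 have c: "pd [i] (\<lambda>x. k (x \<bullet> x)) x = k' (x \<bullet> x) * (2 * (x \<bullet> i))"
  using pd_compose[OF d k] by (simp add: pd_norm2)
 have "k differentiable at (x \<bullet> x)" using k real_differentiable_def by blast
 hence "(\<lambda>x. k (x \<bullet> x)) differentiable (at x)"
  using differentiable_compose[of k "\<lambda>x. x \<bullet> x" x UNIV] d by simp
 thus ?thesis using pd_mult[OF smooth_differentiable[OF P, of x], of "\<lambda>x. k (x \<bullet> x)"] c by simp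
qed

lemma pd2_radial:
 fixes P :: "'a::euclidean_space => real"
 assumes P: "smooth P" and k: "\<And>s. DERIV k s :> k' s" "\<And>s. DERIV k' s :> k'' s"
  and sk: "smooth k'" and ij: "i \<in> Basis" "j \<in> Basis"
 shows "pd [i, j] (\<lambda>x. P x * k (x \<bullet> x)) x = pd [i, j] P x * k (x \<bullet> x)
   + 2 * ((x \<bullet> i) * pd [j] P x + (x \<bullet> j) * pd [i] P x + (i \<bullet> j) * P x) * k' (x \<bullet> x)
   + 4 * (x \<bullet> i) * (x \<bullet> j) * P x * k'' (x \<bullet> x)"
proof -
 have e: "pd [j] (\<lambda>x. P x * k (x \<bullet> x)) = (\<lambda>x. pd [j] P x * k (x \<bullet> x) + (2 * (x \<bullet> j) * P x) * k' (x \<bullet> x))"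
  by (rule ext) (rule pd_radial[OF P k(1)])
 have sj: "smooth (pd [j] P)" by (rule smooth_pd[OF P ij(2)])
 have sP: "smooth (\<lambda>x. 2 * (x \<bullet> j) * P x)" by (intro smooth_mult smooth_const smooth_inner P)
 have kd: "k differentiable at s" for s using k(1) real_differentiable_def by blast
 have d1: "(\<lambda>x. pd [j] P x * k (x \<bullet> x)) differentiable (at x)"
  by (intro differentiable_mult smooth_differentiable[OF sj] differentiable_compose[of k "\<lambda>x. x \<bullet> x" x UNIV, simplified]
    kd smooth_differentiable[OF smooth_norm2])
 have d2: "(\<lambda>x. (2 * (x \<bullet> j) * P x) * k' (x \<bullet> x)) differentiable (at x)"
  by (intro smooth_differentiable smooth_mult sP smooth_compose[OF sk smooth_norm2])
 have p: "pd [i] (\<lambda>x. 2 * (x \<bullet> j) * P x) x = 2 * (x \<bullet> j) * pd [i] P x + 2 * (i \<bullet> j) * P x"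
 proof -
  have d3: "(\<lambda>x. x \<bullet> j) differentiable (at x)" by (rule smooth_differentiable[OF smooth_inner])
  have d4: "(\<lambda>x. 2 * (x \<bullet> j)) differentiable (at x)" by (rule smooth_differentiable[OF smooth_cmult[OF smooth_inner]])
  have "pd [i] (\<lambda>x. 2 * (x \<bullet> j)) x = 2 * (i \<bullet> j)"
   by (rule pd_eqI) (auto intro!: derivative_eq_intros)
  thus ?thesis using pd_mult[OF d4 smooth_differentiable[OF P]] by simp
 qed
 show ?thesis
  unfolding pd_two e pd_add[OF d1 d2] pd_radial[OF sj k(1)] pd_radial[OF sP k(2)] p
  by (simp add: algebra_simps)
qed

lemma sum_Basis_inner_square: "(\<Sum>i\<in>Basis. (x \<bullet> i) * (x \<bullet> i)) = x \<bullet> (x::'a::euclidean_space)"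
 by (rule euclidean_inner[symmetric])

lemma laplacian_radial:
 fixes P :: "'a::euclidean_space => real"
 assumes P: "smooth P" and k: "\<And>s. DERIV k s :> k' s" "\<And>s. DERIV k' s :> k'' s"
  and sk: "smooth k'"
 shows "laplacian (\<lambda>x. P x * k (x \<bullet> x)) x = laplacian P x * k (x \<bullet> x)
   + (4 * (\<Sum>i\<in>Basis. (x \<bullet> i) * pd [i] P x) + 2 * real DIM('a) * P x) * k' (x \<bullet> x)
   + 4 * (x \<bullet> x) * P x * k'' (x \<bullet> x)"
proof -
 have "laplacian (\<lambda>x. P x * k (x \<bullet> x)) x = (\<Sum>i\<in>Basis. pd [i, i] P x * k (x \<bullet> x)
   + (4 * k' (x \<bullet> x)) * ((x \<bullet> i) * pd [i] P x) + 2 * P x * k' (x \<bullet> x)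
   + (4 * P x * k'' (x \<bullet> x)) * ((x \<bullet> i) * (x \<bullet> i)))"
  unfolding laplacian_def
  by (intro sum.cong refl, subst pd2_radial[OF P k sk]) (auto simp: algebra_simps)
 also have "\<dots> = (\<Sum>i\<in>Basis. pd [i, i] P x) * k (x \<bullet> x)
   + (4 * k' (x \<bullet> x)) * (\<Sum>i\<in>Basis. (x \<bullet> i) * pd [i] P x) + real DIM('a) * (2 * P x * k' (x \<bullet> x))
   + (4 * P x * k'' (x \<bullet> x)) * (\<Sum>i\<in>Basis. (x \<bullet> i) * (x \<bullet> i))"
  by (simp add: sum.distrib sum_distrib_left sum_distrib_right)
 finally show ?thesis unfolding sum_Basis_inner_square by (simp add: laplacian_def algebra_simps)
qed

lemma laplacian_add:
 assumes "smooth f" "smooth g"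
 shows "laplacian (\<lambda>x. f x + g x) x = laplacian f x + laplacian g x"
proof -
 have "pd [i, i] (\<lambda>x. f x + g x) x = pd [i, i] f x + pd [i, i] g x" if i: "i \<in> Basis" for i
 proof -
  have "pd [i] (\<lambda>x. f x + g x) = (\<lambda>x. pd [i] f x + pd [i] g x)"
   by (intro ext pd_add smooth_differentiable assms)
  thus ?thesis unfolding pd_two by (simp add: pd_add smooth_differentiable smooth_pd assms i)
 qed
 thus ?thesis by (simp add: laplacian_def sum.distrib)
qed

lemma pd_cmult: "smooth f ==> pd [i] (\<lambda>x. c * f x) = (\<lambda>x. c * pd [i] f x)"
 using pd_mult[of "\<lambda>_. c" _ f i] by (intro ext) (simp add: smooth_differentiable pd_const)

lemma laplacian_cmult:
 assumes "smooth f"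
 shows "laplacian (\<lambda>x. c * f x) x = c * laplacian f x"
 unfolding laplacian_def sum_distrib_left pd_two
 by (intro sum.cong refl) (simp add: pd_cmult assms smooth_pd)

lemma smooth_laplacian: "smooth f ==> smooth (laplacian f)"
 unfolding laplacian_def[abs_def] pd_two by (intro smooth_sum smooth_pd)

section \<open>Homogeneous polynomials and harmonic projection\<close>

text \<open>Homogeneous polynomials as functions, generated without coefficients or normal forms.
  The degree is an upper layer of bookkeeping: the zero function has every degree.\<close>

inductive hpoly :: "nat => ('a::euclidean_space => real) => bool" where
 const: "hpoly 0 (\<lambda>x. c)"
| mult: "hpoly d f ==> i \<in> Basis ==> hpoly (Suc d) (\<lambda>x. (x \<bullet> i) * f x)"
| add: "hpoly d f ==> hpoly d g ==> hpoly d (\<lambda>x. f x + g x)"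

lemma hpoly_zero: "hpoly d (\<lambda>x::'a::euclidean_space. 0)"
proof (induction d)
 case (Suc d)
 obtain i :: 'a where "i \<in> Basis" using nonempty_Basis by blast
 from hpoly.mult[OF Suc this] show ?case by simp
qed (rule hpoly.const)

lemma hpoly_cmult: "hpoly d f ==> hpoly d (\<lambda>x. c * f x)"
proof (induction rule: hpoly.induct)
 case (const c')
 show ?case by (rule hpoly.const)
next
 case (mult d f i)
 from hpoly.mult[OF mult.IH mult.hyps(2)] show ?case by (simp add: mult.left_commute)
next
 case (add d f g)
 from hpoly.add[OF add.IH] show ?case by (simp add: distrib_left)
qed

lemma hpoly_diff: "hpoly d f ==> hpoly d g ==> hpoly d (\<lambda>x. f x - g x)"
 using hpoly.add[OF _ hpoly_cmult[of d g "-1"]] by simp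

lemma hpoly_sum: "(\<And>i. i \<in> I ==> hpoly d (f i)) ==> hpoly d (\<lambda>x. \<Sum>i\<in>I. f i x)"
 by (induction I rule: infinite_finite_induct) (auto intro: hpoly_zero hpoly.add)

lemma hpoly_smooth: "hpoly d f ==> smooth f"
 by (induction rule: hpoly.induct) auto

lemma hpoly_homogeneous: "hpoly d f ==> f (t *\<^sub>R x) = t ^ d * f x"
 by (induction rule: hpoly.induct) (auto simp: algebra_simps)

lemma pd_inner_mult: "smooth f ==> pd [i] (\<lambda>x. (x \<bullet> j) * f x) = (\<lambda>x. (x \<bullet> j) * pd [i] f x + (i \<bullet> j) * f x)"
 by (intro ext, subst pd_mult) (auto simp: pd_inner intro!: smooth_differentiable)

lemma pd_plus: "smooth f ==> smooth g ==> pd [i] (\<lambda>x. f x + g x) = (\<lambda>x. pd [i] f x + pd [i] g x)"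
 by (intro ext pd_add smooth_differentiable)

lemma hpoly_pd:
 assumes "hpoly d f"
 shows "hpoly (d - 1) (pd [i] f)" "d = 0 ==> pd [i] f = (\<lambda>x. 0)"
proof -
 have "hpoly (d - 1) (pd [i] f) \<and> (d = 0 --> pd [i] f = (\<lambda>x. 0))"
  using assms
 proof (induction rule: hpoly.induct)
  case (const c)
  show ?case unfolding pd_const by (simp add: hpoly_zero)
 next
  case (mult d f j)
  have s: "smooth f" by (rule hpoly_smooth[OF mult.hyps(1)])
  have "hpoly d (\<lambda>x. (x \<bullet> j) * pd [i] f x)"
  proof (cases d)
   case 0
   thus ?thesis using mult.IH by (simp add: hpoly_zero)
  next
   case (Suc d')
   thus ?thesis using hpoly.mult[of d' "pd [i] f" j] mult by simp
  qed
  from hpoly.add[OF this hpoly_cmult[OF mult.hyps(1), of "i \<bullet> j"]]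
  show ?case unfolding pd_inner_mult[OF s] by simp
 next
  case (add d f g)
  thus ?case unfolding pd_plus[OF hpoly_smooth[OF add.hyps(1)] hpoly_smooth[OF add.hyps(2)]]
   by (auto intro: hpoly.add)
 qed
 thus "hpoly (d - 1) (pd [i] f)" "d = 0 ==> pd [i] f = (\<lambda>x. 0)" by auto
qed

lemma hpoly_euler: "hpoly d f ==> (\<Sum>i\<in>Basis. (x \<bullet> i) * pd [i] f x) = real d * f (x::'a::euclidean_space)"
proof (induction rule: hpoly.induct)
 case (const c)
 show ?case unfolding pd_const by simp
next
 case (mult d f j)
 have "(\<Sum>i\<in>Basis. (x \<bullet> i) * pd [i] (\<lambda>x. (x \<bullet> j) * f x) x)
   = (x \<bullet> j) * (\<Sum>i\<in>Basis. (x \<bullet> i) * pd [i] f x) + f x * (\<Sum>i\<in>Basis. (x \<bullet> i) * (j \<bullet> i))"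
  unfolding pd_inner_mult[OF hpoly_smooth[OF mult.hyps(1)]]
  by (simp add: sum_distrib_left sum.distrib[symmetric] algebra_simps inner_commute)
 also have "(\<Sum>i\<in>Basis. (x \<bullet> i) * (j \<bullet> i)) = x \<bullet> j" by (rule euclidean_inner[symmetric])
 finally show ?case using mult.IH by (simp add: algebra_simps)
next
 case (add d f g)
 thus ?case unfolding pd_plus[OF hpoly_smooth[OF add.hyps(1)] hpoly_smooth[OF add.hyps(2)]]
  by (simp add: sum.distrib algebra_simps)
qed

text \<open>Needed because two integrations by parts reverse the order of the indices, whereas
  \<open>H02\<close> compares with derivatives in the original order.\<close>

lemma hpoly_pd_commute:
 assumes "hpoly d f" "i \<in> Basis" "j \<in> Basis"
 shows "pd [i, j] f = pd [j, i] f"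
 using assms(1)
proof (induction rule: hpoly.induct)
 case (const c)
 show ?case by (simp add: pd_two pd_const)
next
 case (mult d f k)
 have s: "smooth f" by (rule hpoly_smooth[OF mult.hyps(1)])
 have "pd [a, b] (\<lambda>x. (x \<bullet> k) * f x) = (\<lambda>x. ((x \<bullet> k) * pd [a, b] f x + (a \<bullet> k) * pd [b] f x) + (b \<bullet> k) * pd [a] f x)"
  if "a \<in> Basis" "b \<in> Basis" for a b
  unfolding pd_two pd_inner_mult[OF s]
  by (subst pd_plus) (auto simp: pd_inner_mult[OF smooth_pd[OF s that(2)]] pd_cmult[OF s] intro!: smooth_pd s that)
 from this[of i j] this[of j i] show ?case using mult.IH assms by (simp add: add_ac)
next
 case (add d f g)
 have s: "smooth f" "smooth g" using add.hyps hpoly_smooth by blast+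
 have "pd [a, b] (\<lambda>x. f x + g x) = (\<lambda>x. pd [a, b] f x + pd [a, b] g x)" if "a \<in> Basis" "b \<in> Basis" for a b
  unfolding pd_two pd_plus[OF s] by (rule pd_plus) (intro smooth_pd s that)+
 thus ?case using add.IH assms by simp
qed

lemma hpoly_laplacian:
 assumes "hpoly d f" shows "hpoly (d - 2) (laplacian f)" "d < 2 ==> laplacian f = (\<lambda>x. 0)"
proof -
 have "hpoly (d - 1 - 1) (pd [i, i] f)" for i unfolding pd_two by (intro hpoly_pd assms)
 thus "hpoly (d - 2) (laplacian f)" unfolding laplacian_def[abs_def]
  by (intro hpoly_sum) (simp add: numeral_2_eq_2)
 have "pd [i, i] f = (\<lambda>x. 0)" if "d < 2" for i
  unfolding pd_two using hpoly_pd(2)[OF hpoly_pd(1)[OF assms]] that by simp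
 thus "d < 2 ==> laplacian f = (\<lambda>x. 0)" by (simp add: laplacian_def fun_eq_iff)
qed

lemma hpoly_norm2:
 assumes "hpoly d f" shows "hpoly (d + 2) (\<lambda>x. (x \<bullet> x) * f x)"
proof -
 have "hpoly (Suc (Suc d)) (\<lambda>x. \<Sum>i\<in>Basis. (x \<bullet> i) * ((x \<bullet> i) * f x))"
  by (intro hpoly_sum hpoly.mult assms)
 moreover have "(\<lambda>x. \<Sum>i\<in>Basis. (x \<bullet> i) * ((x \<bullet> i) * f x)) = (\<lambda>x. (x \<bullet> x) * f x)"
  by (rule ext) (simp add: sum_Basis_inner_square[symmetric] sum_distrib_right mult.assoc)
 ultimately show ?thesis by simp
qed

lemma laplacian_norm2:
 fixes f :: "'a::euclidean_space => real"
 assumes f: "hpoly d f"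
 shows "laplacian (\<lambda>x. (x \<bullet> x) * f x) x = (2 * real DIM('a) + 4 * real d) * f x + (x \<bullet> x) * laplacian f x"
proof -
 have "laplacian (\<lambda>x. f x * (x \<bullet> x)) x = laplacian f x * (x \<bullet> x) + (4 * (\<Sum>i\<in>Basis. (x \<bullet> i) * pd [i] f x) + 2 * real DIM('a) * f x) * 1
   + 4 * (x \<bullet> x) * f x * 0"
  by (rule laplacian_radial[OF hpoly_smooth[OF f], of "\<lambda>s. s" "\<lambda>_. 1" "\<lambda>_. 0"]) auto
 thus ?thesis unfolding hpoly_euler[OF f] by (simp add: algebra_simps)
qed

text \<open>The equation is c' R + |x|^2 \<Delta>R = g. Applying \<Delta> gives c' S +
  \<Delta>(|x|^2 S) = \<Delta>g for S = \<Delta>R: the same equation two degrees lower with c' in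
  place of c, which is why c is carried along. Solving for S first, R is (g - |x|^2 S) / c'.\<close>

lemma laplacian_norm2_surj:
 fixes g :: "'a::euclidean_space => real"
 assumes "hpoly d g" "c \<ge> 0"
 shows "\<exists>R. hpoly d R \<and> (\<forall>x. c * R x + laplacian (\<lambda>x. (x \<bullet> x) * R x) x = g x)"
 using assms
proof (induction d arbitrary: g c rule: less_induct)
 case (less d)
 define c' where "c' = c + 2 * real DIM('a) + 4 * real d"
 have c': "c' > 0" using less.prems(2) DIM_positive[where 'a='a] unfolding c'_def by linarith
 have key: "c * R x + laplacian (\<lambda>x. (x \<bullet> x) * R x) x = c' * R x + (x \<bullet> x) * laplacian R x" if "hpoly d R" for R :: "'a => real" and x
  unfolding laplacian_norm2[OF that] c'_def by (simp add: algebra_simps)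
 show ?case
 proof (cases "d < 2")
  case True
  define R where "R x = 1 / c' * g x" for x
  have R: "hpoly d R" unfolding R_def by (rule hpoly_cmult[OF less.prems(1)])
  hence "c * R x + laplacian (\<lambda>x. (x \<bullet> x) * R x) x = g x" for x
   unfolding key[OF R] hpoly_laplacian(2)[OF R True] using c' by (simp add: R_def)
  thus ?thesis using R by blast
 next
  case False
  hence d2: "d - 2 < d" "d = d - 2 + 2" by auto
  obtain S where S: "hpoly (d - 2) S" "\<And>x. c' * S x + laplacian (\<lambda>x. (x \<bullet> x) * S x) x = laplacian g x"
   using less.IH[OF d2(1) hpoly_laplacian(1)[OF less.prems(1)] less_imp_le[OF c']] by blast
  have hS: "hpoly d (\<lambda>x. (x \<bullet> x) * S x)" using hpoly_norm2[OF S(1)] d2(2) by simp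
  define R where "R x = 1 / c' * (g x - (x \<bullet> x) * S x)" for x
  have R: "hpoly d R" unfolding R_def by (intro hpoly_cmult hpoly_diff less.prems(1) hS)
  have lapR: "laplacian R x = 1 / c' * (laplacian g x - laplacian (\<lambda>x. (x \<bullet> x) * S x) x)" for x
  proof -
   have s: "smooth g" "smooth (\<lambda>x. (x \<bullet> x) * S x)" using less.prems(1) hS hpoly_smooth by blast+
   have "laplacian (\<lambda>x. g x + (-1) * ((x \<bullet> x) * S x)) x = laplacian g x + (-1) * laplacian (\<lambda>x. (x \<bullet> x) * S x) x"
    by (subst laplacian_add[OF s(1) smooth_cmult[OF s(2)]]) (simp only: laplacian_cmult[OF s(2)])
   thus ?thesis unfolding R_def[abs_def] by (subst laplacian_cmult) (use s in auto)
  qed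
  hence "c * R x + laplacian (\<lambda>x. (x \<bullet> x) * R x) x = g x" for x
  proof -
   have "laplacian g x - laplacian (\<lambda>x. (x \<bullet> x) * S x) x = c' * S x" using S(2)[of x] by linarith
   hence "laplacian R x = S x" unfolding lapR using c' by simp
   thus ?thesis unfolding key[OF R] using c' by (simp add: R_def)
  qed
  thus ?thesis using R by blast
 qed
qed

text \<open>One step of the Fischer decomposition: solving \<Delta>(|x|^2 R) = \<Delta>f, the case c
  = 0 of the previous equation, leaves a harmonic remainder.\<close>

lemma harmonic_projection:
 fixes f :: "'a::euclidean_space => real"
 assumes f: "hpoly d f"
 shows "\<exists>H R. hpoly d H \<and> laplacian H = (\<lambda>x. 0) \<and> hpoly (d - 2) R \<and> (d < 2 --> R = (\<lambda>x. 0)) \<and> (\<forall>x. f x = H x + (x \<bullet> x) * R x)"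
proof (cases "d < 2")
 case True
 thus ?thesis using f hpoly_laplacian(2)[OF f] hpoly_zero by (intro exI[of _ f] exI[of _ "\<lambda>x. 0"]) auto
next
 case False
 obtain R where R: "hpoly (d - 2) R" "\<And>x. 0 * R x + laplacian (\<lambda>x. (x \<bullet> x) * R x) x = laplacian f x"
  using laplacian_norm2_surj[OF hpoly_laplacian(1)[OF f], of 0] by auto
 have hR: "hpoly d (\<lambda>x. (x \<bullet> x) * R x)"
 proof -
  have "d - 2 + 2 = d" using False by simp
  thus ?thesis using hpoly_norm2[OF R(1)] by metis
 qed
 define H where "H x = f x + (-1) * ((x \<bullet> x) * R x)" for x
 have H: "hpoly d H" unfolding H_def by (intro hpoly.add f hpoly_cmult hR)
 have s: "smooth f" "smooth (\<lambda>x. (x \<bullet> x) * R x)" using f hR hpoly_smooth by blast+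
 have "laplacian H x = 0" for x
  unfolding H_def[abs_def] using R(2)[of x]
  by (subst laplacian_add[OF s(1) smooth_cmult[OF s(2)]]) (simp only: laplacian_cmult[OF s(2)])
 thus ?thesis using H R(1) False by (intro exI[of _ H] exI[of _ R]) (auto simp: H_def fun_eq_iff)
qed

section \<open>A basis of the harmonic polynomials and its size\<close>

definition mpow :: "('a::euclidean_space => nat) => 'a => real" where
 "mpow \<alpha> x = (\<Prod>i\<in>Basis. (x \<bullet> i) ^ \<alpha> i)"

definition mdeg :: "('a::euclidean_space => nat) => nat" where
 "mdeg \<alpha> = (\<Sum>i\<in>Basis. \<alpha> i)"

definition e0 :: "'a::euclidean_space" where "e0 = (SOME i. i \<in> Basis)"

lemma e0_Basis [simp]: "e0 \<in> Basis"
 unfolding e0_def using nonempty_Basis some_in_eq by blast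

lemma hpoly_power_mult: "hpoly d f ==> i \<in> Basis ==> hpoly (d + k) (\<lambda>x. (x \<bullet> i) ^ k * f x)"
proof (induction k)
 case (Suc k)
 from hpoly.mult[OF Suc.IH[OF Suc.prems] Suc.prems(2)] show ?case by (simp add: mult.assoc)
qed simp

lemma hpoly_mpow: "hpoly (mdeg \<alpha>) (mpow \<alpha>)"
proof -
 have "hpoly (\<Sum>i\<in>A. \<alpha> i) (\<lambda>x. \<Prod>i\<in>A. (x \<bullet> i) ^ \<alpha> i)" if "finite A" "A \<subseteq> Basis" for A :: "'a set"
  using that
 proof (induction A rule: finite_induct)
  case empty
  thus ?case using hpoly.const[of 1] by simp
 next
  case (insert i A)
  hence "hpoly (sum \<alpha> A + \<alpha> i) (\<lambda>x. (x \<bullet> i) ^ \<alpha> i * (\<Prod>i\<in>A. (x \<bullet> i) ^ \<alpha> i))"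
   by (intro hpoly_power_mult) auto
  thus ?case using insert by (simp add: add.commute)
 qed
 thus ?thesis unfolding mdeg_def mpow_def[abs_def] by simp
qed

lemma mpow_mult: "i \<in> Basis ==> (x \<bullet> i) ^ k * mpow \<alpha> x = mpow (\<alpha>(i := \<alpha> i + k)) x"
 unfolding mpow_def by (simp add: prod.remove[of Basis i] power_add mult_ac)

lemma mdeg_upd: "i \<in> Basis ==> mdeg (\<alpha>(i := \<alpha> i + k)) = mdeg \<alpha> + k"
 unfolding mdeg_def by (simp add: sum.remove[of Basis i])

lemma hpoly_mpow_induct:
 assumes "hpoly d f" "\<And>\<alpha>. mdeg \<alpha> = d ==> Q (mpow \<alpha>)" "\<And>f g. Q f ==> Q g ==> Q (\<lambda>x. f x + g x)"
  "\<And>c f. Q f ==> Q (\<lambda>x. c * f x)"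
 shows "Q f"
 using assms
proof (induction arbitrary: Q rule: hpoly.induct)
 case (const c)
 have "Q (mpow (\<lambda>_. 0))" by (rule const(1)) (simp add: mdeg_def)
 hence "Q (\<lambda>x. c * mpow (\<lambda>_. 0) x)" by (rule const(3))
 thus ?case by (simp add: mpow_def)
next
 case (mult d f i)
 show ?case
 proof (rule mult.IH[of "\<lambda>f. Q (\<lambda>x. (x \<bullet> i) * f x)"])
  fix \<alpha> :: "'a => nat" assume "mdeg \<alpha> = d"
  hence "Q (mpow (\<alpha>(i := \<alpha> i + 1)))" by (intro mult.prems(1)) (simp only: mdeg_upd[OF mult.hyps(2)] Suc_eq_plus1)
  moreover have "mpow (\<alpha>(i := \<alpha> i + 1)) = (\<lambda>x. (x \<bullet> i) * mpow \<alpha> x)"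
   using mpow_mult[OF mult.hyps(2), of _ 1 \<alpha>] by (intro ext) simp
  ultimately show "Q (\<lambda>x. (x \<bullet> i) * mpow \<alpha> x)" by simp
 next
  fix f g assume "Q (\<lambda>x. (x \<bullet> i) * f x)" "Q (\<lambda>x. (x \<bullet> i) * g x)"
  from mult.prems(2)[OF this] show "Q (\<lambda>x. (x \<bullet> i) * (f x + g x))" by (simp add: distrib_left)
 next
  fix c f assume "Q (\<lambda>x. (x \<bullet> i) * f x)"
  from mult.prems(3)[OF this, of c] show "Q (\<lambda>x. (x \<bullet> i) * (c * f x))" by (simp add: mult.left_commute)
 qed
next
 case (add d f g)
 show ?case using add.IH[of Q] add.prems by blast
qed

text \<open>Modulo \<open>|x|\<^sup>2\<close>, the square of one fixed coordinate can be eliminated, so the monomials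
 of degree at most 1 in that coordinate represent a basis of the harmonic polynomials.\<close>

definition hidx :: "nat => ('a::euclidean_space => nat) set" where
 "hidx l = {\<alpha>. (\<forall>i. i \<notin> Basis --> \<alpha> i = 0) \<and> mdeg \<alpha> = l \<and> \<alpha> e0 \<le> 1}"

text \<open>The harmonic representative of a monomial modulo |x|^2. The quotient \<open>R\<close> is
  kept inside the choice since spanning and independence both compare \<open>hbasis\<close> with the
  monomial itself.\<close>

definition hbasis :: "('a::euclidean_space => nat) => 'a => real" where
 "hbasis \<alpha> = (SOME H. \<exists>R. hpoly (mdeg \<alpha>) H \<and> laplacian H = (\<lambda>x. 0) \<and> hpoly (mdeg \<alpha> - 2) R
   \<and> (mdeg \<alpha> < 2 --> R = (\<lambda>x. 0)) \<and> (\<forall>x. mpow \<alpha> x = H x + (x \<bullet> x) * R x))"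

lemma hbasis_spec:
 "\<exists>R. hpoly (mdeg \<alpha>) (hbasis \<alpha>) \<and> laplacian (hbasis \<alpha>) = (\<lambda>x. 0) \<and> hpoly (mdeg \<alpha> - 2) R
   \<and> (mdeg \<alpha> < 2 --> R = (\<lambda>x. 0)) \<and> (\<forall>x. mpow \<alpha> x = hbasis \<alpha> x + (x \<bullet> x) * R x)"
 using someI_ex[OF harmonic_projection[OF hpoly_mpow[of \<alpha>]]] unfolding hbasis_def[symmetric] .

lemma hbasis_hpoly: "hpoly (mdeg \<alpha>) (hbasis \<alpha>)" and hbasis_harmonic: "laplacian (hbasis \<alpha>) = (\<lambda>x. 0)"
 using hbasis_spec by blast+

lemma mpow_cong: "(\<And>i. i \<in> Basis ==> \<alpha> i = \<beta> i) ==> mpow \<alpha> = mpow \<beta>"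
 unfolding mpow_def by (intro ext prod.cong) auto

text \<open>Spanning, put as an induction principle so that it can be applied to vanishing of
  pairings. Outer induction on the degree handles the quotients by |x|^2, inner induction on the
  exponent of the distinguished coordinate reduces to monomials indexed by
  \<open>hidx\<close>.\<close>

lemma hbasis_span:
 fixes Q :: "('a::euclidean_space => real) => bool"
 assumes add: "\<And>f g. Q f ==> Q g ==> Q (\<lambda>x. f x + g x)"
  and cm: "\<And>c f. Q f ==> Q (\<lambda>x. c * f x)"
  and nm: "\<And>f. Q f ==> Q (\<lambda>x. (x \<bullet> x) * f x)"
  and hm: "\<And>l \<alpha>. \<alpha> \<in> hidx l ==> Q (hbasis \<alpha>)"
 shows "hpoly d f ==> Q f"
proof (induction d arbitrary: f rule: less_induct)
 case (less d)
 have Q0: "Q (\<lambda>x. 0)"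
 proof -
  have "(\<lambda>_. 0 :: nat) \<in> hidx 0" by (simp add: hidx_def mdeg_def)
  from cm[OF hm[OF this], of 0] show ?thesis by simp
 qed
 have Qsum: "Q (\<lambda>x. \<Sum>i\<in>I. g i x)" if "finite I" "\<And>i. i \<in> I ==> Q (g i)" for I :: "'a set" and g
  using that by (induction I rule: finite_induct) (auto intro: Q0 add)
 have Qm: "Q (mpow \<beta>)" if "mdeg \<beta> = d" for \<beta>
  using that
 proof (induction "\<beta> e0" arbitrary: \<beta> rule: less_induct)
  case (less \<beta>)
  note inner = this
  show ?case
  proof (cases "\<beta> e0 \<le> 1")
   case True
   define \<alpha> where "\<alpha> i = (if i \<in> Basis then \<beta> i else 0)" for i
   have eq: "mpow \<beta> = mpow \<alpha>" by (rule mpow_cong) (simp add: \<alpha>_def)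
   have deg: "mdeg \<alpha> = d" using inner(2) by (simp add: mdeg_def \<alpha>_def)
   have "\<alpha> \<in> hidx d" using True deg by (simp add: hidx_def \<alpha>_def)
   hence Qh: "Q (hbasis \<alpha>)" by (rule hm)
   obtain R where R: "hpoly (d - 2) R" "d < 2 ==> R = (\<lambda>x. 0)" "\<And>x. mpow \<alpha> x = hbasis \<alpha> x + (x \<bullet> x) * R x"
    using hbasis_spec[of \<alpha>] deg by auto
   have "Q R" using R less.IH[of "d - 2" R] Q0 by (cases "d < 2") auto
   hence "Q (\<lambda>x. hbasis \<alpha> x + (x \<bullet> x) * R x)" by (intro add Qh nm)
   moreover have "mpow \<alpha> = (\<lambda>x. hbasis \<alpha> x + (x \<bullet> x) * R x)" by (rule ext) (rule R(3))
   ultimately show ?thesis unfolding eq by simp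
  next
   case False
   \<comment> \<open>Two factors of the distinguished coordinate are traded by x0^2 = |x|^2 minus
     the sum of the other squares: one term has a factor |x|^2 and lower degree, the others have a
     smaller exponent of that coordinate.\<close>
   define \<gamma> where "\<gamma> = \<beta>(e0 := \<beta> e0 - 2)"
   have ge0: "\<gamma> e0 = \<beta> e0 - 2" by (simp add: \<gamma>_def)
   have b: "\<beta> = \<gamma>(e0 := \<gamma> e0 + 2)" using False by (auto simp: \<gamma>_def fun_eq_iff)
   have deg: "mdeg \<gamma> + 2 = d" using mdeg_upd[of e0 \<gamma> 2] inner(2) unfolding b[symmetric] by simp
   have Qg: "Q (mpow \<gamma>)" by (rule less.IH[OF _ hpoly_mpow]) (use deg in simp)
   have Qi: "Q (mpow (\<gamma>(i := \<gamma> i + 2)))" if i: "i \<in> Basis - {e0}" for i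
   proof (rule inner(1))
    show "(\<gamma>(i := \<gamma> i + 2)) e0 < \<beta> e0" using i False by (auto simp: ge0)
    show "mdeg (\<gamma>(i := \<gamma> i + 2)) = d" using mdeg_upd[of i \<gamma> 2] i deg by (simp del: add_2_eq_Suc')
   qed
   have e: "mpow \<beta> x = (x \<bullet> x) * mpow \<gamma> x + (-1) * (\<Sum>i\<in>Basis - {e0}. mpow (\<gamma>(i := \<gamma> i + 2)) x)" for x
   proof -
    have "(x \<bullet> x) = (x \<bullet> e0) ^ 2 + (\<Sum>i\<in>Basis - {e0}. (x \<bullet> i) ^ 2)"
     using sum.remove[of Basis "e0 :: 'a" "\<lambda>i. (x \<bullet> i) * (x \<bullet> i)"] sum_Basis_inner_square[of x]
     by (simp add: power2_eq_square)
    moreover have "mpow \<beta> x = (x \<bullet> e0) ^ 2 * mpow \<gamma> x"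
     by (subst b) (rule mpow_mult[OF e0_Basis, symmetric])
    moreover have "(\<Sum>i\<in>Basis - {e0}. mpow (\<gamma>(i := \<gamma> i + 2)) x) = (\<Sum>i\<in>Basis - {e0}. (x \<bullet> i) ^ 2) * mpow \<gamma> x"
     unfolding sum_distrib_right by (intro sum.cong refl mpow_mult[symmetric]) simp
    ultimately show ?thesis by (simp add: algebra_simps)
   qed
   have "Q (\<lambda>x. (x \<bullet> x) * mpow \<gamma> x + (-1) * (\<Sum>i\<in>Basis - {e0}. mpow (\<gamma>(i := \<gamma> i + 2)) x))"
    by (intro add nm cm Qsum Qg Qi) auto
   moreover have "mpow \<beta> = (\<lambda>x. (x \<bullet> x) * mpow \<gamma> x + (-1) * (\<Sum>i\<in>Basis - {e0}. mpow (\<gamma>(i := \<gamma> i + 2)) x))"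
    by (rule ext) (rule e)
   ultimately show ?thesis by simp
  qed
 qed
 show ?case by (rule hpoly_mpow_induct[OF less.prems, of Q]) (use Qm add cm in auto)
qed

text \<open>Varying a single coordinate gives a polynomial in \<open>t\<close> that vanishes
  identically, so each of its coefficients, a polynomial in the remaining coordinates, vanishes;
  induction on the number of coordinates.\<close>

lemma monomials_independent:
 fixes c :: "('i => nat) => real"
 assumes "finite A" "finite F" "\<And>\<alpha> i. \<alpha> \<in> F ==> i \<notin> A ==> \<alpha> i = 0"
  and "\<And>x. (\<Sum>\<alpha>\<in>F. c \<alpha> * (\<Prod>i\<in>A. x i ^ \<alpha> i)) = 0"
 shows "\<forall>\<alpha>\<in>F. c \<alpha> = 0"
 using assms
proof (induction A arbitrary: F c rule: finite_induct)
 case empty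
 show ?case
 proof
  fix \<alpha> assume a: "\<alpha> \<in> F"
  have "F = {\<alpha>}"
   using a empty.prems(2) by (auto simp: fun_eq_iff) (metis ext)+
  thus "c \<alpha> = 0" using empty.prems(3)[of "\<lambda>_. 0"] by simp
 qed
next
 case (insert a A)
 show ?case
 proof
  fix \<alpha>0 assume a0: "\<alpha>0 \<in> F"
  define k where "k = \<alpha>0 a"
  define Fk where "Fk j = {\<alpha>\<in>F. \<alpha> a = j}" for j
  define M where "M \<alpha> x = (\<Prod>i\<in>A. x i ^ \<alpha> i)" for \<alpha> :: "'i => nat" and x :: "'i => real"
  define S where "S x j = (\<Sum>\<alpha>\<in>Fk j. c \<alpha> * M \<alpha> x)" for x j
  define n where "n = Max ((\<lambda>\<alpha>. \<alpha> a) ` F)"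
  have n: "\<alpha> a \<le> n" if "\<alpha> \<in> F" for \<alpha> unfolding n_def using insert.prems(1) that by (intro Max_ge) auto
  have Sx: "(\<Sum>j\<le>n. S x j * t ^ j) = 0" for x t
  proof -
   have Mt: "M \<alpha> (x(a := t)) = M \<alpha> x" for \<alpha>
    unfolding M_def by (intro prod.cong refl) (use insert.hyps in auto)
   have "0 = (\<Sum>\<alpha>\<in>F. c \<alpha> * (\<Prod>i\<in>insert a A. (x(a := t)) i ^ \<alpha> i))" using insert.prems(3) by simp
   also have "\<dots> = (\<Sum>\<alpha>\<in>F. c \<alpha> * M \<alpha> x * t ^ \<alpha> a)"
   proof (intro sum.cong refl)
    fix \<alpha>
    have "(\<Prod>i\<in>insert a A. (x(a := t)) i ^ \<alpha> i) = t ^ \<alpha> a * M \<alpha> (x(a := t))"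
     unfolding M_def by (subst prod.insert[OF insert.hyps]) simp
    thus "c \<alpha> * (\<Prod>i\<in>insert a A. (x(a := t)) i ^ \<alpha> i) = c \<alpha> * M \<alpha> x * t ^ \<alpha> a"
     by (simp only: Mt mult_ac)
   qed
   also have "\<dots> = (\<Sum>j\<le>n. \<Sum>\<alpha>\<in>Fk j. c \<alpha> * M \<alpha> x * t ^ \<alpha> a)"
    unfolding Fk_def by (rule sum.group[symmetric]) (use insert.prems(1) n in auto)
   also have "\<dots> = (\<Sum>j\<le>n. S x j * t ^ j)"
    unfolding S_def sum_distrib_right by (intro sum.cong refl) (auto simp: Fk_def)
   finally show ?thesis by simp
  qed
  have S0: "S x k = 0" for x
   using polyfun_eq_0[of "S x" n] Sx[of x] n[OF a0] unfolding k_def by blast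
  define \<pi> where "\<pi> \<alpha> = \<alpha>(a := 0 :: nat)" for \<alpha> :: "'i => nat"
  define c' where "c' \<beta> = c (\<beta>(a := k))" for \<beta>
  have inj: "inj_on \<pi> (Fk k)"
  proof (rule inj_onI)
   fix \<alpha> \<beta> assume ab: "\<alpha> \<in> Fk k" "\<beta> \<in> Fk k" "\<pi> \<alpha> = \<pi> \<beta>"
   hence "\<alpha> a = \<beta> a" by (simp add: Fk_def)
   thus "\<alpha> = \<beta>" using ab(3) unfolding \<pi>_def by (metis fun_upd_triv fun_upd_upd)
  qed
  have bk: "(\<pi> \<alpha>)(a := k) = \<alpha>" if "\<alpha> \<in> Fk k" for \<alpha> using that by (auto simp: \<pi>_def Fk_def)
  have "\<forall>\<beta>\<in>\<pi> ` Fk k. c' \<beta> = 0"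
  proof (rule insert.IH)
   show "finite (\<pi> ` Fk k)" using insert.prems(1) by (simp add: Fk_def)
   show "\<beta> i = 0" if "\<beta> \<in> \<pi> ` Fk k" "i \<notin> A" for \<beta> i
    using that insert.prems(2) by (auto simp: \<pi>_def Fk_def)
   fix x
   have "(\<Sum>\<beta>\<in>\<pi> ` Fk k. c' \<beta> * (\<Prod>i\<in>A. x i ^ \<beta> i)) = (\<Sum>\<alpha>\<in>Fk k. c' (\<pi> \<alpha>) * M (\<pi> \<alpha>) x)"
    by (simp add: sum.reindex[OF inj] M_def)
   also have "\<dots> = S x k" unfolding S_def
   proof (intro sum.cong refl)
    fix \<alpha> assume "\<alpha> \<in> Fk k"
    hence "c' (\<pi> \<alpha>) = c \<alpha>" by (simp add: c'_def bk)
    moreover have "M (\<pi> \<alpha>) x = M \<alpha> x" unfolding M_def by (intro prod.cong refl) (use insert.hyps in \<open>auto simp: \<pi>_def\<close>)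
    ultimately show "c' (\<pi> \<alpha>) * M (\<pi> \<alpha>) x = c \<alpha> * M \<alpha> x" by simp
   qed
   finally show "(\<Sum>\<beta>\<in>\<pi> ` Fk k. c' \<beta> * (\<Prod>i\<in>A. x i ^ \<beta> i)) = 0" using S0 by simp
  qed
  moreover have "\<alpha>0 \<in> Fk k" using a0 by (simp add: Fk_def k_def)
  ultimately have "c' (\<pi> \<alpha>0) = 0" by blast
  thus "c \<alpha>0 = 0" using bk[OF \<open>\<alpha>0 \<in> Fk k\<close>] by (simp add: c'_def)
 qed
qed

lemma hpoly_line: "hpoly d f ==> \<exists>p. \<forall>t. f (z + t *\<^sub>R v) = poly p t"
proof (induction rule: hpoly.induct)
 case (const c)
 show ?case by (rule exI[of _ "[:c:]"]) simp
next
 case (mult d f i)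
 then obtain p where "\<And>t. f (z + t *\<^sub>R v) = poly p t" by blast
 thus ?case by (intro exI[of _ "[:z \<bullet> i, v \<bullet> i:] * p"]) (simp add: algebra_simps inner_add_left)
next
 case (add d f g)
 then obtain p q where "\<And>t. f (z + t *\<^sub>R v) = poly p t" "\<And>t. g (z + t *\<^sub>R v) = poly q t" by blast
 thus ?case by (intro exI[of _ "p + q"]) simp
qed

definition le_idx :: "'i set => nat => ('i => nat) set" where
 "le_idx A L = {\<alpha>. (\<forall>i. i \<notin> A --> \<alpha> i = 0) \<and> sum \<alpha> A \<le> L}"

text \<open>Sorting by the exponent \<open>k\<close> of the new variable leaves multi-indices of
  size at most \<open>L - k\<close> in the others, and the hockey-stick identity sums the
  binomials.\<close>

lemma card_le_idx: "finite A ==> finite (le_idx A L) \<and> card (le_idx A L) = (card A + L) choose L"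
proof (induction A arbitrary: L rule: finite_induct)
 case empty
 have "le_idx ({} :: 'a set) L = {\<lambda>_. 0}" by (auto simp: le_idx_def)
 thus ?case by simp
next
 case (insert a A)
 define U where "U k = (\<lambda>\<alpha>. \<alpha>(a := k)) ` le_idx A (L - k)" for k
 have s: "sum (\<alpha>(a := k)) A = sum \<alpha> A" for \<alpha> :: "'a => nat" and k
  by (intro sum.cong refl) (use insert.hyps in auto)
 have eq: "le_idx (insert a A) L = (\<Union>k\<in>{..L}. U k)"
 proof (intro equalityI subsetI)
  fix \<alpha> assume al: "\<alpha> \<in> le_idx (insert a A) L"
  hence "\<alpha>(a := 0) \<in> le_idx A (L - \<alpha> a)" "\<alpha> a \<le> L"
   using insert.hyps unfolding le_idx_def mem_Collect_eq s by auto
  moreover have "\<alpha> = (\<alpha>(a := 0))(a := \<alpha> a)" by simp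
  ultimately show "\<alpha> \<in> (\<Union>k\<in>{..L}. U k)" unfolding U_def by blast
 next
  fix \<alpha> assume "\<alpha> \<in> (\<Union>k\<in>{..L}. U k)"
  then obtain k \<beta> where k: "k \<le> L" "\<beta> \<in> le_idx A (L - k)" "\<alpha> = \<beta>(a := k)" by (auto simp: U_def)
  hence "sum \<alpha> A = sum \<beta> A" "\<alpha> a = k" by (simp_all only: s fun_upd_same)
  thus "\<alpha> \<in> le_idx (insert a A) L" using insert.hyps k by (auto simp: le_idx_def)
 qed
 have inj: "inj_on (\<lambda>\<alpha>. \<alpha>(a := k)) (le_idx A m)" for k m
 proof (rule inj_onI)
  fix \<alpha> \<beta> assume ab: "\<alpha> \<in> le_idx A m" "\<beta> \<in> le_idx A m" "\<alpha>(a := k) = \<beta>(a := k)"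
  have "\<alpha> a = \<beta> a" using ab insert.hyps by (simp add: le_idx_def)
  thus "\<alpha> = \<beta>" using ab(3) by (metis fun_upd_triv fun_upd_upd)
 qed
 have fU: "finite (U k)" and cU: "card (U k) = (card A + (L - k)) choose (L - k)" for k
  unfolding U_def using insert.IH card_image[OF inj] by auto
 have "card (\<Union>k\<in>{..L}. U k) = (\<Sum>k\<le>L. card (U k))"
  by (rule card_UN_disjoint) (use fU in \<open>auto simp: U_def dest: fun_cong[of _ _ a]\<close>)
 also have "\<dots> = (\<Sum>k\<le>L. (card A + (L - k)) choose (L - k))" by (simp add: cU)
 also have "\<dots> = (\<Sum>k\<le>L. (card A + k) choose k)"
  by (rule sum.reindex_bij_witness[of _ "\<lambda>k. L - k" "\<lambda>k. L - k"]) auto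
 also have "\<dots> = Suc (card A + L) choose L" by (rule sum_choose_lower)
 finally show ?case using insert.hyps fU by (simp add: eq)
qed

lemma finite_hidx: "finite (hidx l :: ('a::euclidean_space => nat) set)"
proof (rule finite_subset)
 show "(hidx l :: ('a => nat) set) \<subseteq> le_idx Basis l" by (auto simp: hidx_def le_idx_def mdeg_def)
 show "finite (le_idx (Basis :: 'a set) l)" using card_le_idx[of "Basis :: 'a set"] by simp
qed

definition hdim :: "'a::euclidean_space itself => nat => nat" where
 "hdim _ l = card (hidx l :: ('a => nat) set)"

text \<open>Among all indices of degree up to \<open>Suc L\<close>, those with exponent 0 in the
  distinguished coordinate leave any multi-index in n - 1 variables of size at most
  \<open>Suc L\<close>, those with exponent 1 one of size at most \<open>L\<close>. Later estimates
  use only such cumulated dimensions.\<close>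

lemma sum_hdim:
 "(\<Sum>l\<le>Suc L. hdim TYPE('a::euclidean_space) l) = ((DIM('a) - 1 + Suc L) choose Suc L) + ((DIM('a) - 1 + L) choose L)"
proof -
 define A where "A = (Basis :: 'a set) - {e0}"
 have A: "finite A" "e0 \<notin> A" "insert e0 A = Basis" "card A = DIM('a) - 1"
  by (auto simp: A_def insert_absorb)
 have md: "mdeg \<alpha> = \<alpha> e0 + sum \<alpha> A" for \<alpha> :: "'a => nat"
  unfolding mdeg_def A(3)[symmetric] using A(1,2) by simp
 have s: "sum (\<alpha>(e0 := k)) A = sum \<alpha> A" for \<alpha> :: "'a => nat" and k
  by (intro sum.cong refl) (use A in auto)
 define U where "U = (\<lambda>\<alpha>::'a => nat. \<alpha>(e0 := 1)) ` le_idx A L"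
 have eq: "(\<Union>l\<in>{..Suc L}. hidx l) = le_idx A (Suc L) \<union> U"
 proof (intro equalityI subsetI)
  fix \<alpha> :: "'a => nat" assume "\<alpha> \<in> (\<Union>l\<in>{..Suc L}. hidx l)"
  hence al: "\<And>i. i \<notin> Basis ==> \<alpha> i = 0" "\<alpha> e0 + sum \<alpha> A \<le> Suc L" "\<alpha> e0 \<le> 1"
   by (auto simp: hidx_def md)
  show "\<alpha> \<in> le_idx A (Suc L) \<union> U"
  proof (cases "\<alpha> e0 = 0")
   case True
   have "\<alpha> i = 0" if "i \<notin> A" for i using that True al(1) A(3) by (cases "i = e0") auto
   thus ?thesis using al True by (simp add: le_idx_def)
  next
   case False
   hence a1: "\<alpha> e0 = 1" using al by simp
   have "\<alpha>(e0 := 0) \<in> le_idx A L"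
   proof -
    have "(\<alpha>(e0 := 0)) i = 0" if "i \<notin> A" for i using that al(1) A(3) by (cases "i = e0") auto
    thus ?thesis using al a1 by (simp add: le_idx_def s del: fun_upd_apply)
   qed
   moreover have "\<alpha> = (\<alpha>(e0 := 0))(e0 := 1)" using a1 by (auto simp: fun_eq_iff)
   ultimately show ?thesis unfolding U_def by blast
  qed
 next
  fix \<alpha> assume "\<alpha> \<in> le_idx A (Suc L) \<union> U"
  then consider "\<alpha> \<in> le_idx A (Suc L)" | \<beta> where "\<beta> \<in> le_idx A L" "\<alpha> = \<beta>(e0 := 1)"
   unfolding U_def by blast
  hence "\<alpha> \<in> hidx (mdeg \<alpha>) \<and> mdeg \<alpha> \<le> Suc L"
  proof cases
   case 1
   thus ?thesis using A(2,3) by (auto simp: le_idx_def hidx_def md)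
  next
   case 2
   hence "\<alpha> e0 = 1" "sum \<alpha> A = sum \<beta> A" by (simp_all only: s fun_upd_same)
   moreover have "\<alpha> i = 0" if "i \<notin> Basis" for i using that 2 A(3) by (auto simp: le_idx_def)
   ultimately show ?thesis using 2(1) unfolding hidx_def md by (simp add: le_idx_def)
  qed
  thus "\<alpha> \<in> (\<Union>l\<in>{..Suc L}. hidx l)" by auto
 qed
 have inj: "inj_on (\<lambda>\<alpha>. \<alpha>(e0 := 1)) (le_idx A L)"
 proof (rule inj_onI)
  fix \<alpha> \<beta> assume ab: "\<alpha> \<in> le_idx A L" "\<beta> \<in> le_idx A L" "\<alpha>(e0 := 1) = \<beta>(e0 := 1 :: nat)"
  have "\<alpha> e0 = \<beta> e0" using ab A(2) by (simp add: le_idx_def)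
  thus "\<alpha> = \<beta>" using ab(3) by (metis fun_upd_triv fun_upd_upd)
 qed
 have "(\<Sum>l\<le>Suc L. hdim TYPE('a) l) = card (\<Union>l\<in>{..Suc L}. hidx l :: ('a => nat) set)"
  unfolding hdim_def by (rule card_UN_disjoint[symmetric]) (simp, simp add: finite_hidx, auto simp: hidx_def)
 also have "\<dots> = card (le_idx A (Suc L)) + card U"
  unfolding eq by (rule card_Un_disjoint) (use card_le_idx[OF A(1)] A(2) in \<open>auto simp: U_def le_idx_def\<close>)
 also have "card U = card (le_idx A L)" unfolding U_def by (rule card_image[OF inj])
 finally show ?thesis using card_le_idx[OF A(1)] A(4) by simp
qed

lemma hdim_0: "hdim TYPE('a::euclidean_space) 0 = 1"
proof -
 have "hidx 0 = {\<lambda>_::'a. 0 :: nat}"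
  by (auto simp: hidx_def mdeg_def fun_eq_iff)
 thus ?thesis by (simp add: hdim_def)
qed

text \<open>A relation between the \<open>hbasis \<alpha>\<close> makes the same combination of
  monomials a multiple of |x|^2. Along lines in the distinguished direction it has degree at most 1,
  while |x|^2 has degree 2, so the combination is 0 and monomial independence applies.\<close>

lemma hbasis_independent:
 fixes c :: "('a::euclidean_space => nat) => real"
 assumes z: "\<And>x. (\<Sum>\<alpha>\<in>hidx l. c \<alpha> * hbasis \<alpha> x) = 0"
 shows "\<forall>\<alpha>\<in>hidx l. c \<alpha> = 0"
proof -
 have "\<exists>R. hpoly (l - 2) R \<and> (\<forall>x. mpow \<alpha> x = hbasis \<alpha> x + (x \<bullet> x) * R x)" if "\<alpha> \<in> hidx l" for \<alpha> :: "'a => nat"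
  using hbasis_spec[of \<alpha>] that by (auto simp: hidx_def)
 then obtain R where R: "\<And>\<alpha>::'a => nat. \<alpha> \<in> hidx l ==> hpoly (l - 2) (R \<alpha>)"
  "\<And>\<alpha> x. \<alpha> \<in> hidx l ==> mpow \<alpha> x = hbasis \<alpha> x + (x \<bullet> x) * R \<alpha> x" by metis
 define G where "G x = (\<Sum>\<alpha>\<in>hidx l. c \<alpha> * R \<alpha> x)" for x
 have G: "hpoly (l - 2) G" unfolding G_def by (intro hpoly_sum hpoly_cmult R)
 define P where "P x = (\<Sum>\<alpha>\<in>hidx l. c \<alpha> * mpow \<alpha> x)" for x
 have PG: "P x = (x \<bullet> x) * G x" for x
 proof -
  have "P x = (\<Sum>\<alpha>\<in>hidx l. c \<alpha> * hbasis \<alpha> x) + (x \<bullet> x) * G x"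
   unfolding P_def G_def sum_distrib_left sum.distrib[symmetric]
   by (intro sum.cong refl) (simp add: R algebra_simps)
  thus ?thesis using z by simp
 qed
 have P0: "P x = 0" for x
 proof -
  define v where "v = x - (x \<bullet> e0) *\<^sub>R e0"
  have ve: "v \<bullet> e0 = 0" by (simp add: v_def inner_diff_left)
  have vi: "(v + t *\<^sub>R e0) \<bullet> i = (if i = e0 then t else x \<bullet> i)" if "i \<in> Basis" for i t
   using that by (auto simp: v_def inner_add_left inner_diff_left inner_Basis)
  obtain p where p: "\<And>t. G (v + t *\<^sub>R e0) = poly p t" using hpoly_line[OF G] by blast
  define M where "M \<alpha> = (\<Prod>i\<in>Basis - {e0}. (x \<bullet> i) ^ \<alpha> i)" for \<alpha>
  have mpow_line: "mpow \<alpha> (v + t *\<^sub>R e0) = M \<alpha> * t ^ \<alpha> e0" for \<alpha> t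
   unfolding mpow_def M_def by (subst prod.remove[of _ e0]) (auto simp: vi intro!: prod.cong)
  define a where "a = (\<Sum>\<alpha>\<in>hidx l. if \<alpha> e0 = 0 then c \<alpha> * M \<alpha> else 0)"
  define b where "b = (\<Sum>\<alpha>\<in>hidx l. if \<alpha> e0 = 0 then 0 else c \<alpha> * M \<alpha>)"
  have Pl: "P (v + t *\<^sub>R e0) = poly [:a, b:] t" for t
  proof -
   have "poly [:a, b:] t = (\<Sum>\<alpha>\<in>hidx l. (if \<alpha> e0 = 0 then c \<alpha> * M \<alpha> else 0) + t * (if \<alpha> e0 = 0 then 0 else c \<alpha> * M \<alpha>))"
    by (simp add: a_def b_def sum.distrib sum_distrib_left)
   also have "\<dots> = P (v + t *\<^sub>R e0)" unfolding P_def mpow_line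
   proof (intro sum.cong refl)
    fix \<alpha> :: "'a => nat" assume "\<alpha> \<in> hidx l"
    hence "\<alpha> e0 = 0 \<or> \<alpha> e0 = 1" by (auto simp: hidx_def)
    thus "(if \<alpha> e0 = 0 then c \<alpha> * M \<alpha> else 0) + t * (if \<alpha> e0 = 0 then 0 else c \<alpha> * M \<alpha>) = c \<alpha> * (M \<alpha> * t ^ \<alpha> e0)"
     by auto
   qed
   finally show ?thesis by simp
  qed
  have nn: "(v + t *\<^sub>R e0) \<bullet> (v + t *\<^sub>R e0) = poly [:v \<bullet> v, 0, 1:] t" for t
   using ve by (simp add: inner_add_left inner_add_right inner_commute[of e0 v] power2_eq_square)
  have "poly [:a, b:] t = poly ([:v \<bullet> v, 0, 1:] * p) t" for t
   using PG[of "v + t *\<^sub>R e0"] unfolding Pl nn p by (simp add: algebra_simps)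
  hence pe: "[:a, b:] = [:v \<bullet> v, 0, 1:] * p" by (simp add: poly_eq_poly_eq_iff[symmetric] fun_eq_iff)
  \<comment> \<open>A nonzero \<open>p\<close> would give degree at least 2 on the right; the
    restriction to exponents at most 1 in \<open>hidx\<close> keeps the left side at degree at most
    1.\<close>
  have "p = 0"
  proof (rule ccontr)
   assume "p \<noteq> 0"
   hence "degree ([:v \<bullet> v, 0, 1:] * p) = 2 + degree p" by (subst degree_mult_eq) auto
   moreover have "degree [:a, b:] \<le> 1" by simp
   ultimately show False unfolding pe by simp
  qed
  hence "P (v + (x \<bullet> e0) *\<^sub>R e0) = 0" unfolding Pl pe by simp
  thus ?thesis by (simp add: v_def)
 qed
 have "(\<Sum>\<alpha>\<in>hidx l. c \<alpha> * (\<Prod>i\<in>Basis. y i ^ \<alpha> i)) = 0" for y :: "'a => real"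
 proof -
  define x where "x = (\<Sum>i\<in>Basis. y i *\<^sub>R i)"
  have "x \<bullet> i = y i" if "i \<in> Basis" for i using that by (simp add: x_def)
  hence "P x = (\<Sum>\<alpha>\<in>hidx l. c \<alpha> * (\<Prod>i\<in>Basis. y i ^ \<alpha> i))" by (simp add: P_def mpow_def)
  thus ?thesis using P0 by simp
 qed
 thus ?thesis
  by (intro monomials_independent[of Basis]) (auto simp: finite_hidx, auto simp: hidx_def)
qed

section \<open>Density of polynomials on the closed ball\<close>

lemma hpoly_mult_hpoly: "hpoly d f ==> hpoly k g ==> hpoly (d + k) (\<lambda>x. f x * g x)"
proof (induction rule: hpoly.induct)
 case (const c)
 thus ?case using hpoly_cmult by simp
next
 case (mult d f i)
 from hpoly.mult[OF mult.IH[OF mult.prems] mult.hyps(2)] show ?case by (simp add: mult.assoc)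
next
 case (add d f g')
 from hpoly.add[OF add.IH(1)[OF add.prems] add.IH(2)[OF add.prems]] show ?case by (simp add: distrib_right)
qed

inductive polyf :: "('a::euclidean_space => real) => bool" where
 hpoly: "hpoly d f ==> polyf f"
| add: "polyf f ==> polyf g ==> polyf (\<lambda>x. f x + g x)"

lemma polyf_mult: "polyf f ==> polyf g ==> polyf (\<lambda>x. f x * g x)"
proof (induction rule: polyf.induct)
 case (hpoly d f)
 from hpoly(2) show ?case
 proof (induction rule: polyf.induct)
  case (hpoly k g)
  thus ?case using hpoly_mult_hpoly[OF \<open>hpoly d f\<close>] polyf.hpoly by blast
 next
  case (add g g')
  thus ?case using polyf.add[OF add.IH] by (simp add: distrib_left)
 qed
next
 case (add f f')
 thus ?case using polyf.add[OF add.IH(1)[OF add.prems] add.IH(2)[OF add.prems]] by (simp add: distrib_right)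
qed

lemma polyf_continuous: "polyf f ==> continuous_on S f"
 by (induction rule: polyf.induct) (auto intro!: continuous_intros intro: smooth_continuous hpoly_smooth)

lemma polyf_dense:
 fixes f :: "'a::euclidean_space => real"
 assumes "continuous_on (cball 0 1) f" "e > 0"
 shows "\<exists>g. polyf g \<and> (\<forall>x\<in>cball 0 1. \<bar>f x - g x\<bar> < e)"
proof -
 have coord: "polyf (\<lambda>x. x \<bullet> i)" if "i \<in> Basis" for i :: 'a
  using hpoly.mult[OF hpoly.const[of 1] that] polyf.hpoly by fastforce
 interpret function_ring_on "{f :: 'a => real. polyf f}" "cball 0 1"
 proof
  show "(\<lambda>_. c) \<in> {f :: 'a => real. polyf f}" for c using hpoly.const polyf.hpoly by blast
  fix x y :: 'a assume "x \<noteq> y"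
  then obtain i where "i \<in> Basis" "x \<bullet> i \<noteq> y \<bullet> i" using euclidean_eqI by blast
  thus "\<exists>f\<in>{f. polyf f}. f x \<noteq> f y" using coord by (intro bexI[of _ "\<lambda>x. x \<bullet> i"]) auto
 qed (auto intro: polyf_continuous polyf.add polyf_mult)
 show ?thesis using Stone_Weierstrass_basic[OF assms] by blast
qed

section \<open>Weak solutions tested against radial functions\<close>

definition rad :: "('a::euclidean_space => real) => (real => real) => 'a => real" where
 "rad P \<eta> x = P x * \<eta> (x \<bullet> x)"

definition sig :: "'a::euclidean_space itself => nat => real" where
 "sig _ l = real DIM('a) / 2 + real l - 1"

definition weak_sol :: "real => ('a::euclidean_space => complex) => bool" where
 "weak_sol \<kappa> v \<longleftrightarrow> (\<forall>\<phi>. test_fun (ball 0 1) \<phi> --> ip v (\<lambda>x. laplacian \<phi> x + \<kappa> * \<phi> x) = 0)"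

lemma sig_nonneg: "DIM('a::euclidean_space) \<ge> 2 ==> sig TYPE('a) l \<ge> 0"
proof -
 have "real DIM('a) \<ge> 2" if "DIM('a) \<ge> 2" using that by linarith
 thus "DIM('a::euclidean_space) \<ge> 2 ==> sig TYPE('a) l \<ge> 0" unfolding sig_def by linarith
qed

lemma continuous_rad:
 assumes "continuous_on UNIV P" "continuous_on UNIV \<eta>" shows "continuous_on UNIV (rad P \<eta>)"
proof -
 have "continuous_on UNIV (\<lambda>x. \<eta> (x \<bullet> x))"
  by (rule continuous_on_compose2[OF assms(2)]) (auto intro!: continuous_intros)
 thus ?thesis unfolding rad_def[abs_def] by (rule continuous_on_mult[OF assms(1)])
qed

lemma smooth_rad: "smooth P ==> smooth \<eta> ==> smooth (rad P \<eta>)"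
 unfolding rad_def[abs_def] by (rule smooth_mult[OF _ smooth_compose[OF _ smooth_norm2]])

text \<open>Euler's identity replaces x . grad P by l P, and 4 l + 2 n = 4 (\<open>sig\<close> + 1):
  the Laplacian acts on the profile alone, as the operator of Bessel's equation.\<close>

lemma laplacian_rad:
 fixes P :: "'a::euclidean_space => real"
 assumes P: "hpoly l P" "laplacian P = (\<lambda>x. 0)"
  and k: "\<And>s. DERIV k s :> k' s" "\<And>s. DERIV k' s :> k'' s" "smooth k'"
 shows "laplacian (rad P k) x = rad P (\<lambda>\<rho>. 4 * (sig TYPE('a) l + 1) * k' \<rho> + 4 * \<rho> * k'' \<rho>) x"
 unfolding rad_def[abs_def] laplacian_radial[OF hpoly_smooth[OF P(1)] k] hpoly_euler[OF P(1)] P(2)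
 by (simp add: sig_def algebra_simps)

section \<open>Cut-offs of radial profiles\<close>

definition cutd1 :: "real => nat => (real => real) => (real => real) => real => real" where
 "cutd1 R N h h1 \<rho> = h1 \<rho> * cut0 R N \<rho> + h \<rho> * cut1 R N \<rho>"
definition cutd2 :: "real => nat => (real => real) => (real => real) => (real => real) => real => real" where
 "cutd2 R N h h1 h2 \<rho> = h2 \<rho> * cut0 R N \<rho> + 2 * h1 \<rho> * cut1 R N \<rho> + h \<rho> * cut2 R N \<rho>"

lemma cutd_derivative:
 assumes "\<And>s. DERIV h s :> h1 s" "\<And>s. DERIV h1 s :> h2 s"
 shows "DERIV (\<lambda>\<rho>. h \<rho> * cut0 R N \<rho>) s :> cutd1 R N h h1 s"
  and "DERIV (cutd1 R N h h1) s :> cutd2 R N h h1 h2 s"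
proof -
 show "DERIV (\<lambda>\<rho>. h \<rho> * cut0 R N \<rho>) s :> cutd1 R N h h1 s"
  by (rule DERIV_cong[OF DERIV_mult[OF assms(1) cut_has_derivative(1)]]) (simp add: cutd1_def)
 show "DERIV (cutd1 R N h h1) s :> cutd2 R N h h1 h2 s"
  unfolding cutd1_def[abs_def]
  by (rule DERIV_cong[OF DERIV_add[OF DERIV_mult[OF assms(2) cut_has_derivative(1)] DERIV_mult[OF assms(1) cut_has_derivative(2)]]])
   (simp add: cutd2_def)
qed

lemma smooth_real_deriv:
 assumes "smooth (h :: real => real)" "\<And>s. DERIV h s :> h1 s" shows "smooth h1"
proof -
 have "pd [1] h = h1" using pd_real[OF assms(2)] by (intro ext)
 thus ?thesis using smooth_pd[OF assms(1), of 1] by (simp add: Basis_real_def)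
qed

lemma smooth_imp_DERIV: "smooth (h :: real => real) ==> DERIV h s :> pd [1] h s"
proof -
 assume "smooth h"
 then obtain D where "DERIV h s :> D"
  using smooth_differentiable[of h s] real_differentiable_def by blast
 moreover from this have "pd [1] h s = D" by (rule pd_real)
 ultimately show ?thesis by simp
qed

lemma cutd_zero:
 assumes "\<rho> \<ge> R" shows "h \<rho> * cut0 R N \<rho> = 0" "cutd1 R N h h1 \<rho> = 0" "cutd2 R N h h1 h2 \<rho> = 0"
proof -
 have "1 / real (Suc N) \<ge> 0" by simp
 hence "\<rho> \<ge> R - 1 / real (Suc N)" using assms by linarith
 from cut_zero[OF this] show "h \<rho> * cut0 R N \<rho> = 0" "cutd1 R N h h1 \<rho> = 0" "cutd2 R N h h1 h2 \<rho> = 0"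
  by (simp_all add: cutd1_def cutd2_def)
qed

lemma cutd_tendsto:
 assumes "\<rho> < R"
 shows "(\<lambda>N. h \<rho> * cut0 R N \<rho>) \<longlonglongrightarrow> h \<rho>" "(\<lambda>N. cutd1 R N h h1 \<rho>) \<longlonglongrightarrow> h1 \<rho>" "(\<lambda>N. cutd2 R N h h1 h2 \<rho>) \<longlonglongrightarrow> h2 \<rho>"
proof -
 note c = cut_tendsto[OF assms]
 show "(\<lambda>N. h \<rho> * cut0 R N \<rho>) \<longlonglongrightarrow> h \<rho>" using tendsto_mult_left[OF c(1), of "h \<rho>"] by simp
 show "(\<lambda>N. cutd1 R N h h1 \<rho>) \<longlonglongrightarrow> h1 \<rho>" unfolding cutd1_def
  using tendsto_add[OF tendsto_mult_left[OF c(1), of "h1 \<rho>"] tendsto_mult_left[OF c(2), of "h \<rho>"]] by simp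
 show "(\<lambda>N. cutd2 R N h h1 h2 \<rho>) \<longlonglongrightarrow> h2 \<rho>" unfolding cutd2_def
  using tendsto_add[OF tendsto_add[OF tendsto_mult_left[OF c(1), of "h2 \<rho>"] tendsto_mult_left[OF c(2), of "2 * h1 \<rho>"]]
    tendsto_mult_left[OF c(3), of "h \<rho>"]] by simp
qed

text \<open>The derivative of the cut-off grows like the inverse distance to the edge; a zero of
  \<open>h\<close> at the edge compensates this uniformly in \<open>N\<close>.\<close>

lemma cutd_bound1:
 assumes "\<And>\<rho>. 0 \<le> \<rho> ==> \<rho> < R ==> \<bar>h \<rho>\<bar> \<le> A * (R - \<rho>)" "\<And>\<rho>. 0 \<le> \<rho> ==> \<rho> < R ==> \<bar>h1 \<rho>\<bar> \<le> A" "A \<ge> 0"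
 shows "\<exists>C\<ge>0. \<forall>N \<rho>. 0 \<le> \<rho> --> \<bar>h \<rho> * cut0 R N \<rho>\<bar> \<le> C \<and> \<bar>cutd1 R N h h1 \<rho>\<bar> \<le> C"
proof -
 obtain B where B: "B > 0" "\<And>N \<rho>. \<rho> < R ==> \<bar>cut1 R N \<rho>\<bar> * (R - \<rho>) \<le> B" using cut_derivative_bounds by metis
 define C where "C = A * \<bar>R\<bar> + A + A * B"
 have C: "C \<ge> 0" using assms(3) B by (simp add: C_def)
 have "\<bar>h \<rho> * cut0 R N \<rho>\<bar> \<le> C \<and> \<bar>cutd1 R N h h1 \<rho>\<bar> \<le> C" if r: "0 \<le> \<rho>" for N \<rho>
 proof (cases "\<rho> < R")
  case True
  have c: "\<bar>cut0 R N \<rho>\<bar> \<le> 1" using cut_bounds[of R N \<rho>] by simp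
  have "\<bar>h \<rho> * cut0 R N \<rho>\<bar> \<le> (A * (R - \<rho>)) * 1" unfolding abs_mult
   using assms(1)[OF r True] c True assms(3) by (intro mult_mono) auto
  also have "\<dots> \<le> A * \<bar>R\<bar>" using r assms(3) by (simp add: mult_left_mono)
  finally have 1: "\<bar>h \<rho> * cut0 R N \<rho>\<bar> \<le> A * \<bar>R\<bar>" .
  have 2: "\<bar>h1 \<rho> * cut0 R N \<rho>\<bar> \<le> A * 1" unfolding abs_mult
   using assms(2)[OF r True] c assms(3) by (intro mult_mono) auto
  have "\<bar>h \<rho> * cut1 R N \<rho>\<bar> \<le> (A * (R - \<rho>)) * \<bar>cut1 R N \<rho>\<bar>" unfolding abs_mult
   using assms(1)[OF r True] by (intro mult_right_mono) auto
  also have "\<dots> = A * (\<bar>cut1 R N \<rho>\<bar> * (R - \<rho>))" by simp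
  also have "\<dots> \<le> A * B" using B(2)[OF True] assms(3) by (rule mult_left_mono)
  finally have "\<bar>cutd1 R N h h1 \<rho>\<bar> \<le> A + A * B" using 2 unfolding cutd1_def by linarith
  moreover have "0 \<le> A * \<bar>R\<bar>" "0 \<le> A * B" using assms(3) B by auto
  ultimately show ?thesis using 1 assms(3) by (simp add: C_def)
 next
  case False
  thus ?thesis using C by (simp add: cutd_zero)
 qed
 thus ?thesis using C by blast
qed

text \<open>The same compensation one order higher: a double zero at the edge pairs with the inverse
  square growth of the second derivative of the cut-off.\<close>

lemma cutd_bound2:
 assumes "\<And>\<rho>. 0 \<le> \<rho> ==> \<rho> < R ==> \<bar>h \<rho>\<bar> \<le> A * (R - \<rho>)\<^sup>2" "\<And>\<rho>. 0 \<le> \<rho> ==> \<rho> < R ==> \<bar>h1 \<rho>\<bar> \<le> A * (R - \<rho>)"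
  "\<And>\<rho>. 0 \<le> \<rho> ==> \<rho> < R ==> \<bar>h2 \<rho>\<bar> \<le> A" "A \<ge> 0"
 shows "\<exists>C\<ge>0. \<forall>N \<rho>. 0 \<le> \<rho> --> \<bar>h \<rho> * cut0 R N \<rho>\<bar> \<le> C \<and> \<bar>cutd1 R N h h1 \<rho>\<bar> \<le> C \<and> \<bar>cutd2 R N h h1 h2 \<rho>\<bar> \<le> C"
proof -
 \<comment> \<open>Since R - \<rho> is at most |R| + 1, quadratic vanishing with constant
   \<open>A\<close> implies linear vanishing with constant \<open>A'\<close>, and the first-order
   lemma covers \<open>h\<close> and \<open>h1\<close>.\<close>
 define A' where "A' = A * (\<bar>R\<bar> + 1)"
 have A': "A' \<ge> 0" "A \<le> A'" using assms(4) by (auto simp: A'_def algebra_simps)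
 have h1: "\<bar>h \<rho>\<bar> \<le> A' * (R - \<rho>)" "\<bar>h1 \<rho>\<bar> \<le> A'" if r: "0 \<le> \<rho>" "\<rho> < R" for \<rho>
 proof -
  have "R - \<rho> \<le> \<bar>R\<bar> + 1" using r by simp
  hence m: "A * (R - \<rho>) \<le> A'" unfolding A'_def using assms(4) by (rule mult_left_mono)
  thus "\<bar>h1 \<rho>\<bar> \<le> A'" using assms(2)[OF r] by linarith
  have "\<bar>h \<rho>\<bar> \<le> (A * (R - \<rho>)) * (R - \<rho>)" using assms(1)[OF r] by (simp add: power2_eq_square mult.assoc)
  also have "\<dots> \<le> A' * (R - \<rho>)" using m r by (intro mult_right_mono) auto
  finally show "\<bar>h \<rho>\<bar> \<le> A' * (R - \<rho>)" .
 qed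
 obtain C1 where C1: "C1 \<ge> 0" "\<And>N \<rho>. 0 \<le> \<rho> ==> \<bar>h \<rho> * cut0 R N \<rho>\<bar> \<le> C1" "\<And>N \<rho>. 0 \<le> \<rho> ==> \<bar>cutd1 R N h h1 \<rho>\<bar> \<le> C1"
 proof -
  have "\<exists>C\<ge>0. \<forall>N \<rho>. 0 \<le> \<rho> --> \<bar>h \<rho> * cut0 R N \<rho>\<bar> \<le> C \<and> \<bar>cutd1 R N h h1 \<rho>\<bar> \<le> C"
   by (rule cutd_bound1[of R h A' h1]; (rule h1 A'(1), assumption+ | rule A'(1)))
  thus ?thesis using that by blast
 qed
 obtain B where B: "B > 0" "\<And>N \<rho>. \<rho> < R ==> \<bar>cut1 R N \<rho>\<bar> * (R - \<rho>) \<le> B"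
   "\<And>N \<rho>. \<rho> < R ==> \<bar>cut2 R N \<rho>\<bar> * (R - \<rho>)\<^sup>2 \<le> B" using cut_derivative_bounds by metis
 define C where "C = C1 + A + 2 * (A * B) + A * B"
 have C: "C \<ge> 0" "C1 \<le> C" using C1 assms(4) B by (simp_all add: C_def)
 have "\<bar>cutd2 R N h h1 h2 \<rho>\<bar> \<le> C" if r: "0 \<le> \<rho>" for N \<rho>
 proof (cases "\<rho> < R")
  case True
  have c: "\<bar>cut0 R N \<rho>\<bar> \<le> 1" using cut_bounds[of R N \<rho>] by simp
  have 1: "\<bar>h2 \<rho> * cut0 R N \<rho>\<bar> \<le> A * 1" unfolding abs_mult
   using assms(3)[OF r True] c assms(4) by (intro mult_mono) auto
  have "\<bar>h1 \<rho> * cut1 R N \<rho>\<bar> \<le> (A * (R - \<rho>)) * \<bar>cut1 R N \<rho>\<bar>" unfolding abs_mult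
   using assms(2)[OF r True] by (intro mult_right_mono) auto
  also have "\<dots> = A * (\<bar>cut1 R N \<rho>\<bar> * (R - \<rho>))" by simp
  also have "\<dots> \<le> A * B" using B(2)[OF True] assms(4) by (rule mult_left_mono)
  finally have 2: "\<bar>h1 \<rho> * cut1 R N \<rho>\<bar> \<le> A * B" .
  have "\<bar>h \<rho> * cut2 R N \<rho>\<bar> \<le> (A * (R - \<rho>)\<^sup>2) * \<bar>cut2 R N \<rho>\<bar>" unfolding abs_mult
   using assms(1)[OF r True] by (intro mult_right_mono) auto
  also have "\<dots> = A * (\<bar>cut2 R N \<rho>\<bar> * (R - \<rho>)\<^sup>2)" by simp
  also have "\<dots> \<le> A * B" using B(3)[OF True] assms(4) by (rule mult_left_mono)
  finally have 3: "\<bar>h \<rho> * cut2 R N \<rho>\<bar> \<le> A * B" .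
  have "\<bar>cutd2 R N h h1 h2 \<rho>\<bar> \<le> \<bar>h2 \<rho> * cut0 R N \<rho>\<bar> + 2 * \<bar>h1 \<rho> * cut1 R N \<rho>\<bar> + \<bar>h \<rho> * cut2 R N \<rho>\<bar>"
   unfolding cutd2_def by linarith
  thus ?thesis using 1 2 3 C1(1) unfolding C_def by linarith
 next
  case False
  thus ?thesis using C by (simp add: cutd_zero)
 qed
 moreover have "\<bar>h \<rho> * cut0 R N \<rho>\<bar> \<le> C" "\<bar>cutd1 R N h h1 \<rho>\<bar> \<le> C" if "0 \<le> \<rho>" for N \<rho>
  using C1(2,3)[OF that, of N] C(2) by linarith+
 ultimately show ?thesis using C(1) by blast
qed

lemma test_fun_cut:
 assumes P: "smooth P" and h: "smooth h" and R: "R \<le> 1"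
 shows "test_fun (ball 0 1) (rad P (\<lambda>\<rho>. h \<rho> * cut0 R N \<rho>) :: 'a::euclidean_space => real)"
proof -
 let ?\<phi> = "rad P (\<lambda>\<rho>. h \<rho> * cut0 R N \<rho>)"
 define K where "K = {x::'a. x \<bullet> x \<le> R - 1 / real (Suc N)}"
 have cl: "closed K" unfolding K_def by (intro closed_Collect_le continuous_intros)
 have sub: "K \<subseteq> ball 0 1"
 proof
  fix x assume "x \<in> K"
  moreover have "1 / real (Suc N) > 0" by simp
  ultimately have "x \<bullet> x < 1" using R unfolding K_def mem_Collect_eq by linarith
  hence "(norm x)\<^sup>2 < 1\<^sup>2" by (simp add: power2_norm_eq_inner)
  thus "x \<in> ball 0 1" by (simp add: power2_less_imp_less)
 qed
 have "compact K" using cl bounded_subset[OF bounded_ball sub] by (simp add: compact_eq_bounded_closed)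
 moreover have "{x. ?\<phi> x \<noteq> 0} \<subseteq> K"
 proof
  fix x assume "x \<in> {x. ?\<phi> x \<noteq> 0}"
  hence "cut0 R N (x \<bullet> x) \<noteq> 0" by (auto simp: rad_def)
  hence "\<not> R - 1 / real (Suc N) \<le> x \<bullet> x" using cut_zero(1) by blast
  thus "x \<in> K" unfolding K_def mem_Collect_eq by linarith
 qed
 hence "closure {x. ?\<phi> x \<noteq> 0} \<subseteq> K" using cl by (rule closure_minimal)
 ultimately have "compact (closure {x. ?\<phi> x \<noteq> 0})"
  "closure {x. ?\<phi> x \<noteq> 0} \<subseteq> ball 0 1"
  using compact_Int_closed[of K "closure {x. ?\<phi> x \<noteq> 0}"] sub by (auto simp: Int_absorb1)
 moreover have "smooth ?\<phi>"
  by (intro smooth_rad P smooth_mult h smooth_cut)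
 ultimately show ?thesis by (simp add: test_fun_iff)
qed

lemma inner_self_less_1: "x \<in> ball 0 1 ==> x \<bullet> x < 1" "0 \<le> x \<bullet> x"
proof -
 assume "x \<in> ball 0 1"
 hence "(norm x)\<^sup>2 < 1" by (simp add: power_less_one_iff)
 thus "x \<bullet> x < 1" by (simp add: power2_norm_eq_inner)
qed simp

lemma continuous_on_DERIV: "(\<And>s. DERIV h s :> h1 s) ==> continuous_on S h"
 by (meson DERIV_isCont continuous_at_imp_continuous_on)

lemma rad_tendsto:
 assumes w: "ubi w" and P: "continuous_on UNIV P" and h: "\<And>N. continuous_on UNIV (h N)" "continuous_on UNIV h'"
  and C: "\<And>N \<rho>. 0 \<le> \<rho> ==> \<rho> < 1 ==> \<bar>h N \<rho>\<bar> \<le> C"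
  and lim: "\<And>\<rho>. 0 \<le> \<rho> ==> \<rho> < 1 ==> (\<lambda>N. h N \<rho>) \<longlonglongrightarrow> h' \<rho>"
 shows "(\<lambda>N. ip w (rad P (h N))) \<longlonglongrightarrow> ip w (rad P h')"
proof -
 obtain B where B: "B > 0" "\<And>x. x \<in> cball 0 1 ==> norm (P x) \<le> B" using continuous_bounded_ball[OF P] by blast
 show ?thesis
 proof (rule ip_dominated[OF w continuous_rad[OF P h(1)] continuous_rad[OF P h(2)], where C = "B * C"])
  fix N and x :: 'a assume x: "x \<in> ball 0 1"
  have "\<bar>h N (x \<bullet> x)\<bar> \<le> C" using C inner_self_less_1(1)[OF x] by simp
  thus "\<bar>rad P (h N) x\<bar> \<le> B * C" unfolding rad_def abs_mult using B x by (intro mult_mono) auto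
 next
  fix x :: 'a assume x: "x \<in> ball 0 1"
  show "(\<lambda>N. rad P (h N) x) \<longlonglongrightarrow> rad P h' x" unfolding rad_def
   using lim inner_self_less_1(1)[OF x] by (intro tendsto_mult tendsto_const) simp
 qed
qed

text \<open>Truncated powers satisfy a closed recursion under the radial Laplacian, since \<open>\<rho> = R - (R - \<rho>)\<close>.\<close>

definition tp :: "nat => real => real => real" where "tp q R \<rho> = max 0 (R - \<rho>) ^ q"

lemma continuous_tp: "continuous_on UNIV (tp q R)"
 unfolding tp_def[abs_def] by (intro continuous_intros)

text \<open>The weak equation is tested with \<open>P\<close> times the cut-off of (R - \<rho>)^q,
  and \<open>N\<close> tends to infinity. For q at least 3 all three truncated powers vanish at and
  beyond \<open>R\<close>, where the cut-off functions vanish as well, so the limit holds at every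
  point of the ball.\<close>

lemma tp_ode:
 fixes P :: "'a::euclidean_space => real"
 assumes P: "hpoly l P" "laplacian P = (\<lambda>x. 0)" and v: "ubi v" "weak_sol \<kappa> v"
  and R: "0 < R" "R \<le> 1" and q: "q \<ge> 3"
 shows "complex_of_real \<kappa> * ip v (rad P (tp q R)) - 4 * of_nat q * complex_of_real (real q + sig TYPE('a) l) * ip v (rad P (tp (q - 1) R))
   + 4 * complex_of_real R * of_nat q * of_nat (q - 1) * ip v (rad P (tp (q - 2) R)) = 0"
proof -
 define \<nu> where "\<nu> = sig TYPE('a) l"
 define h where "h \<rho> = (R - \<rho>) ^ q" for \<rho>
 define h1 where "h1 \<rho> = - real q * (R - \<rho>) ^ (q - 1)" for \<rho>
 define h2 where "h2 \<rho> = real q * real (q - 1) * (R - \<rho>) ^ (q - 2)" for \<rho>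
 have d1: "DERIV h s :> h1 s" for s
  unfolding h_def h1_def by (auto intro!: derivative_eq_intros)
 have d2: "DERIV h1 s :> h2 s" for s
  unfolding h1_def h2_def by (auto intro!: derivative_eq_intros simp: numeral_2_eq_2)
 have sh: "smooth h" unfolding h_def by (intro smooth_power smooth_diff smooth_const smooth_real_id)
 have ch: "continuous_on UNIV h" "continuous_on UNIV h1" "continuous_on UNIV h2"
  unfolding h_def h1_def h2_def by (intro continuous_intros)+
 have pw: "s ^ a \<le> s ^ b" if "0 \<le> s" "s \<le> 1" "b \<le> a" for s :: real and a b using that by (intro power_decreasing)
 define A where "A = real q * real q"
 have A: "A \<ge> 1" "A \<ge> real q" "A \<ge> real q * real (q - 1)" using q mult_mono[of 1 "real q" 1 "real q"]
  by (auto simp: A_def mult_left_mono)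
 have b0: "\<bar>h \<rho>\<bar> \<le> A * (R - \<rho>)\<^sup>2" and b1: "\<bar>h1 \<rho>\<bar> \<le> A * (R - \<rho>)" and b2: "\<bar>h2 \<rho>\<bar> \<le> A" if r: "0 \<le> \<rho>" "\<rho> < R" for \<rho>
 proof -
  have s: "0 \<le> R - \<rho>" "R - \<rho> \<le> 1" using r R by auto
  have "(R - \<rho>) ^ q \<le> 1 * (R - \<rho>)\<^sup>2" using pw[OF s, of 2 q] q by simp
  also have "\<dots> \<le> A * (R - \<rho>)\<^sup>2" using A by (intro mult_right_mono) auto
  finally show "\<bar>h \<rho>\<bar> \<le> A * (R - \<rho>)\<^sup>2" using s by (simp add: h_def)
  have "real q * (R - \<rho>) ^ (q - 1) \<le> A * (R - \<rho>) ^ 1" using pw[OF s, of 1 "q - 1"] q s A by (intro mult_mono) auto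
  thus "\<bar>h1 \<rho>\<bar> \<le> A * (R - \<rho>)" using s by (simp add: h1_def abs_mult)
  have "real q * real (q - 1) * (R - \<rho>) ^ (q - 2) \<le> A * 1" using s A by (intro mult_mono power_le_one) auto
  thus "\<bar>h2 \<rho>\<bar> \<le> A" using s by (simp add: h2_def abs_mult)
 qed
 obtain C where C: "C \<ge> 0" "\<And>N \<rho>. 0 \<le> \<rho> ==> \<bar>h \<rho> * cut0 R N \<rho>\<bar> \<le> C" "\<And>N \<rho>. 0 \<le> \<rho> ==> \<bar>cutd1 R N h h1 \<rho>\<bar> \<le> C"
  "\<And>N \<rho>. 0 \<le> \<rho> ==> \<bar>cutd2 R N h h1 h2 \<rho>\<bar> \<le> C"
 proof -
  have "\<exists>C\<ge>0. \<forall>N \<rho>. 0 \<le> \<rho> --> \<bar>h \<rho> * cut0 R N \<rho>\<bar> \<le> C \<and> \<bar>cutd1 R N h h1 \<rho>\<bar> \<le> C \<and> \<bar>cutd2 R N h h1 h2 \<rho>\<bar> \<le> C"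
   by (rule cutd_bound2[of R h A h1 h2]; (rule b0 b1 b2, assumption+ | rule order.trans[OF zero_le_one A(1)]))
  thus ?thesis using that by blast
 qed
 define L where "L N \<rho> = 4 * (\<nu> + 1) * cutd1 R N h h1 \<rho> + 4 * \<rho> * cutd2 R N h h1 h2 \<rho> + \<kappa> * (h \<rho> * cut0 R N \<rho>)" for N \<rho>
 define g where "g \<rho> = \<kappa> * tp q R \<rho> - 4 * real q * (real q + \<nu>) * tp (q - 1) R \<rho> + 4 * R * real q * real (q - 1) * tp (q - 2) R \<rho>" for \<rho>
 have LN: "ip v (rad P (L N)) = 0" for N
 proof -
  let ?\<phi> = "rad P (\<lambda>\<rho>. h \<rho> * cut0 R N \<rho>)"
  have t: "test_fun (ball 0 1) ?\<phi>" by (rule test_fun_cut[OF hpoly_smooth[OF P(1)] sh R(2)])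
  have s: "smooth (cutd1 R N h h1)"
   by (rule smooth_real_deriv[OF smooth_mult[OF sh smooth_cut] cutd_derivative(1)[OF d1 d2]])
  have "laplacian ?\<phi> x + \<kappa> * ?\<phi> x = rad P (L N) x" for x
   unfolding laplacian_rad[OF P cutd_derivative[OF d1 d2] s] by (simp add: rad_def L_def \<nu>_def algebra_simps)
  hence "(\<lambda>x. laplacian ?\<phi> x + \<kappa> * ?\<phi> x) = rad P (L N)" by (rule ext)
  thus ?thesis using v(2)[unfolded weak_sol_def, rule_format, OF t] by (simp only:)
 qed
 have "(\<lambda>N. ip v (rad P (L N))) \<longlonglongrightarrow> ip v (rad P g)"
 proof (rule rad_tendsto[OF v(1) smooth_continuous[OF hpoly_smooth[OF P(1)]], where C = "4 * \<bar>\<nu> + 1\<bar> * C + 4 * 1 * C + \<bar>\<kappa>\<bar> * C"])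
  have s1: "smooth (cutd1 R N h h1)" for N
   by (rule smooth_real_deriv[OF smooth_mult[OF sh smooth_cut] cutd_derivative(1)[OF d1 d2]])
  have "smooth (cutd2 R N h h1 h2)" for N by (rule smooth_real_deriv[OF s1 cutd_derivative(2)[OF d1 d2]])
  hence "smooth (L N)" for N unfolding L_def
   by (intro smooth_add smooth_mult smooth_const smooth_real_id sh smooth_cut s1)
  thus "continuous_on UNIV (L N)" for N by (rule smooth_continuous)
  show "continuous_on UNIV g" unfolding g_def
   by (intro continuous_on_add continuous_on_diff continuous_on_mult continuous_on_const continuous_tp)
  fix \<rho> :: real assume r: "0 \<le> \<rho>" "\<rho> < 1"
  show "\<bar>L N \<rho>\<bar> \<le> 4 * \<bar>\<nu> + 1\<bar> * C + 4 * 1 * C + \<bar>\<kappa>\<bar> * C" for N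
  proof -
   have "\<bar>L N \<rho>\<bar> \<le> \<bar>4 * (\<nu> + 1) * cutd1 R N h h1 \<rho>\<bar> + \<bar>4 * \<rho> * cutd2 R N h h1 h2 \<rho>\<bar> + \<bar>\<kappa> * (h \<rho> * cut0 R N \<rho>)\<bar>"
    unfolding L_def by linarith
   also have "\<dots> = 4 * \<bar>\<nu> + 1\<bar> * \<bar>cutd1 R N h h1 \<rho>\<bar> + 4 * \<rho> * \<bar>cutd2 R N h h1 h2 \<rho>\<bar> + \<bar>\<kappa>\<bar> * \<bar>h \<rho> * cut0 R N \<rho>\<bar>"
    unfolding abs_mult[of "_ * _"] abs_mult[of \<kappa>] abs_mult[of 4] using r by simp
   also have "\<dots> \<le> 4 * \<bar>\<nu> + 1\<bar> * C + 4 * 1 * C + \<bar>\<kappa>\<bar> * C"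
    by (intro add_mono mult_mono order.refl C(2-4)[OF r(1)]) (use r C(1) in auto)
   finally show ?thesis .
  qed
  show "(\<lambda>N. L N \<rho>) \<longlonglongrightarrow> g \<rho>"
  proof (cases "\<rho> < R")
   case True
   have e: "4 * (\<nu> + 1) * h1 \<rho> + 4 * \<rho> * h2 \<rho> + \<kappa> * h \<rho> = g \<rho>"
   proof -
    define j where "j = q - 2"
    have j: "q = Suc (Suc j)" using q by (simp add: j_def)
    have gen: "4 * (\<nu> + 1) * (- real q * t ^ (q - 1)) + 4 * (R - t) * (real q * real (q - 1) * t ^ (q - 2)) + \<kappa> * t ^ q
     = \<kappa> * t ^ q - 4 * real q * (real q + \<nu>) * t ^ (q - 1) + 4 * R * real q * real (q - 1) * t ^ (q - 2)" for t
     unfolding j by (simp add: algebra_simps)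
    have m: "max 0 (R - \<rho>) = R - \<rho>" using True by simp
    show ?thesis using gen[of "R - \<rho>"] unfolding g_def h_def h1_def h2_def tp_def m by simp
   qed
   show ?thesis unfolding e[symmetric] L_def by (intro tendsto_add tendsto_mult_left cutd_tendsto True)
  next
   case False
   hence "g \<rho> = 0" using q by (simp add: g_def tp_def power_0_left)
   moreover have "L N \<rho> = 0" for N
    using False unfolding L_def by (simp only: cutd_zero not_less mult_zero_right add_0_right)
   ultimately show ?thesis by simp
  qed
 qed
 hence "ip v (rad P g) = 0" unfolding LN by (simp add: LIMSEQ_const_iff)
 moreover have "rad P g = (\<lambda>x. (\<kappa> * rad P (tp q R) x - (4 * real q * (real q + \<nu>)) * rad P (tp (q - 1) R) x)
   + (4 * R * real q * real (q - 1)) * rad P (tp (q - 2) R) x)"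
  by (rule ext) (simp add: rad_def g_def algebra_simps)
 moreover have cr: "continuous_on UNIV (rad P (tp j R))" for j
  by (rule continuous_rad[OF smooth_continuous[OF hpoly_smooth[OF P(1)]] continuous_tp])
 ultimately show ?thesis
  using ip_add[OF v(1), of "\<lambda>x. \<kappa> * rad P (tp q R) x - (4 * real q * (real q + \<nu>)) * rad P (tp (q - 1) R) x"
    "\<lambda>x. (4 * R * real q * real (q - 1)) * rad P (tp (q - 2) R) x"]
   ip_diff[OF v(1), of "\<lambda>x. \<kappa> * rad P (tp q R) x" "\<lambda>x. (4 * real q * (real q + \<nu>)) * rad P (tp (q - 1) R) x"]
  by (simp add: ip_cmult continuous_intros \<nu>_def)
qed

section \<open>Moments as functions of the truncation radius\<close>

lemma tp_has_derivative:
 assumes "q \<ge> 2" shows "DERIV (\<lambda>t. max 0 t ^ q) t :> real q * max 0 t ^ (q - 1)"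
proof -
 consider "t < 0" | "t > 0" | "t = 0" by linarith
 thus ?thesis
 proof cases
  case 1
  hence "DERIV (\<lambda>_. 0) t :> real q * max 0 t ^ (q - 1)" using assms by (simp add: max_def power_0_left)
  thus ?thesis by (rule has_field_derivative_transform_within_open[of _ _ _ "{..<0}"]) (use 1 assms in \<open>auto simp: max_def\<close>)
 next
  case 2
  hence "DERIV (\<lambda>t. t ^ q) t :> real q * max 0 t ^ (q - 1)" by (auto intro!: derivative_eq_intros)
  thus ?thesis by (rule has_field_derivative_transform_within_open[of _ _ _ "{0<..}"]) (use 2 in auto)
 next
  case 3
  define j where "j = q - 2"
  have j: "q = Suc (Suc j)" using assms by (simp add: j_def)
  have "((\<lambda>h. max 0 h ^ q / h) \<longlongrightarrow> 0) (at (0::real))"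
  proof (rule Lim_null_comparison[of _ "\<lambda>h. \<bar>h\<bar> ^ Suc j"])
   have "norm (max 0 h ^ q / h) \<le> \<bar>h\<bar> ^ Suc j" for h :: real
   proof (cases "h > 0")
    case False
    hence "max 0 h = 0" by simp
    thus ?thesis by (simp only: j power_Suc mult_zero_left div_0 norm_zero zero_le_power abs_ge_zero mult_nonneg_nonneg)
   qed (simp add: j)
   thus "\<forall>\<^sub>F h in at 0. norm (max 0 h ^ q / h) \<le> \<bar>h :: real\<bar> ^ Suc j" by simp
   show "((\<lambda>h. \<bar>h::real\<bar> ^ Suc j) \<longlongrightarrow> 0) (at 0)" by (intro tendsto_eq_intros refl) auto
  qed
  thus ?thesis using 3 j by (simp add: has_field_derivative_iff)
 qed
qed

text \<open>Differentiation under the pairing: the derivative of the truncated power is Lipschitz on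
  the relevant range, so the first-order Taylor error is O((S - R)^2) uniformly in x.\<close>

lemma ip_tp_has_derivative:
 fixes P :: "'a::euclidean_space => real"
 assumes P: "continuous_on UNIV P" and v: "ubi v" and q: "q \<ge> 2" and R: "0 < R" "R < 1"
 shows "((\<lambda>R. ip v (rad P (tp q R))) has_vector_derivative of_nat q * ip v (rad P (tp (q - 1) R))) (at R)"
proof -
 obtain B where B: "B > 0" "\<And>x. x \<in> cball 0 1 ==> norm (P x) \<le> B" using continuous_bounded_ball[OF P] by blast
 have m: "0 \<le> mass v" unfolding mass_def set_lebesgue_integral_def by (rule integral_nonneg_AE) auto
 define K where "K = B * (real q * real (q - 1)) * mass v"
 have K: "K \<ge> 0" using B m by (simp add: K_def)
 have c: "continuous_on UNIV (rad P (tp j S))" for j S by (intro continuous_rad P continuous_tp)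
 let ?F = "\<lambda>R. ip v (rad P (tp q R))" and ?D = "of_nat q * ip v (rad P (tp (q - 1) R))"
 have main: "norm (?F S - ?F R - complex_of_real (S - R) * ?D)
   \<le> K * (S - R)\<^sup>2" if S: "0 < S" "S < 1" for S
 proof -
  define \<psi> where "\<psi> x = (rad P (tp q S) x - rad P (tp q R) x) - ((S - R) * real q) * rad P (tp (q - 1) R) x" for x
  have c\<psi>: "continuous_on UNIV \<psi>" unfolding \<psi>_def by (intro continuous_intros c)
  have eq: "ip v \<psi> = ?F S - ?F R - complex_of_real (S - R) * ?D"
   unfolding \<psi>_def[abs_def]
   using ip_diff[OF v, of "\<lambda>x. rad P (tp q S) x - rad P (tp q R) x" "\<lambda>x. ((S - R) * real q) * rad P (tp (q - 1) R) x"]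
    ip_diff[OF v c c, of q S q R] by (simp add: ip_cmult continuous_intros c)
  have "\<bar>\<psi> x\<bar> \<le> B * (real q * real (q - 1) * (S - R)\<^sup>2)" if x: "x \<in> ball 0 1" for x
  proof -
   define \<rho> where "\<rho> = x \<bullet> x"
   have r: "0 \<le> \<rho>" using inner_self_less_1 by (simp add: \<rho>_def)
   define p where "p t = max 0 t ^ q" for t :: real
   define p' where "p' t = real q * max 0 t ^ (q - 1)" for t :: real
   have dp: "DERIV p t :> p' t" for t unfolding p_def p'_def by (rule tp_has_derivative[OF q])
   \<comment> \<open>Mean value point between \<open>R - \<rho>\<close> and
     \<open>S - \<rho>\<close>, in either order. The bound by 1 keeps the bases of the powers in the
     unit interval, where they are Lipschitz with constant \<open>q - 1\<close>.\<close>
   obtain \<xi> where xi: "p (S - \<rho>) - p (R - \<rho>) = (S - R) * p' \<xi>" "\<bar>\<xi> - (R - \<rho>)\<bar> \<le> \<bar>S - R\<bar>" "\<xi> \<le> 1"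
   proof (cases "S = R")
    case True
    thus ?thesis using that[of "R - \<rho>"] R r by simp
   next
    case False
    show ?thesis
    proof (cases "R < S")
     case True
     obtain z where "R - \<rho> < z" "z < S - \<rho>" "p (S - \<rho>) - p (R - \<rho>) = (S - \<rho> - (R - \<rho>)) * p' z"
      using MVT2[of "R - \<rho>" "S - \<rho>" p p'] dp True by auto
     thus ?thesis using that[of z] S r by auto
    next
     case F: False
     hence "S < R" using False by simp
     then obtain z where z: "S - \<rho> < z" "z < R - \<rho>" "p (R - \<rho>) - p (S - \<rho>) = (R - \<rho> - (S - \<rho>)) * p' z"
      using MVT2[of "S - \<rho>" "R - \<rho>" p p'] dp by auto
     hence "p (S - \<rho>) - p (R - \<rho>) = (S - R) * p' z" by (simp add: algebra_simps)
     thus ?thesis using that[of z] z R r by auto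
    qed
   qed
   have "\<bar>p' \<xi> - p' (R - \<rho>)\<bar> = real q * \<bar>max 0 \<xi> ^ (q - 1) - max 0 (R - \<rho>) ^ (q - 1)\<bar>"
    unfolding p'_def by (simp add: right_diff_distrib[symmetric] abs_mult)
   also have "\<bar>max 0 \<xi> ^ (q - 1) - max 0 (R - \<rho>) ^ (q - 1)\<bar> \<le> real (q - 1) * \<bar>max 0 \<xi> - max 0 (R - \<rho>)\<bar>"
    using norm_power_diff[of "max 0 \<xi>" "max 0 (R - \<rho>)" "q - 1"] xi(3) R r by auto
   also have "\<bar>max 0 \<xi> - max 0 (R - \<rho>)\<bar> \<le> \<bar>S - R\<bar>" using xi(2) by linarith
   finally have "\<bar>p' \<xi> - p' (R - \<rho>)\<bar> \<le> real q * (real (q - 1) * \<bar>S - R\<bar>)" by (simp add: mult_left_mono)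
   hence "\<bar>S - R\<bar> * \<bar>p' \<xi> - p' (R - \<rho>)\<bar> \<le> \<bar>S - R\<bar> * (real q * (real (q - 1) * \<bar>S - R\<bar>))"
    by (intro mult_left_mono) auto
   also have "\<dots> = real q * real (q - 1) * (S - R)\<^sup>2"
    by (simp add: power2_abs[of "S - R", symmetric] power2_eq_square del: power2_abs)
   finally have e: "\<bar>(S - R) * (p' \<xi> - p' (R - \<rho>))\<bar> \<le> real q * real (q - 1) * (S - R)\<^sup>2" by (simp add: abs_mult)
   have "\<psi> x = P x * ((p (S - \<rho>) - p (R - \<rho>)) - (S - R) * p' (R - \<rho>))"
    unfolding \<psi>_def rad_def tp_def p_def p'_def \<rho>_def by (simp add: algebra_simps)
   also have "\<dots> = P x * ((S - R) * (p' \<xi> - p' (R - \<rho>)))" unfolding xi(1) by (simp add: algebra_simps)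
   finally have "\<bar>\<psi> x\<bar> = \<bar>P x\<bar> * \<bar>(S - R) * (p' \<xi> - p' (R - \<rho>))\<bar>" by (simp only: abs_mult)
   also have "\<dots> \<le> B * (real q * real (q - 1) * (S - R)\<^sup>2)"
    using e B(1) B(2)[of x] x by (intro mult_mono) (auto simp del: abs_mult)
   finally show ?thesis .
  qed
  from norm_ip_le[OF v c\<psi> this] show ?thesis unfolding eq by (simp add: K_def mult_ac)
 qed
 show ?thesis unfolding has_vector_derivative_def has_derivative_within
 proof
  show "bounded_linear (\<lambda>x. x *\<^sub>R ?D)" by (rule bounded_linear_scaleR_left)
  show "((\<lambda>y. (1 / norm (y - R)) *\<^sub>R (?F y - (?F R + (y - R) *\<^sub>R ?D))) \<longlongrightarrow> 0) (at R)"
  proof (rule Lim_null_comparison[of _ "\<lambda>y. K * \<bar>y - R\<bar>"])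
   show "((\<lambda>y. K * \<bar>y - R\<bar>) \<longlongrightarrow> 0) (at R)" by (intro tendsto_eq_intros refl) auto
   have "norm ((1 / norm (y - R)) *\<^sub>R (?F y - (?F R + (y - R) *\<^sub>R ?D))) \<le> K * \<bar>y - R\<bar>"
    if y: "y \<noteq> R" "0 < y" "y < 1" for y
   proof -
    have "norm (?F y - (?F R + (y - R) *\<^sub>R ?D)) \<le> K * (y - R)\<^sup>2"
     using main[OF y(2,3)] by (simp add: scaleR_conv_of_real algebra_simps)
    hence "norm (?F y - (?F R + (y - R) *\<^sub>R ?D)) \<le> (K * \<bar>y - R\<bar>) * \<bar>y - R\<bar>"
     by (simp add: power2_eq_square mult.assoc)
    thus ?thesis using y(1) by (simp add: divide_simps)
   qed
   moreover have "\<forall>\<^sub>F y in at R. y \<noteq> R \<and> 0 < y \<and> y < 1"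
    using R eventually_at_in_open[of "{0<..<1}" R] by (auto simp: eventually_at_filter elim!: eventually_mono)
   ultimately show "\<forall>\<^sub>F y in at R. norm ((1 / norm (y - R)) *\<^sub>R (?F y - (?F R + (y - R) *\<^sub>R ?D))) \<le> K * \<bar>y - R\<bar>"
    by (auto elim!: eventually_mono)
  qed
 qed
qed

lemma AE_continuous_zero:
 fixes w :: "'a::euclidean_space => 'b::real_normed_vector"
 assumes c: "continuous_on UNIV w" and ae: "AE x in lebesgue. x \<in> ball 0 1 --> w x = 0" and x: "x \<in> ball 0 1"
 shows "w x = 0"
proof (rule ccontr)
 assume n: "w x \<noteq> 0"
 define S where "S = w -` (- {0}) \<inter> ball 0 1"
 have "open S" unfolding S_def using c by (intro open_Int open_vimage) auto
 moreover have "S \<noteq> {}" using n x by (auto simp: S_def)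
 ultimately have "\<not> negligible S" by (rule open_not_negligible)
 moreover have "S \<in> sets lebesgue" using borel_open[OF \<open>open S\<close>] by (simp add: sets_completionI_sets)
 hence "S \<in> null_sets lebesgue"
  using ae by (subst AE_iff_null_sets) (auto simp: S_def elim!: eventually_mono)
 ultimately show False by (simp add: negligible_iff_null_sets)
qed

lemma integral_continuous_pos:
 fixes w :: "'a::euclidean_space => real"
 assumes c: "continuous_on UNIV w" and n: "\<And>x. x \<in> ball 0 1 ==> w x \<ge> 0" and x: "x \<in> ball 0 1" "w x \<noteq> 0"
 shows "(LINT x:ball 0 1|lebesgue. w x) > 0"
proof -
 have i: "integrable lebesgue (\<lambda>x. indicator (ball 0 1) x *\<^sub>R w x)"
  using ubi_continuous_real[OF c] by (simp add: set_integrable_def)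
 have nn: "AE x in lebesgue. 0 \<le> indicator (ball 0 1) x *\<^sub>R w x" using n by (auto simp: indicator_def)
 have "(LINT x:ball 0 1|lebesgue. w x) \<ge> 0" unfolding set_lebesgue_integral_def by (rule integral_nonneg_AE[OF nn])
 moreover have "(LINT x:ball 0 1|lebesgue. w x) \<noteq> 0"
 proof
  assume "(LINT x:ball 0 1|lebesgue. w x) = 0"
  hence "AE x in lebesgue. indicator (ball 0 1) x *\<^sub>R w x = 0"
   using integral_nonneg_eq_0_iff_AE[OF i nn] by (simp add: set_lebesgue_integral_def)
  hence "AE x in lebesgue. x \<in> ball 0 1 --> w x = 0" by eventually_elim auto
  from AE_continuous_zero[OF c this x(1)] x(2) show False by simp
 qed
 ultimately show ?thesis by linarith
qed

lemma ip_laplacian: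
 fixes w :: "'a::euclidean_space => real"
 assumes t: "test_fun (ball 0 1) \<phi>" and w: "smooth w"
 shows "ip (cplx w) (laplacian \<phi>) = ip (cplx (laplacian w)) \<phi>"
proof -
 define W where "W = (cplx w)"
 have s: "smooth \<phi>" using test_fun_smooth[OF t] .
 have cont: "continuous_on UNIV (pd [i] (pd [i] f))" if "smooth f" "i \<in> Basis" for f :: "'a => real" and i
  using that by (intro smooth_continuous smooth_pd)
 have "ip W (laplacian \<phi>) = ip W (\<lambda>x. \<Sum>i\<in>Basis. pd [i] (pd [i] \<phi>) x)"
  by (simp add: laplacian_def[abs_def] pd_two)
 also have "\<dots> = (\<Sum>i\<in>Basis. ip W (pd [i] (pd [i] \<phi>)))" unfolding W_def
  by (rule ip_sum[OF ubi_continuous[OF smooth_continuous[OF w]] finite_Basis cont[OF s]])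
 also have "\<dots> = (\<Sum>i\<in>Basis. ip (cplx (pd [i] (pd [i] w))) \<phi>)"
 proof (rule sum.cong)
  fix i :: 'a assume i: "i \<in> Basis"
  have "ip W (pd [i] (pd [i] \<phi>)) = - ip (cplx (pd [i] w)) (pd [i] \<phi>)"
   unfolding W_def by (rule ip_by_parts(1)[OF test_fun_pd[OF t i] w i])
  also have "\<dots> = ip (cplx (pd [i] (pd [i] w))) \<phi>"
   by (subst ip_by_parts(1)[OF t smooth_pd[OF w i] i]) simp
  finally show "ip W (pd [i] (pd [i] \<phi>)) = ip (cplx (pd [i] (pd [i] w))) \<phi>" .
 qed simp
 also have "\<dots> = ip (\<lambda>x. \<Sum>i\<in>Basis. 1 * complex_of_real (pd [i] (pd [i] w) x)) \<phi>"
  by (subst ip_lincomb(1)) (auto intro: ubi_continuous[OF cont[OF w]] smooth_continuous[OF s])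
 finally show ?thesis by (simp add: W_def laplacian_def[abs_def] pd_two)
qed

section \<open>The regular radial solutions\<close>

definition bsol :: "real => real => real => real" where "bsol \<nu> \<kappa> \<rho> = bes \<nu> (\<kappa> * \<rho>)"
definition bsol1 :: "real => real => real => real" where "bsol1 \<nu> \<kappa> \<rho> = \<kappa> * bes' \<nu> (\<kappa> * \<rho>)"
definition bsol2 :: "real => real => real => real" where
 "bsol2 \<nu> \<kappa> \<rho> = \<kappa>\<^sup>2 * (bes (\<nu> + 2) (\<kappa> * \<rho>) / (16 * (\<nu> + 1) * (\<nu> + 2)))"

lemma bsol_derivative:
 assumes "\<nu> \<ge> 0"
 shows "DERIV (bsol \<nu> \<kappa>) s :> bsol1 \<nu> \<kappa> s" "DERIV (bsol1 \<nu> \<kappa>) s :> bsol2 \<nu> \<kappa> s"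
proof -
 have m: "DERIV (\<lambda>\<rho>. \<kappa> * \<rho>) s :> \<kappa>" by (auto intro!: derivative_eq_intros)
 show "DERIV (bsol \<nu> \<kappa>) s :> bsol1 \<nu> \<kappa> s" unfolding bsol_def[abs_def] bsol1_def
  using DERIV_chain2[OF bes_has_derivative[OF assms] m] by (simp add: mult.commute)
 show "DERIV (bsol1 \<nu> \<kappa>) s :> bsol2 \<nu> \<kappa> s" unfolding bsol1_def[abs_def] bsol2_def
  using DERIV_cmult[OF DERIV_chain2[OF bes'_has_derivative[OF assms] m], of \<kappa>]
  by (simp add: power2_eq_square mult_ac)
qed

lemma smooth_bsol: "\<nu> \<ge> 0 ==> smooth (bsol \<nu> \<kappa>)"
 unfolding bsol_def[abs_def] by (intro smooth_compose[OF smooth_bes] smooth_cmult smooth_real_id)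

lemma smooth_bsol1: "\<nu> \<ge> 0 ==> smooth (bsol1 \<nu> \<kappa>)"
 by (rule smooth_real_deriv[OF smooth_bsol bsol_derivative(1)])

lemma bsol_ode:
 assumes "\<nu> \<ge> 0"
 shows "4 * (\<nu> + 1) * bsol1 \<nu> \<kappa> \<rho> + 4 * \<rho> * bsol2 \<nu> \<kappa> \<rho> = - \<kappa> * bsol \<nu> \<kappa> \<rho>"
proof -
 have "4 * \<rho> * bsol2 \<nu> \<kappa> \<rho> = 4 * \<kappa> * (\<kappa> * \<rho> * (bes (\<nu> + 2) (\<kappa> * \<rho>) / (16 * (\<nu> + 1) * (\<nu> + 2))))"
  by (simp add: bsol2_def power2_eq_square)
 thus ?thesis unfolding bes_ode[OF assms] bsol1_def bsol_def by (simp add: algebra_simps)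
qed

lemma weak_sol_smooth:
 assumes w: "smooth w" "laplacian w = (\<lambda>x. - \<kappa> * w x)"
 shows "weak_sol \<kappa> (cplx w)"
 unfolding weak_sol_def
proof (intro allI impI)
 fix \<phi> :: "'a => real" assume t: "test_fun (ball 0 1) \<phi>"
 have s: "smooth \<phi>" using test_fun_smooth[OF t] .
 have "ip (cplx w) (\<lambda>x. laplacian \<phi> x + \<kappa> * \<phi> x)
   = ip (cplx (laplacian w)) \<phi> + of_real \<kappa> * ip (cplx w) \<phi>"
  by (subst ip_add) (auto intro!: ubi_continuous smooth_continuous w s smooth_laplacian smooth_cmult simp: ip_cmult ip_laplacian[OF t w(1)])
 moreover have "ip (cplx (laplacian w)) \<phi> = - of_real \<kappa> * ip (cplx w) \<phi>"
  unfolding w(2) ip_cmult_left[symmetric] by simp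
 ultimately show "ip (cplx w) (\<lambda>x. laplacian \<phi> x + \<kappa> * \<phi> x) = 0" by simp
qed

lemma laplacian_bsol:
 fixes P :: "'a::euclidean_space => real"
 assumes "DIM('a) \<ge> 2" "hpoly l P" "laplacian P = (\<lambda>x. 0)"
 shows "laplacian (rad P (bsol (sig TYPE('a) l) \<kappa>)) = (\<lambda>x. - \<kappa> * rad P (bsol (sig TYPE('a) l) \<kappa>) x)"
proof
 fix x
 have s: "sig TYPE('a) l \<ge> 0" using assms(1) by (rule sig_nonneg)
 show "laplacian (rad P (bsol (sig TYPE('a) l) \<kappa>)) x = - \<kappa> * rad P (bsol (sig TYPE('a) l) \<kappa>) x"
  unfolding laplacian_rad[OF assms(2,3) bsol_derivative[OF s] smooth_bsol1[OF s]] rad_def bsol_ode[OF s] by simp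
qed

text \<open>Gronwall's argument for the energy f^2 + g^2: the bound |E'| \<le> L E makes
  \<open>E * exp (- L * t)\<close> nonincreasing and \<open>E * exp (L * t)\<close> nondecreasing,
  which propagates the zero at \<open>r\<close> in both directions.\<close>

lemma linear_ode_unique:
 fixes f g \<alpha> \<beta> :: "real => real"
 assumes ab: "a \<le> b" "r \<in> {a..b}" and K: "\<And>t. t \<in> {a..b} ==> \<bar>\<alpha> t\<bar> \<le> K" "\<And>t. t \<in> {a..b} ==> \<bar>\<beta> t\<bar> \<le> K"
  and f: "\<And>t. t \<in> {a..b} ==> DERIV f t :> g t"
  and g: "\<And>t. t \<in> {a..b} ==> DERIV g t :> \<alpha> t * g t + \<beta> t * f t"
  and z: "f r = 0" "g r = 0" and t: "t \<in> {a..b}"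
 shows "f t = 0"
proof -
 define L where "L = 3 * (K + 1)"
 define E where "E t = (f t)\<^sup>2 + (g t)\<^sup>2" for t
 define E' where "E' t = 2 * f t * g t + 2 * g t * (\<alpha> t * g t + \<beta> t * f t)" for t
 have K0: "K \<ge> 0" using K(1)[OF ab(2)] by linarith
 have dE: "DERIV E t :> E' t" if "t \<in> {a..b}" for t
  unfolding E_def[abs_def] E'_def by (auto intro!: derivative_eq_intros f[OF that] g[OF that] simp: algebra_simps)
 have bE: "\<bar>E' t\<bar> \<le> L * E t" if "t \<in> {a..b}" for t
 proof -
  have fg: "2 * \<bar>f t * g t\<bar> \<le> E t" unfolding E_def abs_mult using sum_squares_bound[of "\<bar>f t\<bar>" "\<bar>g t\<bar>"] by simp
  have gE: "(g t)\<^sup>2 \<le> E t" "0 \<le> E t" by (auto simp: E_def)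
  have 1: "\<bar>\<alpha> t * (g t)\<^sup>2\<bar> \<le> K * E t" unfolding abs_mult using K(1)[OF that] gE K0 by (intro mult_mono) auto
  have "\<bar>\<beta> t * (2 * (f t * g t))\<bar> \<le> K * E t" unfolding abs_mult using K(2)[OF that] fg K0 by (intro mult_mono) (auto simp: abs_mult)
  moreover have "E' t = 2 * (f t * g t) + 2 * (\<alpha> t * (g t)\<^sup>2) + \<beta> t * (2 * (f t * g t))"
   by (simp add: E'_def power2_eq_square algebra_simps)
  moreover have "L * E t = 3 * (K * E t) + 3 * E t" by (simp add: L_def algebra_simps)
  ultimately show ?thesis using 1 fg gE by linarith
 qed
 have "E t \<le> 0"
 proof (cases "r \<le> t")
  case True
  have "E t * exp (- L * t) \<le> E r * exp (- L * r)"
  proof (rule DERIV_nonpos_imp_nonincreasing[OF True])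
   fix s assume s: "r \<le> s" "s \<le> t"
   hence s': "s \<in> {a..b}" using ab t by auto
   have "DERIV (\<lambda>s. E s * exp (- L * s)) s :> (E' s - L * E s) * exp (- L * s)"
    by (auto intro!: derivative_eq_intros dE[OF s'] simp: algebra_simps)
   moreover have "(E' s - L * E s) * exp (- L * s) \<le> 0" using bE[OF s'] by (intro mult_nonpos_nonneg) auto
   ultimately show "\<exists>y. DERIV (\<lambda>s. E s * exp (- L * s)) s :> y \<and> y \<le> 0" by blast
  qed
  hence "E t * exp (- L * t) \<le> 0" using z by (simp add: E_def)
  thus ?thesis by (simp add: mult_le_0_iff)
 next
  case False
  hence le: "t \<le> r" by simp
  have "E t * exp (L * t) \<le> E r * exp (L * r)"
  proof (rule DERIV_nonneg_imp_nondecreasing[OF le])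
   fix s assume s: "t \<le> s" "s \<le> r"
   hence s': "s \<in> {a..b}" using ab t by auto
   have "DERIV (\<lambda>s. E s * exp (L * s)) s :> (E' s + L * E s) * exp (L * s)"
    by (auto intro!: derivative_eq_intros dE[OF s'] simp: algebra_simps)
   moreover have "(E' s + L * E s) * exp (L * s) \<ge> 0" using bE[OF s'] by (intro mult_nonneg_nonneg) auto
   ultimately show "\<exists>y. DERIV (\<lambda>s. E s * exp (L * s)) s :> y \<and> 0 \<le> y" by blast
  qed
  hence "E t * exp (L * t) \<le> 0" using z by (simp add: E_def)
  thus ?thesis by (simp add: mult_le_0_iff)
 qed
 thus ?thesis unfolding E_def by (smt (verit) power2_less_0 zero_eq_power2 zero_le_power2)
qed

lemma vanishes_at_0_imp_le_0:
 fixes a K e :: real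
 assumes "e > 0" and "\<And>s. 0 < s ==> s < 1 ==> a \<le> K * s powr e"
 shows "a \<le> 0"
proof (rule tendsto_lowerbound)
 have "((\<lambda>s::real. s powr e) \<longlongrightarrow> 0) (at_right 0)"
  by (rule tendsto_zero_powrI[OF tendsto_ident_at tendsto_const]) (use assms(1) in \<open>auto simp: eventually_at_filter\<close>)
 thus "((\<lambda>s. K * s powr e) \<longlongrightarrow> 0) (at_right 0)" by (rule tendsto_mult_right_zero)
 show "\<forall>\<^sub>F s in at_right 0. a \<le> K * s powr e"
  unfolding eventually_at_right_field using assms(2) by (intro exI[of _ 1]) auto
qed simp

text \<open>For fixed \<open>q0\<close> both moments solve one second-order equation with a singular
  point at 0. Their Wronskian is a multiple of R^(q0 + \<nu>), but the bounds force O(R^(2 q0 - 1)),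
  which is of higher order because q0 > \<nu> + 1; hence it vanishes. Higher \<open>q\<close> follow
  by integration from 0.\<close>

lemma moment_proportional:
 fixes M N :: "nat => real => real"
 assumes dM: "\<And>q R. q \<ge> 2 ==> 0 < R ==> R < 1 ==> (M q has_real_derivative real q * M (q - 1) R) (at R)"
  and oM: "\<And>q R. q \<ge> 3 ==> 0 < R ==> R < 1 ==>
    \<kappa> * M q R - 4 * real q * (real q + \<nu>) * M (q - 1) R + 4 * R * real q * real (q - 1) * M (q - 2) R = 0"
  and bM: "\<And>q R. 0 < R ==> R < 1 ==> \<bar>M q R\<bar> \<le> C * R ^ q"
  and dN: "\<And>q R. q \<ge> 2 ==> 0 < R ==> R < 1 ==> (N q has_real_derivative real q * N (q - 1) R) (at R)"
  and oN: "\<And>q R. q \<ge> 3 ==> 0 < R ==> R < 1 ==>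
    \<kappa> * N q R - 4 * real q * (real q + \<nu>) * N (q - 1) R + 4 * R * real q * real (q - 1) * N (q - 2) R = 0"
  and bN: "\<And>q R. 0 < R ==> R < 1 ==> \<bar>N q R\<bar> \<le> C * R ^ q"
  and q0: "q0 \<ge> 3" "real q0 > \<nu> + 1" and \<nu>: "\<nu> \<ge> 0" and R0: "0 < R0" "R0 < 1"
  and q: "q \<ge> q0" and R: "0 < R" "R < 1"
 shows "N q0 R0 * M q R = M q0 R0 * N q R"
proof -
 define p where "p = real q0 + \<nu>"
 define Z where "Z q R = N q0 R0 * M q R - M q0 R0 * N q R" for q R
 define Z1 where "Z1 R = real q0 * Z (q0 - 1) R" for R
 have dZ: "(Z q has_real_derivative real q * Z (q - 1) R) (at R)" if "q \<ge> 2" "0 < R" "R < 1" for q R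
  unfolding Z_def by (rule DERIV_cong[OF DERIV_diff[OF DERIV_cmult[OF dM[OF that]] DERIV_cmult[OF dN[OF that]]]])
   (simp add: algebra_simps)
 have oM': "4 * R * real q0 * real (q0 - 1) * M (q0 - 2) R = 4 * real q0 * p * M (q0 - 1) R - \<kappa> * M q0 R"
  and oN': "4 * R * real q0 * real (q0 - 1) * N (q0 - 2) R = 4 * real q0 * p * N (q0 - 1) R - \<kappa> * N q0 R"
  if "0 < R" "R < 1" for R
  using oM[OF q0(1) that] oN[OF q0(1) that] unfolding p_def by linarith+
 have C0: "C \<ge> 0"
 proof -
  have "0 \<le> C * R0 ^ 0" using bM[OF R0, of 0] by (meson abs_ge_zero order_trans)
  thus ?thesis by simp
 qed
 have W0: "M q0 R0 * N (q0 - 1) R0 - M (q0 - 1) R0 * N q0 R0 = 0"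
 proof -
  define W where "W R = M q0 R * N (q0 - 1) R - M (q0 - 1) R * N q0 R" for R
  have dW: "(W has_real_derivative p / R * W R) (at R)" if R: "0 < R" "R < 1" for R
  proof -
   have q1: "q0 - 1 \<ge> 2" and q2: "q0 \<ge> 2" and e: "q0 - 1 - 1 = q0 - 2" using q0 by auto
   have 1: "(W has_real_derivative (M q0 R * (real (q0 - 1) * N (q0 - 2) R) - real (q0 - 1) * M (q0 - 2) R * N q0 R)) (at R)"
    unfolding W_def[abs_def]
    by (rule DERIV_cong[OF DERIV_diff[OF DERIV_mult[OF dM[OF q2 R] dN[OF q1 R, unfolded e]]
       DERIV_mult[OF dM[OF q1 R, unfolded e] dN[OF q2 R]]]])
     (simp add: algebra_simps)
   have "4 * R * real q0 * (M q0 R * (real (q0 - 1) * N (q0 - 2) R) - real (q0 - 1) * M (q0 - 2) R * N q0 R)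
     = M q0 R * (4 * R * real q0 * real (q0 - 1) * N (q0 - 2) R) - (4 * R * real q0 * real (q0 - 1) * M (q0 - 2) R) * N q0 R"
    by (simp add: algebra_simps)
   also have "\<dots> = 4 * real q0 * p * W R" unfolding oM'[OF R] oN'[OF R] W_def by (simp add: algebra_simps)
   finally have "4 * real q0 * (R * (M q0 R * (real (q0 - 1) * N (q0 - 2) R) - real (q0 - 1) * M (q0 - 2) R * N q0 R)) = 4 * real q0 * (p * W R)"
    by (simp add: mult_ac)
   moreover have "4 * real q0 \<noteq> 0" using q0 by simp
   ultimately have "R * (M q0 R * (real (q0 - 1) * N (q0 - 2) R) - real (q0 - 1) * M (q0 - 2) R * N q0 R) = p * W R" by simp
   hence "M q0 R * (real (q0 - 1) * N (q0 - 2) R) - real (q0 - 1) * M (q0 - 2) R * N q0 R = p / R * W R"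
    using R by (simp add: field_simps)
   with 1 show ?thesis by simp
  qed
  \<comment> \<open>By \<open>dW\<close>, the Wronskian divided by R^p is constant, so it can be
    evaluated as the argument tends to 0.\<close>
  define V where "V R = W R * R powr (- p)" for R
  have dV: "(V has_real_derivative 0) (at R)" if R: "0 < R" "R < 1" for R
  proof -
   have "((\<lambda>R. R powr (- p)) has_real_derivative - p * R powr (- p - 1)) (at R)"
    by (rule has_real_derivative_powr[OF R(1)])
   moreover have "R powr (- p - 1) = R powr (- p) / R" using R by (simp add: powr_diff)
   ultimately show ?thesis unfolding V_def[abs_def]
    by (intro DERIV_cong[OF DERIV_mult[OF dW[OF R]]]) auto
  qed
  have "\<bar>V R0\<bar> \<le> 2 * C\<^sup>2 * s powr (real q0 - 1 - \<nu>)" if s: "0 < s" "s < 1" for s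
  proof -
   have "V R0 = V s" by (rule DERIV_isconst3[of 0 1]) (use s R0 dV in auto)
   have pr: "\<bar>x * y\<bar> \<le> C\<^sup>2 * s ^ (q0 + (q0 - 1))"
    if "\<bar>x\<bar> \<le> C * s ^ a" "\<bar>y\<bar> \<le> C * s ^ b" "a + b = q0 + (q0 - 1)" for x y a b
   proof -
    have "\<bar>x\<bar> * \<bar>y\<bar> \<le> (C * s ^ a) * (C * s ^ b)" using that s C0 by (intro mult_mono) auto
    also have "\<dots> = C\<^sup>2 * s ^ (a + b)" by (simp add: power_add power2_eq_square mult_ac)
    finally show ?thesis unfolding abs_mult that(3) .
   qed
   have "\<bar>W s\<bar> \<le> \<bar>M q0 s * N (q0 - 1) s\<bar> + \<bar>M (q0 - 1) s * N q0 s\<bar>" unfolding W_def by linarith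
   also have "\<dots> \<le> 2 * C\<^sup>2 * s ^ (q0 + (q0 - 1))"
    using pr[OF bM[OF s, of q0] bN[OF s, of "q0 - 1"] refl] pr[OF bM[OF s, of "q0 - 1"] bN[OF s, of q0] add.commute] by linarith
   finally have "\<bar>V s\<bar> \<le> 2 * C\<^sup>2 * s ^ (q0 + (q0 - 1)) * s powr (- p)"
    unfolding V_def abs_mult by (simp add: mult_right_mono)
   also have "\<dots> = 2 * C\<^sup>2 * (s powr real (q0 + (q0 - 1)) * s powr (- p))" using s by (simp only: powr_realpow mult.assoc)
   also have "s powr real (q0 + (q0 - 1)) * s powr (- p) = s powr (real q0 - 1 - \<nu>)"
    using q0 by (simp add: p_def flip: powr_add) (simp add: algebra_simps)
   finally show ?thesis using \<open>V R0 = V s\<close> by simp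
  qed
  hence "\<bar>V R0\<bar> \<le> 0" by (rule vanishes_at_0_imp_le_0[rotated]) (use q0 in auto)
  thus ?thesis using R0 by (simp add: V_def W_def)
 qed
 have Zq0: "Z q0 R = 0" if R: "0 < R" "R < 1" for R
 proof -
  \<comment> \<open>The interval joins \<open>R\<close> to \<open>R0\<close> and stays away from the
    singular point 0, so the coefficients of the equation are bounded on it.\<close>
  define a where "a = min R R0" define b where "b = max R R0"
  define K where "K = (p + \<bar>\<kappa>\<bar>) / a"
  have ab: "0 < a" "a \<le> b" "b < 1" "R0 \<in> {a..b}" "R \<in> {a..b}" using R R0 by (auto simp: a_def b_def)
  have p0: "p \<ge> 0" using \<nu> by (simp add: p_def)
  show ?thesis
  proof (rule linear_ode_unique[OF ab(2,4), of "\<lambda>t. p / t" K "\<lambda>t. - \<kappa> / (4 * t)" "Z q0" Z1 R])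
   fix t assume t: "t \<in> {a..b}"
   hence t0: "0 < t" "t < 1" "a \<le> t" using ab by auto
   have "\<bar>p / t\<bar> \<le> p / a" using t0 p0 ab by (simp add: frac_le)
   also have "\<dots> \<le> K" using ab by (simp add: K_def divide_right_mono)
   finally show "\<bar>p / t\<bar> \<le> K" .
   have "\<bar>- \<kappa> / (4 * t)\<bar> \<le> \<bar>\<kappa>\<bar> / a" using t0 ab by (simp add: frac_le)
   also have "\<dots> \<le> K" using ab p0 by (simp add: K_def divide_right_mono)
   finally show "\<bar>- \<kappa> / (4 * t)\<bar> \<le> K" .
   show "DERIV (Z q0) t :> Z1 t" unfolding Z1_def using dZ[of q0 t] t0 q0 by simp
   have q1: "q0 - 1 \<ge> 2" and e: "q0 - 1 - 1 = q0 - 2" using q0 by auto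
   have 1: "DERIV Z1 t :> real q0 * (real (q0 - 1) * Z (q0 - 2) t)"
    unfolding Z1_def[abs_def] using DERIV_cmult[OF dZ[OF q1 t0(1,2)]] unfolding e .
   have "4 * t * real q0 * real (q0 - 1) * Z (q0 - 2) t = 4 * p * Z1 t - \<kappa> * Z q0 t"
   proof -
    have "4 * t * real q0 * real (q0 - 1) * Z (q0 - 2) t
      = N q0 R0 * (4 * t * real q0 * real (q0 - 1) * M (q0 - 2) t) - M q0 R0 * (4 * t * real q0 * real (q0 - 1) * N (q0 - 2) t)"
     by (simp add: Z_def algebra_simps)
    thus ?thesis unfolding oM'[OF t0(1,2)] oN'[OF t0(1,2)] by (simp add: Z_def Z1_def algebra_simps)
   qed
   hence "real q0 * (real (q0 - 1) * Z (q0 - 2) t) = p / t * Z1 t + - \<kappa> / (4 * t) * Z q0 t"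
    using t0 by (simp add: field_simps)
   with 1 show "DERIV Z1 t :> p / t * Z1 t + - \<kappa> / (4 * t) * Z q0 t" by simp
  next
   show "Z q0 R0 = 0" by (simp add: Z_def)
   have "N q0 R0 * M (q0 - 1) R0 - M q0 R0 * N (q0 - 1) R0 = 0" using W0 by (simp add: algebra_simps)
   thus "Z1 R0 = 0" by (simp add: Z1_def Z_def)
  qed (use ab in auto)
 qed
 have "\<forall>R. 0 < R --> R < 1 --> Z q R = 0"
  using q
 proof (induction q rule: dec_induct)
  case base
  thus ?case using Zq0 by blast
 next
  \<comment> \<open>The derivative of \<open>Z (Suc q)\<close> is a multiple of \<open>Z q\<close>,
    which is 0, so \<open>Z (Suc q)\<close> is constant; its bound by a multiple of \<open>s\<close>
    for small \<open>s\<close> makes the constant 0.\<close>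
  case (step q)
  define D where "D = (\<bar>N q0 R0\<bar> + \<bar>M q0 R0\<bar>) * C"
  show ?case
  proof (intro allI impI)
   fix R :: real assume R: "0 < R" "R < 1"
   have "\<bar>Z (Suc q) R\<bar> \<le> D * s powr 1" if s: "0 < s" "s < 1" for s
   proof -
    have "Z (Suc q) R = Z (Suc q) s"
     by (rule DERIV_isconst3[of 0 1]) (use s R dZ[of "Suc q"] step q0 in auto)
    have sq: "s ^ Suc q \<le> s" using s power_decreasing[of 1 "Suc q" s] by simp
    have b: "\<bar>x * y\<bar> \<le> \<bar>x\<bar> * (C * s)" if "\<bar>y\<bar> \<le> C * s ^ Suc q" for x y
    proof -
     have "\<bar>y\<bar> \<le> C * s" using that mult_left_mono[OF sq C0] by linarith
     thus ?thesis unfolding abs_mult by (rule mult_left_mono) simp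
    qed
    have "\<bar>Z (Suc q) s\<bar> \<le> \<bar>N q0 R0 * M (Suc q) s\<bar> + \<bar>M q0 R0 * N (Suc q) s\<bar>" unfolding Z_def by linarith
    also have "\<dots> \<le> \<bar>N q0 R0\<bar> * (C * s) + \<bar>M q0 R0\<bar> * (C * s)" using b[OF bM[OF s]] b[OF bN[OF s]] by (rule add_mono)
    also have "\<dots> = D * s powr 1" using s by (simp add: D_def algebra_simps)
    finally show ?thesis using \<open>Z (Suc q) R = Z (Suc q) s\<close> by simp
   qed
   hence "\<bar>Z (Suc q) R\<bar> \<le> 0" by (rule vanishes_at_0_imp_le_0[rotated]) auto
   thus "Z (Suc q) R = 0" by simp
  qed
 qed
 thus ?thesis using R by (simp add: Z_def)
qed

lemma tp_bounds: "0 \<le> \<rho> ==> 0 \<le> R ==> 0 \<le> tp q R \<rho> \<and> tp q R \<rho> \<le> R ^ q"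
 by (auto simp: tp_def intro!: power_mono)

text \<open>Letting \<open>R\<close> tend to 1 gives vanishing against (1 - \<rho>)^q for all q
  \<ge> q0, hence against every polynomial divisible by (1 - \<rho>)^q0. Such polynomials
  approximate an arbitrary one boundedly and pointwise in the open ball.\<close>

lemma moments_vanish:
 fixes P :: "'a::euclidean_space => real"
 assumes P: "continuous_on UNIV P" and w: "ubi w" and q0: "q0 > 0"
  and z: "\<And>q R. q \<ge> q0 ==> 0 < R ==> R < 1 ==> ip w (rad P (tp q R)) = 0"
 shows "ip w (rad P (poly p)) = 0"
proof -
 obtain B where B: "B > 0" "\<And>x. x \<in> cball 0 1 ==> norm (P x) \<le> B" using continuous_bounded_ball[OF P] by blast
 have poly: "continuous_on UNIV (\<lambda>\<rho>. poly p (f \<rho>))" if "continuous_on UNIV f" for p :: "real poly" and f :: "real => real"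
  using that by (rule continuous_on_poly)
 have 1: "ip w (rad P (\<lambda>\<rho>. (1 - \<rho>) ^ q)) = 0" if q: "q \<ge> q0" for q
 proof -
  define R where "R k = 1 - 1 / real (Suc (Suc k))" for k
  have R: "0 < R k" "R k < 1" for k by (auto simp: R_def)
  have Rl: "R \<longlonglongrightarrow> 1"
  proof -
   have "(\<lambda>k. 1 / real (Suc (Suc k))) \<longlonglongrightarrow> 0" using LIMSEQ_Suc[OF inverse_Suc_tendsto_0] by (simp add: inverse_eq_divide)
   from tendsto_diff[OF tendsto_const this, of 1] show ?thesis by (simp add: R_def[abs_def])
  qed
  have "(\<lambda>k. ip w (rad P (tp q (R k)))) \<longlonglongrightarrow> ip w (rad P (tp q 1))"
  proof (rule ip_dominated[OF w, of _ _ B])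
   fix k and x :: 'a assume x: "x \<in> ball 0 1"
   have "tp q (R k) (x \<bullet> x) \<le> 1" "0 \<le> tp q (R k) (x \<bullet> x)"
    using tp_bounds[of "x \<bullet> x" "R k" q] R[of k] power_le_one[of "R k" q] by auto
   hence "\<bar>P x\<bar> * \<bar>tp q (R k) (x \<bullet> x)\<bar> \<le> B * 1" using B x by (intro mult_mono) auto
   thus "\<bar>rad P (tp q (R k)) x\<bar> \<le> B" by (simp add: rad_def abs_mult)
  next
   fix x :: 'a
   show "(\<lambda>k. rad P (tp q (R k)) x) \<longlonglongrightarrow> rad P (tp q 1) x"
    unfolding rad_def tp_def by (intro tendsto_intros Rl)
  qed (intro continuous_rad P continuous_tp)+
  hence "ip w (rad P (tp q 1)) = 0" using z[OF q R] by (simp add: LIMSEQ_const_iff)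
  moreover have "ip w (rad P (tp q 1)) = ip w (rad P (\<lambda>\<rho>. (1 - \<rho>) ^ q))"
   by (rule ip_cong) (use inner_self_less_1 in \<open>force simp: rad_def tp_def max_def\<close>)
  ultimately show ?thesis by simp
 qed
 have 2: "ip w (rad P (\<lambda>\<rho>. (1 - \<rho>) ^ q0 * poly r (1 - \<rho>))) = 0" for r :: "real poly"
 proof -
  have e: "rad P (\<lambda>\<rho>. (1 - \<rho>) ^ q0 * poly r (1 - \<rho>)) = (\<lambda>x. \<Sum>i\<le>degree r. coeff r i * rad P (\<lambda>\<rho>. (1 - \<rho>) ^ (q0 + i)) x)"
   by (auto simp: rad_def poly_altdef sum_distrib_left power_add mult_ac)
  have "ip w (rad P (\<lambda>\<rho>. (1 - \<rho>) ^ q0 * poly r (1 - \<rho>))) = (\<Sum>i\<le>degree r. ip w (\<lambda>x. coeff r i * rad P (\<lambda>\<rho>. (1 - \<rho>) ^ (q0 + i)) x))"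
   unfolding e by (rule ip_sum[OF w]) (auto intro!: continuous_intros continuous_rad P)
  also have "\<dots> = 0" by (rule sum.neutral) (simp add: ip_cmult 1)
  finally show ?thesis .
 qed
 \<comment> \<open>With y = (1 - \<rho>)^q0, the factor 1 - (1 - y)^N is divisible by y and tends to
   1 for 0 < y \<le> 1; this removes the divisibility requirement in the limit.\<close>
 define g where "g N \<rho> = poly p \<rho> * (1 - (1 - (1 - \<rho>) ^ q0) ^ N)" for N \<rho>
 have cg: "continuous_on UNIV (g N)" for N unfolding g_def by (intro continuous_intros poly)
 have g0: "ip w (rad P (g N)) = 0" for N
 proof -
  have "g N \<rho> = (1 - \<rho>) ^ q0 * poly (pcompose p [:1, -1:] * (\<Sum>i<N. (1 - monom 1 q0) ^ i)) (1 - \<rho>)" for \<rho>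
   unfolding g_def one_diff_power_eq[of "1 - (1 - \<rho>) ^ q0" N] by (simp add: poly_pcompose poly_sum poly_monom)
  hence "g N = (\<lambda>\<rho>. (1 - \<rho>) ^ q0 * poly (pcompose p [:1, -1:] * (\<Sum>i<N. (1 - monom 1 q0) ^ i)) (1 - \<rho>))" by blast
  thus ?thesis using 2 by (simp only:)
 qed
 have "compact (poly p ` {0..1})" by (intro compact_continuous_image continuous_on_poly continuous_intros) auto
 then obtain D where D: "D > 0" "\<And>\<rho>. \<rho> \<in> {0..1} ==> \<bar>poly p \<rho>\<bar> \<le> D"
  by (auto dest!: compact_imp_bounded simp: bounded_pos)
 have "(\<lambda>N. ip w (rad P (g N))) \<longlonglongrightarrow> ip w (rad P (poly p))"
 proof (rule ip_dominated[OF w, of _ _ "B * (D * 1)"])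
  fix N and x :: 'a assume x: "x \<in> ball 0 1"
  have r: "0 \<le> x \<bullet> x" "x \<bullet> x < 1" using inner_self_less_1(1)[OF x] by auto
  have "0 \<le> (1 - x \<bullet> x) ^ q0" "(1 - x \<bullet> x) ^ q0 \<le> 1" using r by (auto intro!: power_le_one)
  hence "0 \<le> (1 - (1 - x \<bullet> x) ^ q0) ^ N" "(1 - (1 - x \<bullet> x) ^ q0) ^ N \<le> 1" by (auto intro!: power_le_one)
  hence "\<bar>g N (x \<bullet> x)\<bar> \<le> D * 1" unfolding g_def abs_mult using D r by (intro mult_mono) auto
  thus "\<bar>rad P (g N) x\<bar> \<le> B * (D * 1)" unfolding rad_def abs_mult using B x by (intro mult_mono) auto
 next
  fix x :: 'a assume x: "x \<in> ball 0 1"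
  have r: "0 \<le> x \<bullet> x" "x \<bullet> x < 1" using inner_self_less_1(1)[OF x] by auto
  have "0 < (1 - x \<bullet> x) ^ q0" "(1 - x \<bullet> x) ^ q0 \<le> 1" using r by (auto intro!: power_le_one)
  hence "(\<lambda>N. (1 - (1 - x \<bullet> x) ^ q0) ^ N) \<longlonglongrightarrow> 0" by (intro LIMSEQ_power_zero) simp
  hence "(\<lambda>N. P x * (poly p (x \<bullet> x) * (1 - (1 - (1 - x \<bullet> x) ^ q0) ^ N))) \<longlonglongrightarrow> P x * (poly p (x \<bullet> x) * (1 - 0))"
   by (intro tendsto_mult tendsto_const tendsto_diff)
  thus "(\<lambda>N. rad P (g N) x) \<longlonglongrightarrow> rad P (poly p) x" by (simp add: rad_def g_def)
 qed (intro continuous_rad P cg continuous_on_poly continuous_intros)+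
 thus ?thesis using g0 by (simp add: LIMSEQ_const_iff)
qed

lemma moment_bound:
 assumes P: "continuous_on UNIV P" and v: "ubi v"
 shows "\<exists>C\<ge>0. \<forall>q R. 0 < R --> R < 1 --> norm (ip v (rad P (tp q R))) \<le> C * R ^ q"
proof -
 obtain B where B: "B > 0" "\<And>x. x \<in> cball 0 1 ==> norm (P x) \<le> B" using continuous_bounded_ball[OF P] by blast
 have m: "0 \<le> mass v" unfolding mass_def set_lebesgue_integral_def by (rule integral_nonneg_AE) auto
 have "norm (ip v (rad P (tp q R))) \<le> (B * mass v) * R ^ q" if R: "0 < R" "R < 1" for q R
 proof -
  have "norm (ip v (rad P (tp q R))) \<le> (B * R ^ q) * mass v"
  proof (rule norm_ip_le[OF v continuous_rad[OF P continuous_tp]])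
   fix x :: 'a assume x: "x \<in> ball 0 1"
   show "\<bar>rad P (tp q R) x\<bar> \<le> B * R ^ q"
    unfolding rad_def abs_mult using tp_bounds[of "x \<bullet> x" R q] B x R by (intro mult_mono) auto
  qed
  thus ?thesis by (simp add: mult_ac)
 qed
 thus ?thesis using B m by (intro exI[of _ "B * mass v"]) auto
qed

lemma moments_real:
 fixes P :: "'a::euclidean_space => real"
 assumes T: "T = Re \<or> T = Im" and P: "hpoly l P" "laplacian P = (\<lambda>x. 0)" and v: "ubi v" "weak_sol \<kappa> v"
 shows "q \<ge> 2 ==> 0 < R ==> R < 1 ==>
   ((\<lambda>R. T (ip v (rad P (tp q R)))) has_real_derivative real q * T (ip v (rad P (tp (q - 1) R)))) (at R)"
  and "q \<ge> 3 ==> 0 < R ==> R < 1 ==>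
   \<kappa> * T (ip v (rad P (tp q R))) - 4 * real q * (real q + sig TYPE('a) l) * T (ip v (rad P (tp (q - 1) R)))
    + 4 * R * real q * real (q - 1) * T (ip v (rad P (tp (q - 2) R))) = 0"
proof -
 have bl: "bounded_linear T" using T bounded_linear_Re bounded_linear_Im by auto
 have lin: "T (complex_of_real r * z) = r * T z" for r z using T by auto
 show "((\<lambda>R. T (ip v (rad P (tp q R)))) has_real_derivative real q * T (ip v (rad P (tp (q - 1) R)))) (at R)"
  if "q \<ge> 2" "0 < R" "R < 1"
  using bounded_linear.has_vector_derivative[OF bl ip_tp_has_derivative[OF smooth_continuous[OF hpoly_smooth[OF P(1)]] v(1) that]]
   lin[of "real q"] by (simp add: has_real_derivative_iff_has_vector_derivative)
 assume q: "q \<ge> 3" and R: "0 < R" "R < 1"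
 have "complex_of_real \<kappa> * ip v (rad P (tp q R)) - complex_of_real (4 * real q * (real q + sig TYPE('a) l)) * ip v (rad P (tp (q - 1) R))
   + complex_of_real (4 * R * real q * real (q - 1)) * ip v (rad P (tp (q - 2) R)) = 0"
  using tp_ode[OF P v R(1) less_imp_le[OF R(2)] q] by simp
 from arg_cong[OF this, of T] show "\<kappa> * T (ip v (rad P (tp q R))) - 4 * real q * (real q + sig TYPE('a) l) * T (ip v (rad P (tp (q - 1) R)))
    + 4 * R * real q * real (q - 1) * T (ip v (rad P (tp (q - 2) R))) = 0"
  unfolding linear_diff[OF bounded_linear.linear[OF bl]] linear_add[OF bounded_linear.linear[OF bl]] lin linear_0[OF bounded_linear.linear[OF bl]] .
qed

definition usol :: "real => nat => ('a::euclidean_space => real) => 'a => real" where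
 "usol \<kappa> l P = rad P (bsol (sig TYPE('a) l) \<kappa>)"

lemma usol_smooth: "DIM('a::euclidean_space) \<ge> 2 ==> hpoly l (P :: 'a => real) ==> smooth (usol \<kappa> l P)"
 unfolding usol_def by (intro smooth_rad hpoly_smooth smooth_bsol sig_nonneg)

text \<open>Testing a weak solution against \<open>P(x) (R - |x|\<^sup>2)\<^sub>+\<^sup>q\<close> gives functions of \<open>R\<close> obeying a second-order linear ODE with a
 singular point at \<open>0\<close>. Only one solution of that ODE (up to scaling) is \<open>O(R\<^sup>q)\<close>, namely the one given by the Bessel solution.\<close>

lemma weak_sol_component:
 fixes P :: "'a::euclidean_space => real"
 assumes dim: "DIM('a) \<ge> 2" and P: "hpoly l P" "laplacian P = (\<lambda>x. 0)" and nz: "P y \<noteq> 0"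
 shows "\<exists>\<psi>. continuous_on UNIV \<psi> \<and> ip (cplx (usol \<kappa> l P)) \<psi> \<noteq> 0 \<and>
  (\<forall>v p. ubi v --> weak_sol \<kappa> v -->
    ip (cplx (usol \<kappa> l P)) \<psi> * ip v (rad P (poly p)) =
    ip v \<psi> * ip (cplx (usol \<kappa> l P)) (rad P (poly p)))"
proof -
 define \<nu> where "\<nu> = sig TYPE('a) l"
 have \<nu>: "\<nu> \<ge> 0" unfolding \<nu>_def by (rule sig_nonneg[OF dim])
 define w where "w = usol \<kappa> l P"
 define u where "u = (cplx w)"
 have ws: "smooth w" unfolding w_def by (rule usol_smooth[OF dim P(1)])
 have uu: "ubi u" unfolding u_def by (intro ubi_continuous smooth_continuous ws)
 have uw: "weak_sol \<kappa> u" unfolding u_def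
  by (rule weak_sol_smooth[OF ws]) (unfold w_def usol_def, rule laplacian_bsol[OF dim P])
 have cP: "continuous_on UNIV P" by (intro smooth_continuous hpoly_smooth[OF P(1)])
 have cPt: "continuous_on UNIV (rad P (tp q R))" for q R by (intro continuous_rad cP continuous_tp)
 \<comment> \<open>Large enough both for the recursion, which starts at 3, and for the comparison of
   orders at 0, which needs more than \<nu> + 1.\<close>
 define q0 where "q0 = nat \<lceil>\<nu> + 3\<rceil>"
 have q0: "q0 \<ge> 3" "real q0 > \<nu> + 1" using \<nu> unfolding q0_def by linarith+
 \<comment> \<open>The profile is 1 at the origin, so it is positive on a small interval; there the
   moment of the Bessel solution integrates a nonnegative function and can serve as a nonzero
   denominator.\<close>
 obtain R0 where R0: "0 < R0" "R0 < 1" "\<And>\<rho>. 0 \<le> \<rho> ==> \<rho> < R0 ==> bsol \<nu> \<kappa> \<rho> > 0"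
 proof -
  have "isCont (bsol \<nu> \<kappa>) 0" using bsol_derivative(1)[OF \<nu>] DERIV_isCont by blast
  hence "eventually (\<lambda>\<rho>. bsol \<nu> \<kappa> \<rho> > 0) (at 0)"
   unfolding isCont_def by (rule order_tendstoD) (simp add: bsol_def bes_0)
  then obtain d where d: "d > 0" "\<And>\<rho>. \<rho> \<noteq> 0 ==> dist \<rho> 0 < d ==> bsol \<nu> \<kappa> \<rho> > 0"
   unfolding eventually_at by blast
  show ?thesis
  proof (rule that[of "min d (1/2)"])
   fix \<rho> :: real assume "0 \<le> \<rho>" "\<rho> < min d (1/2)"
   thus "bsol \<nu> \<kappa> \<rho> > 0" using d(2)[of \<rho>] by (cases "\<rho> = 0") (auto simp: bsol_def bes_0)
  qed (use d in auto)
 qed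
 define N where "N q R = Re (ip u (rad P (tp q R)))" for q R
 have uN: "ip u (rad P (tp q R)) = of_real (N q R)" for q R unfolding N_def u_def ip_real by simp
 have N0: "N q0 R0 > 0"
 proof -
  define f where "f x = w x * rad P (tp q0 R0) x" for x
  have f: "f x = (P x)\<^sup>2 * (bsol \<nu> \<kappa> (x \<bullet> x) * tp q0 R0 (x \<bullet> x))" for x
   by (simp add: f_def w_def usol_def rad_def \<nu>_def power2_eq_square)
  have bt: "bsol \<nu> \<kappa> \<rho> * tp q0 R0 \<rho> \<ge> 0" if "\<rho> \<ge> 0" for \<rho>
   using R0(3)[OF that] q0(1) by (cases "\<rho> < R0") (auto simp: tp_def max_def power_0_left)
  have "0 < (LINT x:ball 0 1|lebesgue. f x)"
  proof (rule integral_continuous_pos)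
   show "continuous_on UNIV f" unfolding f_def[abs_def] by (intro continuous_intros cPt smooth_continuous ws)
   show "f x \<ge> 0" for x unfolding f by (intro mult_nonneg_nonneg bt) auto
   \<comment> \<open>Scales \<open>y\<close> into the ball of radius \<open>R0\<close>; homogeneity
     keeps \<open>P\<close> nonzero there.\<close>
   define t where "t = R0 / (1 + norm y)"
   have ny: "1 + norm y > 0" "norm y < 1 + norm y" by (simp_all add: add_pos_nonneg)
   have t: "t > 0" unfolding t_def using R0(1) ny(1) by (rule divide_pos_pos)
   have "t * norm y < t * (1 + norm y)" using t ny(2) by (rule mult_strict_left_mono[rotated])
   also have "\<dots> = R0" using ny(1) by (simp add: t_def)
   finally have ty: "t * norm y < R0" .
   have nt: "norm (t *\<^sub>R y) < R0" using t ty by simp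
   thus "t *\<^sub>R y \<in> ball 0 1" using R0 by simp
   have "(norm (t *\<^sub>R y))\<^sup>2 < R0\<^sup>2" using nt by (intro power_strict_mono) auto
   moreover have "R0\<^sup>2 < R0" using R0 by (simp add: power2_eq_square)
   ultimately have yy: "(t *\<^sub>R y) \<bullet> (t *\<^sub>R y) < R0" by (simp only: power2_norm_eq_inner)
   have "P (t *\<^sub>R y) = t ^ l * P y" using hpoly_homogeneous[OF P(1)] by simp
   hence "P (t *\<^sub>R y) \<noteq> 0" using t nz by simp
   moreover have "bsol \<nu> \<kappa> ((t *\<^sub>R y) \<bullet> (t *\<^sub>R y)) > 0" by (rule R0(3)[OF inner_ge_zero yy])
   moreover have "tp q0 R0 ((t *\<^sub>R y) \<bullet> (t *\<^sub>R y)) \<noteq> 0" using yy by (simp add: tp_def max_def)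
   ultimately show "f (t *\<^sub>R y) \<noteq> 0" unfolding f by simp
  qed
  thus ?thesis unfolding N_def u_def ip_real f_def by simp
 qed
 define \<psi> where "\<psi> = rad P (tp q0 R0)"
 have key: "ip u \<psi> * ip v (rad P (poly p)) = ip v \<psi> * ip u (rad P (poly p))" if v: "ubi v" "weak_sol \<kappa> v" for v p
 proof -
  define M where "M q R = ip v (rad P (tp q R))" for q R
  obtain C1 where C1: "\<And>q R. 0 < R ==> R < 1 ==> norm (M q R) \<le> C1 * R ^ q"
   using moment_bound[OF cP v(1)] by (auto simp: M_def)
  obtain C2 where C2: "\<And>q R. 0 < R ==> R < 1 ==> norm (ip u (rad P (tp q R))) \<le> C2 * R ^ q"
   using moment_bound[OF cP uu] by auto
  define C where "C = max C1 C2"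
  have bN: "\<bar>N q R\<bar> \<le> C * R ^ q" if "0 < R" "R < 1" for q R
  proof -
   have "C2 * R ^ q \<le> C * R ^ q" using that by (intro mult_right_mono) (auto simp: C_def)
   thus ?thesis using C2[OF that, of q] unfolding uN norm_of_real by linarith
  qed
  have bM: "norm (M q R) \<le> C * R ^ q" if "0 < R" "R < 1" for q R
  proof -
   have "C1 * R ^ q \<le> C * R ^ q" using that by (intro mult_right_mono) (auto simp: C_def)
   thus ?thesis using C1[OF that, of q] by linarith
  qed
  have prp: "N q0 R0 * T (M q R) = T (M q0 R0) * N q R" if T: "T = Re \<or> T = Im" and q: "q \<ge> q0" and R: "0 < R" "R < 1" for T q R
  proof (rule moment_proportional[where M = "\<lambda>q R. T (M q R)" and N = N and \<nu> = \<nu> and \<kappa> = \<kappa> and C = C])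
   fix q R assume R: "(0::real) < R" "R < 1"
   show "\<bar>T (M q R)\<bar> \<le> C * R ^ q" using bM[OF R, of q] T abs_Re_le_cmod[of "M q R"] abs_Im_le_cmod[of "M q R"] by auto
   show "\<bar>N q R\<bar> \<le> C * R ^ q" by (rule bN[OF R])
   show "((\<lambda>R. T (M q R)) has_real_derivative real q * T (M (q - 1) R)) (at R)" if "q \<ge> 2"
    unfolding M_def by (rule moments_real(1)[OF T P v that R])
   show "(N q has_real_derivative real q * N (q - 1) R) (at R)" if "q \<ge> 2"
    unfolding N_def[abs_def] by (rule moments_real(1)[OF _ P uu uw that R]) simp
   show "\<kappa> * T (M q R) - 4 * real q * (real q + \<nu>) * T (M (q - 1) R) + 4 * R * real q * real (q - 1) * T (M (q - 2) R) = 0"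
    if "q \<ge> 3" unfolding M_def \<nu>_def by (rule moments_real(2)[OF T P v that R])
   show "\<kappa> * N q R - 4 * real q * (real q + \<nu>) * N (q - 1) R + 4 * R * real q * real (q - 1) * N (q - 2) R = 0"
    if "q \<ge> 3" unfolding N_def \<nu>_def by (rule moments_real(2)[OF _ P uu uw that R]) simp
  qed (use q0 \<nu> R0 q R in auto)
  \<comment> \<open>The combination of the weak solution and the Bessel solution whose truncated
    moments vanish from \<open>q0\<close> on, so that all its polynomial moments vanish.\<close>
  define z where "z x = ip u \<psi> * v x - ip v \<psi> * u x" for x
  have ipz: "ip z \<eta> = ip u \<psi> * ip v \<eta> - ip v \<psi> * ip u \<eta>" if "continuous_on UNIV \<eta>" for \<eta>
   unfolding z_def by (subst ip_diff_left) (auto intro!: v(1) uu that simp: ip_cmult_left)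
  have uz: "ubi z" unfolding z_def by (intro set_integral_diff set_integrable_mult_right v(1) uu)
  have "ip z (rad P (poly p)) = 0"
  proof (rule moments_vanish[OF cP uz, of q0])
   fix q R assume q: "q \<ge> q0" and R: "(0::real) < R" "R < 1"
   show "ip z (rad P (tp q R)) = 0"
    unfolding ipz[OF cPt] \<psi>_def uN M_def[symmetric]
    using prp[OF _ q R, of Re] prp[OF _ q R, of Im] by (simp add: complex_eq_iff)
  qed (use q0 in auto)
  moreover have "continuous_on UNIV (rad P (poly p))" by (intro continuous_rad cP continuous_on_poly continuous_intros)
  ultimately show ?thesis using ipz by simp
 qed
 have "ip u \<psi> \<noteq> 0" using N0 unfolding \<psi>_def uN by simp
 moreover have "continuous_on UNIV \<psi>" unfolding \<psi>_def by (rule cPt)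
 ultimately show ?thesis using key unfolding u_def w_def by blast
qed

section \<open>Boundary behaviour and Green's formula\<close>

lemma continuous_bounded_unit:
 fixes f :: "real => real"
 assumes "continuous_on UNIV f" shows "\<exists>A\<ge>0. \<forall>\<rho>\<in>{0..1}. \<bar>f \<rho>\<bar> \<le> A"
proof -
 have "compact (f ` {0..1})" using assms continuous_on_subset by (intro compact_continuous_image) blast+
 then obtain D where "D > 0" "\<And>\<rho>. \<rho> \<in> {0..1} ==> \<bar>f \<rho>\<bar> \<le> D"
  by (auto dest!: compact_imp_bounded simp: bounded_pos)
 thus ?thesis by (intro exI[of _ D]) auto
qed

lemma boundary_order1:
 fixes h h1 :: "real => real"
 assumes h: "\<And>s. DERIV h s :> h1 s" and c: "continuous_on UNIV h1" and z: "h 1 = 0"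
 shows "\<exists>A\<ge>0. \<forall>\<rho>\<in>{0..1}. \<bar>h \<rho>\<bar> \<le> A * (1 - \<rho>) \<and> \<bar>h1 \<rho>\<bar> \<le> A"
proof -
 obtain A where A: "A \<ge> 0" "\<And>\<rho>. \<rho> \<in> {0..1} ==> \<bar>h1 \<rho>\<bar> \<le> A" using continuous_bounded_unit[OF c] by blast
 have "\<bar>h \<rho>\<bar> \<le> A * (1 - \<rho>)" if r: "\<rho> \<in> {0..1}" for \<rho>
 proof (cases "\<rho> = 1")
  case False
  then obtain t where t: "\<rho> < t" "t < 1" "h 1 - h \<rho> = (1 - \<rho>) * h1 t" using MVT2[of \<rho> 1 h h1] h r by auto
  have "h \<rho> = - ((1 - \<rho>) * h1 t)" using t(3) z by simp
  hence "\<bar>h \<rho>\<bar> = \<bar>h1 t\<bar> * (1 - \<rho>)" using r by (simp only: abs_minus_cancel abs_mult) simp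
  also have "\<dots> \<le> A * (1 - \<rho>)" using A(2)[of t] t r by (intro mult_right_mono) auto
  finally show ?thesis .
 qed (simp add: z)
 thus ?thesis using A by blast
qed

lemma boundary_order2:
 fixes h h1 h2 :: "real => real"
 assumes h: "\<And>s. DERIV h s :> h1 s" "\<And>s. DERIV h1 s :> h2 s"
  and c: "continuous_on UNIV h2" and z: "h 1 = 0" "h1 1 = 0"
 shows "\<exists>A\<ge>0. \<forall>\<rho>\<in>{0..1}. \<bar>h \<rho>\<bar> \<le> A * (1 - \<rho>)\<^sup>2 \<and> \<bar>h1 \<rho>\<bar> \<le> A * (1 - \<rho>) \<and> \<bar>h2 \<rho>\<bar> \<le> A"
proof -
 obtain A where A: "A \<ge> 0" "\<And>\<rho>. \<rho> \<in> {0..1} ==> \<bar>h1 \<rho>\<bar> \<le> A * (1 - \<rho>)" "\<And>\<rho>. \<rho> \<in> {0..1} ==> \<bar>h2 \<rho>\<bar> \<le> A"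
  using boundary_order1[OF h(2) c z(2)] by blast
 have "\<bar>h \<rho>\<bar> \<le> A * (1 - \<rho>)\<^sup>2" if r: "\<rho> \<in> {0..1}" for \<rho>
 proof (cases "\<rho> = 1")
  case False
  then obtain t where t: "\<rho> < t" "t < 1" "h 1 - h \<rho> = (1 - \<rho>) * h1 t" using MVT2[of \<rho> 1 h h1] h r by auto
  have "h \<rho> = - ((1 - \<rho>) * h1 t)" using t(3) z by simp
  hence "\<bar>h \<rho>\<bar> = \<bar>h1 t\<bar> * (1 - \<rho>)" using r by (simp only: abs_minus_cancel abs_mult) simp
  also have "\<dots> \<le> (A * (1 - \<rho>)) * (1 - \<rho>)"
  proof (intro mult_right_mono)
   have "A * (1 - t) \<le> A * (1 - \<rho>)" using A(1) t by (intro mult_left_mono) auto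
   thus "\<bar>h1 t\<bar> \<le> A * (1 - \<rho>)" using A(2)[of t] t r by auto
  qed (use r in auto)
  finally show ?thesis by (simp add: power2_eq_square mult.assoc)
 qed (simp add: z)
 thus ?thesis using A by blast
qed

lemma pd_rad:
 fixes P :: "'a::euclidean_space => real"
 assumes P: "smooth P" and k: "\<And>s. DERIV k s :> k' s"
 shows "pd [i] (rad P k) = (\<lambda>x. rad (pd [i] P) k x + rad (\<lambda>x. 2 * (x \<bullet> i) * P x) k' x)"
 unfolding rad_def[abs_def] by (rule ext) (simp add: pd_radial[OF P k])

lemma rad_cut_tendsto1:
 assumes w: "ubi w" and P: "continuous_on UNIV P"
  and h: "\<And>s. DERIV h s :> h1 s" and c: "continuous_on UNIV h1" and z: "h 1 = 0"
 shows "(\<lambda>N. ip w (rad P (\<lambda>\<rho>. h \<rho> * cut0 1 N \<rho>))) \<longlonglongrightarrow> ip w (rad P h)"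
  and "(\<lambda>N. ip w (rad P (cutd1 1 N h h1))) \<longlonglongrightarrow> ip w (rad P h1)"
proof -
 obtain A where A: "A \<ge> 0" "\<And>\<rho>. \<rho> \<in> {0..1} ==> \<bar>h \<rho>\<bar> \<le> A * (1 - \<rho>)" "\<And>\<rho>. \<rho> \<in> {0..1} ==> \<bar>h1 \<rho>\<bar> \<le> A"
  using boundary_order1[OF h c z] by blast
 obtain C where C: "\<And>N \<rho>. 0 \<le> \<rho> ==> \<bar>h \<rho> * cut0 1 N \<rho>\<bar> \<le> C" "\<And>N \<rho>. 0 \<le> \<rho> ==> \<bar>cutd1 1 N h h1 \<rho>\<bar> \<le> C"
  using cutd_bound1[of 1 h A h1] A by fastforce
 have ch: "continuous_on UNIV h" by (rule continuous_on_DERIV[OF h])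
 have cc: "continuous_on UNIV (cut0 1 N)" for N by (rule continuous_on_DERIV[OF cut_has_derivative(1)])
 have cc1: "continuous_on UNIV (cut1 1 N)" for N by (rule continuous_on_DERIV[OF cut_has_derivative(2)])
 show "(\<lambda>N. ip w (rad P (\<lambda>\<rho>. h \<rho> * cut0 1 N \<rho>))) \<longlonglongrightarrow> ip w (rad P h)"
  by (rule rad_tendsto[OF w P, where C = C]; (rule C cutd_tendsto)?) (auto intro!: continuous_on_mult ch cc)
 show "(\<lambda>N. ip w (rad P (cutd1 1 N h h1))) \<longlonglongrightarrow> ip w (rad P h1)"
  by (rule rad_tendsto[OF w P, where C = C]; (rule C cutd_tendsto)?)
   (auto simp: cutd1_def[abs_def] intro!: continuous_on_mult continuous_on_add ch cc cc1 c)
qed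

text \<open>The cut-off itself is bounded by 1, so pairings without derivatives converge for every
  continuous profile, whatever its boundary value.\<close>

lemma rad_cut_tendsto0:
 assumes w: "ubi w" and P: "continuous_on UNIV P" and h: "continuous_on UNIV h"
 shows "(\<lambda>N. ip w (rad P (\<lambda>\<rho>. h \<rho> * cut0 1 N \<rho>))) \<longlonglongrightarrow> ip w (rad P h)"
proof -
 obtain A where A: "A \<ge> 0" "\<And>\<rho>. \<rho> \<in> {0..1} ==> \<bar>h \<rho>\<bar> \<le> A" using continuous_bounded_unit[OF h] by blast
 have cc: "continuous_on UNIV (cut0 1 N)" for N by (rule continuous_on_DERIV[OF cut_has_derivative(1)])
 show ?thesis
 proof (rule rad_tendsto[OF w P, where C = "A * 1"])
  show "\<bar>h \<rho> * cut0 1 N \<rho>\<bar> \<le> A * 1" if "0 \<le> \<rho>" "\<rho> < 1" for \<rho> N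
   unfolding abs_mult using A that cut_bounds[of 1 N \<rho>] by (intro mult_mono) auto
 qed (auto intro!: continuous_on_mult h cc cutd_tendsto)
qed

text \<open>The integrand is half the divergence of the field x P^2 k(|x|^2): Euler's identity for
  P^2 contributes 2 l and div x contributes n, with n + 2 l = 2 (\<open>sig\<close> + 1). As k
  vanishes on the sphere, cut-offs turn the field into test functions.\<close>

lemma radial_divergence0:
 fixes P :: "'a::euclidean_space => real"
 assumes P: "hpoly l P" and k: "smooth k" "\<And>s. DERIV k s :> k1 s" "k 1 = 0"
 shows "(LINT x:ball 0 1|lebesgue. rad (\<lambda>x. P x * P x) (\<lambda>\<rho>. (sig TYPE('a) l + 1) * k \<rho> + \<rho> * k1 \<rho>) x) = 0"
proof -
 define \<nu> where "\<nu> = sig TYPE('a) l"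
 define Q where "Q = (\<lambda>x. P x * P x)"
 have Q: "hpoly (l + l) Q" unfolding Q_def by (rule hpoly_mult_hpoly[OF P P])
 have sQ: "smooth Q" by (rule hpoly_smooth[OF Q])
 have cQ: "continuous_on UNIV Q" by (rule smooth_continuous[OF sQ])
 have sk1: "smooth k1" by (rule smooth_real_deriv[OF k(1,2)])
 define u where "u = (\<lambda>x::'a. complex_of_real 1)"
 have uu: "ubi u" unfolding u_def by (intro ubi_continuous continuous_intros)
 define kN where "kN N \<rho> = k \<rho> * cut0 1 N \<rho>" for N \<rho>
 have dN: "DERIV (kN N) s :> cutd1 1 N k k1 s" for N s
  unfolding kN_def[abs_def] using smooth_imp_DERIV[OF sk1]
  by (intro cutd_derivative(1)[OF k(2)])
 have tQ: "test_fun (ball 0 1) (rad Q (kN N))" for N unfolding kN_def[abs_def] by (rule test_fun_cut[OF sQ k(1)]) simp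
 have skN: "smooth (kN N)" for N unfolding kN_def[abs_def] by (intro smooth_mult k smooth_cut)
 have z: "ip u (\<lambda>x. 2 * (\<nu> + 1) * rad Q (kN N) x + 2 * rad (\<lambda>x. (x \<bullet> x) * Q x) (cutd1 1 N k k1) x) = 0" for N
 proof -
  define f where "f i x = pd [i] (\<lambda>x. (x \<bullet> i) * rad Q (kN N) x) x" for i and x :: 'a
  have s: "smooth (rad Q (kN N))" by (intro smooth_rad sQ skN)
  have "f i x = (x \<bullet> i) * pd [i] (rad Q (kN N)) x + (i \<bullet> i) * rad Q (kN N) x" for i x
   unfolding f_def by (simp add: pd_inner_mult[OF s])
  hence "(\<Sum>i\<in>Basis. f i x) = (\<Sum>i\<in>Basis. (x \<bullet> i) * pd [i] Q x) * kN N (x \<bullet> x)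
    + (\<Sum>i\<in>Basis. (x \<bullet> i) * (x \<bullet> i)) * (2 * Q x * cutd1 1 N k k1 (x \<bullet> x)) + real DIM('a) * rad Q (kN N) x" for x
   unfolding pd_rad[OF sQ dN] by (simp add: rad_def sum.distrib sum_distrib_left sum_distrib_right algebra_simps)
  hence e: "(\<Sum>i\<in>Basis. f i x) = 2 * (\<nu> + 1) * rad Q (kN N) x + 2 * rad (\<lambda>x. (x \<bullet> x) * Q x) (cutd1 1 N k k1) x" for x
   unfolding hpoly_euler[OF Q] euclidean_inner[symmetric] \<nu>_def sig_def rad_def by (simp add: algebra_simps)
  have t: "test_fun (ball 0 1) (\<lambda>x. (x \<bullet> i) * rad Q (kN N) x)" for i by (rule test_fun_mult[OF tQ]) auto
  have "ip u (\<lambda>x. \<Sum>i\<in>Basis. f i x) = (\<Sum>i\<in>Basis. ip u (f i))"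
   by (rule ip_sum[OF uu finite_Basis]) (unfold f_def, intro smooth_continuous test_fun_smooth[OF test_fun_pd[OF t]])
  also have "\<dots> = 0"
  proof (rule sum.neutral, rule ballI)
   fix i :: 'a assume i: "i \<in> Basis"
   show "ip u (f i) = 0" unfolding f_def u_def ip_real using integral_pd_zero[OF t i] by simp
  qed
  finally show ?thesis unfolding e .
 qed
 have c1: "continuous_on UNIV (rad Q h)" "continuous_on UNIV (rad (\<lambda>x. (x \<bullet> x) * Q x) h)" if "continuous_on UNIV h" for h
  using that by (intro continuous_rad cQ continuous_intros; simp)+
 have lin: "ip u (\<lambda>x. 2 * (\<nu> + 1) * rad Q h x + 2 * rad (\<lambda>x. (x \<bullet> x) * Q x) h' x) =
   2 * (\<nu> + 1) * ip u (rad Q h) + 2 * ip u (rad (\<lambda>x. (x \<bullet> x) * Q x) h')"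
  if "continuous_on UNIV h" "continuous_on UNIV h'" for h h'
  by (subst ip_add[OF uu]) (auto intro!: continuous_on_mult continuous_on_const c1 that simp: ip_cmult)
 have ck: "continuous_on UNIV (kN N)" "continuous_on UNIV (cutd1 1 N k k1)" for N
  using continuous_on_DERIV[OF dN] smooth_continuous[OF smooth_real_deriv[OF skN dN]] by auto
 have "(\<lambda>N. 2 * (\<nu> + 1) * ip u (rad Q (kN N)) + 2 * ip u (rad (\<lambda>x. (x \<bullet> x) * Q x) (cutd1 1 N k k1)))
  \<longlonglongrightarrow> 2 * (\<nu> + 1) * ip u (rad Q k) + 2 * ip u (rad (\<lambda>x. (x \<bullet> x) * Q x) k1)"
  unfolding kN_def
  by (intro tendsto_add tendsto_mult tendsto_const rad_cut_tendsto1[OF uu _ k(2) smooth_continuous[OF sk1] k(3)] cQ continuous_intros)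
 hence "2 * (\<nu> + 1) * ip u (rad Q k) + 2 * ip u (rad (\<lambda>x. (x \<bullet> x) * Q x) k1) = 0"
  using z unfolding lin[OF ck] by (simp add: LIMSEQ_const_iff)
 hence "ip u (\<lambda>x. 2 * (\<nu> + 1) * rad Q k x + 2 * rad (\<lambda>x. (x \<bullet> x) * Q x) k1 x) = 0"
  using lin[of k k1] smooth_continuous[OF k(1)] smooth_continuous[OF sk1] by simp
 moreover have "(\<lambda>x. 2 * (\<nu> + 1) * rad Q k x + 2 * rad (\<lambda>x. (x \<bullet> x) * Q x) k1 x) =
  (\<lambda>x. 2 * rad Q (\<lambda>\<rho>. (\<nu> + 1) * k \<rho> + \<rho> * k1 \<rho>) x)" by (auto simp: rad_def algebra_simps)
 ultimately have "ip u (rad Q (\<lambda>\<rho>. (\<nu> + 1) * k \<rho> + \<rho> * k1 \<rho>)) = 0" by (simp add: ip_cmult)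
 thus ?thesis unfolding u_def ip_real Q_def \<nu>_def by simp
qed

text \<open>Applying the vanishing case to \<open>k - k 1\<close> leaves the constant as a boundary
  term. It is expressed by the integral of P^2 over the ball, so no surface measure enters.\<close>

lemma radial_divergence:
 fixes P :: "'a::euclidean_space => real"
 assumes P: "hpoly l P" and k: "smooth k" "\<And>s. DERIV k s :> k1 s"
 shows "(LINT x:ball 0 1|lebesgue. rad (\<lambda>x. P x * P x) (\<lambda>\<rho>. (sig TYPE('a) l + 1) * k \<rho> + \<rho> * k1 \<rho>) x)
  = (sig TYPE('a) l + 1) * k 1 * (LINT x:ball 0 1|lebesgue. P x * P x)"
proof -
 define \<nu> where "\<nu> = sig TYPE('a) l"
 have c: "continuous_on UNIV (\<lambda>x. P x * P x)" by (intro continuous_on_mult smooth_continuous hpoly_smooth[OF P])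
 have ck: "continuous_on UNIV k" "continuous_on UNIV k1"
  using smooth_continuous[OF k(1)] smooth_continuous[OF smooth_real_deriv[OF k]] by auto
 have "0 = (LINT x:ball 0 1|lebesgue. rad (\<lambda>x. P x * P x) (\<lambda>\<rho>. (\<nu> + 1) * (k \<rho> - k 1) + \<rho> * k1 \<rho>) x)"
  unfolding \<nu>_def by (rule radial_divergence0[OF P, symmetric]) (auto intro!: smooth_diff k derivative_eq_intros)
 also have "\<dots> = (LINT x:ball 0 1|lebesgue. rad (\<lambda>x. P x * P x) (\<lambda>\<rho>. (\<nu> + 1) * k \<rho> + \<rho> * k1 \<rho>) x - (\<nu> + 1) * k 1 * (P x * P x))"
  by (simp add: rad_def algebra_simps)
 also have "\<dots> = (LINT x:ball 0 1|lebesgue. rad (\<lambda>x. P x * P x) (\<lambda>\<rho>. (\<nu> + 1) * k \<rho> + \<rho> * k1 \<rho>) x)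
   - (LINT x:ball 0 1|lebesgue. (\<nu> + 1) * k 1 * (P x * P x))"
  by (intro set_integral_diff ubi_continuous_real continuous_rad c continuous_on_add continuous_on_mult continuous_on_const ck continuous_on_id)
 finally show ?thesis unfolding \<nu>_def by simp
qed

text \<open>Green's formula between the Bessel profile and \<eta>: the boundary term is their
  Wronskian at 1. The constant \<open>c\<close> is 4 (\<nu> + 1) times the integral of P^2, positive
  because \<open>P\<close> is not identically 0 in the ball.\<close>

lemma usol_green:
 fixes P :: "'a::euclidean_space => real"
 assumes dim: "DIM('a) \<ge> 2" and P: "hpoly l P" and nz: "P y \<noteq> 0"
 defines "\<nu> \<equiv> sig TYPE('a) l"
 shows "\<exists>c>0. \<forall>\<eta> \<eta>1 \<eta>2. smooth \<eta> --> (\<forall>s. DERIV \<eta> s :> \<eta>1 s) --> (\<forall>s. DERIV \<eta>1 s :> \<eta>2 s) -->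
   ip (cplx (usol \<kappa> l P)) (rad P (\<lambda>\<rho>. 4 * (\<nu> + 1) * \<eta>1 \<rho> + 4 * \<rho> * \<eta>2 \<rho> + \<kappa> * \<eta> \<rho>))
   = complex_of_real (c * (bes \<nu> \<kappa> * \<eta>1 1 - \<kappa> * bes' \<nu> \<kappa> * \<eta> 1))"
proof -
 have \<nu>: "\<nu> \<ge> 0" unfolding \<nu>_def by (rule sig_nonneg[OF dim])
 define I where "I = (LINT x:ball 0 1|lebesgue. P x * P x)"
 have cP: "continuous_on UNIV P" by (intro smooth_continuous hpoly_smooth[OF P])
 have I: "I > 0" unfolding I_def
 proof (rule integral_continuous_pos)
  show "continuous_on UNIV (\<lambda>x. P x * P x)" by (intro continuous_on_mult cP)
  define t where "t = 1 / (1 + norm y)"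
  have ny: "1 + norm y > 0" "norm y < 1 + norm y" by (simp_all add: add_pos_nonneg)
  have t: "t > 0" unfolding t_def using ny(1) by simp
  have "t * norm y < t * (1 + norm y)" using t ny(2) by (rule mult_strict_left_mono[rotated])
  also have "\<dots> = 1" using ny(1) by (simp add: t_def)
  finally show "t *\<^sub>R y \<in> ball 0 1" using t by simp
  have "P (t *\<^sub>R y) = t ^ l * P y" using hpoly_homogeneous[OF P(1)] by simp
  thus "P (t *\<^sub>R y) * P (t *\<^sub>R y) \<noteq> 0" using t nz by simp
 qed auto
 define c where "c = 4 * (\<nu> + 1) * I"
 have "ip (cplx (usol \<kappa> l P)) (rad P (\<lambda>\<rho>. 4 * (\<nu> + 1) * \<eta>1 \<rho> + 4 * \<rho> * \<eta>2 \<rho> + \<kappa> * \<eta> \<rho>))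
   = complex_of_real (c * (bes \<nu> \<kappa> * \<eta>1 1 - \<kappa> * bes' \<nu> \<kappa> * \<eta> 1))"
  if \<eta>: "smooth \<eta>" "\<And>s. DERIV \<eta> s :> \<eta>1 s" "\<And>s. DERIV \<eta>1 s :> \<eta>2 s" for \<eta> \<eta>1 \<eta>2
 proof -
  define F where "F = bsol \<nu> \<kappa>" define F1 where "F1 = bsol1 \<nu> \<kappa>" define F2 where "F2 = bsol2 \<nu> \<kappa>"
  note dF = bsol_derivative[OF \<nu>, of \<kappa>, folded F_def F1_def F2_def]
  have sF: "smooth F" "smooth F1" unfolding F_def F1_def using smooth_bsol[OF \<nu>] smooth_bsol1[OF \<nu>] by auto
  \<comment> \<open>The Wronskian of the two profiles; the products of first derivatives cancel in
    \<open>k1\<close>, so the divergence formula reproduces exactly the difference of the two Bessel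
    operators.\<close>
  define k where "k \<rho> = F \<rho> * \<eta>1 \<rho> - F1 \<rho> * \<eta> \<rho>" for \<rho>
  define k1 where "k1 \<rho> = F \<rho> * \<eta>2 \<rho> - F2 \<rho> * \<eta> \<rho>" for \<rho>
  have dk: "DERIV k s :> k1 s" for s unfolding k_def[abs_def] k1_def
   by (rule DERIV_cong[OF DERIV_diff[OF DERIV_mult[OF dF(1) \<eta>(3)] DERIV_mult[OF dF(2) \<eta>(2)]]]) (simp add: algebra_simps)
  have sk: "smooth k" unfolding k_def[abs_def]
   by (intro smooth_diff smooth_mult sF \<eta>(1) smooth_real_deriv[OF \<eta>(1,2)])
  have e: "usol \<kappa> l P x * rad P (\<lambda>\<rho>. 4 * (\<nu> + 1) * \<eta>1 \<rho> + 4 * \<rho> * \<eta>2 \<rho> + \<kappa> * \<eta> \<rho>) x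
    = 4 * rad (\<lambda>x. P x * P x) (\<lambda>\<rho>. (\<nu> + 1) * k \<rho> + \<rho> * k1 \<rho>) x" for x
  proof -
   have o: "4 * (\<nu> + 1) * F1 t + 4 * t * F2 t = - \<kappa> * F t" for t using bsol_ode[OF \<nu>] unfolding F_def F1_def F2_def .
   define t where "t = x \<bullet> x"
   have "F t * (4 * (\<nu> + 1) * \<eta>1 t + 4 * t * \<eta>2 t + \<kappa> * \<eta> t) =
     F t * (4 * (\<nu> + 1) * \<eta>1 t + 4 * t * \<eta>2 t) - (4 * (\<nu> + 1) * F1 t + 4 * t * F2 t) * \<eta> t"
    by (simp only: o) (simp add: algebra_simps)
   also have "\<dots> = 4 * ((\<nu> + 1) * k t + t * k1 t)" by (simp add: k_def k1_def algebra_simps)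
   finally show ?thesis unfolding usol_def rad_def \<nu>_def[symmetric] F_def[symmetric] t_def[symmetric]
    by (simp add: mult_ac)
  qed
  have "(LINT x:ball 0 1|lebesgue. 4 * rad (\<lambda>x. P x * P x) (\<lambda>\<rho>. (\<nu> + 1) * k \<rho> + \<rho> * k1 \<rho>) x) = c * k 1"
   using radial_divergence[OF P sk dk] unfolding \<nu>_def[symmetric] by (simp add: c_def I_def)
  thus ?thesis unfolding ip_real e by (simp add: k_def F_def F1_def bsol_def bsol1_def)
 qed
 moreover have "c > 0" using I \<nu> by (simp add: c_def)
 ultimately show ?thesis by blast
qed

lemma weak_pd_ip:
 "weak_pd1 (ball 0 1) u i g \<longleftrightarrow> (\<forall>\<phi>. test_fun (ball 0 1) \<phi> --> ip u (pd [i] \<phi>) = - ip g \<phi>)"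
 "weak_pd2 (ball 0 1) u i j h \<longleftrightarrow> (\<forall>\<phi>. test_fun (ball 0 1) \<phi> --> ip u (pd [i, j] \<phi>) = ip h \<phi>)"
 by (simp_all add: weak_pd1_def weak_pd2_def ip_def)

lemma ip_commute: "ip (cplx f) g = ip (cplx g) f"
 unfolding ip_real by (simp add: mult.commute)

lemma ip_laplacian_sum:
 assumes u: "ubi u" and s: "smooth \<psi>"
 shows "ip u (laplacian \<psi>) = (\<Sum>i\<in>Basis. ip u (pd [i, i] \<psi>))"
proof -
 have "ip u (laplacian \<psi>) = ip u (\<lambda>x. \<Sum>i\<in>Basis. pd [i, i] \<psi> x)" by (simp add: laplacian_def[abs_def])
 also have "\<dots> = (\<Sum>i\<in>Basis. ip u (pd [i, i] \<psi>))"
  by (rule ip_sum[OF u finite_Basis]) (auto intro!: smooth_continuous smooth_pds s)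
 finally show ?thesis .
qed

lemma weak_sol_laplacian:
 assumes u: "ubi u" and w: "weak_sol \<kappa> u" and t: "test_fun (ball 0 1) \<phi>"
 shows "ip u (laplacian \<phi>) = - of_real \<kappa> * ip u \<phi>"
proof -
 have s: "smooth \<phi>" using test_fun_smooth[OF t] .
 have "0 = ip u (\<lambda>x. laplacian \<phi> x + \<kappa> * \<phi> x)" using w t by (simp add: weak_sol_def)
 also have "\<dots> = ip u (laplacian \<phi>) + of_real \<kappa> * ip u \<phi>"
  by (subst ip_add[OF u]) (auto intro!: smooth_continuous s smooth_laplacian smooth_cmult simp: ip_cmult)
 finally show ?thesis by (simp add: add_eq_0_iff2)
qed

section \<open>The boundary conditions in weak form\<close>

text \<open>A radial function that may be nonzero on the sphere, hence not a test function. It is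
  compared with its cut-offs \<open>\<psi>N\<close>, which are test functions; how much \<eta> has
  to vanish at 1 depends on how many derivatives must be moved onto it.\<close>

locale radial_test =
 fixes P :: "'a::euclidean_space => real" and l :: nat and \<eta> \<eta>1 \<eta>2 :: "real => real"
 assumes dim: "DIM('a) \<ge> 2" and P: "hpoly l P" "laplacian P = (\<lambda>x. 0)"
  and \<eta>: "smooth \<eta>" "\<And>s. DERIV \<eta> s :> \<eta>1 s" "\<And>s. DERIV \<eta>1 s :> \<eta>2 s"
begin

lemma sP: "smooth P" by (rule hpoly_smooth[OF P(1)])
lemma s\<eta>1: "smooth \<eta>1" by (rule smooth_real_deriv[OF \<eta>(1,2)])
lemma s\<eta>2: "smooth \<eta>2" by (rule smooth_real_deriv[OF s\<eta>1 \<eta>(3)])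
lemma s\<psi>: "smooth (rad P \<eta>)" by (intro smooth_rad sP \<eta>(1))

definition "\<psi>N N = rad P (\<lambda>\<rho>. \<eta> \<rho> * cut0 1 N \<rho>)"
lemma t\<psi>N: "test_fun (ball 0 1) (\<psi>N N)" unfolding \<psi>N_def by (rule test_fun_cut[OF sP \<eta>(1)]) simp

lemma lap: "laplacian (rad P \<eta>) = rad P (\<lambda>\<rho>. 4 * (sig TYPE('a) l + 1) * \<eta>1 \<rho> + 4 * \<rho> * \<eta>2 \<rho>)"
 by (rule ext) (rule laplacian_rad[OF P \<eta>(2,3) s\<eta>1])

lemma split:
 assumes "ubi u"
 shows "ip u (rad P (\<lambda>\<rho>. 4 * (sig TYPE('a) l + 1) * \<eta>1 \<rho> + 4 * \<rho> * \<eta>2 \<rho> + \<kappa> * \<eta> \<rho>))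
   = ip u (laplacian (rad P \<eta>)) + of_real \<kappa> * ip u (rad P \<eta>)"
proof -
 have "rad P (\<lambda>\<rho>. 4 * (sig TYPE('a) l + 1) * \<eta>1 \<rho> + 4 * \<rho> * \<eta>2 \<rho> + \<kappa> * \<eta> \<rho>) = (\<lambda>x. laplacian (rad P \<eta>) x + \<kappa> * rad P \<eta> x)"
  unfolding lap by (simp add: rad_def[abs_def] algebra_simps)
 thus ?thesis
  using ip_add[OF assms, of "laplacian (rad P \<eta>)" "\<lambda>x. \<kappa> * rad P \<eta> x"]
  by (simp add: ip_cmult smooth_continuous smooth_laplacian s\<psi> smooth_cmult)
qed

text \<open>One integration by parts uses the test functions approximating \<open>u\<close>, so no
  boundary term arises. The gradient then falls on the radial function, whose cut-offs converge in
  the first derivatives because \<eta> vanishes at 1; for them the weak equation applies.\<close>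

lemma H01_component:
 assumes H: "H01 (ball 0 1) u" and w: "weak_sol \<kappa> u" and z: "\<eta> 1 = 0"
 shows "ip u (rad P (\<lambda>\<rho>. 4 * (sig TYPE('a) l + 1) * \<eta>1 \<rho> + 4 * \<rho> * \<eta>2 \<rho> + \<kappa> * \<eta> \<rho>)) = 0"
proof -
 obtain \<phi> g where L: "L2 (ball 0 1) u" and t: "\<And>k. test_fun (ball 0 1) (\<phi> k)"
  and g: "\<And>i. i \<in> Basis ==> L2 (ball 0 1) (g i)" "\<And>i. i \<in> Basis ==> weak_pd1 (ball 0 1) u i (g i)"
  and lim: "(\<lambda>k. L2_dist2 (ball 0 1) u (\<phi> k)) \<longlonglongrightarrow> 0"
    "\<And>i. i \<in> Basis ==> (\<lambda>k. L2_dist2 (ball 0 1) (g i) (pd [i] (\<phi> k))) \<longlonglongrightarrow> 0"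
  using H unfolding H01_def by metis
 have u: "ubi u" by (rule L2_ubi[OF L])
 let ?S = "\<Sum>i\<in>Basis. ip (g i) (pd [i] (rad P \<eta>))"
 have A: "ip u (laplacian (rad P \<eta>)) = - ?S"
 proof -
  have "ip (cplx (\<phi> k)) (laplacian (rad P \<eta>))
    = - (\<Sum>i\<in>Basis. ip (cplx (pd [i] (\<phi> k))) (pd [i] (rad P \<eta>)))" for k
   unfolding sum_negf[symmetric] ip_laplacian_sum[OF ubi_continuous[OF smooth_continuous[OF test_fun_smooth[OF t]]] s\<psi>] pd_two
   by (rule sum.cong) (auto simp: ip_by_parts(2)[OF t smooth_pd[OF s\<psi>]])
  moreover have "(\<lambda>k. - (\<Sum>i\<in>Basis. ip (cplx (pd [i] (\<phi> k))) (pd [i] (rad P \<eta>)))) \<longlonglongrightarrow> - ?S"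
   by (intro tendsto_minus tendsto_sum L2_dist2_ip_tendsto g lim smooth_continuous smooth_pd s\<psi> test_fun_smooth[OF t])
  moreover have "(\<lambda>k. ip (cplx (\<phi> k)) (laplacian (rad P \<eta>))) \<longlonglongrightarrow> ip u (laplacian (rad P \<eta>))"
   by (intro L2_dist2_ip_tendsto L lim smooth_continuous smooth_laplacian s\<psi> test_fun_smooth[OF t])
  ultimately show ?thesis using LIMSEQ_unique by auto
 qed
 have B: "(\<Sum>i\<in>Basis. ip (g i) (pd [i] (\<psi>N N))) = of_real \<kappa> * ip u (\<psi>N N)" for N
 proof -
  have "- of_real \<kappa> * ip u (\<psi>N N) = ip u (laplacian (\<psi>N N))" by (rule weak_sol_laplacian[OF u w t\<psi>N, symmetric])
  also have "\<dots> = (\<Sum>i\<in>Basis. ip u (pd [i, i] (\<psi>N N)))" by (rule ip_laplacian_sum[OF u test_fun_smooth[OF t\<psi>N]])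
  also have "\<dots> = (\<Sum>i\<in>Basis. - ip (g i) (pd [i] (\<psi>N N)))"
   using g(2) test_fun_pd[OF t\<psi>N] unfolding weak_pd_ip pd_two by (intro sum.cong) auto
  finally show ?thesis by (simp add: sum_negf)
 qed
 have D: "(\<lambda>N. ip (g i) (pd [i] (\<psi>N N))) \<longlonglongrightarrow> ip (g i) (pd [i] (rad P \<eta>))" if i: "i \<in> Basis" for i
 proof -
  have gi: "ubi (g i)" by (rule L2_ubi[OF g(1)[OF i]])
  define Q where "Q x = 2 * (x \<bullet> i) * P x" for x
  have c: "continuous_on UNIV (pd [i] P)" "continuous_on UNIV Q"
   using smooth_continuous[OF smooth_pd[OF sP i]] unfolding Q_def
   by (auto intro!: continuous_intros smooth_continuous[OF sP])
  have e: "ip (g i) (pd [i] (rad P h)) = ip (g i) (rad (pd [i] P) h) + ip (g i) (rad Q h')"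
   if "\<And>s. DERIV h s :> h' s" "continuous_on UNIV h'" for h h'
   unfolding pd_rad[OF sP that(1)] Q_def[symmetric]
   by (rule ip_add[OF gi]) (intro continuous_rad c that(2) continuous_on_DERIV[OF that(1)])+
  have "continuous_on UNIV (cutd1 1 N \<eta> \<eta>1)" for N
   by (rule continuous_on_DERIV[OF cutd_derivative(2)[OF \<eta>(2,3)]])
  hence "ip (g i) (pd [i] (\<psi>N N)) = ip (g i) (rad (pd [i] P) (\<lambda>\<rho>. \<eta> \<rho> * cut0 1 N \<rho>)) + ip (g i) (rad Q (cutd1 1 N \<eta> \<eta>1))" for N
   unfolding \<psi>N_def by (intro e cutd_derivative(1)[OF \<eta>(2,3)])
  moreover have "ip (g i) (pd [i] (rad P \<eta>)) = ip (g i) (rad (pd [i] P) \<eta>) + ip (g i) (rad Q \<eta>1)"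
   by (intro e \<eta> smooth_continuous s\<eta>1)
  ultimately show ?thesis
   using tendsto_add[OF rad_cut_tendsto1(1)[OF gi c(1) \<eta>(2) smooth_continuous[OF s\<eta>1] z] rad_cut_tendsto1(2)[OF gi c(2) \<eta>(2) smooth_continuous[OF s\<eta>1] z]]
   by simp
 qed
 have "(\<lambda>N. \<Sum>i\<in>Basis. ip (g i) (pd [i] (\<psi>N N))) \<longlonglongrightarrow> ?S" by (intro tendsto_sum D)
 moreover have "(\<lambda>N. of_real \<kappa> * ip u (\<psi>N N)) \<longlonglongrightarrow> of_real \<kappa> * ip u (rad P \<eta>)"
  unfolding \<psi>N_def by (intro tendsto_mult tendsto_const rad_cut_tendsto0 u smooth_continuous sP \<eta>(1))
 ultimately have "?S = of_real \<kappa> * ip u (rad P \<eta>)" unfolding B by (rule LIMSEQ_unique)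
 thus ?thesis unfolding split[OF u] A by simp
qed

text \<open>Here both derivatives fall on \<open>u - v\<close>, which test functions approximate up
  to second order. Only values of the radial function are left, so its cut-offs converge for
  arbitrary boundary values of \<eta>, and both boundary conditions become visible.\<close>

lemma H02_component:
 assumes H: "H02 (ball 0 1) (\<lambda>x. u x - v x)" and u: "ubi u" "weak_sol \<kappa>1 u" and v: "ubi v" "weak_sol \<kappa>2 v"
 shows "ip u (rad P (\<lambda>\<rho>. 4 * (sig TYPE('a) l + 1) * \<eta>1 \<rho> + 4 * \<rho> * \<eta>2 \<rho> + \<kappa>1 * \<eta> \<rho>)) =
   ip v (rad P (\<lambda>\<rho>. 4 * (sig TYPE('a) l + 1) * \<eta>1 \<rho> + 4 * \<rho> * \<eta>2 \<rho> + \<kappa>2 * \<eta> \<rho>))"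
proof -
 define w where "w x = u x - v x" for x
 have "H2 (ball 0 1) w" "\<exists>\<phi> g2. (\<forall>k. test_fun (ball 0 1) (\<phi> k)) \<and> (\<forall>i\<in>Basis. \<forall>j\<in>Basis. L2 (ball 0 1) (g2 i j) \<and> weak_pd2 (ball 0 1) w i j (g2 i j))
   \<and> (\<lambda>k. L2_dist2 (ball 0 1) w (\<phi> k)) \<longlonglongrightarrow> 0
   \<and> (\<forall>i\<in>Basis. \<forall>j\<in>Basis. (\<lambda>k. L2_dist2 (ball 0 1) (g2 i j) (pd [i, j] (\<phi> k))) \<longlonglongrightarrow> 0)"
  using H unfolding H02_def w_def[abs_def, symmetric] by blast+
 then obtain \<phi> g where L: "L2 (ball 0 1) w" and t: "\<And>k. test_fun (ball 0 1) (\<phi> k)"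
  and g: "\<And>i. i \<in> Basis ==> L2 (ball 0 1) (g i i)" "\<And>i. i \<in> Basis ==> weak_pd2 (ball 0 1) w i i (g i i)"
  and lim: "(\<lambda>k. L2_dist2 (ball 0 1) w (\<phi> k)) \<longlonglongrightarrow> 0"
    "\<And>i. i \<in> Basis ==> (\<lambda>k. L2_dist2 (ball 0 1) (g i i) (pd [i, i] (\<phi> k))) \<longlonglongrightarrow> 0"
  unfolding H2_def by metis
 have ipw: "ip w \<psi> = ip u \<psi> - ip v \<psi>" if "continuous_on UNIV \<psi>" for \<psi>
  unfolding w_def by (rule ip_diff_left[OF u(1) v(1) that])
 have wu: "ubi w" by (rule L2_ubi[OF L])
 let ?S = "\<Sum>i\<in>Basis. ip (g i i) (rad P \<eta>)"
 have A: "ip w (laplacian (rad P \<eta>)) = ?S"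
 proof -
  have "ip (cplx (\<phi> k)) (laplacian (rad P \<eta>))
    = (\<Sum>i\<in>Basis. ip (cplx (pd [i, i] (\<phi> k))) (rad P \<eta>))" for k
  proof -
   have "ip (cplx (\<phi> k)) (laplacian (rad P \<eta>)) = ip (cplx (rad P \<eta>)) (laplacian (\<phi> k))"
    by (subst ip_commute) (rule ip_laplacian[OF t s\<psi>, symmetric])
   also have "\<dots> = (\<Sum>i\<in>Basis. ip (cplx (rad P \<eta>)) (pd [i, i] (\<phi> k)))"
    by (rule ip_laplacian_sum[OF ubi_continuous[OF smooth_continuous[OF s\<psi>]] test_fun_smooth[OF t]])
   finally show ?thesis by (simp only: ip_commute[of "rad P \<eta>"])
  qed
  moreover have "(\<lambda>k. \<Sum>i\<in>Basis. ip (cplx (pd [i, i] (\<phi> k))) (rad P \<eta>)) \<longlonglongrightarrow> ?S"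
   by (intro tendsto_sum L2_dist2_ip_tendsto g lim smooth_continuous smooth_pds s\<psi> test_fun_smooth[OF t]) auto
  moreover have "(\<lambda>k. ip (cplx (\<phi> k)) (laplacian (rad P \<eta>))) \<longlonglongrightarrow> ip w (laplacian (rad P \<eta>))"
   by (intro L2_dist2_ip_tendsto L lim smooth_continuous smooth_laplacian s\<psi> test_fun_smooth[OF t])
  ultimately show ?thesis using LIMSEQ_unique by auto
 qed
 have B: "(\<Sum>i\<in>Basis. ip (g i i) (\<psi>N N)) = - of_real \<kappa>1 * ip u (\<psi>N N) + of_real \<kappa>2 * ip v (\<psi>N N)" for N
 proof -
  have "(\<Sum>i\<in>Basis. ip (g i i) (\<psi>N N)) = (\<Sum>i\<in>Basis. ip w (pd [i, i] (\<psi>N N)))"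
   using g(2) t\<psi>N unfolding weak_pd_ip by (intro sum.cong) auto
  also have "\<dots> = ip w (laplacian (\<psi>N N))" by (rule ip_laplacian_sum[OF wu test_fun_smooth[OF t\<psi>N], symmetric])
  also have "\<dots> = ip u (laplacian (\<psi>N N)) - ip v (laplacian (\<psi>N N))"
   by (rule ipw) (intro smooth_continuous smooth_laplacian test_fun_smooth[OF t\<psi>N])
  finally show ?thesis by (simp add: weak_sol_laplacian[OF u t\<psi>N] weak_sol_laplacian[OF v t\<psi>N])
 qed
 have "(\<lambda>N. \<Sum>i\<in>Basis. ip (g i i) (\<psi>N N)) \<longlonglongrightarrow> ?S"
  unfolding \<psi>N_def by (intro tendsto_sum rad_cut_tendsto0 L2_ubi g smooth_continuous sP \<eta>(1))
 moreover have "(\<lambda>N. - of_real \<kappa>1 * ip u (\<psi>N N) + of_real \<kappa>2 * ip v (\<psi>N N)) \<longlonglongrightarrow> - of_real \<kappa>1 * ip u (rad P \<eta>) + of_real \<kappa>2 * ip v (rad P \<eta>)"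
  unfolding \<psi>N_def by (intro tendsto_add tendsto_mult tendsto_const rad_cut_tendsto0 u v smooth_continuous sP \<eta>(1))
 ultimately have "?S = - of_real \<kappa>1 * ip u (rad P \<eta>) + of_real \<kappa>2 * ip v (rad P \<eta>)" unfolding B by (rule LIMSEQ_unique)
 moreover have "ip w (laplacian (rad P \<eta>)) = ip u (laplacian (rad P \<eta>)) - ip v (laplacian (rad P \<eta>))"
  by (rule ipw) (intro smooth_continuous smooth_laplacian s\<psi>)
 ultimately have "ip u (laplacian (rad P \<eta>)) - ip v (laplacian (rad P \<eta>)) = - of_real \<kappa>1 * ip u (rad P \<eta>) + of_real \<kappa>2 * ip v (rad P \<eta>)"
  using A by simp
 thus ?thesis unfolding split[OF u(1)] split[OF v(1)] by (simp add: diff_eq_eq)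
qed

end

text \<open>Rescaling makes the pairing with \<psi> the coefficient of \<open>u\<close> relative to
  the Bessel solution, and \<open>d p\<close> the moment of the latter. The two polynomials are the
  images of \<eta> = 1 and \<eta> = 1 - \<rho> under the operator of Green's formula; they give the
  radial derivative and the boundary value.\<close>

lemma weak_sol_coefficient:
 fixes P :: "'a::euclidean_space => real"
 assumes dim: "DIM('a) \<ge> 2" and P: "hpoly l P" "laplacian P = (\<lambda>x. 0)" and nz: "P y \<noteq> 0"
 defines "\<nu> \<equiv> sig TYPE('a) l"
 shows "\<exists>\<psi> d c. continuous_on UNIV \<psi> \<and> (c::real) > 0 \<and>
  (\<forall>u p. ubi u --> weak_sol \<kappa> u --> ip u (rad P (poly p)) = ip u \<psi> * d p) \<and>
  d [:\<kappa>:] = complex_of_real (- c * (\<kappa> * bes' \<nu> \<kappa>)) \<and>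
  d [: - 4 * (\<nu> + 1) + \<kappa>, - \<kappa> :] = complex_of_real (- c * bes \<nu> \<kappa>)"
proof -
 define U where "U = (cplx (usol \<kappa> l P))"
 obtain \<psi> where \<psi>: "continuous_on UNIV \<psi>" "ip U \<psi> \<noteq> 0"
  "\<And>u p. ubi u ==> weak_sol \<kappa> u ==> ip U \<psi> * ip u (rad P (poly p)) = ip u \<psi> * ip U (rad P (poly p))"
  using weak_sol_component[OF dim P nz, of \<kappa>] unfolding U_def by blast
 obtain r where r: "ip U \<psi> = complex_of_real r" unfolding U_def ip_real by blast
 obtain c where c: "c > 0" and g: "\<forall>\<eta> \<eta>1 \<eta>2. smooth \<eta> --> (\<forall>s. DERIV \<eta> s :> \<eta>1 s) --> (\<forall>s. DERIV \<eta>1 s :> \<eta>2 s) -->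
   ip U (rad P (\<lambda>\<rho>. 4 * (\<nu> + 1) * \<eta>1 \<rho> + 4 * \<rho> * \<eta>2 \<rho> + \<kappa> * \<eta> \<rho>))
   = complex_of_real (c * (bes \<nu> \<kappa> * \<eta>1 1 - \<kappa> * bes' \<nu> \<kappa> * \<eta> 1))"
  using usol_green[OF dim P(1) nz, of \<kappa>] unfolding U_def \<nu>_def by blast
 have e1: "ip U (rad P (\<lambda>\<rho>. 4 * (\<nu> + 1) * 0 + 4 * \<rho> * 0 + \<kappa> * 1)) = complex_of_real (c * (bes \<nu> \<kappa> * 0 - \<kappa> * bes' \<nu> \<kappa> * 1))"
  by (rule g[rule_format]) (auto intro!: derivative_eq_intros)
 have e2: "ip U (rad P (\<lambda>\<rho>. 4 * (\<nu> + 1) * - 1 + 4 * \<rho> * 0 + \<kappa> * (1 - \<rho>))) = complex_of_real (c * (bes \<nu> \<kappa> * - 1 - \<kappa> * bes' \<nu> \<kappa> * (1 - 1)))"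
  by (rule g[rule_format]) (auto intro!: derivative_eq_intros)
 have p1: "(\<lambda>\<rho>. 4 * (\<nu> + 1) * 0 + 4 * \<rho> * 0 + \<kappa> * 1) = poly [:\<kappa>:]" by auto
 have p2: "(\<lambda>\<rho>. 4 * (\<nu> + 1) * - 1 + 4 * \<rho> * 0 + \<kappa> * (1 - \<rho>)) = poly [: - 4 * (\<nu> + 1) + \<kappa>, - \<kappa> :]" by (auto simp: algebra_simps)
 have "ip u (rad P (poly p)) = ip u (\<lambda>x. 1 / r * \<psi> x) * ip U (rad P (poly p))" if "ubi u" "weak_sol \<kappa> u" for u p
  using \<psi>(3)[OF that, of p] \<psi>(2) unfolding ip_cmult r by (simp add: field_simps)
 moreover have "continuous_on UNIV (\<lambda>x. 1 / r * \<psi> x)" by (intro continuous_intros \<psi>)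
 ultimately show ?thesis using c e1 e2 unfolding p1 p2 by (intro exI[of _ "\<lambda>x. 1 / r * \<psi> x"] exI[of _ "\<lambda>p. ip U (rad P (poly p))"] exI[of _ c]) simp
qed

section \<open>Completeness of the components\<close>

text \<open>The bounded function \<open>b\<close> has the sign of \<open>w\<close> and is an almost
  everywhere limit of continuous functions. Testing with these gives in the limit that the
  nonnegative function \<open>W * b\<close> has integral 0.\<close>

lemma orthogonal_continuous_imp_AE_zero:
 fixes w :: "'a::euclidean_space => real"
 assumes w: "ubi w" and z: "\<And>g. continuous_on UNIV g ==> (LINT x:ball 0 1|lebesgue. w x * g x) = 0"
 shows "AE x in lebesgue. x \<in> ball 0 1 --> w x = 0"
proof -
 define W where "W x = indicator (ball 0 1) x *\<^sub>R w x" for x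
 have W: "integrable lebesgue W" using w unfolding W_def[abs_def] set_integrable_def .
 have [measurable]: "W \<in> borel_measurable lebesgue" using W by (rule borel_measurable_integrable)
 define b where "b x = W x / (1 + \<bar>W x\<bar>)" for x
 have [measurable]: "b \<in> borel_measurable lebesgue" unfolding b_def[abs_def] by measurable
 have bb: "\<bar>b x\<bar> \<le> 1" for x by (simp add: b_def field_simps)
 obtain N g where N: "negligible N" and g: "\<And>n. continuous_on UNIV (g n)" "\<And>x. x \<notin> N ==> (\<lambda>n. g n x) \<longlonglongrightarrow> b x"
  using lebesgue_measurable_imp_measurable_on[of b UNIV] unfolding measurable_on_def by auto
 \<comment> \<open>Clipping to [-1, 1] preserves continuity and the limit, as \<open>b\<close> lies
   in that range, and makes \<open>\<bar>W x\<bar>\<close> a dominating function.\<close>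
 define h where "h n x = max (-1) (min 1 (g n x))" for n x
 have ch: "continuous_on UNIV (h n)" for n unfolding h_def by (intro continuous_intros g)
 have [measurable]: "h n \<in> borel_measurable lebesgue" for n by (rule continuous_borel_lebesgue[OF ch])
 have hb: "\<bar>h n x\<bar> \<le> 1" for n x by (auto simp: h_def)
 have "(\<lambda>n. LINT x|lebesgue. W x * h n x) \<longlonglongrightarrow> (LINT x|lebesgue. W x * b x)"
 proof (rule integral_dominated_convergence[where w = "\<lambda>x. \<bar>W x\<bar>"])
  show "integrable lebesgue (\<lambda>x. \<bar>W x\<bar>)" using W by simp
  have "AE x in lebesgue. x \<notin> N" using N by (intro AE_not_in) (simp add: negligible_iff_null_sets)
  thus "AE x in lebesgue. (\<lambda>n. W x * h n x) \<longlonglongrightarrow> W x * b x"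
  proof eventually_elim
   case (elim x)
   have "(\<lambda>n. h n x) \<longlonglongrightarrow> max (-1) (min 1 (b x))" unfolding h_def by (intro tendsto_intros g(2) elim)
   moreover have "max (-1) (min 1 (b x)) = b x" using bb[of x] by (auto simp: abs_le_iff)
   ultimately show ?case by (intro tendsto_mult tendsto_const) simp
  qed
  show "AE x in lebesgue. norm (W x * h n x) \<le> \<bar>W x\<bar>" for n
   using hb[of n] by (auto simp: abs_mult intro!: mult_left_le)
 qed measurable
 moreover have "(LINT x|lebesgue. W x * h n x) = 0" for n
  using z[OF ch] by (simp add: W_def set_lebesgue_integral_def mult.assoc)
 ultimately have 0: "(LINT x|lebesgue. W x * b x) = 0" by (simp add: LIMSEQ_const_iff)
 have "integrable lebesgue (\<lambda>x. W x * b x)"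
  by (rule Bochner_Integration.integrable_bound[OF integrable_abs[OF W]]) (auto simp: abs_mult intro!: mult_left_le bb)
 moreover have nn: "W x * b x \<ge> 0" for x by (auto simp: b_def field_simps)
 ultimately have "AE x in lebesgue. W x * b x = 0" using 0
  by (subst integral_nonneg_eq_0_iff_AE[symmetric]) auto
 thus ?thesis
 proof eventually_elim
  case (elim x)
  hence "W x = 0" by (auto simp: b_def abs_if split: if_splits)
  thus ?case by (auto simp: W_def)
 qed
qed

text \<open>Vanishing against all \<open>hbasis \<alpha>\<close> times radial polynomials spreads by
  the spanning principle to all polynomials, by Stone-Weierstrass to all continuous functions, and
  from there to \<open>v\<close> itself.\<close>

lemma components_zero_imp_AE_zero:
 fixes v :: "'a::euclidean_space => complex"
 assumes v: "ubi v" and z: "\<And>l \<alpha> p. \<alpha> \<in> hidx l ==> ip v (rad (hbasis \<alpha>) (poly p)) = 0"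
 shows "AE x in lebesgue. x \<in> ball 0 1 --> v x = 0"
proof -
 define Q :: "('a => real) => bool" where "Q f \<longleftrightarrow> continuous_on UNIV f \<and> (\<forall>p. ip v (rad f (poly p)) = 0)" for f
 have cp: "continuous_on UNIV (poly p)" for p :: "real poly" by (intro continuous_on_poly continuous_intros)
 have "Q f" if "hpoly d f" for d f
  using _ _ _ _ that
 proof (rule hbasis_span)
  fix f g assume "Q f" "Q g"
  moreover have "rad (\<lambda>x. f x + g x) (poly p) = (\<lambda>x. rad f (poly p) x + rad g (poly p) x)" for p
   by (auto simp: rad_def algebra_simps)
  ultimately show "Q (\<lambda>x. f x + g x)" unfolding Q_def
   by (auto intro!: continuous_on_add) (subst ip_add[OF v], auto intro!: continuous_rad cp)
 next
  fix c f assume "Q f"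
  moreover have "rad (\<lambda>x. c * f x) (poly p) = (\<lambda>x. c * rad f (poly p) x)" for p by (auto simp: rad_def)
  ultimately show "Q (\<lambda>x. c * f x)" unfolding Q_def by (auto intro!: continuous_on_mult continuous_on_const simp: ip_cmult)
 next
  fix f assume f: "Q f"
  \<comment> \<open>A factor |x|^2 is absorbed into the radial polynomial; for this reason the
    predicate quantifies over all \<open>p\<close>.\<close>
  have "rad (\<lambda>x. (x \<bullet> x) * f x) (poly p) = rad f (poly (pCons 0 p))" for p by (auto simp: rad_def)
  with f show "Q (\<lambda>x. (x \<bullet> x) * f x)" unfolding Q_def by (auto intro!: continuous_intros)
 next
  show "Q (hbasis \<alpha>)" if "\<alpha> \<in> hidx l" for l \<alpha>
   unfolding Q_def using z[OF that] by (auto intro!: smooth_continuous hpoly_smooth[OF hbasis_hpoly])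
 qed
 hence h: "ip v f = 0" if "hpoly d f" for d f using that[THEN \<open>\<And>f d. hpoly d f ==> Q f\<close>] unfolding Q_def
  by (auto dest!: spec[of _ 1] simp: rad_def[abs_def])
 have pf: "ip v f = 0" if "polyf f" for f
  using that by (induction rule: polyf.induct) (auto simp: h ip_add[OF v polyf_continuous polyf_continuous])
 have c: "ip v f = 0" if f: "continuous_on UNIV f" for f
 proof -
  have m: "0 \<le> mass v" unfolding mass_def set_lebesgue_integral_def by (rule integral_nonneg_AE) auto
  have "norm (ip v f) \<le> e" if e: "e > 0" for e
  proof -
   define d where "d = e / (1 + mass v)"
   have d: "d > 0" "d * mass v \<le> e" using e m by (auto simp: d_def field_simps)
   obtain g where g: "polyf g" "\<And>x. x \<in> cball 0 1 ==> \<bar>f x - g x\<bar> < d"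
    using polyf_dense[OF continuous_on_subset[OF f] d(1)] by auto
   have "ip v f = ip v (\<lambda>x. f x - g x)" using ip_diff[OF v f polyf_continuous[OF g(1)]] pf[OF g(1)] by simp
   also have "norm \<dots> \<le> d * mass v"
    using g(2) by (intro norm_ip_le[OF v] continuous_on_diff f polyf_continuous g(1)) (force intro: less_imp_le)
   finally show ?thesis using d by simp
  qed
  hence "norm (ip v f) \<le> 0" by (rule field_le_epsilon) simp
  thus ?thesis by simp
 qed
 have T: "AE x in lebesgue. x \<in> ball 0 1 --> T (v x) = 0" if T: "T = Re \<or> T = Im" for T
 proof (rule orthogonal_continuous_imp_AE_zero)
  have bl: "bounded_linear T" using T bounded_linear_Re bounded_linear_Im by auto
  have e: "indicator (ball 0 1) x *\<^sub>R T y = T (indicator (ball 0 1) x *\<^sub>R y)" for x :: 'a and y using T by auto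
  show "ubi (\<lambda>x. T (v x))" using integrable_bounded_linear[OF bl] v unfolding set_integrable_def e by blast
  show "(LINT x:ball 0 1|lebesgue. T (v x) * g x) = 0" if g: "continuous_on UNIV g" for g
  proof -
   have i: "integrable lebesgue (\<lambda>x. indicator (ball 0 1) x *\<^sub>R (v x * complex_of_real (g x)))"
    using ubi_mult_continuous[OF v g] unfolding set_integrable_def .
   have "(LINT x:ball 0 1|lebesgue. T (v x) * g x) = (LINT x|lebesgue. T (indicator (ball 0 1) x *\<^sub>R (v x * complex_of_real (g x))))"
    unfolding set_lebesgue_integral_def using T by (auto intro!: Bochner_Integration.integral_cong)
   also have "\<dots> = T (ip v g)" unfolding ip_def set_lebesgue_integral_def by (rule integral_bounded_linear[OF bl i])
   finally show ?thesis using c[OF g] T by auto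
  qed
 qed
 have "AE x in lebesgue. x \<in> ball 0 1 --> Re (v x) = 0" "AE x in lebesgue. x \<in> ball 0 1 --> Im (v x) = 0"
  using T[of Re] T[of Im] by auto
 thus ?thesis by eventually_elim (simp add: complex_eq_iff)
qed

text \<open>Gaussian elimination: fewer homogeneous equations than unknowns. A pivot
  \<open>s0\<close> of equation \<open>i\<close> is eliminated from the other equations, and its
  coefficient is recovered from equation \<open>i\<close> at the end.\<close>

lemma card_gt_imp_nontrivial_kernel:
 fixes T :: "'i => 'b => complex"
 assumes "finite I" "finite S" "card I < card S"
 shows "\<exists>c. (\<forall>i\<in>I. (\<Sum>s\<in>S. c s * T i s) = 0) \<and> (\<exists>s\<in>S. c s \<noteq> 0)"
 using assms
proof (induction I arbitrary: S T rule: finite_induct)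
 case empty
 then obtain s where "s \<in> S" by (metis card.empty card_gt_0_iff ex_in_conv)
 thus ?case by (intro exI[of _ "\<lambda>_. 1"]) auto
next
 case (insert i I)
 show ?case
 proof (cases "\<forall>s\<in>S. T i s = 0")
  case True
  have "card I < card S" using insert by simp
  from insert.IH[OF insert.prems(1) this, of T] True show ?thesis by auto
 next
  case False
  then obtain s0 where s0: "s0 \<in> S" "T i s0 \<noteq> 0" by blast
  define S' where "S' = S - {s0}"
  have S': "finite S'" "card I < card S'" "s0 \<notin> S'" "S = insert s0 S'" using insert s0 by (auto simp: S'_def)
  obtain c where c: "\<And>j. j \<in> I ==> (\<Sum>s\<in>S'. c s * (T j s - T j s0 * T i s / T i s0)) = 0" "\<exists>s\<in>S'. c s \<noteq> 0"
   using insert.IH[OF S'(1,2), of "\<lambda>j s. T j s - T j s0 * T i s / T i s0"] by blast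
  define a where "a = - (\<Sum>s\<in>S'. c s * T i s) / T i s0"
  define c' where "c' = c(s0 := a)"
  have sum: "(\<Sum>s\<in>S. c' s * T j s) = a * T j s0 + (\<Sum>s\<in>S'. c s * T j s)" for j
  proof -
   have "(\<Sum>s\<in>S'. c' s * T j s) = (\<Sum>s\<in>S'. c s * T j s)" using S'(3) by (intro sum.cong) (auto simp: c'_def)
   thus ?thesis unfolding S'(4) using S'(1,3) by (simp add: c'_def)
  qed
  have "(\<Sum>s\<in>S. c' s * T j s) = 0" if j: "j \<in> insert i I" for j
  proof (cases "j = i")
   case True
   thus ?thesis unfolding sum using s0 by (simp add: a_def)
  next
   case False
   have "(\<Sum>s\<in>S'. c s * T j s) - (\<Sum>s\<in>S'. c s * T i s) * T j s0 / T i s0 = 0"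
    using c(1)[of j] j False by (simp add: right_diff_distrib sum_subtractf sum_distrib_left sum_distrib_right sum_divide_distrib mult_ac)
   thus ?thesis unfolding sum by (simp add: a_def)
  qed
  moreover have "\<exists>s\<in>S. c' s \<noteq> 0" using c(2) S'(3,4) by (auto simp: c'_def)
  ultimately show ?thesis by blast
 qed
qed

lemma H01_ubi: "H01 (ball 0 1) u ==> ubi u" and H2_ubi: "H2 (ball 0 1) u ==> ubi u"
 by (auto simp: H01_def H2_def intro: L2_ubi)

lemma hbasis_nonzero: "\<alpha> \<in> hidx l ==> \<exists>y. hbasis \<alpha> y \<noteq> 0"
proof (rule ccontr)
 assume a: "\<alpha> \<in> hidx l" and "\<nexists>y. hbasis \<alpha> y \<noteq> 0"
 hence "(\<Sum>\<beta>\<in>hidx l. (if \<beta> = \<alpha> then 1 else 0) * hbasis \<beta> x) = 0" for x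
  by (intro sum.neutral) auto
 from hbasis_independent[OF this] a show False by auto
qed

lemma disjoint_hidx: "\<alpha> \<in> hidx l ==> \<alpha> \<in> hidx k ==> l = k"
 by (auto simp: hidx_def)

lemma card_hidx_UN: "finite A ==> finite (\<Union>l\<in>A. hidx l :: ('a::euclidean_space => nat) set) \<and>
  card (\<Union>l\<in>A. hidx l :: ('a => nat) set) = (\<Sum>l\<in>A. hdim TYPE('a) l)"
 by (subst card_UN_disjoint) (auto simp: finite_hidx hdim_def dest: disjoint_hidx)

section \<open>One-dimensionality of the components\<close>

text \<open>Testing with \<eta> = 1 - \<rho>, which vanishes on the sphere, shows that the
  coefficient times \<open>bes\<close> at \<kappa> is 0.\<close>

lemma dir_component:
 fixes P :: "'a::euclidean_space => real"
 assumes dim: "DIM('a) \<ge> 2" and P: "hpoly l P" "laplacian P = (\<lambda>x. 0)" and nz: "P y \<noteq> 0"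
 shows "\<exists>\<psi> d. continuous_on UNIV \<psi> \<and> (\<forall>u. H01 (ball 0 1) u --> weak_sol \<kappa> u -->
   (\<forall>p. ip u (rad P (poly p)) = ip u \<psi> * d p) \<and> (bes (sig TYPE('a) l) \<kappa> \<noteq> 0 --> ip u \<psi> = 0))"
proof -
 define \<nu> where "\<nu> = sig TYPE('a) l"
 obtain \<psi> d c where U: "continuous_on UNIV \<psi>" "(c::real) > 0"
  "\<And>u p. ubi u ==> weak_sol \<kappa> u ==> ip u (rad P (poly p)) = ip u \<psi> * d p"
  "d [: - 4 * (\<nu> + 1) + \<kappa>, - \<kappa> :] = complex_of_real (- c * bes \<nu> \<kappa>)"
  using weak_sol_coefficient[OF dim P nz, of \<kappa>] unfolding \<nu>_def by blast
 have rt: "radial_test P l (\<lambda>\<rho>. 1 - \<rho>) (\<lambda>_. - 1) (\<lambda>_. 0)" by unfold_locales (auto intro!: derivative_eq_intros dim P)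
 have p: "(\<lambda>\<rho>. 4 * (\<nu> + 1) * - 1 + 4 * \<rho> * 0 + \<kappa> * (1 - \<rho>)) = poly [: - 4 * (\<nu> + 1) + \<kappa>, - \<kappa> :]" by (auto simp: algebra_simps)
 have "ip u \<psi> = 0" if u: "H01 (ball 0 1) u" "weak_sol \<kappa> u" and b: "bes \<nu> \<kappa> \<noteq> 0" for u
 proof -
  have "ip u \<psi> * d [: - 4 * (\<nu> + 1) + \<kappa>, - \<kappa> :] = 0"
   using radial_test.H01_component[OF rt u] U(3)[OF H01_ubi[OF u(1)] u(2)] unfolding \<nu>_def[symmetric] p by simp
  thus ?thesis using b U(2) unfolding U(4) by simp
 qed
 thus ?thesis using U(1,3) H01_ubi unfolding \<nu>_def by blast
qed

text \<open>The test functions 1 and 1 - \<rho> give two linear equations between the coefficients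
  of \<open>u\<close> and \<open>v\<close>: radial derivatives agree and boundary values agree. One
  of them determines the coefficient of \<open>v\<close>, and elimination multiplies that of
  \<open>u\<close> by the determinant.\<close>

lemma ite_component:
 fixes P :: "'a::euclidean_space => real"
 assumes dim: "DIM('a) \<ge> 2" and P: "hpoly l P" "laplacian P = (\<lambda>x. 0)" and nz: "P y \<noteq> 0" and t: "t > 0"
 shows "\<exists>\<psi> d d'. continuous_on UNIV \<psi> \<and> (\<forall>u v. ubi u --> weak_sol (m * t) u --> ubi v --> weak_sol t v --> H02 (ball 0 1) (\<lambda>x. u x - v x) -->
    (\<forall>p. ip u (rad P (poly p)) = ip u \<psi> * d p \<and> ip v (rad P (poly p)) = ip u \<psi> * d' p)
    \<and> (bes_det (sig TYPE('a) l) m 1 t \<noteq> 0 --> ip u \<psi> = 0))"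
proof -
 define \<nu> where "\<nu> = sig TYPE('a) l"
 have \<nu>: "\<nu> \<ge> 0" unfolding \<nu>_def by (rule sig_nonneg[OF dim])
 define A where "A = bes \<nu> (m * t)" define A' where "A' = m * t * bes' \<nu> (m * t)"
 define B where "B = bes \<nu> t" define B' where "B' = t * bes' \<nu> t"
 have det: "bes_det \<nu> m 1 t = A * B' - A' * B" unfolding bes_det_def A_def A'_def B_def B'_def by simp
 have BB: "complex_of_real (B\<^sup>2 + B'\<^sup>2) \<noteq> 0" unfolding of_real_eq_0_iff
  using bes_nonzero(1)[OF \<nu> less_imp_le[OF t]] t by (auto simp: B_def B'_def sum_power2_eq_zero_iff)
 obtain \<psi> d c where U: "continuous_on UNIV \<psi>" "(c::real) > 0"
   "\<And>u p. ubi u ==> weak_sol (m * t) u ==> ip u (rad P (poly p)) = ip u \<psi> * d p"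
   "d [:m * t:] = complex_of_real (- c * A')"
   "d [: - 4 * (\<nu> + 1) + m * t, - (m * t) :] = complex_of_real (- c * A)"
  using weak_sol_coefficient[OF dim P nz, of "m * t"] unfolding A_def A'_def \<nu>_def by blast
 obtain \<phi> d' e where V: "continuous_on UNIV \<phi>" "(e::real) > 0"
   "\<And>u p. ubi u ==> weak_sol t u ==> ip u (rad P (poly p)) = ip u \<phi> * d' p"
   "d' [:t:] = complex_of_real (- e * B')"
   "d' [: - 4 * (\<nu> + 1) + t, - t :] = complex_of_real (- e * B)"
  using weak_sol_coefficient[OF dim P nz, of t] unfolding B_def B'_def \<nu>_def by blast
 have e0: "complex_of_real e \<noteq> 0" "complex_of_real c \<noteq> 0" using U(2) V(2) by auto
 \<comment> \<open>The boundary data of \<open>u\<close> projected onto the data (B, B') of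
   \<open>v\<close>, which never vanish together. Dividing by one of them alone would fail at its
   zeros.\<close>
 define f where "f = complex_of_real (c * (A * B + A' * B')) / (of_real e * of_real (B\<^sup>2 + B'\<^sup>2))"
 have rt1: "radial_test P l (\<lambda>_. 1) (\<lambda>_. 0) (\<lambda>_. 0)" and rt2: "radial_test P l (\<lambda>\<rho>. 1 - \<rho>) (\<lambda>_. - 1) (\<lambda>_. 0)"
  by (unfold_locales, auto intro!: derivative_eq_intros dim P)
 have p1: "(\<lambda>\<rho>. 4 * (\<nu> + 1) * 0 + 4 * \<rho> * 0 + \<kappa> * 1) = poly [:\<kappa>:]" for \<kappa> by auto
 have p2: "(\<lambda>\<rho>. 4 * (\<nu> + 1) * - 1 + 4 * \<rho> * 0 + \<kappa> * (1 - \<rho>)) = poly [: - 4 * (\<nu> + 1) + \<kappa>, - \<kappa> :]" for \<kappa> by (auto simp: algebra_simps)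
 have key: "ip v \<phi> = ip u \<psi> * f" "A * B' - A' * B \<noteq> 0 --> ip u \<psi> = 0"
  if u: "ubi u" "weak_sol (m * t) u" and v: "ubi v" "weak_sol t v" and H: "H02 (ball 0 1) (\<lambda>x. u x - v x)" for u v
 proof -
  define a where "a = ip u \<psi>" define b where "b = ip v \<phi>"
  have r1: "a * of_real c * of_real A' = b * of_real e * of_real B'"
   using radial_test.H02_component[OF rt1 H u v] unfolding \<nu>_def[symmetric] p1 U(3)[OF u] V(3)[OF v] U(4) V(4) by (simp add: a_def b_def mult.assoc)
  have r2: "a * of_real c * of_real A = b * of_real e * of_real B"
   using radial_test.H02_component[OF rt2 H u v] unfolding \<nu>_def[symmetric] p2 U(3)[OF u] V(3)[OF v] U(5) V(5) by (simp add: a_def b_def mult.assoc)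
  have "b * of_real e * of_real (B\<^sup>2 + B'\<^sup>2) = (b * of_real e * of_real B) * of_real B + (b * of_real e * of_real B') * of_real B'"
   by (simp add: power2_eq_square algebra_simps)
  also have "\<dots> = a * of_real (c * (A * B + A' * B'))" unfolding r1[symmetric] r2[symmetric] by (simp add: algebra_simps)
  finally have "b * (of_real e * of_real (B\<^sup>2 + B'\<^sup>2)) = a * of_real (c * (A * B + A' * B'))" by (simp only: mult.assoc)
  thus "ip v \<phi> = ip u \<psi> * f" unfolding a_def[symmetric] b_def[symmetric] f_def
   using BB e0 by (simp only: times_divide_eq_right eq_divide_eq mult_eq_0_iff) simp
  show "A * B' - A' * B \<noteq> 0 --> ip u \<psi> = 0"
  proof
   assume d: "A * B' - A' * B \<noteq> 0"
   have "a * of_real c * complex_of_real (A * B' - A' * B) = (a * of_real c * of_real A) * of_real B' - (a * of_real c * of_real A') * of_real B"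
    by (simp add: algebra_simps)
   also have "\<dots> = 0" unfolding r1 r2 by (simp add: algebra_simps)
   finally show "ip u \<psi> = 0" using d e0 by (simp only: mult_eq_0_iff of_real_eq_0_iff) (simp add: a_def)
  qed
 qed
 show ?thesis unfolding \<nu>_def[symmetric] det
  by (rule exI[of _ \<psi>], rule exI[of _ d], rule exI[of _ "\<lambda>p. f * d' p"]) (use U(1,3) V(3) key in \<open>auto simp: mult.assoc\<close>)
qed

section \<open>Dimensions of the eigenspaces\<close>

lemma ip_uminus: "ip u (\<lambda>x. - \<psi> x) = - ip u \<psi>"
 using ip_cmult[of u "-1" \<psi>] by simp

lemma ITE_pair_iff:
 "ITE_pair (ball 0 1) m lam u v \<longleftrightarrow> H2 (ball 0 1) u \<and> H2 (ball 0 1) v \<and> weak_sol (m * lam\<^sup>2) u \<and> weak_sol (lam\<^sup>2) v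
   \<and> H02 (ball 0 1) (\<lambda>x. u x - v x)"
proof -
 have "(LINT x:ball 0 1|lebesgue. u x * complex_of_real (- laplacian \<phi> x - lam\<^sup>2 * m * \<phi> x)) = - ip u (\<lambda>x. laplacian \<phi> x + (m * lam\<^sup>2) * \<phi> x)" for u :: "'a => complex" and \<phi>
  unfolding ip_uminus[symmetric] by (simp add: ip_def algebra_simps)
 moreover have "(LINT x:ball 0 1|lebesgue. u x * complex_of_real (- laplacian \<phi> x - lam\<^sup>2 * \<phi> x)) = - ip u (\<lambda>x. laplacian \<phi> x + lam\<^sup>2 * \<phi> x)" for u :: "'a => complex" and \<phi>
  unfolding ip_uminus[symmetric] by (simp add: ip_def algebra_simps)
 ultimately show ?thesis unfolding ITE_pair_def weak_sol_def by (simp only: neg_equal_0_iff_equal)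
qed

lemma dir_eigenspace_iff:
 assumes k: "k > 0"
 shows "u \<in> dir_eigenspace (ball 0 1) k \<mu> \<longleftrightarrow> H01 (ball 0 1) u \<and> weak_sol (\<mu> / k) u"
proof (cases "H01 (ball 0 1) u")
 case True
 have u: "ubi u" by (rule H01_ubi[OF True])
 have "(LINT x:ball 0 1|lebesgue. u x * complex_of_real (- k * laplacian \<phi> x)) = complex_of_real \<mu> * (LINT x:ball 0 1|lebesgue. u x * complex_of_real (\<phi> x))
   \<longleftrightarrow> ip u (\<lambda>x. laplacian \<phi> x + \<mu> / k * \<phi> x) = 0" if t: "test_fun (ball 0 1) \<phi>" for \<phi>
 proof -
  have s: "smooth \<phi>" using test_fun_smooth[OF t] .
  have "ip u (\<lambda>x. laplacian \<phi> x + \<mu> / k * \<phi> x) = ip u (laplacian \<phi>) + of_real (\<mu> / k) * ip u \<phi>"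
   by (subst ip_add[OF u]) (auto intro!: smooth_continuous s smooth_laplacian smooth_cmult simp only: ip_cmult)
  moreover have "(LINT x:ball 0 1|lebesgue. u x * complex_of_real (- k * laplacian \<phi> x)) = of_real (- k) * ip u (laplacian \<phi>)"
   using ip_cmult[of u "- k" "laplacian \<phi>"] by (simp only: ip_def)
  moreover have "complex_of_real \<mu> * (LINT x:ball 0 1|lebesgue. u x * complex_of_real (\<phi> x)) = of_real \<mu> * ip u \<phi>" by (simp add: ip_def)
  moreover have "of_real (- k) * a = of_real \<mu> * b \<longleftrightarrow> a + of_real (\<mu> / k) * b = 0" for a b :: complex
  proof -
   have "a + of_real (\<mu> / k) * b = (of_real k * a + of_real \<mu> * b) / of_real k" using k by (simp add: field_simps)
   hence "a + of_real (\<mu> / k) * b = 0 \<longleftrightarrow> of_real k * a + of_real \<mu> * b = 0" using k by simp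
   also have "\<dots> \<longleftrightarrow> of_real (- k) * a = of_real \<mu> * b" by (auto simp: add_eq_0_iff)
   finally show ?thesis by blast
  qed
  ultimately show ?thesis by (simp only:)
 qed
 thus ?thesis using True unfolding dir_eigenspace_def weak_sol_def by auto
qed (simp add: dir_eigenspace_def)

lemma sig_square_ge:
 assumes "DIM('a::euclidean_space) \<ge> 2" "real l \<ge> x" "l \<ge> 1"
 shows "x \<le> (sig TYPE('a) l)\<^sup>2"
proof -
 have "real DIM('a) \<ge> 2" using assms by linarith
 hence "sig TYPE('a) l \<ge> real l" unfolding sig_def by linarith
 hence "real l * real l \<le> sig TYPE('a) l * sig TYPE('a) l" by (intro mult_mono) auto
 moreover have "real l * 1 \<le> real l * real l" using assms by (intro mult_left_mono) auto
 ultimately show ?thesis using assms(2) unfolding power2_eq_square by linarith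
qed

section \<open>Upper bounds for the dimensions\<close>

definition dirset :: "'a::euclidean_space itself => real => nat set" where
 "dirset _ \<kappa> = {l. bes (sig TYPE('a) l) \<kappa> = 0}"

definition iteset :: "'a::euclidean_space itself => real => real => nat set" where
 "iteset _ m t = {l. bes_det (sig TYPE('a) l) m 1 t = 0}"

lemma finite_dirset:
 assumes dim: "DIM('a::euclidean_space) \<ge> 2" and k: "\<kappa> \<ge> 0" shows "finite (dirset TYPE('a) \<kappa>)"
proof (rule finite_subset)
 show "dirset TYPE('a) \<kappa> \<subseteq> {..nat \<lceil>\<kappa>\<rceil>}"
 proof
  fix l assume l: "l \<in> dirset TYPE('a) \<kappa>"
  show "l \<in> {..nat \<lceil>\<kappa>\<rceil>}"
  proof (rule ccontr)
   assume "l \<notin> {..nat \<lceil>\<kappa>\<rceil>}"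
   hence "real l \<ge> \<kappa>" "l \<ge> 1" by (auto, linarith)
   from bes_pos_below[OF sig_nonneg[OF dim] k sig_square_ge[OF dim this]] l show False by (simp add: dirset_def)
  qed
 qed
qed simp

lemma bes_det_swap: "bes_det \<nu> b a x = - bes_det \<nu> a b x"
 by (simp add: bes_det_def)

lemma bes_det_zero_imp:
 assumes s: "\<nu> \<ge> 0" and m: "m > 0" "m \<noteq> 1" and t: "t > 0" and z: "bes_det \<nu> m 1 t = 0"
 shows "\<nu>\<^sup>2 < max m 1 * t"
proof (rule ccontr)
 assume a: "\<not> \<nu>\<^sup>2 < max m 1 * t"
 show False
 proof (cases "m < 1")
  case True
  hence "det_zeros \<nu> m 1 t = {}" using a m by (intro det_zeros_count(3)[OF s]) auto
  thus False using z t by (auto simp: det_zeros_def)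
 next
  case False
  hence "det_zeros \<nu> 1 m t = {}" using a m by (intro det_zeros_count(3)[OF s]) auto
  thus False using z t bes_det_swap[of \<nu> 1 m t] by (auto simp: det_zeros_def)
 qed
qed

lemma finite_iteset:
 assumes dim: "DIM('a::euclidean_space) \<ge> 2" and m: "m > 0" "m \<noteq> 1" and t: "t > 0"
 shows "finite (iteset TYPE('a) m t)"
proof (rule finite_subset)
 show "iteset TYPE('a) m t \<subseteq> {..nat \<lceil>max m 1 * t\<rceil>}"
 proof
  fix l assume l: "l \<in> iteset TYPE('a) m t"
  show "l \<in> {..nat \<lceil>max m 1 * t\<rceil>}"
  proof (rule ccontr)
   assume "l \<notin> {..nat \<lceil>max m 1 * t\<rceil>}"
   hence "real l \<ge> max m 1 * t" "l \<ge> 1" by (auto, linarith)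
   from sig_square_ge[OF dim this] bes_det_zero_imp[OF sig_nonneg[OF dim] m t] l show False by (force simp: iteset_def)
  qed
 qed
qed simp

text \<open>With more functions than coefficients, some nontrivial combination has all coefficients
  of degree in \<open>A\<close> equal to 0; those of other degrees vanish by assumption. Then every
  component of the combination vanishes, against independence. One coefficient controls both entries
  of a pair, so only the first entries supply equations.\<close>

lemma card_le_sum_hdim:
 fixes S :: "(('a::euclidean_space => complex) \<times> ('a => complex)) set"
 assumes A: "finite A" and S: "finite S" "\<And>s. s \<in> S ==> ubi (fst s) \<and> ubi (snd s)" "ae_indep_pairs (ball 0 1) S"
  and comp: "\<And>l P y. hpoly l P ==> laplacian P = (\<lambda>x. 0) ==> P y \<noteq> 0 ==> \<exists>\<psi> d d'. continuous_on UNIV \<psi> \<and>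
   (\<forall>s\<in>S. (\<forall>p. ip (fst s) (rad P (poly p)) = ip (fst s) \<psi> * d p \<and> ip (snd s) (rad P (poly p)) = ip (fst s) \<psi> * d' p)
    \<and> (l \<notin> A --> ip (fst s) \<psi> = 0))"
 shows "card S \<le> (\<Sum>l\<in>A. hdim TYPE('a) l)"
proof (rule ccontr)
 assume gt: "\<not> ?thesis"
 define I where "I = (\<Union>l\<in>A. hidx l :: ('a => nat) set)"
 have I: "finite I" "card I < card S" unfolding I_def using card_hidx_UN[where 'a='a, OF A] gt by auto
 define R where "R \<alpha> \<psi> \<longleftrightarrow> (\<exists>d d'. \<forall>s\<in>S. (\<forall>p. ip (fst s) (rad (hbasis \<alpha>) (poly p)) = ip (fst s) \<psi> * d p \<and> ip (snd s) (rad (hbasis \<alpha>) (poly p)) = ip (fst s) \<psi> * d' p)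
    \<and> (mdeg \<alpha> \<notin> A --> ip (fst s) \<psi> = 0))" for \<alpha> \<psi>
 have "\<forall>\<alpha>\<in>(\<Union>l. hidx l). \<exists>\<psi>. R \<alpha> \<psi>"
 proof
  fix \<alpha> :: "'a => nat" assume "\<alpha> \<in> (\<Union>l. hidx l)"
  then obtain y where y: "hbasis \<alpha> y \<noteq> 0" using hbasis_nonzero by blast
  show "\<exists>\<psi>. R \<alpha> \<psi>" unfolding R_def using comp[OF hbasis_hpoly hbasis_harmonic y] by blast
 qed
 then obtain \<psi> where \<psi>: "\<And>l \<alpha>. \<alpha> \<in> hidx l ==> R \<alpha> (\<psi> \<alpha>)" using bchoice[of "\<Union>l. hidx l" R] by blast
 obtain c where c: "\<And>\<alpha>. \<alpha> \<in> I ==> (\<Sum>s\<in>S. c s * ip (fst s) (\<psi> \<alpha>)) = 0" "\<exists>s\<in>S. c s \<noteq> 0"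
  using card_gt_imp_nontrivial_kernel[OF I(1) S(1) I(2), of "\<lambda>\<alpha> s. ip (fst s) (\<psi> \<alpha>)"] by (elim exE conjE) (rule that, auto)
 have "AE x in lebesgue. x \<in> ball 0 1 --> (\<Sum>s\<in>S. c s * h s x) = 0" if h: "h = fst \<or> h = snd" for h
 proof (rule components_zero_imp_AE_zero)
  have uh: "ubi (h s)" if "s \<in> S" for s using h S(2)[OF that] by auto
  show "ubi (\<lambda>x. \<Sum>s\<in>S. c s * h s x)" by (rule ip_lincomb(2)[OF S(1) uh continuous_on_const])
  fix l and \<alpha> :: "'a => nat" and p assume a: "\<alpha> \<in> hidx l"
  obtain e where e: "\<And>s p. s \<in> S ==> ip (h s) (rad (hbasis \<alpha>) (poly p)) = ip (fst s) (\<psi> \<alpha>) * e p"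
   "\<And>s. s \<in> S ==> mdeg \<alpha> \<notin> A ==> ip (fst s) (\<psi> \<alpha>) = 0"
   using \<psi>[OF a] h unfolding R_def by metis
  have cr: "continuous_on UNIV (rad (hbasis \<alpha>) (poly p))"
   by (intro continuous_rad smooth_continuous hpoly_smooth[OF hbasis_hpoly] continuous_on_poly continuous_on_id)
  have "ip (\<lambda>x. \<Sum>s\<in>S. c s * h s x) (rad (hbasis \<alpha>) (poly p)) = (\<Sum>s\<in>S. c s * ip (h s) (rad (hbasis \<alpha>) (poly p)))"
   by (rule ip_lincomb(1)[OF S(1) uh cr])
  also have "\<dots> = (\<Sum>s\<in>S. c s * ip (fst s) (\<psi> \<alpha>)) * e p" using e(1) by (simp add: sum_distrib_right mult.assoc)
  also have "(\<Sum>s\<in>S. c s * ip (fst s) (\<psi> \<alpha>)) = 0"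
   using c(1)[of \<alpha>] e(2) a by (cases "mdeg \<alpha> \<in> A") (auto simp: I_def hidx_def)
  finally show "ip (\<lambda>x. \<Sum>s\<in>S. c s * h s x) (rad (hbasis \<alpha>) (poly p)) = 0" by simp
 qed
 from this[of fst] this[of snd] have "AE x in lebesgue. x \<in> ball 0 1 --> (\<Sum>s\<in>S. c s * fst s x) = 0 \<and> (\<Sum>s\<in>S. c s * snd s x) = 0"
  by (simp add: AE_conj_iff imp_conjR)
 thus False using S(3) c(2) unfolding ae_indep_pairs_def by blast
qed

text \<open>Dirichlet eigenfunctions are treated as diagonal pairs (u, u), so that the bound for
  pairs applies.\<close>

lemma dir_card_le:
 assumes dim: "DIM('a::euclidean_space) \<ge> 2" and k: "\<kappa> \<ge> 0"
  and S: "finite S" "\<And>u. u \<in> S ==> H01 (ball (0::'a) 1) u \<and> weak_sol \<kappa> u" "ae_indep (ball 0 1) S"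
 shows "card S \<le> (\<Sum>l\<in>dirset TYPE('a) \<kappa>. hdim TYPE('a) l)"
proof -
 have inj: "inj_on (\<lambda>u. (u, u)) S" by (rule inj_onI) simp
 have "card ((\<lambda>u. (u, u)) ` S) \<le> (\<Sum>l\<in>dirset TYPE('a) \<kappa>. hdim TYPE('a) l)"
 proof (rule card_le_sum_hdim[OF finite_dirset[OF dim k]])
  show "ae_indep_pairs (ball 0 1) ((\<lambda>u. (u, u)) ` S)" unfolding ae_indep_pairs_def
  proof (intro allI impI)
   fix c assume "AE x in lebesgue. x \<in> ball 0 1 --> (\<Sum>p\<in>(\<lambda>u. (u, u)) ` S. c p * fst p x) = 0 \<and> (\<Sum>p\<in>(\<lambda>u. (u, u)) ` S. c p * snd p x) = 0"
   hence "AE x in lebesgue. x \<in> ball 0 1 --> (\<Sum>u\<in>S. c (u, u) * u x) = 0" unfolding sum.reindex[OF inj] by simp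
   thus "\<forall>p\<in>(\<lambda>u. (u, u)) ` S. c p = 0" using S(3)[unfolded ae_indep_def, rule_format, of "\<lambda>u. c (u, u)"] by blast
  qed
  fix l and P :: "'a => real" and y assume P: "hpoly l P" "laplacian P = (\<lambda>x. 0)" "P y \<noteq> 0"
  from dir_component[OF dim P, of \<kappa>] obtain \<psi> d where "continuous_on UNIV \<psi>" "\<And>u. H01 (ball 0 1) u ==> weak_sol \<kappa> u ==>
   (\<forall>p. ip u (rad P (poly p)) = ip u \<psi> * d p) \<and> (bes (sig TYPE('a) l) \<kappa> \<noteq> 0 --> ip u \<psi> = 0)" by blast
  thus "\<exists>\<psi> d d'. continuous_on UNIV \<psi> \<and> (\<forall>s\<in>(\<lambda>u. (u, u)) ` S. (\<forall>p. ip (fst s) (rad P (poly p)) = ip (fst s) \<psi> * d p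
    \<and> ip (snd s) (rad P (poly p)) = ip (fst s) \<psi> * d' p) \<and> (l \<notin> dirset TYPE('a) \<kappa> --> ip (fst s) \<psi> = 0))"
   using S(2) by (intro exI[of _ \<psi>] exI[of _ d]) (auto simp: dirset_def)
 qed (use S(1) S(2)[THEN conjunct1, THEN H01_ubi] in auto)
 thus ?thesis by (simp add: card_image[OF inj])
qed

lemma ite_card_le:
 assumes dim: "DIM('a::euclidean_space) \<ge> 2" and m: "m > 0" "m \<noteq> 1" and lam: "lam > 0"
  and S: "finite S" "\<And>p. p \<in> S ==> ITE_pair (ball (0::'a) 1) m lam (fst p) (snd p)" "ae_indep_pairs (ball 0 1) S"
 shows "card S \<le> (\<Sum>l\<in>iteset TYPE('a) m (lam\<^sup>2). hdim TYPE('a) l)"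
proof -
 have t: "lam\<^sup>2 > 0" using lam by simp
 have us: "ubi (fst s) \<and> ubi (snd s)" if "s \<in> S" for s using S(2)[OF that] H2_ubi unfolding ITE_pair_def by blast
 show ?thesis
 proof (rule card_le_sum_hdim[OF finite_iteset[OF dim m t] S(1) us S(3)])
  fix l and P :: "'a => real" and y assume P: "hpoly l P" "laplacian P = (\<lambda>x. 0)" "P y \<noteq> 0"
  obtain \<psi> d d' where c: "continuous_on UNIV \<psi>" and R: "\<forall>u v. ubi u --> weak_sol (m * lam\<^sup>2) u --> ubi v --> weak_sol (lam\<^sup>2) v -->
    H02 (ball 0 1) (\<lambda>x. u x - v x) --> (\<forall>p. ip u (rad P (poly p)) = ip u \<psi> * d p \<and> ip v (rad P (poly p)) = ip u \<psi> * d' p)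
    \<and> (bes_det (sig TYPE('a) l) m 1 (lam\<^sup>2) \<noteq> 0 --> ip u \<psi> = 0)"
   using ite_component[OF dim P t, of m] by (elim exE conjE) (rule that)
  have "(\<forall>p. ip (fst s) (rad P (poly p)) = ip (fst s) \<psi> * d p \<and> ip (snd s) (rad P (poly p)) = ip (fst s) \<psi> * d' p)
    \<and> (l \<notin> iteset TYPE('a) m (lam\<^sup>2) --> ip (fst s) \<psi> = 0)" if "s \<in> S" for s
   using R[rule_format, of "fst s" "snd s"] S(2)[OF that, unfolded ITE_pair_iff] us[OF that] by (simp add: iteset_def)
  thus "\<exists>\<psi> d d'. continuous_on UNIV \<psi> \<and> (\<forall>s\<in>S. (\<forall>p. ip (fst s) (rad P (poly p)) = ip (fst s) \<psi> * d p
    \<and> ip (snd s) (rad P (poly p)) = ip (fst s) \<psi> * d' p) \<and> (l \<notin> iteset TYPE('a) m (lam\<^sup>2) --> ip (fst s) \<psi> = 0))" using c by blast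
 qed
qed

section \<open>Sobolev membership of explicit eigenfunctions\<close>

lemma L2_dist2_tendsto_0:
 fixes w :: "'a::euclidean_space => real"
 assumes c: "continuous_on UNIV w" "\<And>k. continuous_on UNIV (\<phi> k)"
  and C: "\<And>k x. x \<in> ball 0 1 ==> \<bar>\<phi> k x\<bar> \<le> C" and lim: "\<And>x. x \<in> ball 0 1 ==> (\<lambda>k. \<phi> k x) \<longlonglongrightarrow> w x"
 shows "(\<lambda>k. L2_dist2 (ball 0 1) (cplx w) (\<phi> k)) \<longlonglongrightarrow> 0"
proof -
 obtain B where B: "B > 0" "\<And>x. x \<in> cball 0 1 ==> norm (w x) \<le> B" using continuous_bounded_ball[OF c(1)] by blast
 define u where "u = (\<lambda>x::'a. complex_of_real 1)"
 have uu: "ubi u" unfolding u_def by (intro ubi_continuous continuous_intros)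
 have e: "ip u (\<lambda>x. (w x - \<phi> k x)\<^sup>2) = complex_of_real (L2_dist2 (ball 0 1) (cplx w) (\<phi> k))" for k
  unfolding u_def ip_real L2_dist2_def by (simp flip: of_real_diff)
 have "(\<lambda>k. ip u (\<lambda>x. (w x - \<phi> k x)\<^sup>2)) \<longlonglongrightarrow> ip u (\<lambda>x. 0)"
 proof (rule ip_dominated[OF uu, where C = "(B + C)\<^sup>2"])
  fix k and x :: 'a assume x: "x \<in> ball 0 1"
  have "\<bar>w x - \<phi> k x\<bar> \<le> B + C" using B(2)[of x] C[OF x, of k] x by auto
  hence "\<bar>w x - \<phi> k x\<bar>\<^sup>2 \<le> (B + C)\<^sup>2" by (intro power_mono) auto
  thus "\<bar>(w x - \<phi> k x)\<^sup>2\<bar> \<le> (B + C)\<^sup>2" by simp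
 next
  fix x :: 'a assume x: "x \<in> ball 0 1"
  have "(\<lambda>k. (w x - \<phi> k x)\<^sup>2) \<longlonglongrightarrow> (w x - w x)\<^sup>2" by (intro tendsto_power tendsto_diff tendsto_const lim x)
  thus "(\<lambda>k. (w x - \<phi> k x)\<^sup>2) \<longlonglongrightarrow> 0" by simp
 qed (intro continuous_intros c)+
 hence "(\<lambda>k. complex_of_real (L2_dist2 (ball 0 1) (cplx w) (\<phi> k))) \<longlonglongrightarrow> of_real 0"
  unfolding e ip_zero by simp
 thus ?thesis by (simp only: tendsto_of_real_iff)
qed

text \<open>Moving the two derivatives over one after the other reverses their order, hence the
  swapped indices in the second-order statement.\<close>

lemma weak_pd_smooth:
 assumes w: "smooth w" and ij: "i \<in> Basis" "j \<in> Basis"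
 shows "weak_pd1 (ball 0 1) (cplx w) i (cplx (pd [i] w))"
  and "weak_pd2 (ball 0 1) (cplx w) i j (cplx (pd [j, i] w))"
proof -
 have "ip (cplx w) (pd [i] (pd [j] \<phi>)) = ip (cplx (pd [j] (pd [i] w))) \<phi>"
  if t: "test_fun (ball 0 1) \<phi>" for \<phi>
  unfolding ip_by_parts(1)[OF test_fun_pd[OF t ij(2)] w ij(1)] ip_by_parts(1)[OF t smooth_pd[OF w ij(1)] ij(2)] by simp
 thus "weak_pd2 (ball 0 1) (cplx w) i j (cplx (pd [j, i] w))"
  unfolding weak_pd_ip pd_two by blast
 show "weak_pd1 (ball 0 1) (cplx w) i (cplx (pd [i] w))"
  unfolding weak_pd_ip using ip_by_parts(1)[OF _ w ij(1)] by blast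
qed

lemma L2_smooth: "smooth w ==> L2 (ball 0 1) (cplx w)"
 by (intro L2_continuous smooth_continuous)

lemma H2_smooth:
 fixes w :: "'a::euclidean_space => real"
 assumes w: "smooth w" shows "H2 (ball 0 1) (cplx w)"
 unfolding H2_def
proof (intro conjI ballI)
 show "L2 (ball 0 1) (cplx w)" by (rule L2_smooth[OF w])
next
 fix i :: 'a assume i: "i \<in> Basis"
 show "\<exists>g. L2 (ball 0 1) g \<and> weak_pd1 (ball 0 1) (cplx w) i g"
  using weak_pd_smooth(1)[OF w i i] L2_smooth[OF smooth_pd[OF w i]] by blast
next
 fix i j :: 'a assume i: "i \<in> Basis" "j \<in> Basis"
 have "smooth (pd [j, i] w)" using i by (intro smooth_pds w) auto
 thus "\<exists>g. L2 (ball 0 1) g \<and> weak_pd2 (ball 0 1) (cplx w) i j g"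
  using weak_pd_smooth(2)[OF w i] L2_smooth by blast
qed

lemma rad_bounded:
 assumes P: "continuous_on UNIV P"
 shows "\<exists>B>0. \<forall>x\<in>ball 0 1. \<forall>h C. \<bar>h (x \<bullet> x)\<bar> \<le> C --> \<bar>rad P h x\<bar> \<le> B * C"
proof -
 obtain B where B: "B > 0" "\<And>x. x \<in> cball 0 1 ==> norm (P x) \<le> B" using continuous_bounded_ball[OF P] by blast
 have "\<bar>rad P h x\<bar> \<le> B * C" if "x \<in> ball 0 1" "\<bar>h (x \<bullet> x)\<bar> \<le> C" for x h C
  unfolding rad_def abs_mult using B that by (intro mult_mono) auto
 thus ?thesis using B(1) by blast
qed

lemma rad_lim: "(\<lambda>N. h N (x \<bullet> x)) \<longlonglongrightarrow> k (x \<bullet> x) ==> (\<lambda>N. rad P (h N) x) \<longlonglongrightarrow> rad P k x"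
 unfolding rad_def by (rule tendsto_mult[OF tendsto_const])

text \<open>The simple zero of \<open>h\<close> at 1 keeps the first derivatives of the cut-offs
  bounded, so pointwise convergence in the open ball is enough for convergence in the mean
  square.\<close>

lemma cut_approximation:
 fixes P :: "'a::euclidean_space => real"
 assumes P: "smooth P" and h: "smooth h" "h 1 = 0"
 shows "(\<lambda>k. L2_dist2 (ball 0 1) (cplx (rad P h)) (rad P (\<lambda>\<rho>. h \<rho> * cut0 1 k \<rho>))) \<longlonglongrightarrow> 0"
  and "i \<in> Basis ==> (\<lambda>k. L2_dist2 (ball 0 1) (cplx (pd [i] (rad P h))) (pd [i] (rad P (\<lambda>\<rho>. h \<rho> * cut0 1 k \<rho>)))) \<longlonglongrightarrow> 0"
proof -
 define h1 where "h1 = pd [1] h"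
 have dh: "DERIV h s :> h1 s" for s unfolding h1_def by (rule smooth_imp_DERIV[OF h(1)])
 have sh1: "smooth h1" by (rule smooth_real_deriv[OF h(1) dh])
 have dh1: "DERIV h1 s :> pd [1] h1 s" for s by (rule smooth_imp_DERIV[OF sh1])
 define \<phi> where "\<phi> N = rad P (\<lambda>\<rho>. h \<rho> * cut0 1 N \<rho>)" for N
 have t: "test_fun (ball 0 1) (\<phi> N)" for N unfolding \<phi>_def by (rule test_fun_cut[OF P h(1)]) simp
 have sr: "smooth (rad P h)" by (rule smooth_rad[OF P h(1)])
 obtain A where A: "A \<ge> 0" "\<And>\<rho>. \<rho> \<in> {0..1} ==> \<bar>h \<rho>\<bar> \<le> A * (1 - \<rho>)" "\<And>\<rho>. \<rho> \<in> {0..1} ==> \<bar>h1 \<rho>\<bar> \<le> A"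
  using boundary_order1[OF dh smooth_continuous[OF sh1] h(2)] by blast
 obtain C where C: "\<And>N \<rho>. 0 \<le> \<rho> ==> \<bar>h \<rho> * cut0 1 N \<rho>\<bar> \<le> C" "\<And>N \<rho>. 0 \<le> \<rho> ==> \<bar>cutd1 1 N h h1 \<rho>\<bar> \<le> C"
  using cutd_bound1[of 1 h A h1] A by fastforce
 obtain B where B: "\<And>x h C. x \<in> ball 0 1 ==> \<bar>h (x \<bullet> x)\<bar> \<le> C ==> \<bar>rad P h x\<bar> \<le> B * C"
  using rad_bounded[OF smooth_continuous[OF P]] by blast
 have "(\<lambda>k. L2_dist2 (ball 0 1) (cplx (rad P h)) (\<phi> k)) \<longlonglongrightarrow> 0"
 proof (rule L2_dist2_tendsto_0[where C = "B * C"])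
  show "(\<lambda>k. \<phi> k x) \<longlonglongrightarrow> rad P h x" if "x \<in> ball 0 1" for x
   unfolding \<phi>_def by (intro rad_lim cutd_tendsto inner_self_less_1 that)
  show "\<bar>\<phi> k x\<bar> \<le> B * C" if "x \<in> ball 0 1" for k x unfolding \<phi>_def by (rule B[OF that C(1)]) simp
 qed (auto intro!: smooth_continuous sr test_fun_smooth[OF t])
 thus "(\<lambda>k. L2_dist2 (ball 0 1) (cplx (rad P h)) (rad P (\<lambda>\<rho>. h \<rho> * cut0 1 k \<rho>))) \<longlonglongrightarrow> 0"
  unfolding \<phi>_def .
 assume i: "i \<in> Basis"
 have c: "continuous_on UNIV (pd [i] P)" "continuous_on UNIV (\<lambda>x. 2 * (x \<bullet> i) * P x)"
  using smooth_continuous[OF smooth_pd[OF P i]] by (auto intro!: continuous_intros smooth_continuous[OF P])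
 obtain B1 where B1: "\<And>x h C. x \<in> ball 0 1 ==> \<bar>h (x \<bullet> x)\<bar> \<le> C ==> \<bar>rad (pd [i] P) h x\<bar> \<le> B1 * C"
  using rad_bounded[OF c(1)] by blast
 obtain B2 where B2: "\<And>x h C. x \<in> ball 0 1 ==> \<bar>h (x \<bullet> x)\<bar> \<le> C ==> \<bar>rad (\<lambda>x. 2 * (x \<bullet> i) * P x) h x\<bar> \<le> B2 * C"
  using rad_bounded[OF c(2)] by blast
 have e: "pd [i] (\<phi> N) x = rad (pd [i] P) (\<lambda>\<rho>. h \<rho> * cut0 1 N \<rho>) x + rad (\<lambda>x. 2 * (x \<bullet> i) * P x) (cutd1 1 N h h1) x" for N x
  unfolding \<phi>_def by (subst pd_rad[OF P cutd_derivative(1)[OF dh dh1]]) simp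
 have "(\<lambda>k. L2_dist2 (ball 0 1) (cplx (pd [i] (rad P h))) (pd [i] (\<phi> k))) \<longlonglongrightarrow> 0"
 proof (rule L2_dist2_tendsto_0[where C = "B1 * C + B2 * C"])
  show "(\<lambda>k. pd [i] (\<phi> k) x) \<longlonglongrightarrow> pd [i] (rad P h) x" if "x \<in> ball 0 1" for x
   unfolding e pd_rad[OF P dh] by (intro tendsto_add rad_lim cutd_tendsto inner_self_less_1 that)
  show "\<bar>pd [i] (\<phi> k) x\<bar> \<le> B1 * C + B2 * C" if x: "x \<in> ball 0 1" for k x
  proof -
   have "\<bar>rad (pd [i] P) (\<lambda>\<rho>. h \<rho> * cut0 1 k \<rho>) x\<bar> \<le> B1 * C" by (rule B1[OF x C(1)]) simp
   moreover have "\<bar>rad (\<lambda>x. 2 * (x \<bullet> i) * P x) (cutd1 1 k h h1) x\<bar> \<le> B2 * C" by (rule B2[OF x C(2)]) simp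
   ultimately show ?thesis unfolding e by linarith
  qed
 qed (auto intro!: smooth_continuous smooth_pd i sr test_fun_smooth[OF t])
 thus "(\<lambda>k. L2_dist2 (ball 0 1) (cplx (pd [i] (rad P h))) (pd [i] (rad P (\<lambda>\<rho>. h \<rho> * cut0 1 k \<rho>)))) \<longlonglongrightarrow> 0"
  unfolding \<phi>_def .
qed

lemma H01_rad:
 fixes P :: "'a::euclidean_space => real"
 assumes P: "smooth P" and h: "smooth h" "h 1 = 0"
 shows "H01 (ball 0 1) (cplx (rad P h))"
proof -
 have sr: "smooth (rad P h)" by (rule smooth_rad[OF P h(1)])
 show ?thesis unfolding H01_def
  by (intro conjI exI[of _ "\<lambda>k. rad P (\<lambda>\<rho>. h \<rho> * cut0 1 k \<rho>)"] exI[of _ "\<lambda>i x. complex_of_real (pd [i] (rad P h) x)"] allI ballI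
    L2_smooth sr test_fun_cut P h smooth_pd weak_pd_smooth cut_approximation) auto
qed

text \<open>The double zero of the profile at 1 keeps the second derivatives of the cut-offs
  bounded, which gives mean-square convergence up to second order by dominated convergence.\<close>

lemma H02_rad:
 fixes P :: "'a::euclidean_space => real"
 assumes P: "hpoly l P" and h: "smooth h" "\<And>s. DERIV h s :> h1 s" "h 1 = 0" "h1 1 = 0"
 shows "H02 (ball 0 1) (cplx (rad P h))"
proof -
 have sP: "smooth P" by (rule hpoly_smooth[OF P])
 note dh = h(2)
 have sh1: "smooth h1" by (rule smooth_real_deriv[OF h(1) dh])
 define h2 where "h2 = pd [1] h1"
 have dh1: "DERIV h1 s :> h2 s" for s unfolding h2_def by (rule smooth_imp_DERIV[OF sh1])
 have sh2: "smooth h2" by (rule smooth_real_deriv[OF sh1 dh1])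
 define \<phi> where "\<phi> N = rad P (\<lambda>\<rho>. h \<rho> * cut0 1 N \<rho>)" for N
 have t: "test_fun (ball 0 1) (\<phi> N)" for N unfolding \<phi>_def by (rule test_fun_cut[OF sP h(1)]) simp
 have sr: "smooth (rad P h)" by (rule smooth_rad[OF sP h(1)])
 obtain A where A: "A \<ge> 0" "\<And>\<rho>. \<rho> \<in> {0..1} ==> \<bar>h \<rho>\<bar> \<le> A * (1 - \<rho>)\<^sup>2" "\<And>\<rho>. \<rho> \<in> {0..1} ==> \<bar>h1 \<rho>\<bar> \<le> A * (1 - \<rho>)" "\<And>\<rho>. \<rho> \<in> {0..1} ==> \<bar>h2 \<rho>\<bar> \<le> A"
  using boundary_order2[OF dh dh1 smooth_continuous[OF sh2] h(3,4)] by blast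
 obtain C where C: "\<And>N \<rho>. 0 \<le> \<rho> ==> \<bar>h \<rho> * cut0 1 N \<rho>\<bar> \<le> C" "\<And>N \<rho>. 0 \<le> \<rho> ==> \<bar>cutd1 1 N h h1 \<rho>\<bar> \<le> C" "\<And>N \<rho>. 0 \<le> \<rho> ==> \<bar>cutd2 1 N h h1 h2 \<rho>\<bar> \<le> C"
  using cutd_bound2[of 1 h A h1 h2] A by fastforce
 have scut: "smooth (\<lambda>\<rho>. h \<rho> * cut0 1 N \<rho>)" for N by (intro smooth_mult h smooth_cut)
 have sc1: "smooth (cutd1 1 N h h1)" for N by (rule smooth_real_deriv[OF scut cutd_derivative(1)[OF dh dh1]])
 define Q where "Q i j x = 2 * ((x \<bullet> i) * pd [j] P x + (x \<bullet> j) * pd [i] P x + (i \<bullet> j) * P x)" for i j and x :: 'a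
 define R where "R i j x = 4 * (x \<bullet> i) * (x \<bullet> j) * P x" for i j and x :: 'a
 have pd2: "pd [i, j] (rad P k) x = rad (pd [i, j] P) k x + rad (Q i j) k' x + rad (R i j) k'' x"
  if k: "\<And>s. DERIV k s :> k' s" "\<And>s. DERIV k' s :> k'' s" "smooth k'" "i \<in> Basis" "j \<in> Basis"
  for k k' k'' and i j x :: "'a"
  using pd2_radial[OF sP k] by (simp add: rad_def[abs_def] Q_def R_def)
 show ?thesis unfolding H02_def
 proof (intro conjI exI[of _ \<phi>] exI[of _ "\<lambda>i x. complex_of_real (pd [i] (rad P h) x)"] exI[of _ "\<lambda>i j x. complex_of_real (pd [j, i] (rad P h) x)"] allI ballI)
  show "H2 (ball 0 1) (cplx (rad P h))" by (rule H2_smooth[OF sr])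
  show "test_fun (ball 0 1) (\<phi> N)" for N by (rule t)
  show "L2 (ball 0 1) (cplx (pd [i] (rad P h)))" if "i \<in> Basis" for i
   by (intro L2_continuous smooth_continuous smooth_pd sr that)
  show "weak_pd1 (ball 0 1) (cplx (rad P h)) i (cplx (pd [i] (rad P h)))" if "i \<in> Basis" for i
   by (rule weak_pd_smooth[OF sr that that])
  show "L2 (ball 0 1) (cplx (pd [j, i] (rad P h)))" if "i \<in> Basis" "j \<in> Basis" for i j
   by (intro L2_continuous smooth_continuous smooth_pds sr) (use that in auto)
  show "weak_pd2 (ball 0 1) (cplx (rad P h)) i j (cplx (pd [j, i] (rad P h)))" if "i \<in> Basis" "j \<in> Basis" for i j
   by (rule weak_pd_smooth[OF sr that])
  show "(\<lambda>k. L2_dist2 (ball 0 1) (cplx (rad P h)) (\<phi> k)) \<longlonglongrightarrow> 0"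
   unfolding \<phi>_def by (rule cut_approximation(1)[OF sP h(1,3)])
  fix i :: 'a assume i: "i \<in> Basis"
  show "(\<lambda>k. L2_dist2 (ball 0 1) (cplx (pd [i] (rad P h))) (pd [i] (\<phi> k))) \<longlonglongrightarrow> 0"
   unfolding \<phi>_def by (rule cut_approximation(2)[OF sP h(1,3) i])
  fix j :: 'a assume j: "j \<in> Basis"
  \<comment> \<open>The weak second derivatives come with reversed indices. The radial terms are
    symmetric in \<open>i\<close> and \<open>j\<close>, so commutation is only needed for the
    polynomial \<open>P\<close>.\<close>
  have sw: "pd [j, i] (rad P h) = pd [i, j] (rad P h)"
  proof
   fix x
   have "Q j i x = Q i j x" "R j i x = R i j x" by (simp_all add: Q_def R_def inner_commute algebra_simps)
   thus "pd [j, i] (rad P h) x = pd [i, j] (rad P h) x"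
    unfolding pd2[OF dh dh1 sh1 i j] pd2[OF dh dh1 sh1 j i] rad_def hpoly_pd_commute[OF P i j] by simp
  qed
  have c: "continuous_on UNIV (pd [i, j] P)" "continuous_on UNIV (Q i j)" "continuous_on UNIV (R i j)"
   using smooth_continuous[OF smooth_pds[OF sP, of "[i, j]"]] smooth_continuous[OF smooth_pd[OF sP i]] smooth_continuous[OF smooth_pd[OF sP j]] i j
   unfolding Q_def R_def by (auto intro!: continuous_intros smooth_continuous[OF sP])
  obtain B3 where B3: "\<And>x h C. x \<in> ball 0 1 ==> \<bar>h (x \<bullet> x)\<bar> \<le> C ==> \<bar>rad (pd [i, j] P) h x\<bar> \<le> B3 * C"
   using rad_bounded[OF c(1)] by blast
  obtain B4 where B4: "\<And>x h C. x \<in> ball 0 1 ==> \<bar>h (x \<bullet> x)\<bar> \<le> C ==> \<bar>rad (Q i j) h x\<bar> \<le> B4 * C"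
   using rad_bounded[OF c(2)] by blast
  obtain B5 where B5: "\<And>x h C. x \<in> ball 0 1 ==> \<bar>h (x \<bullet> x)\<bar> \<le> C ==> \<bar>rad (R i j) h x\<bar> \<le> B5 * C"
   using rad_bounded[OF c(3)] by blast
  note e2 = pd2[OF cutd_derivative[OF dh dh1] sc1 i j, folded \<phi>_def]
  show "(\<lambda>k. L2_dist2 (ball 0 1) (cplx (pd [j, i] (rad P h))) (pd [i, j] (\<phi> k))) \<longlonglongrightarrow> 0"
   unfolding sw
  proof (rule L2_dist2_tendsto_0[where C = "B3 * C + B4 * C + B5 * C"])
   show "(\<lambda>k. pd [i, j] (\<phi> k) x) \<longlonglongrightarrow> pd [i, j] (rad P h) x" if "x \<in> ball 0 1" for x
    unfolding e2 pd2[OF dh dh1 sh1 i j] by (intro tendsto_add rad_lim cutd_tendsto inner_self_less_1 that)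
   show "\<bar>pd [i, j] (\<phi> k) x\<bar> \<le> B3 * C + B4 * C + B5 * C" if x: "x \<in> ball 0 1" for k x
   proof -
    have "\<bar>rad (pd [i, j] P) (\<lambda>\<rho>. h \<rho> * cut0 1 k \<rho>) x\<bar> \<le> B3 * C" by (rule B3[OF x C(1)]) simp
    moreover have "\<bar>rad (Q i j) (cutd1 1 k h h1) x\<bar> \<le> B4 * C" by (rule B4[OF x C(2)]) simp
    moreover have "\<bar>rad (R i j) (cutd2 1 k h h1 h2) x\<bar> \<le> B5 * C" by (rule B5[OF x C(3)]) simp
    ultimately show ?thesis unfolding e2 by linarith
   qed
  qed (use i j in \<open>auto intro!: smooth_continuous smooth_pds sr test_fun_smooth[OF t]\<close>)
 qed
qed

section \<open>Linear independence and exact multiplicities\<close>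

text \<open>Near the origin each solution looks like its harmonic polynomial, as the profile is 1
  there. Different degrees scale differently under x to t x, so the coefficients of degree
  \<open>l\<close> vanish by induction from the lowest degree upwards, using independence of
  \<open>hbasis\<close> within one degree.\<close>

lemma usol_independent_real:
 fixes c :: "('a::euclidean_space => nat) => real"
 assumes dim: "DIM('a) \<ge> 2" and A: "finite A" and I: "I = (\<Union>l\<in>A. hidx l)"
  and z: "\<And>x. x \<in> ball 0 1 ==> (\<Sum>\<alpha>\<in>I. c \<alpha> * usol \<kappa> (mdeg \<alpha>) (hbasis \<alpha>) x) = 0"
 shows "\<forall>\<alpha>\<in>I. c \<alpha> = 0"
proof -
 have I': "finite I" unfolding I using A by (auto simp: finite_hidx)
 have "\<forall>\<alpha>\<in>I. mdeg \<alpha> = l --> c \<alpha> = 0" for l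
 proof (induction l rule: less_induct)
  case (less l)
  have "\<forall>\<alpha>\<in>hidx l. (if l \<in> A then c \<alpha> else 0) = 0"
  proof (rule hbasis_independent)
   fix x :: 'a
   define J where "J = {\<alpha>\<in>I. mdeg \<alpha> \<ge> l}"
   have J: "finite J" "J \<subseteq> I" using I' by (auto simp: J_def)
   \<comment> \<open>The relation at t x divided by t^l, with the degrees below \<open>l\<close>
     already removed. It is continuous in \<open>t\<close>, and at t = 0 only the terms of degree
     exactly \<open>l\<close> survive.\<close>
   define g where "g t = (\<Sum>\<alpha>\<in>J. c \<alpha> * (t ^ (mdeg \<alpha> - l) * hbasis \<alpha> x * bsol (sig TYPE('a) (mdeg \<alpha>)) \<kappa> (t\<^sup>2 * (x \<bullet> x))))" for t
   have "continuous_on UNIV g" unfolding g_def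
   proof (intro continuous_on_sum continuous_on_mult continuous_on_const continuous_on_power continuous_on_id)
    fix \<alpha> :: "'a => nat"
    have "continuous_on UNIV (bsol (sig TYPE('a) (mdeg \<alpha>)) \<kappa>)"
     by (rule continuous_on_DERIV[OF bsol_derivative(1)[OF sig_nonneg[OF dim]]])
    thus "continuous_on UNIV (\<lambda>t. bsol (sig TYPE('a) (mdeg \<alpha>)) \<kappa> (t\<^sup>2 * (x \<bullet> x)))"
     by (rule continuous_on_compose2) (auto intro!: continuous_intros)
   qed
   hence "isCont g 0" by (simp add: continuous_on_eq_continuous_at)
   hence lim: "(g \<longlongrightarrow> g 0) (at_right 0)" unfolding isCont_def by (rule filterlim_mono) (auto simp: at_le)
   have nx: "1 + norm x > 0" "norm x < 1 + norm x" by (simp_all add: add_pos_nonneg)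
   have gz: "g t = 0" if t: "0 < t" "t < 1 / (1 + norm x)" for t
   proof -
    have "t * norm x \<le> t * (1 + norm x)" using t nx by (intro mult_left_mono) auto
    also have "\<dots> < 1" using t nx by (simp add: field_simps)
    finally have tx: "t *\<^sub>R x \<in> ball 0 1" using t by simp
    have e: "c \<alpha> * usol \<kappa> (mdeg \<alpha>) (hbasis \<alpha>) (t *\<^sub>R x) = t ^ l * (c \<alpha> * (t ^ (mdeg \<alpha> - l) * hbasis \<alpha> x * bsol (sig TYPE('a) (mdeg \<alpha>)) \<kappa> (t\<^sup>2 * (x \<bullet> x))))"
     if "\<alpha> \<in> J" for \<alpha>
    proof -
     have "t ^ mdeg \<alpha> = t ^ l * t ^ (mdeg \<alpha> - l)" using that by (simp add: J_def flip: power_add)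
     thus ?thesis unfolding usol_def rad_def hpoly_homogeneous[OF hbasis_hpoly] by (simp add: power2_eq_square mult_ac)
    qed
    have "0 = (\<Sum>\<alpha>\<in>I. c \<alpha> * usol \<kappa> (mdeg \<alpha>) (hbasis \<alpha>) (t *\<^sub>R x))" using z[OF tx] by simp
    also have "\<dots> = (\<Sum>\<alpha>\<in>J. c \<alpha> * usol \<kappa> (mdeg \<alpha>) (hbasis \<alpha>) (t *\<^sub>R x))"
    proof (rule sum.mono_neutral_right[OF I' J(2)], rule ballI)
     fix \<alpha> assume "\<alpha> \<in> I - J"
     hence "c \<alpha> = 0" using less.IH[of "mdeg \<alpha>"] by (auto simp: J_def)
     thus "c \<alpha> * usol \<kappa> (mdeg \<alpha>) (hbasis \<alpha>) (t *\<^sub>R x) = 0" by simp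
    qed
    also have "\<dots> = t ^ l * g t" unfolding g_def sum_distrib_left using e by (intro sum.cong) auto
    finally show ?thesis using t by simp
   qed
   have "\<forall>\<^sub>F t in at_right 0. g t = 0"
    unfolding eventually_at_right_field using gz nx by (intro exI[of _ "1 / (1 + norm x)"]) auto
   hence "(g \<longlongrightarrow> 0) (at_right 0)" by (rule tendsto_eventually)
   with lim have "g 0 = 0" using tendsto_unique[of "at_right (0::real)" g] by simp
   moreover have "g 0 = (\<Sum>\<alpha>\<in>hidx l. (if l \<in> A then c \<alpha> else 0) * hbasis \<alpha> x)"
   proof -
    have "g 0 = (\<Sum>\<alpha>\<in>{\<alpha>\<in>J. mdeg \<alpha> = l}. c \<alpha> * (0 ^ (mdeg \<alpha> - l) * hbasis \<alpha> x * bsol (sig TYPE('a) (mdeg \<alpha>)) \<kappa> (0\<^sup>2 * (x \<bullet> x))))"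
     unfolding g_def using J by (intro sum.mono_neutral_right) (auto simp: J_def power_0_left)
    also have "\<dots> = (\<Sum>\<alpha>\<in>{\<alpha>\<in>J. mdeg \<alpha> = l}. c \<alpha> * hbasis \<alpha> x)"
     by (intro sum.cong) (auto simp: bsol_def bes_0)
    also have "\<dots> = (\<Sum>\<alpha>\<in>hidx l. (if l \<in> A then c \<alpha> else 0) * hbasis \<alpha> x)"
    proof (cases "l \<in> A")
     case True
     hence "{\<alpha>\<in>J. mdeg \<alpha> = l} = hidx l" unfolding J_def I by (auto simp: hidx_def)
     thus ?thesis using True by simp
    next
     case False
     hence "{\<alpha>\<in>J. mdeg \<alpha> = l} = {}" unfolding J_def I by (auto simp: hidx_def)
     thus ?thesis using False by (simp only: sum.empty if_False mult_zero_left sum.neutral_const)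
    qed
    finally show ?thesis .
   qed
   ultimately show "(\<Sum>\<alpha>\<in>hidx l. (if l \<in> A then c \<alpha> else 0) * hbasis \<alpha> x) = 0" by simp
  qed
  thus ?case unfolding I by (auto simp: hidx_def)
 qed
 thus ?thesis by blast
qed

lemma usol_independent:
 fixes c :: "('a::euclidean_space => nat) => complex"
 assumes dim: "DIM('a) \<ge> 2" and A: "finite A" and I: "I = (\<Union>l\<in>A. hidx l)"
  and z: "AE x in lebesgue. x \<in> ball 0 1 --> (\<Sum>\<alpha>\<in>I. c \<alpha> * complex_of_real (usol \<kappa> (mdeg \<alpha>) (hbasis \<alpha>) x)) = 0"
 shows "\<forall>\<alpha>\<in>I. c \<alpha> = 0"
proof -
 have cont: "continuous_on UNIV (\<lambda>x. \<Sum>\<alpha>\<in>I. c \<alpha> * complex_of_real (usol \<kappa> (mdeg \<alpha>) (hbasis \<alpha>) x))"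
  by (intro continuous_on_sum continuous_on_mult continuous_on_const continuous_on_of_real smooth_continuous usol_smooth dim hbasis_hpoly)
 have 0: "(\<Sum>\<alpha>\<in>I. c \<alpha> * complex_of_real (usol \<kappa> (mdeg \<alpha>) (hbasis \<alpha>) x)) = 0" if "x \<in> ball 0 1" for x
  by (rule AE_continuous_zero[OF cont z that])
 have "(\<Sum>\<alpha>\<in>I. Re (c \<alpha>) * usol \<kappa> (mdeg \<alpha>) (hbasis \<alpha>) x) = 0" "(\<Sum>\<alpha>\<in>I. Im (c \<alpha>) * usol \<kappa> (mdeg \<alpha>) (hbasis \<alpha>) x) = 0" if "x \<in> ball 0 1" for x
  using arg_cong[OF 0[OF that], of Re] arg_cong[OF 0[OF that], of Im] by simp_all
 from usol_independent_real[OF dim A I this(1)] usol_independent_real[OF dim A I this(2)]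
 show ?thesis by (simp add: complex_eq_iff)
qed

text \<open>The dimensions are suprema of sets of natural numbers, which mean a dimension only once
  a bound is known; an attained upper bound identifies them.\<close>

lemma Sup_card_eq:
 assumes "\<And>S. S \<in> \<F> ==> card S \<le> D" "S0 \<in> \<F>" "card S0 = D"
 shows "Sup {card S |S. S \<in> \<F>} = (D::nat)"
 by (rule cSup_eq_maximum) (use assms in auto)

text \<open>Nonzero factors \<open>a \<alpha>\<close> are allowed because the first entries of
  transmission pairs come with a normalisation. Distinctness of the functions is part of the claim,
  since independence is formulated for sets.\<close>

lemma usol_ae_indep:
 fixes A :: "nat set" and \<kappa> :: real
 assumes dim: "DIM('a::euclidean_space) \<ge> 2" and A: "finite A" and I: "I = (\<Union>l\<in>A. hidx l :: ('a => nat) set)" and a: "\<And>\<alpha>. a \<alpha> \<noteq> 0"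
 defines "u \<equiv> \<lambda>\<alpha> x. complex_of_real (a \<alpha> * usol \<kappa> (mdeg \<alpha>) (hbasis \<alpha>) x)"
 shows "inj_on u I" "ae_indep (ball (0::'a) 1) (u ` I)"
proof -
 have I': "finite I" unfolding I using A by (auto simp: finite_hidx)
 have ind: "\<forall>\<alpha>\<in>I. c \<alpha> = 0" if "AE x in lebesgue. x \<in> ball 0 1 --> (\<Sum>\<alpha>\<in>I. c \<alpha> * u \<alpha> x) = 0" for c
 proof -
  have "\<forall>\<alpha>\<in>I. c \<alpha> * of_real (a \<alpha>) = 0"
   by (rule usol_independent[OF dim A I, of _ \<kappa>]) (use that in \<open>simp add: u_def mult.assoc\<close>)
  thus ?thesis using a by simp
 qed
 show inj: "inj_on u I"
 proof (rule inj_onI, rule ccontr)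
  fix \<alpha> \<beta> assume ab: "\<alpha> \<in> I" "\<beta> \<in> I" "u \<alpha> = u \<beta>" "\<alpha> \<noteq> \<beta>"
  define c where "c \<gamma> = (if \<gamma> = \<alpha> then 1 else if \<gamma> = \<beta> then -1 else (0::complex))" for \<gamma>
  have "(\<Sum>\<gamma>\<in>I. c \<gamma> * u \<gamma> x) = 0" for x
  proof -
   have "(\<Sum>\<gamma>\<in>I. c \<gamma> * u \<gamma> x) = (\<Sum>\<gamma>\<in>{\<alpha>, \<beta>}. c \<gamma> * u \<gamma> x)"
    using ab I' by (intro sum.mono_neutral_right) (auto simp: c_def)
   thus ?thesis using ab by (simp add: c_def)
  qed
  hence "\<forall>\<gamma>\<in>I. c \<gamma> = 0" by (intro ind) simp
  hence "c \<alpha> = 0" using ab(1) by blast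
  thus False by (simp add: c_def)
 qed
 show "ae_indep (ball (0::'a) 1) (u ` I)" unfolding ae_indep_def
 proof (intro allI impI)
  fix c assume "AE x in lebesgue. x \<in> ball (0::'a) 1 --> (\<Sum>f\<in>u ` I. c f * f x) = 0"
  hence "AE x in lebesgue. x \<in> ball (0::'a) 1 --> (\<Sum>\<alpha>\<in>I. c (u \<alpha>) * u \<alpha> x) = 0"
   by (simp add: sum.reindex[OF inj])
  from ind[OF this] show "\<forall>f\<in>u ` I. c f = 0" by blast
 qed
qed

lemma dir_mult_eq:
 assumes dim: "DIM('a::euclidean_space) \<ge> 2" and k: "k > 0" and mu: "\<mu> > 0"
 shows "dir_mult (ball (0::'a) 1) k \<mu> = (\<Sum>l\<in>dirset TYPE('a) (\<mu> / k). hdim TYPE('a) l)"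
proof -
 define \<kappa> where "\<kappa> = \<mu> / k"
 have \<kappa>: "\<kappa> \<ge> 0" using k mu by (simp add: \<kappa>_def)
 define A where "A = dirset TYPE('a) \<kappa>"
 have A: "finite A" unfolding A_def by (rule finite_dirset[OF dim \<kappa>])
 define I where "I = (\<Union>l\<in>A. hidx l :: ('a => nat) set)"
 define u where "u = (\<lambda>\<alpha> (x::'a). complex_of_real (1 * usol \<kappa> (mdeg \<alpha>) (hbasis \<alpha>) x))"
 note ind = usol_ae_indep[OF dim A I_def, of "\<lambda>_. 1" \<kappa>, folded u_def]
 have I: "finite I" "card I = (\<Sum>l\<in>A. hdim TYPE('a) l)" unfolding I_def using card_hidx_UN[where 'a='a, OF A] by auto
 have mem: "u \<alpha> \<in> dir_eigenspace (ball 0 1) k \<mu>" if "\<alpha> \<in> I" for \<alpha>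
 proof -
  have b: "bes (sig TYPE('a) (mdeg \<alpha>)) \<kappa> = 0" using that unfolding I_def A_def dirset_def by (auto simp: hidx_def)
  have s: "smooth (usol \<kappa> (mdeg \<alpha>) (hbasis \<alpha>))" by (rule usol_smooth[OF dim hbasis_hpoly])
  have "weak_sol \<kappa> (cplx (usol \<kappa> (mdeg \<alpha>) (hbasis \<alpha>)))"
   by (rule weak_sol_smooth[OF s]) (unfold usol_def, rule laplacian_bsol[OF dim hbasis_hpoly hbasis_harmonic])
  moreover have "H01 (ball 0 1) (cplx (usol \<kappa> (mdeg \<alpha>) (hbasis \<alpha>)))" unfolding usol_def
   by (rule H01_rad[OF hpoly_smooth[OF hbasis_hpoly] smooth_bsol[OF sig_nonneg[OF dim]]]) (simp add: bsol_def b)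
  ultimately show ?thesis unfolding dir_eigenspace_iff[OF k] \<kappa>_def[symmetric] u_def by simp
 qed
 have "Sup {card S |S. S \<in> {S. finite S \<and> S \<subseteq> dir_eigenspace (ball (0::'a) 1) k \<mu> \<and> ae_indep (ball 0 1) S}} = card I"
 proof (rule Sup_card_eq)
  show "u ` I \<in> {S. finite S \<and> S \<subseteq> dir_eigenspace (ball (0::'a) 1) k \<mu> \<and> ae_indep (ball 0 1) S}"
   using I ind mem by auto
  show "card (u ` I) = card I" using ind by (simp add: card_image)
  fix S assume S: "S \<in> {S. finite S \<and> S \<subseteq> dir_eigenspace (ball (0::'a) 1) k \<mu> \<and> ae_indep (ball 0 1) S}"
  hence "H01 (ball 0 1) f \<and> weak_sol \<kappa> f" if "f \<in> S" for f
   using that dir_eigenspace_iff[OF k, of f \<mu>] unfolding \<kappa>_def by blast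
  thus "card S \<le> card I" unfolding I(2) A_def using S by (intro dir_card_le[OF dim \<kappa>]) auto
 qed
 thus ?thesis unfolding dir_mult_def ae_dim_def I(2) A_def \<kappa>_def by simp
qed

lemma ITE_mult_eq:
 assumes dim: "DIM('a::euclidean_space) \<ge> 2" and m: "m > 0" "m \<noteq> 1" and lam: "lam > 0"
 shows "ITE_mult (ball (0::'a) 1) m lam = (\<Sum>l\<in>iteset TYPE('a) m (lam\<^sup>2). hdim TYPE('a) l)"
  and "is_ITE (ball (0::'a) 1) m lam ==> iteset TYPE('a) m (lam\<^sup>2) \<noteq> {}"
  and "(\<Sum>l\<in>iteset TYPE('a) m (lam\<^sup>2). hdim TYPE('a) l) > 0 ==> is_ITE (ball (0::'a) 1) m lam"
proof -
 define t where "t = lam\<^sup>2"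
 have t: "t > 0" using lam by (simp add: t_def)
 define A where "A = iteset TYPE('a) m t"
 have A: "finite A" unfolding A_def by (rule finite_iteset[OF dim m t])
 define I where "I = (\<Union>l\<in>A. hidx l :: ('a => nat) set)"
 define B where "B = (\<lambda>\<alpha>::'a => nat. bes (sig TYPE('a) (mdeg \<alpha>)) t)"
 define B' where "B' = (\<lambda>\<alpha>::'a => nat. t * bes' (sig TYPE('a) (mdeg \<alpha>)) t)"
 define C where "C = (\<lambda>\<alpha>::'a => nat. bes (sig TYPE('a) (mdeg \<alpha>)) (m * t))"
 define C' where "C' = (\<lambda>\<alpha>::'a => nat. m * t * bes' (sig TYPE('a) (mdeg \<alpha>)) (m * t))"
 \<comment> \<open>For determinant 0 the data (C, C') and (B, B') are parallel, and multiplying them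
   by these \<open>a\<close> and \<open>b\<close> makes them equal. Unlike quotients of single
   entries, \<open>a\<close> is nonzero in all cases, as B and B' never vanish together.\<close>
 define a where "a \<alpha> = (B \<alpha>)\<^sup>2 + (B' \<alpha>)\<^sup>2" for \<alpha>
 define b where "b \<alpha> = C \<alpha> * B \<alpha> + C' \<alpha> * B' \<alpha>" for \<alpha>
 have a0: "a \<alpha> \<noteq> 0" for \<alpha>
  using bes_nonzero(1)[OF sig_nonneg[OF dim] less_imp_le[OF t]] t by (auto simp: a_def B_def B'_def sum_power2_eq_zero_iff)
 define u where "u = (\<lambda>\<alpha> (x::'a). complex_of_real (a \<alpha> * usol (m * t) (mdeg \<alpha>) (hbasis \<alpha>) x))"
 define v where "v = (\<lambda>\<alpha> (x::'a). complex_of_real (b \<alpha> * usol t (mdeg \<alpha>) (hbasis \<alpha>) x))"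
 note ind = usol_ae_indep[OF dim A I_def, of a "m * t", OF a0, folded u_def]
 have I: "finite I" "card I = (\<Sum>l\<in>A. hdim TYPE('a) l)" unfolding I_def using card_hidx_UN[where 'a='a, OF A] by auto
 have mem: "ITE_pair (ball 0 1) m lam (u \<alpha>) (v \<alpha>)" if "\<alpha> \<in> I" for \<alpha>
 proof -
  define \<nu> where "\<nu> = sig TYPE('a) (mdeg \<alpha>)"
  have \<nu>: "\<nu> \<ge> 0" unfolding \<nu>_def by (rule sig_nonneg[OF dim])
  have "bes_det \<nu> m 1 t = 0" using that unfolding I_def A_def iteset_def \<nu>_def by (auto simp: hidx_def)
  hence det: "C \<alpha> * B' \<alpha> = C' \<alpha> * B \<alpha>" unfolding bes_det_def B_def B'_def C_def C'_def \<nu>_def by simp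
  have s: "smooth (\<lambda>x. r * usol \<kappa> (mdeg \<alpha>) (hbasis \<alpha>) x)" for r \<kappa> by (intro smooth_cmult usol_smooth[OF dim hbasis_hpoly])
  have w: "weak_sol \<kappa> (\<lambda>x. complex_of_real (r * usol \<kappa> (mdeg \<alpha>) (hbasis \<alpha>) x))" for r \<kappa>
  proof (rule weak_sol_smooth[OF s])
   have "laplacian (usol \<kappa> (mdeg \<alpha>) (hbasis \<alpha>)) = (\<lambda>x. - \<kappa> * usol \<kappa> (mdeg \<alpha>) (hbasis \<alpha>) x)"
    unfolding usol_def by (rule laplacian_bsol[OF dim hbasis_hpoly hbasis_harmonic])
   thus "laplacian (\<lambda>x. r * usol \<kappa> (mdeg \<alpha>) (hbasis \<alpha>) x) = (\<lambda>x. - \<kappa> * (r * usol \<kappa> (mdeg \<alpha>) (hbasis \<alpha>) x))"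
    unfolding laplacian_cmult[OF usol_smooth[OF dim hbasis_hpoly]] by (auto simp: mult_ac)
  qed
  define h where "h \<rho> = a \<alpha> * bsol \<nu> (m * t) \<rho> - b \<alpha> * bsol \<nu> t \<rho>" for \<rho>
  define h1 where "h1 \<rho> = a \<alpha> * bsol1 \<nu> (m * t) \<rho> - b \<alpha> * bsol1 \<nu> t \<rho>" for \<rho>
  have "H02 (ball 0 1) (cplx (rad (hbasis \<alpha>) h))"
  proof (rule H02_rad[OF hbasis_hpoly, of h h1])
   show "smooth h" unfolding h_def by (intro smooth_diff smooth_cmult smooth_bsol \<nu>)
   show "DERIV h s :> h1 s" for s unfolding h_def h1_def
    by (intro DERIV_diff DERIV_cmult bsol_derivative \<nu>)
   have "h 1 = a \<alpha> * C \<alpha> - b \<alpha> * B \<alpha>" unfolding h_def bsol_def C_def B_def \<nu>_def by simp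
   also have "\<dots> = B' \<alpha> * (C \<alpha> * B' \<alpha> - C' \<alpha> * B \<alpha>)" by (simp add: a_def b_def power2_eq_square algebra_simps)
   finally show "h 1 = 0" using det by simp
   have "h1 1 = a \<alpha> * C' \<alpha> - b \<alpha> * B' \<alpha>" unfolding h1_def bsol1_def C'_def B'_def \<nu>_def by simp
   also have "\<dots> = B \<alpha> * (C' \<alpha> * B \<alpha> - C \<alpha> * B' \<alpha>)" by (simp add: a_def b_def power2_eq_square algebra_simps)
   finally show "h1 1 = 0" using det by simp
  qed
  moreover have "(cplx (rad (hbasis \<alpha>) h)) = (\<lambda>x. u \<alpha> x - v \<alpha> x)"
   by (auto simp: rad_def h_def u_def v_def usol_def \<nu>_def algebra_simps)
  ultimately have "H02 (ball 0 1) (\<lambda>x. u \<alpha> x - v \<alpha> x)" by (simp only:)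
  thus ?thesis unfolding ITE_pair_iff t_def[symmetric] unfolding u_def v_def by (intro conjI H2_smooth s w)
 qed
 define p where "p \<alpha> = (u \<alpha>, v \<alpha>)" for \<alpha>
 have pinj: "inj_on p I" using ind(1) unfolding inj_on_def p_def by auto
 have pind: "ae_indep_pairs (ball 0 1) (p ` I)" unfolding ae_indep_pairs_def
 proof (intro allI impI)
  fix c assume "AE x in lebesgue. x \<in> ball (0::'a) 1 --> (\<Sum>f\<in>p ` I. c f * fst f x) = 0 \<and> (\<Sum>f\<in>p ` I. c f * snd f x) = 0"
  moreover have "(\<Sum>f\<in>p ` I. c f * fst f x) = (\<Sum>\<alpha>\<in>I. c (p \<alpha>) * u \<alpha> x)" for x
   unfolding sum.reindex[OF pinj] by (simp add: p_def)
  ultimately have "AE x in lebesgue. x \<in> ball (0::'a) 1 --> (\<Sum>\<alpha>\<in>I. c (p \<alpha>) * u \<alpha> x) = 0"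
   by (auto elim!: eventually_mono)
  \<comment> \<open>Coefficients of pairs are transported to coefficients of first entries along the
    bijection through the index \<alpha>, so independence of the first entries is enough.\<close>
  moreover have "(\<Sum>f\<in>u ` I. c (p (the_inv_into I u f)) * f x) = (\<Sum>\<alpha>\<in>I. c (p \<alpha>) * u \<alpha> x)" for x
   unfolding sum.reindex[OF ind(1)] by (intro sum.cong) (auto simp: the_inv_into_f_f[OF ind(1)])
  ultimately have "\<forall>f\<in>u ` I. c (p (the_inv_into I u f)) = 0"
   using ind(2)[unfolded ae_indep_def, rule_format, of "\<lambda>f. c (p (the_inv_into I u f))"] by simp
  thus "\<forall>f\<in>p ` I. c f = 0" by (auto simp: the_inv_into_f_f[OF ind(1)])
 qed
 have upper: "card S \<le> card I" if "finite S" "S \<subseteq> {(u, v). ITE_pair (ball (0::'a) 1) m lam u v}" "ae_indep_pairs (ball 0 1) S" for S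
  unfolding I(2) A_def t_def using that by (intro ite_card_le[OF dim m lam]) auto
 have "Sup {card S |S. S \<in> {S. finite S \<and> S \<subseteq> {(u, v). ITE_pair (ball (0::'a) 1) m lam u v} \<and> ae_indep_pairs (ball 0 1) S}} = card I"
 proof (rule Sup_card_eq)
  show "p ` I \<in> {S. finite S \<and> S \<subseteq> {(u, v). ITE_pair (ball (0::'a) 1) m lam u v} \<and> ae_indep_pairs (ball 0 1) S}"
   using I pind mem by (auto simp: p_def)
  show "card (p ` I) = card I" using pinj by (simp add: card_image)
 qed (use upper in auto)
 thus "ITE_mult (ball (0::'a) 1) m lam = (\<Sum>l\<in>iteset TYPE('a) m (lam\<^sup>2). hdim TYPE('a) l)"
  unfolding ITE_mult_def ae_dim_pairs_def I(2) A_def t_def by simp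
 \<comment> \<open>A nonzero eigenpair alone is an independent set of size 1, which contradicts the
   upper bound 0 that holds if no degree contributes.\<close>
 show "iteset TYPE('a) m (lam\<^sup>2) \<noteq> {}" if ite: "is_ITE (ball (0::'a) 1) m lam"
 proof
  assume em: "iteset TYPE('a) m (lam\<^sup>2) = {}"
  obtain f g where fg: "ITE_pair (ball (0::'a) 1) m lam f g"
   "\<not> ((AE x in lebesgue. x \<in> ball 0 1 --> f x = 0) \<and> (AE x in lebesgue. x \<in> ball 0 1 --> g x = 0))"
   using ite unfolding is_ITE_def by blast
  have "ae_indep_pairs (ball 0 1) {(f, g)}" unfolding ae_indep_pairs_def
  proof (intro allI impI)
   fix c assume z: "AE x in lebesgue. x \<in> ball 0 1 --> (\<Sum>p\<in>{(f, g)}. c p * fst p x) = 0 \<and> (\<Sum>p\<in>{(f, g)}. c p * snd p x) = 0"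
   show "\<forall>p\<in>{(f, g)}. c p = 0"
   proof (rule ccontr)
    assume "\<not> ?thesis"
    hence "c (f, g) \<noteq> 0" by simp
    hence "AE x in lebesgue. x \<in> ball 0 1 --> f x = 0" "AE x in lebesgue. x \<in> ball 0 1 --> g x = 0"
     using z by (auto elim!: eventually_mono)
    with fg(2) show False by blast
   qed
  qed
  hence "card {(f, g)} \<le> card I" using fg(1) by (intro upper) auto
  moreover have "card I = 0" unfolding I(2) A_def t_def em by simp
  ultimately show False by simp
 qed
 show "is_ITE (ball (0::'a) 1) m lam" if pos: "(\<Sum>l\<in>iteset TYPE('a) m (lam\<^sup>2). hdim TYPE('a) l) > 0"
 proof -
  have "I \<noteq> {}" using pos I(2) unfolding A_def t_def by auto
  then obtain \<alpha> where \<alpha>: "\<alpha> \<in> I" by blast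
  have "\<not> (AE x in lebesgue. x \<in> ball 0 1 --> u \<alpha> x = 0)"
  proof
   assume z: "AE x in lebesgue. x \<in> ball 0 1 --> u \<alpha> x = 0"
   define c where "c f = (if f = u \<alpha> then 1 else (0::complex))" for f
   have "(\<Sum>f\<in>u ` I. c f * f x) = u \<alpha> x" for x using I(1) \<alpha> by (simp add: c_def if_distrib[of "\<lambda>y. y * _"] cong: if_cong)
   hence "\<forall>f\<in>u ` I. c f = 0" using ind(2)[unfolded ae_indep_def, rule_format, of c] z by simp
   thus False using \<alpha> by (auto simp: c_def)
  qed
  thus ?thesis using mem[OF \<alpha>] lam unfolding is_ITE_def by blast
 qed
qed

section \<open>Counting eigenvalues\<close>

text \<open>Double counting of the incidences \<open>Q l x\<close>. The set \<open>T\<close> lies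
  between the points of positive multiplicity and the points with some incidence, which fits both
  \<open>N_dir\<close>, summed over positive multiplicity, and \<open>N_ITE\<close>, summed over
  \<open>is_ITE\<close>.\<close>

lemma sum_mult_swap:
 fixes mult :: "real => nat" and w :: "nat => nat"
 assumes L: "finite L" and Z: "\<And>l. l \<in> L ==> finite {x\<in>X. Q l x}" and QL: "\<And>l x. x \<in> X ==> Q l x ==> l \<in> L"
  and mult: "\<And>x. x \<in> X ==> mult x = (\<Sum>l\<in>{l. Q l x}. w l)"
  and T: "T \<subseteq> X" "\<And>x. x \<in> X ==> mult x > 0 ==> x \<in> T" "\<And>x. x \<in> T ==> {l. Q l x} \<noteq> {}"
 shows "(\<Sum>x\<in>T. mult x) = (\<Sum>l\<in>L. w l * card {x\<in>X. Q l x})"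
proof -
 define U where "U = (\<Union>l\<in>L. {x\<in>X. Q l x})"
 have U: "finite U" "U \<subseteq> X" unfolding U_def using L Z by auto
 have TU: "T \<subseteq> U"
 proof
  fix x assume x: "x \<in> T"
  then obtain l where "Q l x" using T(3) by blast
  thus "x \<in> U" unfolding U_def using x T(1) QL[of x l] by blast
 qed
 have "(\<Sum>x\<in>T. mult x) = (\<Sum>x\<in>U. mult x)"
  using T(2) U by (intro sum.mono_neutral_left[OF U(1) TU]) auto
 also have "\<dots> = (\<Sum>x\<in>U. \<Sum>l\<in>L. if Q l x then w l else 0)"
 proof (rule sum.cong)
  fix x assume "x \<in> U"
  hence x: "x \<in> X" using U by blast
  have "{l. Q l x} = {l\<in>L. Q l x}" using QL[OF x] by blast
  thus "mult x = (\<Sum>l\<in>L. if Q l x then w l else 0)" using mult[OF x] L by (simp add: sum.inter_filter)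
 qed simp
 also have "\<dots> = (\<Sum>l\<in>L. \<Sum>x\<in>U. if Q l x then w l else 0)" by (rule sum.swap)
 also have "\<dots> = (\<Sum>l\<in>L. w l * card {x\<in>X. Q l x})"
 proof (rule sum.cong)
  fix l assume l: "l \<in> L"
  have "{x\<in>U. Q l x} = {x\<in>X. Q l x}" using l U by (auto simp: U_def)
  thus "(\<Sum>x\<in>U. if Q l x then w l else 0) = w l * card {x\<in>X. Q l x}"
   using U(1) by (simp flip: sum.inter_filter)
 qed simp
 finally show ?thesis .
qed

lemma sig_gt_imp:
 assumes "DIM('a::euclidean_space) \<ge> 2" "real L \<ge> r" "l > L" "r \<ge> 0"
 shows "r\<^sup>2 \<le> (sig TYPE('a) l)\<^sup>2"
proof -
 have "real DIM('a) \<ge> 2" using assms by linarith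
 hence "r \<le> sig TYPE('a) l" using assms unfolding sig_def by linarith
 thus ?thesis using assms(4) by (rule power_mono)
qed

lemma card_square_scale:
 fixes k r :: real
 assumes k: "k > 0" and r: "r > 0"
 shows "finite {x\<in>{0<..r\<^sup>2 / k}. Q x} \<longleftrightarrow> finite {lam\<in>{0<..r}. Q (lam\<^sup>2 / k)}"
  and "card {lam\<in>{0<..r}. Q (lam\<^sup>2 / k)} = card {x\<in>{0<..r\<^sup>2 / k}. Q x}"
proof -
 have "bij_betw (\<lambda>lam. lam\<^sup>2 / k) {lam\<in>{0<..r}. Q (lam\<^sup>2 / k)} {x\<in>{0<..r\<^sup>2 / k}. Q x}"
 proof (rule bij_betw_byWitness[where f' = "\<lambda>x. sqrt (k * x)"])
  show "(\<lambda>lam. lam\<^sup>2 / k) ` {lam\<in>{0<..r}. Q (lam\<^sup>2 / k)} \<subseteq> {x\<in>{0<..r\<^sup>2 / k}. Q x}"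
   using k by (auto simp: divide_right_mono power_mono)
  show "(\<lambda>x. sqrt (k * x)) ` {x\<in>{0<..r\<^sup>2 / k}. Q x} \<subseteq> {lam\<in>{0<..r}. Q (lam\<^sup>2 / k)}"
   using k r by (auto simp: real_le_lsqrt field_simps real_sqrt_le_iff intro!: real_le_lsqrt)
 qed (use k in auto)
 thus "finite {x\<in>{0<..r\<^sup>2 / k}. Q x} \<longleftrightarrow> finite {lam\<in>{0<..r}. Q (lam\<^sup>2 / k)}"
  and "card {lam\<in>{0<..r}. Q (lam\<^sup>2 / k)} = card {x\<in>{0<..r\<^sup>2 / k}. Q x}"
  using bij_betw_finite bij_betw_same_card by blast+
qed

text \<open>The order exceeds r / sqrt k for all degrees above \<open>L\<close>, and a Bessel
  function has no zero before its turning point, so the sum over degrees is finite.\<close>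

lemma N_dir_eq:
 assumes dim: "DIM('a::euclidean_space) \<ge> 2" and k: "k > 0" and r: "r > 0" and L: "real L \<ge> r / sqrt k"
 shows "N_dir (ball (0::'a) 1) k r = (\<Sum>l\<le>L. hdim TYPE('a) l * card (bes_zeros (sig TYPE('a) l) (r\<^sup>2 / k)))"
proof -
 define Q where "Q l lam \<longleftrightarrow> bes (sig TYPE('a) l) (lam\<^sup>2 / k) = 0" for l and lam :: real
 have bz: "{x\<in>{0<..r\<^sup>2 / k}. bes (sig TYPE('a) l) x = 0} = bes_zeros (sig TYPE('a) l) (r\<^sup>2 / k)" for l
  by (simp add: bes_zeros_def)
 note cs = card_square_scale[OF k r, of "\<lambda>x. bes (sig TYPE('a) l) x = 0" for l, unfolded bz, folded Q_def]
 have fin: "finite {lam\<in>{0<..r}. Q l lam}" for l unfolding cs(1)[symmetric] by (rule finite_bes_zeros[OF sig_nonneg[OF dim]])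
 have dm: "dir_mult (ball (0::'a) 1) k (lam\<^sup>2) = (\<Sum>l\<in>{l. Q l lam}. hdim TYPE('a) l)" if "lam \<in> {0<..r}" for lam
  using dir_mult_eq[OF dim k, of "lam\<^sup>2"] that unfolding dirset_def Q_def by simp
 have "N_dir (ball (0::'a) 1) k r = (\<Sum>l\<in>{..L}. hdim TYPE('a) l * card {lam\<in>{0<..r}. Q l lam})"
  unfolding N_dir_def
 proof (rule sum_mult_swap[OF _ fin _ dm])
  fix l lam assume lam: "lam \<in> {0<..r}" "Q l lam"
  show "l \<in> {..L}"
  proof (rule ccontr)
   assume "l \<notin> {..L}"
   hence "(r / sqrt k)\<^sup>2 \<le> (sig TYPE('a) l)\<^sup>2" using r k by (intro sig_gt_imp[OF dim L]) auto
   hence "r\<^sup>2 / k \<le> (sig TYPE('a) l)\<^sup>2" using k by (simp add: power_divide)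
   hence "bes_zeros (sig TYPE('a) l) (r\<^sup>2 / k) = {}" by (rule bes_zeros_empty[OF sig_nonneg[OF dim]])
   moreover have "lam\<^sup>2 / k \<in> bes_zeros (sig TYPE('a) l) (r\<^sup>2 / k)"
    using lam k unfolding bes_zeros_def Q_def by (auto intro!: divide_right_mono power_mono)
   ultimately show False by blast
  qed
 next
  show "{l. Q l lam} \<noteq> {}" if "lam \<in> {lam. 0 < lam \<and> lam \<le> r \<and> 0 < dir_mult (ball (0::'a) 1) k (lam\<^sup>2)}" for lam
   using dm[of lam] that by force
 qed auto
 thus ?thesis unfolding cs(2) by simp
qed

lemma N_ITE_eq:
 assumes dim: "DIM('a::euclidean_space) \<ge> 2" and m: "m > 0" "m \<noteq> 1" and r: "r > 0" and L: "real L \<ge> sqrt (max m 1) * r"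
 shows "N_ITE (ball (0::'a) 1) m r = (\<Sum>l\<le>L. hdim TYPE('a) l * card (det_zeros (sig TYPE('a) l) m 1 (r\<^sup>2)))"
proof -
 define Q where "Q l lam \<longleftrightarrow> bes_det (sig TYPE('a) l) m 1 (lam\<^sup>2 / 1) = 0" for l and lam :: real
 have bz: "{x\<in>{0<..r\<^sup>2 / 1}. bes_det (sig TYPE('a) l) m 1 x = 0} = det_zeros (sig TYPE('a) l) m 1 (r\<^sup>2)" for l
  by (simp add: det_zeros_def)
 note cs = card_square_scale[OF zero_less_one r, of "\<lambda>x. bes_det (sig TYPE('a) l) m 1 x = 0" for l, unfolded bz, folded Q_def]
 have fz: "finite (det_zeros (sig TYPE('a) l) m 1 (r\<^sup>2))" for l
 proof (cases "m < 1")
  case True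
  thus ?thesis using m by (intro det_zeros_count(1)[OF sig_nonneg[OF dim]])
 next
  case False
  hence "finite (det_zeros (sig TYPE('a) l) 1 m (r\<^sup>2))" using m by (intro det_zeros_count(1)[OF sig_nonneg[OF dim]]) auto
  thus ?thesis unfolding det_zeros_def bes_det_swap[of _ m 1] by simp
 qed
 have fin: "finite {lam\<in>{0<..r}. Q l lam}" for l unfolding cs(1)[symmetric] by (rule fz)
 have dm: "ITE_mult (ball (0::'a) 1) m lam = (\<Sum>l\<in>{l. Q l lam}. hdim TYPE('a) l)" if "lam \<in> {0<..r}" for lam
  using ITE_mult_eq(1)[OF dim m, of lam] that unfolding iteset_def Q_def by simp
 have "N_ITE (ball (0::'a) 1) m r = (\<Sum>l\<in>{..L}. hdim TYPE('a) l * card {lam\<in>{0<..r}. Q l lam})"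
  unfolding N_ITE_def
 proof (rule sum_mult_swap[OF _ fin _ dm])
  fix l lam assume lam: "lam \<in> {0<..r}" "Q l lam"
  show "l \<in> {..L}"
  proof (rule ccontr)
   assume "l \<notin> {..L}"
   hence "(sqrt (max m 1) * r)\<^sup>2 \<le> (sig TYPE('a) l)\<^sup>2" using r m by (intro sig_gt_imp[OF dim L]) auto
   moreover have "(sqrt (max m 1) * r)\<^sup>2 = max m 1 * r\<^sup>2" using m by (simp add: power_mult_distrib)
   moreover have "max m 1 * lam\<^sup>2 \<le> max m 1 * r\<^sup>2" using lam by (intro mult_left_mono power_mono) auto
   moreover have "(sig TYPE('a) l)\<^sup>2 < max m 1 * lam\<^sup>2"
    using lam unfolding Q_def by (intro bes_det_zero_imp[OF sig_nonneg[OF dim] m]) auto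
   ultimately show False by linarith
  qed
 next
  fix lam assume lam: "lam \<in> {0<..r}" "0 < ITE_mult (ball (0::'a) 1) m lam"
  thus "lam \<in> {lam. 0 < lam \<and> lam \<le> r \<and> is_ITE (ball (0::'a) 1) m lam}"
   using ITE_mult_eq(3)[OF dim m, of lam] ITE_mult_eq(1)[OF dim m, of lam] by simp
 next
  show "{l. Q l lam} \<noteq> {}" if "lam \<in> {lam. 0 < lam \<and> lam \<le> r \<and> is_ITE (ball (0::'a) 1) m lam}" for lam
   using ITE_mult_eq(2)[OF dim m, of lam] that unfolding iteset_def Q_def by simp
 qed auto
 thus ?thesis unfolding cs(2) by simp
qed

text \<open>The counting lemma takes the smaller scaling factor first. For m > 1 the two factors
  change places, which changes only the sign of the determinant and not its zeros.\<close>

lemma det_zeros_card: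
 assumes s: "\<nu> \<ge> 0" and m: "m > 0" "m \<noteq> 1"
 shows "\<bar>real (card (det_zeros \<nu> m 1 X)) - sgn (1 - m) * (real (card (bes_zeros \<nu> X)) - real (card (bes_zeros \<nu> (m * X))))\<bar> \<le> 1"
proof (cases "m < 1")
 case True
 have "real_of_int \<bar>int (card (det_zeros \<nu> m 1 X)) - (int (card (bes_zeros \<nu> (1*X))) - int (card (bes_zeros \<nu> (m*X))))\<bar> \<le> 1"
  using det_zeros_count(2)[OF s m(1) True, of X] by linarith
 thus ?thesis using True by simp
next
 case False
 hence l: "0 < (1::real)" "1 < m" using m by auto
 have "real_of_int \<bar>int (card (det_zeros \<nu> 1 m X)) - (int (card (bes_zeros \<nu> (m*X))) - int (card (bes_zeros \<nu> (1*X))))\<bar> \<le> 1"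
  using det_zeros_count(2)[OF s l, of X] by linarith
 moreover have "det_zeros \<nu> m 1 X = det_zeros \<nu> 1 m X" unfolding det_zeros_def bes_det_swap[of \<nu> m 1] by simp
 ultimately show ?thesis using l by simp
qed

lemma N_ITE_N_dir:
 assumes dim: "DIM('a::euclidean_space) \<ge> 2" and m: "m > 0" "m \<noteq> 1" and r: "r > 0" and L: "real L \<ge> sqrt (max m 1) * r"
 shows "\<bar>real (N_ITE (ball (0::'a) 1) m r)
   - \<bar>real (N_dir (ball (0::'a) 1) 1 r) - real (N_dir (ball (0::'a) 1) (1 / (sqrt m)\<^sup>2) r)\<bar>\<bar> \<le> real (\<Sum>l\<le>L. hdim TYPE('a) l)"
proof -
 define a where "a l = real (card (bes_zeros (sig TYPE('a) l) (r\<^sup>2)))" for l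
 define b where "b l = real (card (bes_zeros (sig TYPE('a) l) (m * r\<^sup>2)))" for l
 define c where "c l = real (card (det_zeros (sig TYPE('a) l) m 1 (r\<^sup>2)))" for l
 define w where "w l = real (hdim TYPE('a) l)" for l
 define s where "s = sgn (1 - m)"
 have s: "\<bar>s\<bar> = 1" using m by (simp add: s_def sgn_if)
 have L1: "real L \<ge> r / sqrt 1" and L2: "real L \<ge> r / sqrt (1 / m)"
 proof -
  have "1 * r \<le> sqrt (max m 1) * r" using r by (intro mult_right_mono) auto
  thus "real L \<ge> r / sqrt 1" using L by simp
  have "sqrt m * r \<le> sqrt (max m 1) * r" using r by (intro mult_right_mono) auto
  thus "real L \<ge> r / sqrt (1 / m)" using L m by (simp add: real_sqrt_divide mult.commute)
 qed
 have N1: "real (N_dir (ball (0::'a) 1) 1 r) = (\<Sum>l\<le>L. w l * a l)"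
  using N_dir_eq[OF dim zero_less_one r L1] by (simp add: w_def a_def)
 have Ng: "real (N_dir (ball (0::'a) 1) (1 / (sqrt m)\<^sup>2) r) = (\<Sum>l\<le>L. w l * b l)"
  using N_dir_eq[OF dim _ r L2] m by (simp add: w_def b_def mult.commute)
 have N: "real (N_ITE (ball (0::'a) 1) m r) = (\<Sum>l\<le>L. w l * c l)"
  using N_ITE_eq[OF dim m r L] by (simp add: w_def c_def)
 \<comment> \<open>Whether r^2 or m r^2 is larger depends on m alone, and zero counts are monotone;
   so the absolute value passes through the sum over degrees.\<close>
 have pos: "s * (a l - b l) \<ge> 0" for l
 proof (cases "m < 1")
  case True
  hence "m * r\<^sup>2 \<le> 1 * r\<^sup>2" by (intro mult_right_mono) auto
  thus ?thesis using True card_bes_zeros_mono[OF sig_nonneg[OF dim], of "m * r\<^sup>2" "r\<^sup>2" l] by (simp add: s_def a_def b_def)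
 next
  case False
  hence "1 * r\<^sup>2 \<le> m * r\<^sup>2" by (intro mult_right_mono) auto
  thus ?thesis using False m card_bes_zeros_mono[OF sig_nonneg[OF dim], of "r\<^sup>2" "m * r\<^sup>2" l] by (simp add: s_def a_def b_def)
 qed
 have "\<bar>(\<Sum>l\<le>L. w l * a l) - (\<Sum>l\<le>L. w l * b l)\<bar> = \<bar>s * ((\<Sum>l\<le>L. w l * a l) - (\<Sum>l\<le>L. w l * b l))\<bar>"
  using s by (simp add: abs_mult)
 also have "s * ((\<Sum>l\<le>L. w l * a l) - (\<Sum>l\<le>L. w l * b l)) = (\<Sum>l\<le>L. w l * (s * (a l - b l)))"
  by (simp add: sum_subtractf[symmetric] sum_distrib_left algebra_simps)
 also have "\<bar>\<dots>\<bar> = (\<Sum>l\<le>L. w l * (s * (a l - b l)))" by (intro abs_of_nonneg sum_nonneg mult_nonneg_nonneg pos) (simp add: w_def)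
 finally have e: "\<bar>(\<Sum>l\<le>L. w l * a l) - (\<Sum>l\<le>L. w l * b l)\<bar> = (\<Sum>l\<le>L. w l * (s * (a l - b l)))" .
 have "\<bar>(\<Sum>l\<le>L. w l * c l) - (\<Sum>l\<le>L. w l * (s * (a l - b l)))\<bar> = \<bar>\<Sum>l\<le>L. w l * (c l - s * (a l - b l))\<bar>"
  by (simp add: sum_subtractf right_diff_distrib)
 also have "\<dots> \<le> (\<Sum>l\<le>L. \<bar>w l * (c l - s * (a l - b l))\<bar>)" by (rule sum_abs)
 also have "\<dots> \<le> (\<Sum>l\<le>L. w l * 1)"
 proof (rule sum_mono)
  fix l
  have "\<bar>c l - s * (a l - b l)\<bar> \<le> 1" unfolding c_def s_def a_def b_def by (rule det_zeros_card[OF sig_nonneg[OF dim] m])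
  thus "\<bar>w l * (c l - s * (a l - b l))\<bar> \<le> w l * 1" unfolding abs_mult by (intro mult_mono) (auto simp: w_def)
 qed
 finally show ?thesis unfolding N N1 Ng e by (simp add: w_def)
qed

section \<open>Growth of the dimensions of harmonic polynomials\<close>

lemma binomial_product: "fact N * real ((N + L) choose L) = (\<Prod>j<N. real L + 1 + real j)"
proof (induction N)
 case (Suc N)
 have "Suc (N + L) * ((N + L) choose N) = (Suc (N + L) choose Suc N) * Suc N" by (rule Suc_times_binomial_eq)
 hence "real (Suc (N + L)) * real ((N + L) choose N) = real (Suc (N + L) choose Suc N) * real (Suc N)"
  by (metis of_nat_mult)
 moreover have "(N + L) choose N = (N + L) choose L" "(Suc N + L) choose L = Suc (N + L) choose Suc N"
  using binomial_symmetric[of N "N + L"] binomial_symmetric[of "Suc N" "Suc N + L"] by simp_all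
 ultimately have "fact (Suc N) * real ((Suc N + L) choose L) = fact N * real ((N + L) choose L) * real (Suc (N + L))"
  by (simp only: fact_Suc) (simp add: algebra_simps)
 thus ?case unfolding Suc.IH by (simp add: add_ac)
qed simp

lemma sum_hdim_product:
 assumes dim: "DIM('a::euclidean_space) \<ge> 2"
 defines "N \<equiv> DIM('a) - 1"
 shows "fact N * real (\<Sum>l\<le>L. hdim TYPE('a) l) = (\<Prod>j<N. real L + 1 + real j) + (\<Prod>j<N. real L + real j)"
proof (cases L)
 \<comment> \<open>The closed form for the cumulated dimensions starts at degree 1. At 0 the second
   product has the factor 0 and the formula stays valid.\<close>
 case 0
 have "(0::nat) < N" using dim by (simp add: N_def)
 hence "(\<Prod>j<N. real 0 + real j) = 0" by (intro prod_zero) auto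
 thus ?thesis unfolding 0 using binomial_product[of N 0] by (simp add: hdim_0)
next
 case (Suc M)
 have "real L + real j = real M + 1 + real j" for j using Suc by simp
 thus ?thesis unfolding Suc sum_hdim N_def[symmetric] of_nat_add distrib_left binomial_product by (simp add: add_ac)
qed

text \<open>Each factor differs from q by at most D, so the error is one power of q lower. The
  factor 1 + q on the left expresses this lower power and lets the induction start at
  \<open>N = 0\<close>.\<close>

lemma product_power_bound:
 fixes D :: real
 assumes D: "D \<ge> 0"
 shows "\<exists>C\<ge>0. \<forall>d q. q \<ge> 0 --> (\<forall>j<N. \<bar>d j\<bar> \<le> D) --> \<bar>(\<Prod>j<N. q + d j) - q ^ N\<bar> * (1 + q) \<le> C * (1 + q) ^ N"
proof (induction N)
 case (Suc N)
 then obtain C where C: "C \<ge> 0" "\<And>d q. q \<ge> 0 ==> (\<forall>j<N. \<bar>d j\<bar> \<le> D) ==> \<bar>(\<Prod>j<N. q + d j) - q ^ N\<bar> * (1 + q) \<le> C * (1 + q) ^ N" by blast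
 have "\<bar>(\<Prod>j<Suc N. q + d j) - q ^ Suc N\<bar> * (1 + q) \<le> (C * (1 + D) + D) * (1 + q) ^ Suc N"
  if q: "q \<ge> 0" and d: "\<forall>j<Suc N. \<bar>d j\<bar> \<le> D" for d q
 proof -
  define Y where "Y = (\<Prod>j<N. q + d j)"
  define X where "X = Y - q ^ N"
  have P: "(\<Prod>j<Suc N. q + d j) = Y * (q + d N)" by (simp add: Y_def)
  have "(\<Prod>j<Suc N. q + d j) - q ^ Suc N = X * (q + d N) + q ^ N * d N"
   unfolding P X_def by (simp add: algebra_simps)
  hence "\<bar>(\<Prod>j<Suc N. q + d j) - q ^ Suc N\<bar> \<le> \<bar>X\<bar> * \<bar>q + d N\<bar> + q ^ N * \<bar>d N\<bar>"
   using abs_triangle_ineq[of "X * (q + d N)" "q ^ N * d N"] q by (simp add: abs_mult)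
  hence "\<bar>(\<Prod>j<Suc N. q + d j) - q ^ Suc N\<bar> * (1 + q) \<le> (\<bar>X\<bar> * \<bar>q + d N\<bar> + q ^ N * \<bar>d N\<bar>) * (1 + q)"
   using q by (intro mult_right_mono) auto
  also have "\<dots> = (\<bar>X\<bar> * (1 + q)) * \<bar>q + d N\<bar> + q ^ N * \<bar>d N\<bar> * (1 + q)" by (simp add: algebra_simps)
  also have "\<dots> \<le> (C * (1 + q) ^ N) * ((1 + D) * (1 + q)) + (1 + q) ^ N * D * (1 + q)"
  proof -
   have 1: "\<bar>X\<bar> * (1 + q) \<le> C * (1 + q) ^ N" unfolding X_def Y_def using C(2)[OF q, of d] d by simp
   have dN: "\<bar>d N\<bar> \<le> D" using d by simp
   have "\<bar>q + d N\<bar> \<le> q + D" using dN q by linarith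
   also have "\<dots> \<le> (1 + D) * (1 + q)" using D q by (simp add: algebra_simps)
   finally have 2: "\<bar>q + d N\<bar> \<le> (1 + D) * (1 + q)" .
   have 3: "q ^ N \<le> (1 + q) ^ N" using q by (intro power_mono) auto
   show ?thesis
    by (rule add_mono[OF mult_mono[OF 1 2] mult_right_mono[OF mult_mono[OF 3 dN]]]) (use q C(1) D in auto)
  qed
  also have "\<dots> = (C * (1 + D) + D) * (1 + q) ^ Suc N" by (simp add: algebra_simps)
  finally show ?thesis .
 qed
 moreover have "C * (1 + D) + D \<ge> 0" using C D by simp
 ultimately show ?case by blast
qed auto

lemma sum_hdim_le:
 assumes dim: "DIM('a::euclidean_space) \<ge> 2"
 shows "\<exists>C\<ge>0. \<forall>L. real (\<Sum>l\<le>L. hdim TYPE('a) l) \<le> C * (1 + real L) ^ (DIM('a) - 1)"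
proof -
 define N where "N = DIM('a) - 1"
 have "real (\<Sum>l\<le>L. hdim TYPE('a) l) \<le> 2 * (1 + real N) ^ N * (1 + real L) ^ N" for L
 proof -
  have le: "real L + 1 + real j \<le> (1 + real N) * (1 + real L)" if "j < N" for j
   using that by (simp add: algebra_simps) (metis (no_types) add.commute add_le_cancel_left less_eq_real_def mult_nonneg_nonneg of_nat_0_le_iff of_nat_less_iff add_increasing2)
  have "(\<Prod>j<N. real L + 1 + real j) \<le> (\<Prod>j<N. (1 + real N) * (1 + real L))" using le by (intro prod_mono) auto
  moreover have "(\<Prod>j<N. real L + real j) \<le> (\<Prod>j<N. (1 + real N) * (1 + real L))" using le by (intro prod_mono) force
  ultimately have "fact N * real (\<Sum>l\<le>L. hdim TYPE('a) l) \<le> 2 * ((1 + real N) * (1 + real L)) ^ N"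
   unfolding sum_hdim_product[OF dim, folded N_def] by simp
  moreover have "1 * real (\<Sum>l\<le>L. hdim TYPE('a) l) \<le> fact N * real (\<Sum>l\<le>L. hdim TYPE('a) l)"
   by (intro mult_right_mono fact_ge_1 of_nat_0_le_iff)
  ultimately show ?thesis by (simp add: power_mult_distrib)
 qed
 thus ?thesis unfolding N_def by (intro exI[of _ "2 * (1 + real (DIM('a) - 1)) ^ (DIM('a) - 1)"]) auto
qed

text \<open>Both products in the closed form have N factors, each within a bounded distance of q, so
  each is q^N up to lower order; this is the origin of 2 / N!. The argument is the order rather than
  the degree, since the order enters the phase integral.\<close>

lemma sum_hdim_asymp:
 assumes dim: "DIM('a::euclidean_space) \<ge> 2"
 defines "N \<equiv> DIM('a) - 1"
 shows "\<exists>C\<ge>0. \<forall>M q. 0 \<le> q --> q \<le> real M -->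
   \<bar>(\<Sum>l\<in>{l\<in>{..M}. sig TYPE('a) l \<le> q}. real (hdim TYPE('a) l)) - 2 / fact N * q ^ N\<bar> \<le> C * (1 + q) ^ (N - 1)"
proof -
 define D where "D = real N + 3"
 obtain C where C: "C \<ge> 0" "\<And>d q. q \<ge> 0 ==> (\<forall>j<N. \<bar>d j\<bar> \<le> D) ==> \<bar>(\<Prod>j<N. q + d j) - q ^ N\<bar> * (1 + q) \<le> C * (1 + q) ^ N"
  using product_power_bound[of D N] by (auto simp: D_def)
 have N: "N \<ge> 1" "real DIM('a) = real N + 1" using dim by (auto simp: N_def)
 define f where "f = (fact N :: real)"
 have f: "f \<ge> 1" by (simp add: f_def fact_ge_1)
 define C' where "C' = 2 * C + 2 * (real N + 1)"
 have "\<bar>(\<Sum>l\<in>{l\<in>{..M}. sig TYPE('a) l \<le> q}. real (hdim TYPE('a) l)) - 2 / f * q ^ N\<bar> \<le> C' * (1 + q) ^ (N - 1)"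
  if q: "0 \<le> q" "q \<le> real M" for M q
 proof -
  have pw: "(1 + q) ^ N = (1 + q) ^ (N - 1) * (1 + q)" using N by (metis Suc_diff_1 Suc_le_eq power_Suc2 One_nat_def)
  have e1: "(1 + q) ^ (N - 1) \<ge> 0" using q by simp
  show ?thesis
  proof (cases "sig TYPE('a) 0 \<le> q")
   case False
   have s0: "sig TYPE('a) 0 \<le> sig TYPE('a) l" for l by (simp add: sig_def)
   have "\<not> sig TYPE('a) l \<le> q" for l using False s0[of l] by linarith
   hence e: "{l\<in>{..M}. sig TYPE('a) l \<le> q} = {}" by blast
   \<comment> \<open>If even degree 0 exceeds \<open>q\<close>, the sum is empty but q is bounded,
     so the main term itself is within the error.\<close>
   have qN: "q \<le> real N + 1" using False N by (simp add: sig_def)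
   have "q ^ N = q * q ^ (N - 1)" using N by (metis Suc_diff_1 Suc_le_eq power_Suc One_nat_def)
   also have "\<dots> \<le> (real N + 1) * (1 + q) ^ (N - 1)" using q qN by (intro mult_mono power_mono) auto
   finally have "2 / f * q ^ N \<le> 2 * ((real N + 1) * (1 + q) ^ (N - 1))" using f q by (intro mult_mono) (auto simp: field_simps)
   also have "\<dots> \<le> C' * (1 + q) ^ (N - 1)" using C(1) e1 by (simp add: C'_def algebra_simps)
   finally show ?thesis unfolding e using f q by simp
  next
   case True
   define L where "L = nat \<lfloor>q - sig TYPE('a) 0\<rfloor>"
   have L: "real L \<le> q - sig TYPE('a) 0" "q - sig TYPE('a) 0 < real L + 1" using True unfolding L_def by linarith+
   have sl: "sig TYPE('a) l = sig TYPE('a) 0 + real l" for l by (simp add: sig_def)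
   have s0: "0 \<le> sig TYPE('a) 0" "sig TYPE('a) 0 \<le> real N + 1" using N by (auto simp: sig_def)
   have e: "{l\<in>{..M}. sig TYPE('a) l \<le> q} = {..L}"
   proof (intro set_eqI iffI)
    fix l assume "l \<in> {l\<in>{..M}. sig TYPE('a) l \<le> q}"
    hence "real l < real L + 1" using L sl[of l] by simp
    thus "l \<in> {..L}" by simp
   next
    fix l assume "l \<in> {..L}"
    hence "real l \<le> real L" by simp
    hence "sig TYPE('a) l \<le> q" "real l \<le> real M" using L sl[of l] q s0 by linarith+
    thus "l \<in> {l\<in>{..M}. sig TYPE('a) l \<le> q}" by simp
   qed
   define A where "A = real (\<Sum>l\<le>L. hdim TYPE('a) l)"
   have fA: "f * A = (\<Prod>j<N. q + (real L + 1 + real j - q)) + (\<Prod>j<N. q + (real L + real j - q))"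
    unfolding A_def f_def N_def sum_hdim_product[OF dim] by (simp add: add_ac)
   have d: "\<forall>j<N. \<bar>real L + 1 + real j - q\<bar> \<le> D" "\<forall>j<N. \<bar>real L + real j - q\<bar> \<le> D"
    using L s0 by (auto simp: D_def abs_le_iff)
   have le: "x * (1 + q) \<le> 2 * C * (1 + q) ^ N" if "a * (1 + q) \<le> C * (1 + q) ^ N" "b * (1 + q) \<le> C * (1 + q) ^ N" "x \<le> a + b" for a b x
   proof -
    have "x * (1 + q) \<le> (a + b) * (1 + q)" using that(3) q by (intro mult_right_mono) auto
    also have "\<dots> = a * (1 + q) + b * (1 + q)" by (rule distrib_right)
    finally show ?thesis using that(1,2) by linarith
   qed
   have "\<bar>f * A - 2 * q ^ N\<bar> \<le> \<bar>(\<Prod>j<N. q + (real L + 1 + real j - q)) - q ^ N\<bar> + \<bar>(\<Prod>j<N. q + (real L + real j - q)) - q ^ N\<bar>"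
    unfolding fA by linarith
   from le[OF C(2)[OF q(1) d(1)] C(2)[OF q(1) d(2)] this]
   have "\<bar>f * A - 2 * q ^ N\<bar> * (1 + q) \<le> 2 * C * (1 + q) ^ N" .
   hence "\<bar>f * A - 2 * q ^ N\<bar> * (1 + q) \<le> (2 * C * (1 + q) ^ (N - 1)) * (1 + q)" unfolding pw by (simp add: mult_ac)
   hence b: "\<bar>f * A - 2 * q ^ N\<bar> \<le> 2 * C * (1 + q) ^ (N - 1)" by (rule mult_right_le_imp_le) (use q in simp)
   have "\<bar>A - 2 / f * q ^ N\<bar> = \<bar>f * A - 2 * q ^ N\<bar> / f" using f by (simp add: field_simps abs_div_pos[symmetric])
   also have "\<dots> \<le> \<bar>f * A - 2 * q ^ N\<bar>" using f by (simp add: divide_le_eq mult_le_cancel_left1)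
   also have "\<dots> \<le> 2 * C * (1 + q) ^ (N - 1)" by (rule b)
   also have "\<dots> \<le> C' * (1 + q) ^ (N - 1)" using e1 by (intro mult_right_mono) (auto simp: C'_def)
   finally show ?thesis unfolding e A_def by simp
  qed
 qed
 moreover have "C' \<ge> 0" using C by (simp add: C'_def)
 ultimately show ?thesis unfolding f_def by blast
qed

section \<open>The integral behind the leading constant\<close>

text \<open>Represents the Liouville-Green phase as an integral over orders above \<nu>. Summing
  over degrees then produces the counting function of the orders under one integral, a form of
  summation by parts.\<close>

lemma arccos_integral:
 assumes s: "0 \<le> \<nu>" "\<nu> \<le> R" and R: "R > 0"
 shows "((\<lambda>q. arccos (q / R)) has_integral bes_h \<nu> R) {\<nu>..R}"
proof -
 define G where "G q = - (sqrt (R\<^sup>2 - q\<^sup>2) - q * arccos (q / R))" for q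
 have "((\<lambda>q. arccos (q / R)) has_integral G R - G \<nu>) {\<nu>..R}"
 proof (rule fundamental_theorem_of_calculus_interior[OF s(2)])
  show "continuous_on {\<nu>..R} G" unfolding G_def using s R by (intro continuous_intros) (auto simp: field_simps)
  fix q assume q: "q \<in> {\<nu><..<R}"
  define K where "K = sqrt (R\<^sup>2 - q\<^sup>2)"
  have pos: "R\<^sup>2 - q\<^sup>2 > 0" using q s by (simp add: power_strict_mono)
  have K: "K > 0" "K\<^sup>2 = R\<^sup>2 - q\<^sup>2" using pos by (auto simp: K_def)
  have qr: "-1 < q / R" "q / R < 1" using q s R by (auto simp: field_simps)
  have "1 - (q / R)\<^sup>2 = (K / R)\<^sup>2" unfolding power_divide K(2) using R by (simp add: field_simps)
  hence sq: "sqrt (1 - (q / R)\<^sup>2) = K / R" using K R by simp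
  have d1: "DERIV (\<lambda>q. sqrt (R\<^sup>2 - q\<^sup>2)) q :> - q / K"
   using pos by (auto intro!: derivative_eq_intros simp: K_def field_simps)
  have d2: "DERIV (\<lambda>q. arccos (q / R)) q :> - 1 / K"
  proof (rule DERIV_cong[OF DERIV_chain2[of arccos _ "\<lambda>q. q / R" q, OF DERIV_arccos[OF qr]]])
   show "DERIV (\<lambda>q. q / R) q :> 1 / R" using R by (auto intro!: derivative_eq_intros)
   show "inverse (- sqrt (1 - (q / R)\<^sup>2)) * (1 / R) = - 1 / K" unfolding sq using R K by (simp add: field_simps)
  qed
  have "DERIV G q :> arccos (q / R)" unfolding G_def
   by (rule DERIV_cong[OF DERIV_minus[OF DERIV_diff[OF d1 DERIV_mult[OF DERIV_ident d2]]]]) (simp add: mult.commute)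
  thus "(G has_vector_derivative arccos (q / R)) (at q)" by (simp add: has_real_derivative_iff_has_vector_derivative)
 qed
 moreover have "G R - G \<nu> = bes_h \<nu> R" using R by (simp add: G_def bes_h_def)
 ultimately show ?thesis by simp
qed

text \<open>This is (2 pi)^(-n) times the squared volume of the unit ball, with the powers of pi
  cancelled; in this form it satisfies the same two-step recursion as the arccos integrals.\<close>

definition ballconst :: "nat => real" where "ballconst n = (1 / 2) ^ n / (Gamma (real n / 2 + 1))\<^sup>2"

lemma ballconst_rec: "ballconst (n + 2) = ballconst n / (real n + 2)\<^sup>2"
proof -
 have "Gamma (real (n + 2) / 2 + 1) = Gamma ((real n / 2 + 1) + 1)" by (simp add: add_divide_distrib)
 also have "\<dots> = (real n / 2 + 1) * Gamma (real n / 2 + 1)" by (rule Gamma_plus1) (auto simp: add_pos_nonneg dest: nonpos_Ints_nonpos)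
 finally have "ballconst (n + 2) = (1 / 2) ^ n * (1 / 4) / ((real n / 2 + 1) * Gamma (real n / 2 + 1))\<^sup>2"
  by (simp add: ballconst_def power2_eq_square)
 also have "\<dots> = (1 / 2) ^ n / (Gamma (real n / 2 + 1))\<^sup>2 * ((1 / 4) / (real n / 2 + 1)\<^sup>2)" by (simp add: power_mult_distrib)
 also have "(1 / 4) / (real n / 2 + 1)\<^sup>2 = 1 / (real n + 2)\<^sup>2" by (simp add: field_simps power2_eq_square)
 finally show ?thesis by (simp add: ballconst_def)
qed

text \<open>A recursion from \<open>n\<close> to \<open>n + 2\<close> matches that of
  \<open>ballconst\<close>. The two starting values are computed directly, and the half-integer
  Gamma value brings in pi.\<close>

lemma power_arccos_integral: "((\<lambda>s. s ^ n * arccos s) has_integral (fact n * (pi / 2) * ballconst (Suc n))) {0..1}"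
proof (induction n rule: induct_nat_012)
 case 0
 have "((\<lambda>s. arccos s) has_integral (1 * arccos 1 - sqrt (1 - 1\<^sup>2)) - (0 * arccos 0 - sqrt (1 - 0\<^sup>2))) {0..1}"
 proof (rule fundamental_theorem_of_calculus_interior)
  show "continuous_on {0..1} (\<lambda>s. s * arccos s - sqrt (1 - s\<^sup>2))" by (intro continuous_intros) auto
  fix s :: real assume s: "s \<in> {0<..<1}"
  hence "s\<^sup>2 < 1" by (simp add: power_less_one_iff)
  thus "((\<lambda>s. s * arccos s - sqrt (1 - s\<^sup>2)) has_vector_derivative arccos s) (at s)"
   unfolding has_real_derivative_iff_has_vector_derivative[symmetric] using s
   by (auto intro!: derivative_eq_intros simp: field_simps)
 qed simp
 moreover have "ballconst (Suc 0) = 2 / pi"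
 proof -
  have "Gamma (1 / 2 + 1 :: real) = 1 / 2 * Gamma (1 / 2)" by (rule Gamma_plus1) (auto dest: nonpos_Ints_nonpos)
  hence "Gamma (3 / 2 :: real) = sqrt pi / 2" by (simp add: Gamma_one_half_real)
  hence "(Gamma (3 / 2 :: real))\<^sup>2 = (sqrt pi / 2)\<^sup>2" by (simp only:)
  also have "\<dots> = pi / 4" by (simp add: power_divide)
  finally have G: "(Gamma (3 / 2 :: real))\<^sup>2 = pi / 4" .
  have "ballconst (Suc 0) = 1 / (2 * (Gamma (3 / 2))\<^sup>2)" by (simp add: ballconst_def)
  thus ?thesis unfolding G by simp
 qed
 ultimately show ?case by simp
next
 case 1
 let ?F = "\<lambda>s::real. (s\<^sup>2 / 2 - 1 / 4) * arccos s - s * sqrt (1 - s\<^sup>2) / 4"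
 have "((\<lambda>s. s * arccos s) has_integral ?F 1 - ?F 0) {0..1}"
 proof (rule fundamental_theorem_of_calculus_interior)
  show "continuous_on {0..1} ?F" by (intro continuous_intros) auto
  fix s :: real assume s: "s \<in> {0<..<1}"
  define K where "K = sqrt (1 - s\<^sup>2)"
  have "s\<^sup>2 < 1" using s by (simp add: power_less_one_iff)
  hence K: "K > 0" "K\<^sup>2 = 1 - s\<^sup>2" by (auto simp: K_def)
  have d1: "DERIV (\<lambda>q. sqrt (1 - q\<^sup>2)) s :> - s / K"
   using \<open>s\<^sup>2 < 1\<close> by (auto intro!: derivative_eq_intros simp: K_def field_simps)
  have d2: "DERIV arccos s :> - 1 / K"
   using s by (auto intro!: derivative_eq_intros simp: K_def field_simps)
  have d3: "DERIV (\<lambda>s. s\<^sup>2 / 2 - 1 / 4) s :> s" by (auto intro!: derivative_eq_intros)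
  have "DERIV ?F s :> s * arccos s"
  proof (rule DERIV_cong[OF DERIV_diff[OF DERIV_mult[OF d3 d2] DERIV_cdivide[OF DERIV_mult[OF DERIV_ident d1]]]])
   have "(- 1 / K) * (s\<^sup>2 / 2 - 1 / 4) - (1 * K + - s / K * s) / 4 = 0"
   proof -
    have "(- 1 / K) * (s\<^sup>2 / 2 - 1 / 4) - (1 * K + - s / K * s) / 4 = (1 - s\<^sup>2 - K\<^sup>2) / (4 * K)"
     using K(1) by (simp add: field_simps power2_eq_square)
    thus ?thesis using K(2) by simp
   qed
   thus "s * arccos s + - 1 / K * (s\<^sup>2 / 2 - 1 / 4) - (1 * sqrt (1 - s\<^sup>2) + - s / K * s) / 4 = s * arccos s"
    unfolding K_def[symmetric] by linarith
  qed
  thus "(?F has_vector_derivative s * arccos s) (at s)" by (simp add: has_real_derivative_iff_has_vector_derivative)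
 qed simp
 moreover have "ballconst (Suc 1) = 1 / 4"
 proof -
  have "Gamma (2 :: real) = 1" using Gamma_fact[of 1, where 'a = real] by simp
  thus ?thesis by (simp add: ballconst_def)
 qed
 hence e: "fact 1 * (pi / 2) * ballconst (Suc 1) = pi / 8" by (simp only:) simp
 ultimately show ?case unfolding One_nat_def e[unfolded One_nat_def] by simp
next
 case (ge2 n)
 define m where "m = real n + 1"
 \<comment> \<open>With m = n + 1 this function vanishes at 0 and at 1, and the square roots in its
   derivative cancel. It yields (m + 2)^2 I(n + 2) = m (m + 1) I(n), where I denotes the
   integral.\<close>
 let ?F = "\<lambda>s::real. ((m + 2) * s ^ (n + 3) - (m + 1) * s ^ (n + 1)) * arccos s - s ^ (n + 2) * sqrt (1 - s\<^sup>2)"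
 have F: "((\<lambda>s. (m + 2)\<^sup>2 * (s ^ (n + 2) * arccos s) - m * (m + 1) * (s ^ n * arccos s)) has_integral ?F 1 - ?F 0) {0..1}"
 proof (rule fundamental_theorem_of_calculus_interior)
  show "continuous_on {0..1} ?F" by (intro continuous_intros) auto
  fix s :: real assume s: "s \<in> {0<..<1}"
  define K where "K = sqrt (1 - s\<^sup>2)"
  have "s\<^sup>2 < 1" using s by (simp add: power_less_one_iff)
  hence K: "K > 0" "K\<^sup>2 = 1 - s\<^sup>2" by (auto simp: K_def)
  have d1: "DERIV (\<lambda>q. sqrt (1 - q\<^sup>2)) s :> - s / K"
   using \<open>s\<^sup>2 < 1\<close> by (auto intro!: derivative_eq_intros simp: K_def field_simps)
  have d2: "DERIV arccos s :> - 1 / K"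
   using s by (auto intro!: derivative_eq_intros simp: K_def field_simps)
  have d3: "DERIV (\<lambda>s. (m + 2) * s ^ (n + 3) - (m + 1) * s ^ (n + 1)) s :> (m + 2) * ((m + 2) * s ^ (n + 2)) - (m + 1) * (m * s ^ n)"
   by (rule DERIV_cong[OF DERIV_diff[OF DERIV_cmult[OF DERIV_pow] DERIV_cmult[OF DERIV_pow]]]) (simp add: m_def add_ac)
  have d4: "DERIV (\<lambda>s. s ^ (n + 2)) s :> (m + 1) * s ^ (n + 1)"
   by (rule DERIV_cong[OF DERIV_pow]) (simp add: m_def)
  have "DERIV ?F s :> (m + 2)\<^sup>2 * (s ^ (n + 2) * arccos s) - m * (m + 1) * (s ^ n * arccos s)"
  proof (rule DERIV_cong[OF DERIV_diff[OF DERIV_mult[OF d3 d2] DERIV_mult[OF d4 d1]]])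
   have "- 1 / K * ((m + 2) * s ^ (n + 3) - (m + 1) * s ^ (n + 1)) - ((m + 1) * s ^ (n + 1) * K + - s / K * s ^ (n + 2))
     = - (s ^ (n + 1)) / K * ((m + 2) * s\<^sup>2 - (m + 1) + (m + 1) * K\<^sup>2 - s\<^sup>2)"
    using K(1) by (simp add: field_simps power2_eq_square power_add power3_eq_cube)
   also have "\<dots> = 0" unfolding K(2) by (simp add: algebra_simps)
   finally have "- 1 / K * ((m + 2) * s ^ (n + 3) - (m + 1) * s ^ (n + 1)) - ((m + 1) * s ^ (n + 1) * K + - s / K * s ^ (n + 2)) = 0" .
   thus "((m + 2) * ((m + 2) * s ^ (n + 2)) - (m + 1) * (m * s ^ n)) * arccos s + - 1 / K * ((m + 2) * s ^ (n + 3) - (m + 1) * s ^ (n + 1))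
     - ((m + 1) * s ^ (n + 1) * sqrt (1 - s\<^sup>2) + - s / K * s ^ (n + 2)) = (m + 2)\<^sup>2 * (s ^ (n + 2) * arccos s) - m * (m + 1) * (s ^ n * arccos s)"
    unfolding K_def[symmetric] by (simp add: power2_eq_square algebra_simps)
  qed
  thus "(?F has_vector_derivative (m + 2)\<^sup>2 * (s ^ (n + 2) * arccos s) - m * (m + 1) * (s ^ n * arccos s)) (at s)"
   by (simp add: has_real_derivative_iff_has_vector_derivative)
 qed simp
 have "?F 1 - ?F 0 = 0" by simp
 from has_integral_add[OF F has_integral_mult_right[OF ge2(1), of "m * (m + 1)"], unfolded this]
 have "((\<lambda>s. (m + 2)\<^sup>2 * (s ^ (n + 2) * arccos s)) has_integral m * (m + 1) * (fact n * (pi / 2) * ballconst (Suc n))) {0..1}"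
  by simp
 from has_integral_mult_right[OF this, of "1 / (m + 2)\<^sup>2"]
 have "((\<lambda>s. s ^ (n + 2) * arccos s) has_integral m * (m + 1) * (fact n * (pi / 2) * ballconst (Suc n)) / (m + 2)\<^sup>2) {0..1}"
  by (simp add: m_def mult.commute[of 2])
 moreover have e: "m * (m + 1) * (fact n * (pi / 2) * ballconst (Suc n)) / (m + 2)\<^sup>2 = fact (n + 2) * (pi / 2) * ballconst (Suc (n + 2))"
 proof -
  have b: "ballconst (Suc (n + 2)) = ballconst (Suc n) / (m + 2)\<^sup>2" using ballconst_rec[of "Suc n"] by (simp add: m_def add_ac)
  have f: "fact (n + 2) = (m + 1) * m * fact n" by (simp add: m_def algebra_simps)
  show ?thesis unfolding b f by (simp add: mult_ac)
 qed
 ultimately show ?case unfolding e by (simp only: add_2_eq_Suc')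
qed

lemma power_arccos_integral_scaled:
 assumes R: "R > 0"
 shows "((\<lambda>q. q ^ N * arccos (q / R)) has_integral (fact N * (pi / 2) * ballconst (Suc N) * R ^ Suc N)) {0..R}"
proof -
 have "((\<lambda>q. (1 / R * q) ^ N * arccos (1 / R * q)) has_integral (1 / \<bar>1 / R\<bar>) *\<^sub>R (fact N * (pi / 2) * ballconst (Suc N))) ((\<lambda>q. q / (1 / R)) ` {0..1})"
  using has_integral_stretch_real[OF power_arccos_integral[of N], of "1 / R"] R by simp
 moreover have "(\<lambda>q. q / (1 / R)) ` {0..1} = {0..R}"
 proof (intro set_eqI iffI)
  fix x assume "x \<in> {0..R}"
  thus "x \<in> (\<lambda>q. q / (1 / R)) ` {0..1}" using R by (intro image_eqI[of _ _ "x / R"]) auto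
 qed (use R in \<open>auto simp: mult_left_le_one_le\<close>)
 ultimately have "((\<lambda>q. (q / R) ^ N * arccos (q / R)) has_integral R * (fact N * (pi / 2) * ballconst (Suc N))) {0..R}"
  using R by simp
 from has_integral_mult_right[OF this, of "R ^ N"] show ?thesis
  using R by (simp add: power_divide mult_ac)
qed

section \<open>The Weyl law on the ball with remainder\<close>

text \<open>Zero counts are replaced by phases over pi, at a cost of O(1) per harmonic polynomial;
  the phases become the integral of the order counting function against arccos, and that function is
  replaced by its leading power. The main integral is pi times \<open>ballconst\<close> times
  R^n.\<close>

lemma weyl:
 assumes dim: "DIM('a::euclidean_space) \<ge> 2"
 shows "\<exists>K\<ge>0. \<forall>R\<ge>1. \<bar>(\<Sum>l\<le>nat \<lceil>R\<rceil>. real (hdim TYPE('a) l) * real (card (bes_zeros (sig TYPE('a) l) (R\<^sup>2)))) - ballconst DIM('a) * R ^ DIM('a)\<bar>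
   \<le> K * R ^ (DIM('a) - 1)"
proof -
 let ?s = "sig TYPE('a)"
 define N where "N = DIM('a) - 1"
 have N: "N \<ge> 1" "DIM('a) = Suc N" using dim by (auto simp: N_def)
 have sl: "?s l = ?s 0 + real l" for l by (simp add: sig_def)
 have s0: "0 \<le> ?s l" for l by (rule sig_nonneg[OF dim])
 \<comment> \<open>The uniform count needs order at least 1, which can fail only for degree 0; there
   the constant for a fixed order is used.\<close>
 obtain C1 where C1: "\<And>r. r \<ge> ?s 0 ==> \<bar>real (card (bes_zeros (?s 0) (r\<^sup>2))) - bes_h (?s 0) r / pi\<bar> \<le> C1"
  using bes_count_fixed[OF s0[of 0]] by blast
 define C0 where "C0 = max 4 C1"
 have C0: "\<bar>real (card (bes_zeros (?s l) (R\<^sup>2))) - bes_h (?s l) R / pi\<bar> \<le> C0" if "?s l \<le> R" for l R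
 proof (cases "l = 0")
  case True
  thus ?thesis using C1[of R] that by (simp add: C0_def)
 next
  case False
  hence "1 \<le> ?s l" using sl[of l] s0[of 0] by linarith
  from bes_count_large[OF this that] show ?thesis by (simp add: C0_def)
 qed
 obtain C2 where C2: "C2 \<ge> 0" "\<And>L. real (\<Sum>l\<le>L. hdim TYPE('a) l) \<le> C2 * (1 + real L) ^ N"
  using sum_hdim_le[OF dim] unfolding N_def by blast
 obtain C3 where C3: "C3 \<ge> 0" "\<And>M q. 0 \<le> q ==> q \<le> real M ==>
   \<bar>(\<Sum>l\<in>{l\<in>{..M}. ?s l \<le> q}. real (hdim TYPE('a) l)) - 2 / fact N * q ^ N\<bar> \<le> C3 * (1 + q) ^ (N - 1)"
  using sum_hdim_asymp[OF dim] unfolding N_def by blast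
 define w where "w l = real (hdim TYPE('a) l)" for l
 define K where "K = C0 * C2 * 3 ^ N + C3 * 2 ^ (N - 1)"
 have "\<bar>(\<Sum>l\<le>nat \<lceil>R\<rceil>. w l * real (card (bes_zeros (?s l) (R\<^sup>2)))) - ballconst (Suc N) * R ^ Suc N\<bar> \<le> K * R ^ N" if R: "R \<ge> 1" for R
 proof -
  define M where "M = nat \<lceil>R\<rceil>"
  have M: "R \<le> real M" "real M \<le> R + 1" using R unfolding M_def by linarith+
  define J where "J = {l\<in>{..M}. ?s l \<le> R}"
  have J: "finite J" "J \<subseteq> {..M}" by (auto simp: J_def)
  define S where "S = (\<Sum>l\<le>M. w l * real (card (bes_zeros (?s l) (R\<^sup>2))))"
  define T where "T = (\<Sum>l\<in>J. w l * bes_h (?s l) R)"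
  have SJ: "S = (\<Sum>l\<in>J. w l * real (card (bes_zeros (?s l) (R\<^sup>2))))" unfolding S_def
  proof (rule sum.mono_neutral_right[OF _ J(2)], simp, rule ballI)
   fix l assume "l \<in> {..M} - J"
   hence "R \<le> ?s l" by (auto simp: J_def)
   hence "R\<^sup>2 \<le> (?s l)\<^sup>2" using R by (intro power_mono) auto
   thus "w l * real (card (bes_zeros (?s l) (R\<^sup>2))) = 0" using bes_zeros_empty[OF s0] by simp
  qed
  have 1: "\<bar>S - T / pi\<bar> \<le> C0 * C2 * 3 ^ N * R ^ N"
  proof -
   have "S - T / pi = (\<Sum>l\<in>J. w l * (real (card (bes_zeros (?s l) (R\<^sup>2))) - bes_h (?s l) R / pi))"
    unfolding SJ T_def by (simp add: sum_subtractf sum_divide_distrib right_diff_distrib)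
   also have "\<bar>\<dots>\<bar> \<le> (\<Sum>l\<in>J. w l * C0)"
   proof (rule order_trans[OF sum_abs], rule sum_mono)
    fix l assume "l \<in> J"
    hence "?s l \<le> R" by (simp add: J_def)
    from C0[OF this] show "\<bar>w l * (real (card (bes_zeros (?s l) (R\<^sup>2))) - bes_h (?s l) R / pi)\<bar> \<le> w l * C0"
     unfolding abs_mult by (intro mult_mono) (auto simp: w_def)
   qed
   also have "\<dots> \<le> (\<Sum>l\<le>M. w l * C0)" using J(2) by (intro sum_mono2) (auto simp: w_def C0_def)
   also have "\<dots> = C0 * real (\<Sum>l\<le>M. hdim TYPE('a) l)" by (simp add: w_def sum_distrib_left mult.commute)
   also have "\<dots> \<le> C0 * (C2 * (3 * R) ^ N)"
   proof (intro mult_left_mono order_trans[OF C2(2)[of M]] power_mono)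
    show "1 + real M \<le> 3 * R" using M R by linarith
   qed (use C2 in \<open>auto simp: C0_def\<close>)
   finally show ?thesis by (simp add: power_mult_distrib mult_ac)
  qed
  \<comment> \<open>Counts orders up to \<open>q\<close> with multiplicity. Interchanging the sum
    over degrees with the integral over orders gives \<open>A\<close> as the weight in
    \<open>intT\<close>.\<close>
  define A where "A q = (\<Sum>l\<in>{l\<in>{..M}. ?s l \<le> q}. w l)" for q
  have intT: "((\<lambda>q. A q * arccos (q / R)) has_integral T) {0..R}"
  proof (rule has_integral_eq)
   show "((\<lambda>q. \<Sum>l\<in>J. w l * (if q \<in> {?s l..R} then arccos (q / R) else 0)) has_integral T) {0..R}"
    unfolding T_def
   proof (intro has_integral_sum J(1) has_integral_mult_right)
    fix l assume l: "l \<in> J"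
    have "{?s l..R} \<subseteq> {0..R}" using s0[of l] by auto
    moreover have "((\<lambda>q. arccos (q / R)) has_integral bes_h (?s l) R) {?s l..R}"
     using l R by (intro arccos_integral s0) (auto simp: J_def)
    ultimately show "((\<lambda>q. if q \<in> {?s l..R} then arccos (q / R) else 0) has_integral bes_h (?s l) R) {0..R}"
     by (simp only: has_integral_restrict)
   qed
   fix q assume q: "q \<in> {0..R}"
   have "(\<Sum>l\<in>J. w l * (if q \<in> {?s l..R} then arccos (q / R) else 0)) = (\<Sum>l\<in>{l\<in>{..M}. ?s l \<le> q}. w l * arccos (q / R))"
    using q J(1) by (intro sum.mono_neutral_cong_right) (auto simp: J_def)
   thus "(\<Sum>l\<in>J. w l * (if q \<in> {?s l..R} then arccos (q / R) else 0)) = A q * arccos (q / R)"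
    by (simp add: A_def sum_distrib_right)
  qed
  have "((\<lambda>q. A q * arccos (q / R) - 2 / fact N * (q ^ N * arccos (q / R))) has_integral T - 2 / fact N * (fact N * (pi / 2) * ballconst (Suc N) * R ^ Suc N)) {0..R}"
   using R by (intro has_integral_diff intT has_integral_mult_right power_arccos_integral_scaled) auto
  hence i: "((\<lambda>q. A q * arccos (q / R) - 2 / fact N * (q ^ N * arccos (q / R))) has_integral T - pi * (ballconst (Suc N) * R ^ Suc N)) {0..R}"
   by (simp add: field_simps)
  have "norm (T - pi * (ballconst (Suc N) * R ^ Suc N)) \<le> (C3 * (2 * R) ^ (N - 1) * pi) * measure lborel {0..R}"
  proof (rule has_integral_bound_real[OF _ finite.emptyI i])
   show "0 \<le> C3 * (2 * R) ^ (N - 1) * pi" using C3 R by simp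
   fix q assume q: "q \<in> {0..R} - {}"
   have "\<bar>A q - 2 / fact N * q ^ N\<bar> \<le> C3 * (1 + q) ^ (N - 1)" unfolding A_def w_def using q M by (intro C3(2)) auto
   also have "\<dots> \<le> C3 * (2 * R) ^ (N - 1)" using q R C3 by (intro mult_left_mono power_mono) auto
   finally have a: "\<bar>A q - 2 / fact N * q ^ N\<bar> \<le> C3 * (2 * R) ^ (N - 1)" .
   have "q / R \<in> {0..1}" using q R by (auto simp: divide_le_eq)
   hence "0 \<le> arccos (q / R)" "arccos (q / R) \<le> pi" using arccos_lbound[of "q / R"] arccos_ubound[of "q / R"] by auto
   hence "\<bar>A q - 2 / fact N * q ^ N\<bar> * \<bar>arccos (q / R)\<bar> \<le> C3 * (2 * R) ^ (N - 1) * pi"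
    using a C3 R by (intro mult_mono) auto
   thus "norm (A q * arccos (q / R) - 2 / fact N * (q ^ N * arccos (q / R))) \<le> C3 * (2 * R) ^ (N - 1) * pi"
    by (simp add: abs_mult[symmetric] algebra_simps)
  qed
  moreover have "measure lborel {0..R} = R" using R by simp
  moreover have "R ^ N = R ^ (N - 1) * R" using N by (metis Suc_diff_1 Suc_le_eq power_Suc2 One_nat_def)
  ultimately have 2: "\<bar>T - pi * (ballconst (Suc N) * R ^ Suc N)\<bar> \<le> pi * (C3 * 2 ^ (N - 1) * R ^ N)"
   by (simp only: real_norm_def power_mult_distrib mult_ac)
  have "\<bar>T / pi - ballconst (Suc N) * R ^ Suc N\<bar> = \<bar>T - pi * (ballconst (Suc N) * R ^ Suc N)\<bar> / pi"
   by (simp add: field_simps abs_div_pos[symmetric])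
  also have "\<dots> \<le> C3 * 2 ^ (N - 1) * R ^ N" using 2 by (simp add: divide_le_eq mult.commute)
  finally show ?thesis using 1 unfolding S_def[symmetric] M_def[symmetric] K_def distrib_right by linarith
 qed
 moreover have "K \<ge> 0" using C2 C3 by (simp add: K_def C0_def)
 ultimately show ?thesis unfolding w_def N(2) by (intro exI[of _ K]) simp
qed

lemma ballconst_eq:
 "ballconst DIM('a) = (2 * pi) powr (- real DIM('a)) * (measure lebesgue (ball (0::'a::euclidean_space) 1))\<^sup>2"
proof -
 define n where "n = real DIM('a)"
 have "measure lebesgue (ball (0::'a) 1) = unit_ball_vol n" using content_ball[of 1 "0::'a"] by (simp add: n_def)
 moreover have "(pi powr (n / 2))\<^sup>2 = pi powr n" by (simp add: powr_power)
 moreover have "(2 * pi) powr (- n) = (1 / 2) ^ DIM('a) / pi powr n"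
  by (simp add: powr_mult powr_minus n_def powr_realpow power_one_over divide_simps)
 ultimately show ?thesis unfolding ballconst_def n_def[symmetric] unit_ball_vol_def by (simp add: power_divide)
qed

theorem theorem1:
  fixes m :: real
  assumes "DIM('a::euclidean_space) \<ge> 2" and "m > 0" and "m \<noteq> 1"
  shows "(\<lambda>r. real (N_ITE (ball (0::'a) 1) m r)
            - \<bar>real (N_dir (ball (0::'a) 1) 1 r) - real (N_dir (ball (0::'a) 1) (1 / (sqrt m)\<^sup>2) r)\<bar>)
           \<in> O[at_top](\<lambda>r. r ^ (DIM('a) - 1))
      \<and> (\<lambda>r. real (N_ITE (ball (0::'a) 1) m r)
            - (2 * pi) powr (- real DIM('a)) * (measure lebesgue (ball (0::'a) 1))\<^sup>2
              * \<bar>1 - m powr (real DIM('a) / 2)\<bar> * r ^ DIM('a))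
           \<in> O[at_top](\<lambda>r. r ^ (DIM('a) - 1))"
proof
 note dim = assms(1) and m = assms(2,3)
 define n where "n = DIM('a)"
 define N where "N = n - 1"
 \<comment> \<open>Orders above \<open>c * r\<close> lie beyond the turning points for both wave
   numbers, so degrees above \<open>c * r\<close> contribute to none of the three counts.\<close>
 define c where "c = sqrt (max m 1)"
 have c: "c \<ge> 1" by (simp add: c_def)
 define \<gamma> where "\<gamma> = sqrt m"
 have \<gamma>: "\<gamma> > 0" "\<gamma>\<^sup>2 = m" using m by (auto simp: \<gamma>_def)
 obtain C where C: "C \<ge> 0" "\<And>L. real (\<Sum>l\<le>L. hdim TYPE('a) l) \<le> C * (1 + real L) ^ N"
  using sum_hdim_le[OF dim] unfolding N_def n_def by blast
 have 1: "\<bar>real (N_ITE (ball (0::'a) 1) m r)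
   - \<bar>real (N_dir (ball (0::'a) 1) 1 r) - real (N_dir (ball (0::'a) 1) (1 / (sqrt m)\<^sup>2) r)\<bar>\<bar> \<le> C * (3 * c) ^ N * r ^ N"
  if r: "r \<ge> 1" for r
 proof -
  define L where "L = nat \<lceil>c * r\<rceil>"
  have cr: "c * r \<ge> 1" using mult_mono[OF c r] c by simp
  have L: "c * r \<le> real L" "real L \<le> c * r + 1" using cr unfolding L_def by linarith+
  have "\<bar>real (N_ITE (ball (0::'a) 1) m r) - \<bar>real (N_dir (ball (0::'a) 1) 1 r) - real (N_dir (ball (0::'a) 1) (1 / (sqrt m)\<^sup>2) r)\<bar>\<bar>
   \<le> real (\<Sum>l\<le>L. hdim TYPE('a) l)"
   by (rule N_ITE_N_dir[OF dim m]) (use r L in \<open>auto simp: c_def\<close>)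
  also have "\<dots> \<le> C * (1 + real L) ^ N" by (rule C(2))
  also have "\<dots> \<le> C * (3 * c * r) ^ N" using L cr C(1) by (intro mult_left_mono power_mono) auto
  finally show ?thesis by (simp add: power_mult_distrib mult_ac)
 qed
 thus "(\<lambda>r. real (N_ITE (ball (0::'a) 1) m r)
    - \<bar>real (N_dir (ball (0::'a) 1) 1 r) - real (N_dir (ball (0::'a) 1) (1 / (sqrt m)\<^sup>2) r)\<bar>) \<in> O[at_top](\<lambda>r. r ^ (DIM('a) - 1))"
  unfolding N_def n_def
  by (intro bigoI[of _ "C * (3 * c) ^ (DIM('a) - 1)"] eventually_mono[OF eventually_ge_at_top[of 1]]) simp
 define V where "V = ballconst n"
 have V: "V \<ge> 0" by (simp add: V_def ballconst_def)
 define S where "S R = (\<Sum>l\<le>nat \<lceil>R\<rceil>. real (hdim TYPE('a) l) * real (card (bes_zeros (sig TYPE('a) l) (R\<^sup>2))))" for R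
 obtain K where K: "K \<ge> 0" "\<And>R. R \<ge> 1 ==> \<bar>S R - V * R ^ n\<bar> \<le> K * R ^ N"
  using weyl[OF dim] unfolding S_def V_def N_def n_def by blast
 have "\<bar>real (N_ITE (ball (0::'a) 1) m r) - V * \<bar>1 - m powr (real n / 2)\<bar> * r ^ n\<bar> \<le> (C * (3 * c) ^ N + K + K * \<gamma> ^ N) * r ^ N"
  if r: "r \<ge> max 1 (1 / \<gamma>)" for r
 proof -
  have r1: "r \<ge> 1" "\<gamma> * r \<ge> 1" using r \<gamma> by (auto simp: field_simps)
  have N1: "real (N_dir (ball (0::'a) 1) 1 r) = S r"
   using N_dir_eq[OF dim zero_less_one, of r "nat \<lceil>r\<rceil>"] r1 by (simp add: S_def real_nat_ceiling_ge)
  \<comment> \<open>Scaling: the operator with factor \<gamma>^(-2) has the same count at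
    \<open>r\<close> as the plain Laplacian at \<gamma> r, so the same Weyl estimate serves
    twice.\<close>
  have gr: "r / sqrt (1 / \<gamma>\<^sup>2) = \<gamma> * r" using \<gamma>(1) by (simp add: real_sqrt_divide)
  have Ng: "real (N_dir (ball (0::'a) 1) (1 / (sqrt m)\<^sup>2) r) = S (\<gamma> * r)"
   using N_dir_eq[OF dim _ _ , of "1 / \<gamma>\<^sup>2" r "nat \<lceil>\<gamma> * r\<rceil>"] r1 \<gamma>(1) unfolding gr
   by (simp add: S_def real_nat_ceiling_ge power_mult_distrib mult.commute flip: \<gamma>_def)
  have gn: "\<gamma> ^ n = m powr (real n / 2)" using m \<gamma> by (simp add: \<gamma>_def powr_half_sqrt[symmetric] powr_powr flip: powr_realpow)
  have a: "\<bar>S r - V * r ^ n\<bar> \<le> K * r ^ N" by (rule K(2)[OF r1(1)])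
  have b: "\<bar>S (\<gamma> * r) - V * (\<gamma> ^ n * r ^ n)\<bar> \<le> K * \<gamma> ^ N * r ^ N"
   using K(2)[OF r1(2)] by (simp add: power_mult_distrib mult_ac)
  have "\<bar>V * (r ^ n - \<gamma> ^ n * r ^ n)\<bar> = V * \<bar>1 - m powr (real n / 2)\<bar> * r ^ n"
  proof -
   have "V * (r ^ n - \<gamma> ^ n * r ^ n) = V * (1 - m powr (real n / 2)) * r ^ n" unfolding gn by (simp add: algebra_simps)
   thus ?thesis using V r1 by (simp only: abs_mult) simp
  qed
  \<comment> \<open>The reverse triangle inequality carries the two Weyl errors through the absolute
    value.\<close>
  moreover have "\<bar>\<bar>S r - S (\<gamma> * r)\<bar> - \<bar>V * (r ^ n - \<gamma> ^ n * r ^ n)\<bar>\<bar> \<le> K * r ^ N + K * \<gamma> ^ N * r ^ N"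
   using a b unfolding right_diff_distrib by linarith
  ultimately show ?thesis using 1[OF r1(1)] unfolding N1 Ng distrib_right by linarith
 qed
 thus "(\<lambda>r. real (N_ITE (ball (0::'a) 1) m r)
      - (2 * pi) powr (- real DIM('a)) * (measure lebesgue (ball (0::'a) 1))\<^sup>2
       * \<bar>1 - m powr (real DIM('a) / 2)\<bar> * r ^ DIM('a)) \<in> O[at_top](\<lambda>r. r ^ (DIM('a) - 1))"
  unfolding N_def V_def n_def ballconst_eq
  by (intro bigoI[of _ "C * (3 * c) ^ (DIM('a) - 1) + K + K * \<gamma> ^ (DIM('a) - 1)"] eventually_mono[OF eventually_ge_at_top[of "max 1 (1 / \<gamma>)"]]) simp
qed

end
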